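(* The following decision problem is $\mathcal{NP}$-hard: given a finite simple undirected graph $G$, decide whether $G$ admits a straight-line RAC drawing.
   Context: A straight-line drawing of a graph $G=(V,E)$ maps the vertices to distinct points of the plane and each edge $(u,v)$ to the straight-line segment joining the images of $u$ and $v$; no edge passes through the image of a vertex other than its endpoints, and no two edges overlap. Two edges cross if their segments meet at a point interior to both. A straight-line RAC (right-angle crossing) drawing is a straight-line drawing in which every pair of crossing edges is perpendicular. *)

theory Defs
  imports "HOL-Analysis.Analysis" "HOL-Computational_Algebra.Polynomial"
begin

section \<open>Straight-line RAC drawings\<close>

definition simple_graph :: "'a set \<Rightarrow> 'a set set \<Rightarrow> bool" where
  "simple_graph V E \<longleftrightarrow> finite V \<and> (\<forall>e\<in>E. e \<subseteq> V \<and> card e = 2)"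

definition straight_line_drawing :: "'a set \<Rightarrow> 'a set set \<Rightarrow> ('a \<Rightarrow> real ^ 2) \<Rightarrow> bool" where
  "straight_line_drawing V E f \<longleftrightarrow>
     inj_on f V \<and>
     (\<forall>u v w. {u, v} \<in> E \<and> w \<in> V - {u, v} \<longrightarrow> f w \<notin> closed_segment (f u) (f v)) \<and>
     (\<forall>u v x y. {u, v} \<in> E \<and> {x, y} \<in> E \<and> {u, v} \<noteq> {x, y} \<longrightarrow>
        \<not> (\<exists>a b. a \<noteq> b \<and>
             closed_segment a b \<subseteq> closed_segment (f u) (f v) \<inter> closed_segment (f x) (f y)))"

definition RAC_drawing :: "'a set \<Rightarrow> 'a set set \<Rightarrow> ('a \<Rightarrow> real ^ 2) \<Rightarrow> bool" where
  "RAC_drawing V E f \<longleftrightarrow>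
     straight_line_drawing V E f \<and>
     (\<forall>u v x y. {u, v} \<in> E \<and> {x, y} \<in> E \<and> {u, v} \<noteq> {x, y} \<and>
        open_segment (f u) (f v) \<inter> open_segment (f x) (f y) \<noteq> {} \<longrightarrow>
        orthogonal (f u - f v) (f x - f y))"

definition admits_RAC_drawing :: "'a set \<Rightarrow> 'a set set \<Rightarrow> bool" where
  "admits_RAC_drawing V E \<longleftrightarrow> (\<exists>f. RAC_drawing V E f)"

text \<open>The row-major adjacency matrix of a graph with vertex set \<open>{..<n}\<close>. Its length \<open>n * n\<close>
  determines \<open>n\<close>, so no separators are needed.\<close>

definition adjacency_word :: "nat \<Rightarrow> nat set set \<Rightarrow> bool list" where
  "adjacency_word n E = concat (map (\<lambda>i. map (\<lambda>j. {i, j} \<in> E) [0..<n]) [0..<n])"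

section \<open>Multi-tape Turing machines\<close>

datatype head_move = MoveLeft | Stay | MoveRight

text \<open>States and tape symbols are natural numbers. A transition \<open>((q, rs), (q', ws))\<close> applies in
  state \<open>q\<close> if \<open>rs ! i\<close> is the symbol under the head of tape \<open>i\<close>; it switches to state \<open>q'\<close>
  and on tape \<open>i\<close> performs the write and head movement \<open>ws ! i\<close>. Since the transition relation is
  required to be finite, only finitely many states and symbols can be used.
  State 0 is initial, state 1 is accepting; symbol 0 is the blank, 1 and 2 represent the bits.\<close>

record turing_machine =
  tapes :: nat
  trans :: "((nat \<times> nat list) \<times> (nat \<times> (nat \<times> head_move) list)) set"

definition well_formed :: "turing_machine \<Rightarrow> bool" where
  "well_formed M \<longleftrightarrow> tapes M \<ge> 1 \<and> finite (trans M) \<and>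
     (\<forall>((q, rs), (q', ws)) \<in> trans M. length rs = tapes M \<and> length ws = tapes M)"

text \<open>Two-way infinite tape contents together with the head position.\<close>

type_synonym tape = "(int \<Rightarrow> nat) \<times> int"

type_synonym config = "nat \<times> tape list"

fun read_tape :: "tape \<Rightarrow> nat" where
  "read_tape (t, h) = t h"

fun shift :: "head_move \<Rightarrow> int" where
  "shift MoveLeft = -1"
| "shift Stay = 0"
| "shift MoveRight = 1"

fun update_tape :: "nat \<times> head_move \<Rightarrow> tape \<Rightarrow> tape" where
  "update_tape (s, m) (t, h) = (t(h := s), h + shift m)"

definition step :: "turing_machine \<Rightarrow> (config \<times> config) set" where
  "step M = {((q, ts), (q', map2 update_tape ws ts)) | q ts q' ws.
               ((q, map read_tape ts), (q', ws)) \<in> trans M}"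

definition word_content :: "bool list \<Rightarrow> int \<Rightarrow> nat" where
  "word_content w i =
     (if 0 \<le> i \<and> i < int (length w) then (if w ! nat i then 2 else 1) else 0)"

definition initial :: "turing_machine \<Rightarrow> bool list \<Rightarrow> config" where
  "initial M w = (0, (word_content w, 0) # replicate (tapes M - 1) (\<lambda>_. 0, 0))"

text \<open>Every computation, along every nondeterministic branch, halts within the bound.\<close>

definition polynomial_time :: "turing_machine \<Rightarrow> bool" where
  "polynomial_time M \<longleftrightarrow>
     (\<exists>p :: nat poly. \<forall>w k c. (initial M w, c) \<in> step M ^^ k \<longrightarrow> k \<le> poly p (length w))"

definition halts_in :: "turing_machine \<Rightarrow> bool list \<Rightarrow> config \<Rightarrow> bool" where
  "halts_in M w c \<longleftrightarrow> (initial M w, c) \<in> (step M)\<^sup>* \<and> c \<notin> Domain (step M)"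

definition accepts :: "turing_machine \<Rightarrow> bool list \<Rightarrow> bool" where
  "accepts M w \<longleftrightarrow> (\<exists>c. halts_in M w c \<and> fst c = 1)"

text \<open>The output is the content of the last tape, regardless of its head position.\<close>

definition computes :: "turing_machine \<Rightarrow> (bool list \<Rightarrow> bool list) \<Rightarrow> bool" where
  "computes M f \<longleftrightarrow> (\<forall>w. \<exists>c. halts_in M w c \<and> fst (last (snd c)) = word_content (f w))"

section \<open>NP-hardness\<close>

definition NP :: "bool list set set" where
  "NP = {L. \<exists>M. well_formed M \<and> polynomial_time M \<and> L = {w. accepts M w}}"

definition polynomial_time_computable :: "(bool list \<Rightarrow> bool list) \<Rightarrow> bool" where
  "polynomial_time_computable f \<longleftrightarrow>
     (\<exists>M. well_formed M \<and> single_valued (trans M) \<and> polynomial_time M \<and> computes M f)"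

definition polynomial_time_reducible :: "bool list set \<Rightarrow> bool list set \<Rightarrow> bool" where
  "polynomial_time_reducible A B \<longleftrightarrow>
     (\<exists>f. polynomial_time_computable f \<and> (\<forall>w. w \<in> A \<longleftrightarrow> f w \<in> B))"

definition NP_hard :: "bool list set \<Rightarrow> bool" where
  "NP_hard B \<longleftrightarrow> (\<forall>A\<in>NP. polynomial_time_reducible A B)"

end

theory Submission
  imports Defs
begin

text \<open>Acceptance by a nondeterministic machine is expressed as satisfiability, satisfiability as bin
  packing with numbers of polynomial size, and bin packing by a graph with two hubs \<open>u\<close>, \<open>v\<close> and many
  \<^emph>\<open>layers\<close>, the common neighbours of \<open>u\<close> and \<open>v\<close>. Two disjoint crossing edges are perpendicular, so an
  edge crosses at most one edge of a star; by Thales' theorem at most one pair of layers on either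
  side of the line \<open>uv\<close> has crossing spokes. Hence, up to a bounded number of exceptions, the layers
  \<open>x\<close> give nested triangles \<open>u v x\<close>, cyclically ordered around the segment \<open>uv\<close>, and every other edge
  crosses at most one of them. An item of size \<open>s\<close> is a block of \<open>s\<close> layers, consecutive ones joined by
  nine paths of length two, so that nothing can come between them. Long blocks serve as walls, and the walls
  bounding a bin are joined by a path which has to cross all layers placed in the bin, one layer per edge; its
  length therefore bounds the total size of these items. Conversely, a packing is drawn with all layers on a line
  perpendicular to \<open>uv\<close> and each path crossing the spokes of one hub at right angles. Multiplying all
  sizes by ten absorbs the exceptional layers.\<close>

section \<open>Counter programs and Turing machines\<close>

datatype oper = Inc nat | Dec nat | IncIf nat nat | HeadRight | HeadLeft | Output nat

datatype prog = Op oper | Seq prog prog (infixr ";;" 60) | While nat prog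

type_synonym mem = "(nat \<Rightarrow> nat) \<times> int \<times> bool list"

fun oper_sem :: "bool list \<Rightarrow> oper \<Rightarrow> mem \<Rightarrow> mem" where
  "oper_sem w (Inc r) (s, i, out) = (s(r := s r + 1), i, out)"
| "oper_sem w (Dec r) (s, i, out) = (s(r := s r - 1), i, out)"
| "oper_sem w (IncIf a r) (s, i, out) = (s(r := s r + (if word_content w i = a then 1 else 0)), i, out)"
| "oper_sem w HeadRight (s, i, out) = (s, i + 1, out)"
| "oper_sem w HeadLeft (s, i, out) = (s, i - 1, out)"
| "oper_sem w (Output r) (s, i, out) = (s, i, out @ [s r \<noteq> 0])"

fun oper_below :: "nat \<Rightarrow> oper \<Rightarrow> bool" where
  "oper_below m (Inc r) \<longleftrightarrow> r < m"
| "oper_below m (Dec r) \<longleftrightarrow> r < m"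
| "oper_below m (IncIf a r) \<longleftrightarrow> r < m"
| "oper_below m (Output r) \<longleftrightarrow> r < m"
| "oper_below m _ \<longleftrightarrow> True"

fun prog_below :: "nat \<Rightarrow> prog \<Rightarrow> bool" where
  "prog_below m (Op a) \<longleftrightarrow> oper_below m a"
| "prog_below m (P ;; Q) \<longleftrightarrow> prog_below m P \<and> prog_below m Q"
| "prog_below m (While r P) \<longleftrightarrow> r < m \<and> prog_below m P"

inductive exec :: "bool list \<Rightarrow> prog \<Rightarrow> mem \<Rightarrow> nat \<Rightarrow> mem \<Rightarrow> bool" for w where
  exec_op: "exec w (Op a) x 1 (oper_sem w a x)"
| exec_seq: "exec w P x t y \<Longrightarrow> exec w Q y t' z \<Longrightarrow> exec w (P ;; Q) x (t + t') z"
| exec_done: "fst x r = 0 \<Longrightarrow> exec w (While r P) x 1 x"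
| exec_loop: "fst x r \<noteq> 0 \<Longrightarrow> exec w P x t y \<Longrightarrow> exec w (While r P) y t' z \<Longrightarrow>
    exec w (While r P) x (1 + (t + (1 + t'))) z"

datatype instr = Do oper | Jz nat nat | Jmp nat

fun compile :: "nat \<Rightarrow> prog \<Rightarrow> instr list" where
  "compile b (Op a) = [Do a]"
| "compile b (P ;; Q) = compile b P @ compile (b + length (compile b P)) Q"
| "compile b (While r P) = Jz r (b + length (compile (b + 1) P) + 2) # compile (b + 1) P @ [Jmp b]"

definition keep_tapes :: "nat list \<Rightarrow> (nat \<times> head_move) list" where
  "keep_tapes rs = map (\<lambda>a. (a, Stay)) rs"

fun action :: "nat \<Rightarrow> oper \<Rightarrow> nat list \<Rightarrow> (nat \<times> head_move) list" where
  "action m (Inc r) rs = (keep_tapes rs)[r + 1 := (rs ! (r + 1), MoveRight)]"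
| "action m (Dec r) rs = (keep_tapes rs)
     [r + 1 := (rs ! (r + 1), if rs ! (r + 1) = 1 then Stay else MoveLeft)]"
| "action m (IncIf a r) rs = (keep_tapes rs)
     [r + 1 := (rs ! (r + 1), if rs ! 0 = a then MoveRight else Stay)]"
| "action m HeadRight rs = (keep_tapes rs)[0 := (rs ! 0, MoveRight)]"
| "action m HeadLeft rs = (keep_tapes rs)[0 := (rs ! 0, MoveLeft)]"
| "action m (Output r) rs = (keep_tapes rs)
     [m + 1 := (if rs ! (r + 1) = 1 then 1 else 2, MoveRight)]"

fun instr_next :: "nat \<Rightarrow> nat \<Rightarrow> instr \<Rightarrow> nat list \<Rightarrow> nat \<times> (nat \<times> head_move) list" where
  "instr_next m pc (Do a) rs = (pc + 1, action m a rs)"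
| "instr_next m pc (Jz r l) rs = (if rs ! (r + 1) = 1 then l else pc + 1, keep_tapes rs)"
| "instr_next m pc (Jmp l) rs = (l, keep_tapes rs)"

definition mark_tapes :: "nat \<Rightarrow> nat list \<Rightarrow> (nat \<times> head_move) list" where
  "mark_tapes m rs = (rs ! 0, Stay) # replicate m (1, Stay) @ [(0, Stay)]"

definition next_action :: "nat \<Rightarrow> instr list \<Rightarrow> nat \<Rightarrow> nat list \<Rightarrow> nat \<times> (nat \<times> head_move) list" where
  "next_action m code q rs =
     (if q = 0 then (2, mark_tapes m rs)
      else let (pc, ws) = instr_next m (q - 2) (code ! (q - 2)) rs in (pc + 2, ws))"

definition symbol_lists :: "nat \<Rightarrow> nat list set" where
  "symbol_lists n = {rs. set rs \<subseteq> {0, 1, 2} \<and> length rs = n}"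

text \<open>Tape \<open>0\<close> is the input, tape \<open>r + 1\<close> stores register \<open>r\<close> as the distance of its head from a
  marker at cell \<open>0\<close>, and tape \<open>m + 1\<close> is the output. The marker is written by the first step.\<close>

definition machine :: "nat \<Rightarrow> instr list \<Rightarrow> turing_machine" where
  "machine m code = \<lparr>tapes = m + 2, trans = (\<lambda>(q, rs). ((q, rs), next_action m code q rs)) `
     (({0} \<union> {2..<length code + 2}) \<times> symbol_lists (m + 2))\<rparr>"

definition mem_tape :: "nat \<Rightarrow> bool list \<Rightarrow> mem \<Rightarrow> nat \<Rightarrow> tape" where
  "mem_tape m w x j = (case x of (s, i, out) \<Rightarrow>
     if j = 0 then (word_content w, i)
     else if j \<le> m then ((\<lambda>_. 0)(0 := 1), int (s (j - 1)))
     else (word_content out, int (length out)))"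

definition mem_tapes :: "nat \<Rightarrow> bool list \<Rightarrow> mem \<Rightarrow> tape list" where
  "mem_tapes m w x = map (mem_tape m w x) [0..<m + 2]"

definition mem_config :: "nat \<Rightarrow> bool list \<Rightarrow> nat \<Rightarrow> mem \<Rightarrow> config" where
  "mem_config m w pc x = (pc + 2, mem_tapes m w x)"

lemma word_content_range: "word_content w i \<in> {0, 1, 2}"
  by (simp add: word_content_def)

lemma word_content_snoc:
  "(word_content u)(int (length u) := if b then 2 else 1) = word_content (u @ [b])"
  by (rule ext) (auto simp: word_content_def nth_append)

lemma finite_symbol_lists: "finite (symbol_lists n)"
  unfolding symbol_lists_def by (rule finite_lists_length_eq) simp

lemma length_keep_tapes [simp]: "length (keep_tapes rs) = length rs"
  by (simp add: keep_tapes_def)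

lemma nth_keep_tapes [simp]: "j < length rs \<Longrightarrow> keep_tapes rs ! j = (rs ! j, Stay)"
  by (simp add: keep_tapes_def)

lemma length_action [simp]: "length (action m a rs) = length rs"
  by (cases a) auto

lemma length_next_action: "length rs = m + 2 \<Longrightarrow> length (snd (next_action m code q rs)) = m + 2"
  by (cases "code ! (q - 2)") (auto simp: next_action_def mark_tapes_def Let_def split: prod.splits)

lemma length_mem_tapes [simp]: "length (mem_tapes m w x) = m + 2"
  by (simp add: mem_tapes_def)

lemma nth_mem_tapes [simp]: "j < m + 2 \<Longrightarrow> mem_tapes m w x ! j = mem_tape m w x j"
  by (simp add: mem_tapes_def del: upt_Suc)

lemma well_formed_machine: "well_formed (machine m code)"
proof -
  have "length rs = m + 2 \<and> length ws = m + 2"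
    if "((q, rs), (q', ws)) \<in> trans (machine m code)" for q rs q' ws
  proof -
    from that have "length rs = m + 2" "next_action m code q rs = (q', ws)"
      by (auto simp: machine_def symbol_lists_def)
    then show ?thesis using length_next_action[of rs m code q] by simp
  qed
  moreover have "tapes (machine m code) = m + 2" "finite (trans (machine m code))"
    by (auto simp: machine_def finite_symbol_lists)
  ultimately show ?thesis unfolding well_formed_def by auto
qed

lemma single_valued_machine: "single_valued (trans (machine m code))"
proof (rule single_valuedI)
  fix x y z assume "(x, y) \<in> trans (machine m code)" "(x, z) \<in> trans (machine m code)"
  then have "y = next_action m code (fst x) (snd x)" "z = next_action m code (fst x) (snd x)"
    by (auto simp: machine_def)
  then show "y = z" by simp
qed

lemma machine_step:
  assumes "q \<in> {0} \<union> {2..<length code + 2}" "map read_tape ts \<in> symbol_lists (m + 2)"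
    "next_action m code q (map read_tape ts) = (q', ws)"
  shows "((q, ts), (q', map2 update_tape ws ts)) \<in> step (machine m code)"
proof -
  have "((q, map read_tape ts), (q', ws)) \<in> trans (machine m code)"
    using assms by (auto simp: machine_def image_iff intro!: bexI[of _ "(q, map read_tape ts)"])
  then show ?thesis unfolding step_def by blast
qed

lemma read_mem_tape:
  "read_tape (mem_tape m w (s, i, out) j) =
    (if j = 0 then word_content w i else if j \<le> m then (if s (j - 1) = 0 then 1 else 0) else 0)"
  by (auto simp: mem_tape_def word_content_def)

lemma read_mem_tapes: "map read_tape (mem_tapes m w x) \<in> symbol_lists (m + 2)"
  using word_content_range
  by (cases x) (auto simp: symbol_lists_def mem_tapes_def read_mem_tape word_content_def)

lemma update_tape_Stay: "update_tape (read_tape tp, Stay) tp = tp"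
  by (cases tp) auto

lemma update_action:
  assumes "oper_below m a"
  shows "map2 update_tape (action m a (map read_tape (mem_tapes m w x))) (mem_tapes m w x) =
    mem_tapes m w (oper_sem w a x)"
proof (rule nth_equalityI)
  let ?rs = "map read_tape (mem_tapes m w x)"
  obtain s i out where x: "x = (s, i, out)" by (cases x)
  fix j assume "j < length (map2 update_tape (action m a ?rs) (mem_tapes m w x))"
  then have j: "j < m + 2" by simp
  then have "map2 update_tape (action m a ?rs) (mem_tapes m w x) ! j =
      update_tape (action m a ?rs ! j) (mem_tape m w x j)" by simp
  also have "\<dots> = mem_tape m w (oper_sem w a x) j"
    using assms j word_content_snoc[of out True] word_content_snoc[of out False] unfolding x
    by (cases a)
       (auto simp: nth_list_update update_tape_Stay read_mem_tape,
        auto simp: mem_tape_def fun_upd_idem word_content_def)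
  finally show "map2 update_tape (action m a ?rs) (mem_tapes m w x) ! j =
      mem_tapes m w (oper_sem w a x) ! j" using j by simp
qed simp

lemma step_Do:
  assumes pc: "pc < length code" "code ! pc = Do a" and a: "oper_below m a"
  shows "(mem_config m w pc x, mem_config m w (pc + 1) (oper_sem w a x)) \<in> step (machine m code)"
proof -
  let ?rs = "map read_tape (mem_tapes m w x)"
  have "next_action m code (pc + 2) ?rs = (pc + 1 + 2, action m a ?rs)"
    using pc by (simp add: next_action_def)
  then show ?thesis
    using machine_step[OF _ read_mem_tapes, of "pc + 2" code m w x "pc + 1 + 2" "action m a ?rs"]
      pc(1) update_action[OF a] unfolding mem_config_def by simp
qed

lemma step_jump:
  assumes pc: "pc < length code" and
    l: "(code ! pc = Jmp l) \<or> (\<exists>r k. r < m \<and> code ! pc = Jz r k \<and> l = (if fst x r = 0 then k else pc + 1))"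
  shows "(mem_config m w pc x, mem_config m w l x) \<in> step (machine m code)"
proof -
  let ?rs = "map read_tape (mem_tapes m w x)"
  have "map2 update_tape (keep_tapes ?rs) (mem_tapes m w x) = mem_tapes m w x"
    by (rule nth_equalityI) (auto simp: update_tape_Stay)
  moreover have "next_action m code (pc + 2) ?rs = (l + 2, keep_tapes ?rs)"
    using l by (cases x) (auto simp: next_action_def read_mem_tape)
  ultimately show ?thesis
    using machine_step[OF _ read_mem_tapes, of "pc + 2"] pc unfolding mem_config_def by fastforce
qed

definition code_at :: "instr list \<Rightarrow> nat \<Rightarrow> instr list \<Rightarrow> bool" where
  "code_at code b block \<longleftrightarrow> (\<exists>pre post. code = pre @ block @ post \<and> length pre = b)"

lemma code_at_appendD:
  assumes "code_at code b (block @ block')"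
  shows "code_at code b block" "code_at code (b + length block) block'"
  using assms unfolding code_at_def by (metis append.assoc length_append)+

lemma code_at_ConsD:
  assumes "code_at code b (i # block)"
  shows "b < length code" "code ! b = i" "code_at code (b + 1) block"
proof -
  show "code_at code (b + 1) block" using assms code_at_appendD(2)[of code b "[i]" block] by simp
  obtain pre post where "code = pre @ (i # block) @ post" "length pre = b"
    using assms unfolding code_at_def by blast
  then show "b < length code" "code ! b = i" by auto
qed

lemma exec_compile:
  assumes "exec w P x t y" "prog_below m P" "code_at code b (compile b P)"
  shows "(mem_config m w b x, mem_config m w (b + length (compile b P)) y) \<in> step (machine m code) ^^ t"
  using assms
proof (induction arbitrary: b rule: exec.induct)
  case (exec_op a x)
  then show ?case using step_Do[of b code a m w x] code_at_ConsD[of code b "Do a" "[]"] by auto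
next
  case (exec_seq P x t y Q t' z)
  let ?b = "b + length (compile b P)"
  have placed: "code_at code b (compile b P)" "code_at code ?b (compile ?b Q)"
    using code_at_appendD[of code b "compile b P"] exec_seq.prems(2) by auto
  have "(mem_config m w b x, mem_config m w ?b y) \<in> step (machine m code) ^^ t"
    using exec_seq.prems(1) placed by (intro exec_seq.IH(1)) auto
  moreover have "(mem_config m w ?b y, mem_config m w (?b + length (compile ?b Q)) z)
      \<in> step (machine m code) ^^ t'"
    using exec_seq.prems(1) placed by (intro exec_seq.IH(2)) auto
  ultimately show ?case by (auto simp: relpow_add add.assoc)
next
  case (exec_done x r P)
  have "(mem_config m w b x, mem_config m w (b + length (compile (b + 1) P) + 2) x) \<in> step (machine m code)"
    using exec_done.hyps exec_done.prems code_at_ConsD[of code b "Jz r (b + length (compile (b + 1) P) + 2)"]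
    by (intro step_jump) auto
  then show ?case by (auto simp: add.assoc)
next
  case (exec_loop x r P t y t' z)
  let ?body = "compile (b + 1) P"
  let ?exit = "b + length ?body + 2"
  have placed: "code_at code b (Jz r ?exit # ?body @ [Jmp b])" using exec_loop.prems by simp
  note at_body = code_at_ConsD[OF placed] and at_jump = code_at_appendD[OF code_at_ConsD(3)[OF placed]]
  have enter: "(mem_config m w b x, mem_config m w (b + 1) x) \<in> step (machine m code) ^^ 1"
    using exec_loop.hyps(1) exec_loop.prems at_body step_jump[of b code "b + 1" m x w] by auto
  have body: "(mem_config m w (b + 1) x, mem_config m w (b + 1 + length ?body) y) \<in> step (machine m code) ^^ t"
    using exec_loop.prems at_jump by (intro exec_loop.IH(1)) auto
  have return: "(mem_config m w (b + 1 + length ?body) y, mem_config m w b y) \<in> step (machine m code) ^^ 1"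
    using code_at_ConsD[OF at_jump(2)] step_jump[of "b + 1 + length ?body" code b m y w] by auto
  have again: "(mem_config m w b y, mem_config m w (b + length (compile b (While r P))) z)
      \<in> step (machine m code) ^^ t'"
    using exec_loop.prems by (intro exec_loop.IH(2)) auto
  show ?case using enter body return again unfolding relpow_add by blast
qed

lemma halting_run_bound:
  assumes sv: "single_valued R" and "(a, b) \<in> R ^^ t" "b \<notin> Domain R" "(a, c) \<in> R ^^ k"
  shows "k \<le> t"
proof (rule ccontr)
  assume "\<not> k \<le> t"
  then obtain j where k: "k = t + Suc j" by (metis less_iff_Suc_add not_le add_Suc_right)
  then obtain b' where b': "(a, b') \<in> R ^^ t" "(b', c) \<in> R ^^ Suc j"
    using assms(4) by (auto simp: relpow_add)
  have "single_valued (R ^^ n)" for n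
    by (induction n) (auto intro!: single_valued_relcomp sv single_valued_Id)
  then have "b' = b" using b'(1) assms(2) by (auto dest: single_valuedD)
  then show False using b'(2) assms(3) by (metis Domain.DomainI relpow_Suc_E2)
qed

lemma single_valued_step:
  assumes "single_valued (trans M)"
  shows "single_valued (step M)"
proof (rule single_valuedI)
  fix x y z assume "(x, y) \<in> step M" "(x, z) \<in> step M"
  then obtain q' ws q'' ws' where
    "y = (q', map2 update_tape ws (snd x))" "((fst x, map read_tape (snd x)), (q', ws)) \<in> trans M"
    "z = (q'', map2 update_tape ws' (snd x))" "((fst x, map read_tape (snd x)), (q'', ws')) \<in> trans M"
    by (auto simp: step_def)
  then show "y = z" using assms by (metis prod.inject single_valuedD)
qed

abbreviation init_mem :: mem where
  "init_mem \<equiv> (\<lambda>_. 0, 0, [])"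

lemma machine_initial_step:
  "(initial (machine m code) w, mem_config m w 0 init_mem) \<in> step (machine m code)"
proof -
  let ?ts = "(word_content w, 0) # replicate (m + 1) (\<lambda>_. 0, 0) :: tape list"
  have symbols: "map read_tape ?ts = word_content w 0 # replicate (m + 1) 0" by simp
  then have "map read_tape ?ts \<in> symbol_lists (m + 2)"
    using word_content_range[of w 0] by (auto simp: symbol_lists_def)
  then have "((0, ?ts), (2, map2 update_tape (mark_tapes m (map read_tape ?ts)) ?ts))
      \<in> step (machine m code)"
    by (intro machine_step) (auto simp: next_action_def)
  moreover have "map2 update_tape (mark_tapes m (map read_tape ?ts)) ?ts = mem_tapes m w init_mem"
  proof (rule nth_equalityI)
    fix j assume "j < length (map2 update_tape (mark_tapes m (map read_tape ?ts)) ?ts)"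
    then have "j < m + 2" by (simp add: mark_tapes_def)
    then show "map2 update_tape (mark_tapes m (map read_tape ?ts)) ?ts ! j = mem_tapes m w init_mem ! j"
      unfolding mark_tapes_def symbols
      by (auto simp: nth_Cons' nth_append mem_tape_def word_content_def simp del: replicate_Suc)
  qed (simp add: mark_tapes_def)
  ultimately show ?thesis by (simp add: initial_def mem_config_def machine_def numeral_2_eq_2)
qed

lemma machine_run:
  assumes P: "prog_below m P" and run: "exec w P init_mem t (s, i, out)"
  obtains c where "(initial (machine m (compile 0 P)) w, c) \<in> step (machine m (compile 0 P)) ^^ (1 + t)"
    "c \<notin> Domain (step (machine m (compile 0 P)))" "fst (last (snd c)) = word_content out"
proof
  let ?code = "compile 0 P"
  let ?c = "mem_config m w (length ?code) (s, i, out)"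
  have "code_at ?code 0 ?code" by (auto simp: code_at_def)
  then have "(mem_config m w 0 init_mem, ?c) \<in> step (machine m ?code) ^^ t"
    using exec_compile[OF run P] by fastforce
  moreover have "(initial (machine m ?code) w, mem_config m w 0 init_mem) \<in> step (machine m ?code) ^^ 1"
    using machine_initial_step by simp
  ultimately show "(initial (machine m ?code) w, ?c) \<in> step (machine m ?code) ^^ (1 + t)"
    unfolding relpow_add by blast
  show "?c \<notin> Domain (step (machine m ?code))"
    by (auto simp: step_def machine_def mem_config_def)
  show "fst (last (snd ?c)) = word_content out"
    by (simp add: mem_config_def mem_tapes_def mem_tape_def)
qed

lemma prog_computable:
  assumes P: "prog_below m P"
    and run: "\<And>w. \<exists>t s i. t \<le> poly p (length w) \<and> exec w P init_mem t (s, i, f w)"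
  shows "polynomial_time_computable f"
proof -
  let ?M = "machine m (compile 0 P)"
  have halts: "\<exists>t c. t \<le> poly p (length w) + 1 \<and> (initial ?M w, c) \<in> step ?M ^^ t \<and>
      c \<notin> Domain (step ?M) \<and> fst (last (snd c)) = word_content (f w)" for w
  proof -
    obtain t s i where t: "t \<le> poly p (length w)" "exec w P init_mem t (s, i, f w)" using run by blast
    show ?thesis using machine_run[OF P t(2)] t(1) by (metis Suc_eq_plus1_left Suc_le_mono add.commute)
  qed
  have "polynomial_time ?M"
    unfolding polynomial_time_def
  proof (intro exI[of _ "p + 1"] allI impI)
    fix w k c assume "(initial ?M w, c) \<in> step ?M ^^ k"
    moreover obtain t c' where "t \<le> poly p (length w) + 1" "(initial ?M w, c') \<in> step ?M ^^ t"
        "c' \<notin> Domain (step ?M)"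
      using halts[of w] by blast
    ultimately have "k \<le> t"
      using halting_run_bound[OF single_valued_step[OF single_valued_machine]] by blast
    with \<open>t \<le> _\<close> show "k \<le> poly (p + 1) (length w)" by simp
  qed
  moreover have "computes ?M f"
    unfolding computes_def halts_in_def using halts relpow_imp_rtrancl by blast
  ultimately show ?thesis
    unfolding polynomial_time_computable_def
    using well_formed_machine single_valued_machine by blast
qed

section \<open>Functions computable in polynomial time\<close>

definition runs :: "bool list \<Rightarrow> prog \<Rightarrow> mem \<Rightarrow> nat \<Rightarrow> mem \<Rightarrow> bool" where
  "runs w P x T y \<longleftrightarrow> (\<exists>t\<le>T. exec w P x t y)"

lemma runs_op: "runs w (Op a) x 1 (oper_sem w a x)"
  unfolding runs_def using exec_op by blast

lemma runs_seq: "runs w P x T y \<Longrightarrow> runs w Q y T' z \<Longrightarrow> runs w (P ;; Q) x (T + T') z"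
  unfolding runs_def by (meson add_mono exec_seq)

lemma runs_mono: "runs w P x T y \<Longrightarrow> y = y' \<Longrightarrow> T \<le> T' \<Longrightarrow> runs w P x T' y'"
  unfolding runs_def by (meson le_trans)

lemma runs_op2: "runs w (Op a ;; Op b) x 2 (oper_sem w b (oper_sem w a x))"
  using runs_seq[OF runs_op runs_op] by (simp add: numeral_2_eq_2)

lemma runs_op3: "runs w (Op a ;; Op b ;; Op c) x 3 (oper_sem w c (oper_sem w b (oper_sem w a x)))"
  using runs_seq[OF runs_op runs_op2] by (simp add: numeral_3_eq_3 numeral_2_eq_2)

lemma runs_skip: "fst x r = 0 \<Longrightarrow> runs w (While r P) x 1 x"
  unfolding runs_def using exec_done by blast

lemma runs_loop:
  assumes "\<And>i. i < n \<Longrightarrow> runs w P (S (Suc i)) T (S i)" "\<And>i. i \<le> n \<Longrightarrow> fst (S i) r = 0 \<longleftrightarrow> i = 0"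
  shows "runs w (While r P) (S n) (n * (T + 2) + 1) (S 0)"
  using assms
proof (induction n)
  case 0
  then show ?case using runs_skip[of "S 0" r w P] by simp
next
  case (Suc n)
  have "runs w (While r P) (S n) (n * (T + 2) + 1) (S 0)" using Suc by auto
  then obtain t' where t': "t' \<le> n * (T + 2) + 1" "exec w (While r P) (S n) t' (S 0)"
    by (auto simp: runs_def)
  obtain t where t: "t \<le> T" "exec w P (S (Suc n)) t (S n)"
    using Suc.prems(1)[of n] by (auto simp: runs_def)
  have "exec w (While r P) (S (Suc n)) (1 + (t + (1 + t'))) (S 0)"
    using Suc.prems(2)[of "Suc n"] t t' by (intro exec_loop) auto
  moreover have "1 + (t + (1 + t')) \<le> Suc n * (T + 2) + 1" using t t' by simp
  ultimately show ?case unfolding runs_def by blast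
qed

lemma runs_loop_bound:
  assumes "\<And>i. i < n \<Longrightarrow> runs w P (S (Suc i)) T (S i)" "\<And>i. i \<le> n \<Longrightarrow> fst (S i) r = 0 \<longleftrightarrow> i = 0"
    and "x = S n" "y = S 0" "n \<le> N"
  shows "runs w (While r P) x (N * (T + 2) + 1) y"
proof -
  have "n * (T + 2) + 1 \<le> N * (T + 2) + 1" using assms(5) by (intro add_mono mult_right_mono) auto
  then show ?thesis using runs_mono[OF runs_loop[of n w P S T r] refl] assms(1-4) by blast
qed

definition clear_reg :: "nat \<Rightarrow> prog" where
  "clear_reg a = While a (Op (Dec a))"

definition add_reg :: "nat \<Rightarrow> nat \<Rightarrow> prog" where
  "add_reg a b = While a (Op (Dec a) ;; Op (Inc b))"

definition subtract_reg :: "nat \<Rightarrow> nat \<Rightarrow> prog" where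
  "subtract_reg a b = While a (Op (Dec a) ;; Op (Dec b))"

definition add_reg_both :: "nat \<Rightarrow> nat \<Rightarrow> nat \<Rightarrow> prog" where
  "add_reg_both a b c = While a (Op (Dec a) ;; Op (Inc b) ;; Op (Inc c))"

definition head_right :: "nat \<Rightarrow> nat \<Rightarrow> prog" where
  "head_right a b = While a (Op (Dec a) ;; Op (Inc b) ;; Op HeadRight)"

definition head_left :: "nat \<Rightarrow> prog" where
  "head_left a = While a (Op (Dec a) ;; Op HeadLeft)"

lemmas reg_prog_defs =
  clear_reg_def add_reg_def subtract_reg_def add_reg_both_def head_right_def head_left_def

lemma runs_clear_reg:
  assumes "s a \<le> N"
  shows "runs w (clear_reg a) (s, i, out) (N * 3 + 1) (s(a := 0), i, out)"
  unfolding clear_reg_def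
  by (rule runs_mono[OF runs_loop_bound[where S = "\<lambda>k. (s(a := k), i, out)" and T = 1, OF _ _ _ refl assms] refl])
    (auto intro!: runs_mono[OF runs_op])

lemma runs_add_reg:
  assumes "a \<noteq> b" "s a \<le> N"
  shows "runs w (add_reg a b) (s, i, out) (N * 4 + 1) (s(a := 0, b := s b + s a), i, out)"
  unfolding add_reg_def
  by (rule runs_mono[OF runs_loop_bound[where S = "\<lambda>k. (s(a := k, b := s b + (s a - k)), i, out)"
        and T = 2, OF _ _ _ refl assms(2)]])
    (use assms(1) in \<open>auto intro!: runs_mono[OF runs_op2] simp: fun_eq_iff\<close>)

lemma runs_subtract_reg:
  assumes "a \<noteq> b" "s a \<le> N"
  shows "runs w (subtract_reg a b) (s, i, out) (N * 4 + 1) (s(a := 0, b := s b - s a), i, out)"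
  unfolding subtract_reg_def
  by (rule runs_mono[OF runs_loop_bound[where S = "\<lambda>k. (s(a := k, b := s b - (s a - k)), i, out)"
        and T = 2, OF _ _ _ refl assms(2)]])
    (use assms(1) in \<open>auto intro!: runs_mono[OF runs_op2] simp: fun_eq_iff\<close>)

lemma runs_add_reg_both:
  assumes "a \<noteq> b" "a \<noteq> c" "b \<noteq> c" "s a \<le> N"
  shows "runs w (add_reg_both a b c) (s, i, out) (N * 5 + 1)
    (s(a := 0, b := s b + s a, c := s c + s a), i, out)"
  unfolding add_reg_both_def
  by (rule runs_mono[OF runs_loop_bound[where S = "\<lambda>k. (s(a := k, b := s b + (s a - k), c := s c + (s a - k)), i, out)"
        and T = 3, OF _ _ _ refl assms(4)]])
    (use assms(1-3) in \<open>auto intro!: runs_mono[OF runs_op3] simp: fun_eq_iff\<close>)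

lemma runs_head_right:
  assumes "a \<noteq> b" "s a \<le> N"
  shows "runs w (head_right a b) (s, i, out) (N * 5 + 1) (s(a := 0, b := s b + s a), i + int (s a), out)"
  unfolding head_right_def
  by (rule runs_mono[OF runs_loop_bound[where
        S = "\<lambda>k. (s(a := k, b := s b + (s a - k)), i + int (s a) - int k, out)" and T = 3, OF _ _ _ refl assms(2)]])
    (use assms(1) in \<open>auto intro!: runs_mono[OF runs_op3] simp: fun_eq_iff\<close>)

lemma runs_head_left:
  assumes "s a \<le> N"
  shows "runs w (head_left a) (s, i, out) (N * 4 + 1) (s(a := 0), i - int (s a), out)"
  unfolding head_left_def
  by (rule runs_mono[OF runs_loop_bound[where S = "\<lambda>k. (s(a := k), i - int (s a) + int k, out)"
        and T = 2, OF _ _ _ refl assms]])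
    (auto intro!: runs_mono[OF runs_op2])

definition poly_bounded :: "(nat \<Rightarrow> nat) \<Rightarrow> bool" where
  "poly_bounded q \<longleftrightarrow> (\<exists>p :: nat poly. \<forall>n. q n \<le> poly p n)"

lemma poly_nat_mono: "x \<le> y \<Longrightarrow> poly p x \<le> poly p y" for p :: "nat poly"
  by (induction p) (auto intro: mult_mono)

lemma poly_bounded_id: "poly_bounded (\<lambda>n. n)"
  unfolding poly_bounded_def by (intro exI[of _ "[:0, 1:]"]) simp

lemma poly_bounded_const: "poly_bounded (\<lambda>_. c)"
  unfolding poly_bounded_def by (intro exI[of _ "[:c:]"]) simp

lemma poly_bounded_add:
  assumes "poly_bounded f" "poly_bounded g" shows "poly_bounded (\<lambda>n. f n + g n)"
proof -
  obtain p q where "\<And>n. f n \<le> poly p n" "\<And>n. g n \<le> poly q n"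
    using assms by (auto simp: poly_bounded_def)
  then show ?thesis
    unfolding poly_bounded_def by (intro exI[of _ "p + q"]) (simp add: add_mono)
qed

lemma poly_bounded_mult:
  assumes "poly_bounded f" "poly_bounded g" shows "poly_bounded (\<lambda>n. f n * g n)"
proof -
  obtain p q where "\<And>n. f n \<le> poly p n" "\<And>n. g n \<le> poly q n"
    using assms by (auto simp: poly_bounded_def)
  then show ?thesis
    unfolding poly_bounded_def by (intro exI[of _ "p * q"]) (simp add: mult_mono)
qed

lemma poly_bounded_comp:
  assumes "poly_bounded f" "poly_bounded g" shows "poly_bounded (\<lambda>n. f (g n))"
proof -
  obtain p q where pq: "\<And>n. f n \<le> poly p n" "\<And>n. g n \<le> poly q n"
    using assms by (auto simp: poly_bounded_def)
  have "f (g n) \<le> poly p (poly q n)" for n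
    using pq(1)[of "g n"] poly_nat_mono[OF pq(2)[of n], of p] by (rule order_trans)
  then show ?thesis
    unfolding poly_bounded_def by (intro exI[of _ "pcompose p q"]) (simp add: poly_pcompose)
qed

lemmas poly_bounded_intros =
  poly_bounded_id poly_bounded_const poly_bounded_add poly_bounded_mult

text \<open>A program for level \<open>d\<close> reads its arguments from registers below \<open>d\<close> as directed by \<open>\<rho>\<close> and
  returns the value in register \<open>d\<close>; all registers from \<open>d\<close> on are zero before, and all above \<open>d\<close>
  are zero again afterwards.\<close>

definition realizes ::
  "(bool list \<Rightarrow> (nat \<Rightarrow> nat) \<Rightarrow> nat) \<Rightarrow> (nat \<Rightarrow> nat) \<Rightarrow> nat \<Rightarrow> prog \<Rightarrow> (nat \<Rightarrow> nat) \<Rightarrow> bool" where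
  "realizes f \<rho> d P q \<longleftrightarrow> (\<forall>w s out B. (\<forall>r\<ge>d. s r = 0) \<longrightarrow> (\<forall>j. s (\<rho> j) \<le> B) \<longrightarrow>
     f w (\<lambda>j. s (\<rho> j)) \<le> q B \<and>
     runs w P (s, 0, out) (q B) (s(d := f w (\<lambda>j. s (\<rho> j))), 0, out))"

definition feasible :: "(bool list \<Rightarrow> (nat \<Rightarrow> nat) \<Rightarrow> nat) \<Rightarrow> bool" where
  "feasible f \<longleftrightarrow> (\<forall>\<rho> d. (\<forall>j. \<rho> j < d) \<longrightarrow>
     (\<exists>P m q. prog_below m P \<and> poly_bounded q \<and> realizes f \<rho> d P q))"

lemma feasibleE:
  assumes "feasible f" "\<And>j. \<rho> j < d"
  obtains P m q where "prog_below m P" "poly_bounded q" "realizes f \<rho> d P q"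
  using assms unfolding feasible_def by blast

lemma feasibleI:
  assumes "\<And>\<rho> d. (\<And>j. \<rho> j < d) \<Longrightarrow>
     \<exists>P m q. prog_below m P \<and> poly_bounded q \<and> realizes f \<rho> d P q"
  shows "feasible f"
  unfolding feasible_def using assms by blast

lemma realizesD:
  assumes "realizes f \<rho> d P q" "\<forall>r\<ge>d. s r = 0" "\<forall>j. s (\<rho> j) \<le> B"
  shows "f w (\<lambda>j. s (\<rho> j)) \<le> q B"
    "runs w P (s, 0, out) (q B) (s(d := f w (\<lambda>j. s (\<rho> j))), 0, out)"
  using assms unfolding realizes_def by blast+

lemma realizesI:
  assumes "\<And>w s B. \<forall>r\<ge>d. s r = 0 \<Longrightarrow> \<forall>j. s (\<rho> j) \<le> B \<Longrightarrow> f w (\<lambda>j. s (\<rho> j)) \<le> q B"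
    and "\<And>w s out B. \<forall>r\<ge>d. s r = 0 \<Longrightarrow> \<forall>j. s (\<rho> j) \<le> B \<Longrightarrow>
      runs w P (s, 0, out) (q B) (s(d := f w (\<lambda>j. s (\<rho> j))), 0, out)"
  shows "realizes f \<rho> d P q"
  using assms unfolding realizes_def by blast

lemma prog_below_mono: "prog_below m P \<Longrightarrow> m \<le> m' \<Longrightarrow> prog_below m' P"
proof (induction P)
  case (Op a)
  then show ?case by (cases a) auto
qed auto

lemma feasible_var: "feasible (\<lambda>w e. e j)"
proof (rule feasibleI)
  fix \<rho> :: "nat \<Rightarrow> nat" and d assume "\<And>j. \<rho> j < (d :: nat)"
  then have arg: "\<rho> j < d" .
  let ?P = "add_reg_both (\<rho> j) d (Suc d) ;; add_reg (Suc d) (\<rho> j)"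
  let ?q = "\<lambda>B. (B * 5 + 1) + (B * 4 + 1)"
  have "realizes (\<lambda>w e. e j) \<rho> d ?P ?q"
  proof (rule realizesI)
    fix w s B and out :: "bool list"
    assume zero: "\<forall>r\<ge>d. s r = (0 :: nat)" and bound: "\<forall>j. s (\<rho> j) \<le> B"
    let ?s = "s(\<rho> j := 0, d := s (\<rho> j), Suc d := s (\<rho> j))"
    have "runs w (add_reg_both (\<rho> j) d (Suc d)) (s, 0, out) (B * 5 + 1) (?s, 0, out)"
      using runs_add_reg_both[of "\<rho> j" d "Suc d" s B w 0 out] arg zero bound by simp
    moreover have "runs w (add_reg (Suc d) (\<rho> j)) (?s, 0, out) (B * 4 + 1) (s(d := s (\<rho> j)), 0, out)"
      using arg zero bound by (intro runs_mono[OF runs_add_reg[where N = B]]) (auto simp: fun_eq_iff)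
    ultimately show "runs w ?P (s, 0, out) (?q B) (s(d := s (\<rho> j)), 0, out)" by (rule runs_seq)
    have "s (\<rho> j) \<le> B" using bound by blast
    then show "s (\<rho> j) \<le> ?q B" by simp
  qed
  moreover have "prog_below (d + 2) ?P" using arg by (auto simp: reg_prog_defs)
  moreover have "poly_bounded ?q" by (intro poly_bounded_intros)
  ultimately show "\<exists>P m q. prog_below m P \<and> poly_bounded q \<and> realizes (\<lambda>w e. e j) \<rho> d P q" by blast
qed

lemma feasible_0: "feasible (\<lambda>w e. 0)"
proof (rule feasibleI)
  fix \<rho> :: "nat \<Rightarrow> nat" and d assume "\<And>j. \<rho> j < d"
  have "runs w (While d (Op (Inc d))) (s, 0, out) 1 (s(d := 0), 0, out)" if "s d = 0" for w s out
    using that by (intro runs_mono[OF runs_skip]) auto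
  then show "\<exists>P m q. prog_below m P \<and> poly_bounded q \<and> realizes (\<lambda>w e. 0) \<rho> d P q"
    unfolding realizes_def
    by (intro exI[of _ "While d (Op (Inc d))"] exI[of _ "d + 1"] exI[of _ "\<lambda>_. 1"])
       (auto intro: poly_bounded_const)
qed

lemma feasible_1: "feasible (\<lambda>w e. 1)"
proof (rule feasibleI)
  fix \<rho> :: "nat \<Rightarrow> nat" and d assume "\<And>j. \<rho> j < d"
  have "runs w (Op (Inc d)) (s, 0, out) 1 (s(d := 1), 0, out)" if "s d = 0" for w s out
    using that by (intro runs_mono[OF runs_op]) auto
  then show "\<exists>P m q. prog_below m P \<and> poly_bounded q \<and> realizes (\<lambda>w e. 1) \<rho> d P q"
    unfolding realizes_def
    by (intro exI[of _ "Op (Inc d)"] exI[of _ "d + 1"] exI[of _ "\<lambda>_. 1"])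
       (auto intro: poly_bounded_const)
qed

lemma realizes_binary:
  assumes \<rho>: "\<And>j. \<rho> j < d" and f: "realizes f \<rho> d P q" and g: "realizes g \<rho> (Suc d) Q q'"
    and loop: "\<And>w s out N. s (Suc d) \<le> N \<Longrightarrow>
      runs w L (s, 0, out) (N * 4 + 1) (s(Suc d := 0, d := h (s d) (s (Suc d))), 0, out)"
    and le: "\<And>a b. h a b \<le> a + b"
  shows "realizes (\<lambda>w e. h (f w e) (g w e)) \<rho> d (P ;; Q ;; L) (\<lambda>B. q B + (q' B + (q' B * 4 + 1)))"
proof (rule realizesI)
  fix w s B assume zero: "\<forall>r\<ge>d. s r = (0 :: nat)" and bound: "\<forall>j. s (\<rho> j) \<le> B"
  let ?e = "\<lambda>j. s (\<rho> j)"
  have args: "(\<lambda>j. (s(d := f w ?e)) (\<rho> j)) = ?e" using \<rho> by (auto simp: fun_eq_iff less_imp_neq)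
  have zero': "\<forall>r\<ge>Suc d. (s(d := f w ?e)) r = 0" and bound': "\<forall>j. (s(d := f w ?e)) (\<rho> j) \<le> B"
    using zero bound less_imp_neq[OF \<rho>] by auto
  have value_bounds: "f w ?e \<le> q B" "g w ?e \<le> q' B"
    using realizesD(1)[OF f zero bound] realizesD(1)[OF g zero' bound', of w] args by simp_all
  then show "h (f w ?e) (g w ?e) \<le> q B + (q' B + (q' B * 4 + 1))" using le[of "f w ?e" "g w ?e"] by linarith
  fix out
  have "runs w P (s, 0, out) (q B) (s(d := f w ?e), 0, out)" by (rule realizesD(2)[OF f zero bound])
  moreover have "runs w Q (s(d := f w ?e), 0, out) (q' B) (s(d := f w ?e, Suc d := g w ?e), 0, out)"
    using realizesD(2)[OF g zero' bound', of w out] by (simp only: args)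
  moreover have "runs w L (s(d := f w ?e, Suc d := g w ?e), 0, out) (q' B * 4 + 1)
      (s(d := h (f w ?e) (g w ?e)), 0, out)"
    using value_bounds(2) zero by (intro runs_mono[OF loop[where N = "q' B"]]) (auto simp: fun_eq_iff)
  ultimately show "runs w (P ;; Q ;; L) (s, 0, out) (q B + (q' B + (q' B * 4 + 1)))
      (s(d := h (f w ?e) (g w ?e)), 0, out)" by (intro runs_seq)
qed

lemma feasible_binary:
  assumes f: "feasible f" and g: "feasible g"
    and loop: "\<And>d w s out N. s (Suc d) \<le> N \<Longrightarrow>
      runs w (L d) (s, 0, out) (N * 4 + 1) (s(Suc d := 0, d := h (s d) (s (Suc d))), 0, out)"
    and below: "\<And>d. prog_below (d + 2) (L d)" and le: "\<And>a b. h a b \<le> a + b"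
  shows "feasible (\<lambda>w e. h (f w e) (g w e))"
proof (rule feasibleI)
  fix \<rho> :: "nat \<Rightarrow> nat" and d assume \<rho>: "\<And>j. \<rho> j < (d :: nat)"
  then have \<rho>': "\<And>j. \<rho> j < Suc d" using less_SucI by blast
  obtain P m q where P: "prog_below m P" "poly_bounded q" "realizes f \<rho> d P q"
    using feasibleE[where \<rho> = "\<rho>" and d = "d", OF f \<rho>] by blast
  obtain Q m' q' where Q: "prog_below m' Q" "poly_bounded q'" "realizes g \<rho> (Suc d) Q q'"
    using feasibleE[where \<rho> = "\<rho>" and d = "Suc d", OF g \<rho>'] by blast
  have "prog_below (m + m' + d + 2) (P ;; Q ;; L d)"
    using P(1) Q(1) below[of d] by (auto intro: prog_below_mono)
  moreover have "poly_bounded (\<lambda>B. q B + (q' B + (q' B * 4 + 1)))" by (intro poly_bounded_intros P Q)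
  ultimately show "\<exists>P m q. prog_below m P \<and> poly_bounded q \<and> realizes (\<lambda>w e. h (f w e) (g w e)) \<rho> d P q"
    using realizes_binary[OF \<rho> P(3) Q(3) loop le] by blast
qed

lemma feasible_add: "feasible f \<Longrightarrow> feasible g \<Longrightarrow> feasible (\<lambda>w e. f w e + g w e)"
  by (rule feasible_binary[where L = "\<lambda>d. add_reg (Suc d) d" and h = "(+)"])
    (rule runs_add_reg | simp add: add_reg_def)+

lemma feasible_diff: "feasible f \<Longrightarrow> feasible g \<Longrightarrow> feasible (\<lambda>w e. f w e - g w e)"
  by (rule feasible_binary[where L = "\<lambda>d. subtract_reg (Suc d) d" and h = "(-)"])
    (rule runs_subtract_reg | simp add: subtract_reg_def)+

lemma feasible_const: "feasible (\<lambda>w e. c)"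
  by (induction c) (use feasible_0 feasible_add[OF _ feasible_1] in auto)

text \<open>Summation keeps the index in register \<open>d + 1\<close>, where the bound is computed first, and the
  summands in register \<open>d + 2\<close>.\<close>

definition sum_body :: "nat \<Rightarrow> prog \<Rightarrow> prog" where
  "sum_body d Q = Op (Dec (Suc d)) ;; Q ;; add_reg (Suc (Suc d)) d"

lemma runs_sum_body:
  assumes \<rho>: "\<And>j. \<rho> j < d"
    and g: "realizes (\<lambda>w e. g w (e 0) (\<lambda>j. e (Suc j))) (case_nat (Suc d) \<rho>) (Suc (Suc d)) Q q"
    and zero: "\<forall>r\<ge>Suc (Suc d). s r = 0" and bound: "\<forall>j. s (\<rho> j) \<le> B"
    and index: "s (Suc d) = Suc i" "i \<le> B"
  shows "g w i (\<lambda>j. s (\<rho> j)) \<le> q B"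
    "runs w (sum_body d Q) (s, 0, out) (1 + (q B + (q B * 4 + 1)))
      (s(Suc d := i, d := s d + g w i (\<lambda>j. s (\<rho> j))), 0, out)"
proof -
  let ?s = "s(Suc d := i)" and ?e = "\<lambda>j. s (\<rho> j)"
  have neq: "\<rho> j \<noteq> Suc d" for j using \<rho>[of j] by simp
  have args: "(\<lambda>j. ?s (\<rho> j)) = ?e" using neq by (auto simp: fun_eq_iff)
  have zero': "\<forall>r\<ge>Suc (Suc d). ?s r = 0" using zero by simp
  have bound': "\<forall>j. ?s (case_nat (Suc d) \<rho> j) \<le> B" using bound index(2) neq by (auto split: nat.split)
  show le: "g w i ?e \<le> q B"
    using realizesD(1)[OF g zero' bound', of w] by (simp only: nat.case args fun_upd_same)
  have "runs w (Op (Dec (Suc d))) (s, 0, out) 1 (?s, 0, out)"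
    using index(1) by (intro runs_mono[OF runs_op]) auto
  moreover have "runs w Q (?s, 0, out) (q B) (?s(Suc (Suc d) := g w i ?e), 0, out)"
    using realizesD(2)[OF g zero' bound', of w out] by (simp only: nat.case args fun_upd_same)
  moreover have "runs w (add_reg (Suc (Suc d)) d) (?s(Suc (Suc d) := g w i ?e), 0, out) (q B * 4 + 1)
      (s(Suc d := i, d := s d + g w i ?e), 0, out)"
    using le zero by (intro runs_mono[OF runs_add_reg[where N = "q B"]]) (auto simp: fun_eq_iff)
  ultimately show "runs w (sum_body d Q) (s, 0, out) (1 + (q B + (q B * 4 + 1)))
      (s(Suc d := i, d := s d + g w i ?e), 0, out)"
    unfolding sum_body_def by (intro runs_seq)
qed

lemma runs_sum_loop:
  assumes \<rho>: "\<And>j. \<rho> j < d"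
    and g: "realizes (\<lambda>w e. g w (e 0) (\<lambda>j. e (Suc j))) (case_nat (Suc d) \<rho>) (Suc (Suc d)) Q q"
    and zero: "\<forall>r\<ge>d. s r = 0" and bound: "\<forall>j. s (\<rho> j) \<le> B" and n: "n \<le> B"
  shows "runs w (While (Suc d) (sum_body d Q)) (s(Suc d := n), 0, out)
    (n * (1 + (q B + (q B * 4 + 1)) + 2) + 1) (s(d := \<Sum>i<n. g w i (\<lambda>j. s (\<rho> j))), 0, out)"
proof -
  let ?S = "\<lambda>i. (s(d := \<Sum>k=i..<n. g w k (\<lambda>j. s (\<rho> j)), Suc d := i), 0, out) :: mem"
  have neq: "\<rho> j \<noteq> d" "\<rho> j \<noteq> Suc d" for j using \<rho>[of j] by simp_all
  show ?thesis
  proof (rule runs_loop_bound[where S = ?S and n = n])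
    fix i assume i: "i < n"
    let ?s = "s(d := \<Sum>k=Suc i..<n. g w k (\<lambda>j. s (\<rho> j)), Suc d := Suc i)"
    have "runs w (sum_body d Q) (?s, 0, out) (1 + (q B + (q B * 4 + 1)))
        (?s(Suc d := i, d := ?s d + g w i (\<lambda>j. ?s (\<rho> j))), 0, out)"
      using zero bound neq i n by (intro runs_sum_body[OF \<rho> g]) auto
    then show "runs w (sum_body d Q) (?S (Suc i)) (1 + (q B + (q B * 4 + 1))) (?S i)"
      by (rule runs_mono) (use i neq in \<open>auto simp: fun_eq_iff sum.atLeast_Suc_lessThan\<close>)
  qed (use zero in \<open>auto simp: fun_eq_iff atLeast0LessThan\<close>)
qed

lemma realizes_sum:
  assumes \<rho>: "\<And>j. \<rho> j < d" and f: "realizes f \<rho> (Suc d) P q"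
    and g: "realizes (\<lambda>w e. g w (e 0) (\<lambda>j. e (Suc j))) (case_nat (Suc d) \<rho>) (Suc (Suc d)) Q q'"
  shows "realizes (\<lambda>w e. \<Sum>i<f w e. g w i e) \<rho> d (P ;; While (Suc d) (sum_body d Q))
    (\<lambda>B. q B + (q B * (1 + (q' (B + q B) + (q' (B + q B) * 4 + 1)) + 2) + 1))"
proof (rule realizesI)
  fix w s B assume zero: "\<forall>r\<ge>d. s r = (0 :: nat)" and bound: "\<forall>j. s (\<rho> j) \<le> B"
  let ?e = "\<lambda>j. s (\<rho> j)"
  let ?n = "f w ?e" and ?T = "1 + (q' (B + q B) + (q' (B + q B) * 4 + 1)) + 2"
  have zero': "\<forall>r\<ge>Suc d. s r = 0" using zero by auto
  have n: "?n \<le> q B" by (rule realizesD(1)[OF f zero' bound])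
  have neq: "\<rho> j \<noteq> Suc d" for j using \<rho>[of j] by simp
  have summand: "g w i ?e \<le> q' (B + q B)" if "i < ?n" for i
    using runs_sum_body(1)[OF \<rho> g, of "s(Suc d := Suc i)" "B + q B" i w] zero' bound that n neq
    by (simp add: trans_le_add1)
  have "(\<Sum>i<?n. g w i ?e) \<le> (\<Sum>i<?n. q' (B + q B))" using summand by (intro sum_mono) auto
  also have "\<dots> = ?n * q' (B + q B)" by simp
  also have "\<dots> \<le> q B * ?T" by (intro mult_mono n) auto
  finally show "(\<Sum>i<?n. g w i ?e) \<le> q B + (q B * ?T + 1)" by simp
  fix out
  have "runs w P (s, 0, out) (q B) (s(Suc d := ?n), 0, out)" by (rule realizesD(2)[OF f zero' bound])
  moreover have "runs w (While (Suc d) (sum_body d Q)) (s(Suc d := ?n), 0, out) (?n * ?T + 1)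
      (s(d := \<Sum>i<?n. g w i ?e), 0, out)"
    using bound n by (intro runs_sum_loop[OF \<rho> g zero]) (auto simp: trans_le_add1)
  then have "runs w (While (Suc d) (sum_body d Q)) (s(Suc d := ?n), 0, out) (q B * ?T + 1)
      (s(d := \<Sum>i<?n. g w i ?e), 0, out)"
    by (rule runs_mono[OF _ refl]) (intro add_mono mult_right_mono n, simp_all)
  ultimately show "runs w (P ;; While (Suc d) (sum_body d Q)) (s, 0, out) (q B + (q B * ?T + 1))
      (s(d := \<Sum>i<?n. g w i ?e), 0, out)" by (rule runs_seq)
qed

lemma feasible_sum:
  assumes f: "feasible f" and g: "feasible (\<lambda>w e. g w (e 0) (\<lambda>j. e (Suc j)))"
  shows "feasible (\<lambda>w e. \<Sum>i<f w e. g w i e)"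
proof (rule feasibleI)
  fix \<rho> :: "nat \<Rightarrow> nat" and d assume \<rho>: "\<And>j. \<rho> j < (d :: nat)"
  then have \<rho>': "\<And>j. \<rho> j < Suc d" using less_SucI by blast
  have \<rho>'': "\<And>j. case_nat (Suc d) \<rho> j < Suc (Suc d)" using \<rho>' by (simp add: less_SucI split: nat.split)
  obtain P m q where P: "prog_below m P" "poly_bounded q" "realizes f \<rho> (Suc d) P q"
    using feasibleE[where \<rho> = "\<rho>" and d = "Suc d", OF f \<rho>'] by blast
  obtain Q m' q' where Q: "prog_below m' Q" "poly_bounded q'"
    "realizes (\<lambda>w e. g w (e 0) (\<lambda>j. e (Suc j))) (case_nat (Suc d) \<rho>) (Suc (Suc d)) Q q'"
    using feasibleE[where \<rho> = "case_nat (Suc d) \<rho>" and d = "Suc (Suc d)", OF g \<rho>''] by blast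
  have "prog_below (m + m' + d + 3) (P ;; While (Suc d) (sum_body d Q))"
    using P(1) Q(1) by (auto intro: prog_below_mono simp: sum_body_def reg_prog_defs)
  moreover have "poly_bounded (\<lambda>B. q' (B + q B))"
    by (rule poly_bounded_comp[OF Q(2)]) (intro poly_bounded_intros P)
  then have "poly_bounded (\<lambda>B. q B + (q B * (1 + (q' (B + q B) + (q' (B + q B) * 4 + 1)) + 2) + 1))"
    by (intro poly_bounded_intros P)
  ultimately show "\<exists>P m q. prog_below m P \<and> poly_bounded q \<and> realizes (\<lambda>w e. \<Sum>i<f w e. g w i e) \<rho> d P q"
    using realizes_sum[OF \<rho> P(3) Q(3)] by blast
qed

definition read_symbol :: "nat \<Rightarrow> prog" where
  "read_symbol d = head_right (Suc d) (Suc (Suc d)) ;;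
     (Op (IncIf 1 d) ;; Op (IncIf 2 d) ;; Op (IncIf 2 d)) ;; head_left (Suc (Suc d))"

lemma runs_read_symbol:
  assumes zero: "\<forall>r\<ge>d. s r = 0" and n: "n \<le> N"
  shows "runs w (read_symbol d) (s(Suc d := n), 0, out) ((N * 5 + 1) + (3 + (N * 4 + 1)))
    (s(d := word_content w (int n)), 0, out)"
proof -
  let ?d' = "Suc (Suc d)"
  let ?c = "word_content w (int n)"
  have "runs w (head_right (Suc d) ?d') (s(Suc d := n), 0, out) (N * 5 + 1) (s(?d' := n), int n, out)"
    using n zero by (intro runs_mono[OF runs_head_right[where N = N]]) (auto simp: fun_eq_iff)
  moreover have "runs w (Op (IncIf 1 d) ;; Op (IncIf 2 d) ;; Op (IncIf 2 d)) (s(?d' := n), int n, out) 3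
      (s(?d' := n, d := ?c), int n, out)"
    using zero word_content_range[of w "int n"]
    by (intro runs_mono[OF runs_op3]) (auto simp: fun_eq_iff)
  moreover have "runs w (head_left ?d') (s(?d' := n, d := ?c), int n, out) (N * 4 + 1) (s(d := ?c), 0, out)"
    using n zero by (intro runs_mono[OF runs_head_left[where N = N]]) (auto simp: fun_eq_iff)
  ultimately show ?thesis unfolding read_symbol_def by (intro runs_seq)
qed

lemma feasible_symbol:
  assumes f: "feasible f"
  shows "feasible (\<lambda>w e. word_content w (int (f w e)))"
proof (rule feasibleI)
  fix \<rho> :: "nat \<Rightarrow> nat" and d assume "\<And>j. \<rho> j < (d :: nat)"
  then have \<rho>: "\<And>j. \<rho> j < Suc d" using less_SucI by blast
  obtain P m q where P: "prog_below m P" "poly_bounded q" "realizes f \<rho> (Suc d) P q"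
    using feasibleE[where \<rho> = "\<rho>" and d = "Suc d", OF f \<rho>] by blast
  let ?q = "\<lambda>B. q B + ((q B * 5 + 1) + (3 + (q B * 4 + 1)))"
  have "realizes (\<lambda>w e. word_content w (int (f w e))) \<rho> d (P ;; read_symbol d) ?q"
  proof (rule realizesI)
    fix w s out B assume zero: "\<forall>r\<ge>d. s r = (0 :: nat)" and bound: "\<forall>j. s (\<rho> j) \<le> B"
    then have zero': "\<forall>r\<ge>Suc d. s r = 0" by auto
    show "runs w (P ;; read_symbol d) (s, 0, out) (?q B)
        (s(d := word_content w (int (f w (\<lambda>j. s (\<rho> j))))), 0, out)"
      by (rule runs_seq[OF realizesD(2)[OF P(3) zero' bound]
            runs_read_symbol[OF zero realizesD(1)[OF P(3) zero' bound]]])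
  next
    show "word_content w (int (f w e)) \<le> ?q B" for w e B
      using word_content_range[of w "int (f w e)"] by auto
  qed
  moreover have "prog_below (m + d + 3) (P ;; read_symbol d)"
    using P(1) by (auto intro: prog_below_mono simp: read_symbol_def reg_prog_defs)
  moreover have "poly_bounded ?q" by (intro poly_bounded_intros P)
  ultimately show "\<exists>P m q. prog_below m P \<and> poly_bounded q \<and> realizes (\<lambda>w e. word_content w (int (f w e))) \<rho> d P q"
    by blast
qed

definition length_prog :: prog where
  "length_prog = (Op (IncIf 1 1) ;; Op (IncIf 2 1)) ;;
     While 1 ((Op (Dec 1) ;; Op (Inc 0) ;; Op (Inc 2)) ;; (Op HeadRight ;; Op (IncIf 1 1) ;; Op (IncIf 2 1))) ;;
     head_left 2"

definition length_time :: "nat \<Rightarrow> nat" where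
  "length_time L = 2 + ((L * (6 + 2) + 1) + (L * 4 + 1))"

lemma runs_length_prog:
  "runs w length_prog init_mem (length_time (length w)) ((\<lambda>_. 0)(0 := length w), 0, [])"
proof -
  let ?n = "length w"
  let ?S = "\<lambda>i. ((\<lambda>_. 0)(0 := ?n - i, 1 := (if i = 0 then 0 else 1), 2 := ?n - i), int (?n - i), []) :: mem"
  let ?scan = "(Op (Dec 1) ;; Op (Inc 0) ;; Op (Inc 2)) ;; (Op HeadRight ;; Op (IncIf 1 1) ;; Op (IncIf 2 1))"
  have "runs w (Op (IncIf 1 1) ;; Op (IncIf 2 1)) init_mem 2 (?S ?n)"
    by (intro runs_mono[OF runs_op2]) (auto simp: fun_eq_iff word_content_def)
  moreover have "runs w (While 1 ?scan) (?S ?n) (?n * (6 + 2) + 1) (?S 0)"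
  proof (rule runs_loop)
    fix i assume "i < ?n"
    then show "runs w ?scan (?S (Suc i)) 6 (?S i)"
      by (intro runs_mono[OF runs_seq[OF runs_op3 runs_op3]]) (auto simp: fun_eq_iff word_content_def)
  qed auto
  moreover have "runs w (head_left 2) (?S 0) (?n * 4 + 1) ((\<lambda>_. 0)(0 := ?n), 0, [])"
    by (intro runs_mono[OF runs_head_left[where N = ?n]]) (auto simp: fun_eq_iff)
  ultimately show ?thesis
    unfolding length_prog_def length_time_def by (intro runs_seq)
qed

text \<open>Register \<open>0\<close> holds the input length, register \<open>1\<close> the row and register \<open>2\<close> the column. The loops
  count down, so the matrix is traversed in reverse order.\<close>

definition matrix_args :: "nat \<Rightarrow> nat" where
  "matrix_args = case_nat 2 (case_nat 1 (\<lambda>_. 0))"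

definition matrix_cell :: "prog \<Rightarrow> prog" where
  "matrix_cell Q = Op (Dec 2) ;; Q ;; Op (Output 3) ;; clear_reg 3"

definition matrix_row :: "prog \<Rightarrow> prog \<Rightarrow> prog" where
  "matrix_row P Q = Op (Dec 1) ;; P ;; While 2 (matrix_cell Q)"

definition cell_time :: "(nat \<Rightarrow> nat) \<Rightarrow> nat \<Rightarrow> nat" where
  "cell_time q B = 1 + (q B + (1 + (q B * 3 + 1)))"

lemma matrix_args_less: "matrix_args j < 3"
  by (auto simp: matrix_args_def split: nat.split)

lemma runs_matrix_cell:
  assumes h: "realizes (\<lambda>w e. h w (e 0) (e 1) (e 2)) matrix_args 3 Q q"
    and zero: "\<forall>r\<ge>3. s r = 0" and bound: "s 0 \<le> B" "s 1 \<le> B" "j \<le> B" and column: "s 2 = Suc j"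
  shows "runs w (matrix_cell Q) (s, 0, out) (cell_time q B) (s(2 := j), 0, out @ [h w j (s 1) (s 0) \<noteq> 0])"
proof -
  let ?s = "s(2 := j)" and ?h = "h w j (s 1) (s 0)"
  have args: "?s (matrix_args 0) = j" "?s (matrix_args 1) = s 1" "?s (matrix_args 2) = s 0"
    by (simp_all add: matrix_args_def numeral_2_eq_2)
  have zero': "\<forall>r\<ge>3. ?s r = 0" using zero by simp
  have bound': "\<forall>k. ?s (matrix_args k) \<le> B"
    using bound by (auto simp: matrix_args_def split: nat.split)
  have value_bound: "?h \<le> q B" using realizesD(1)[OF h zero' bound', of w] by (simp only: args)
  have "runs w (Op (Dec 2)) (s, 0, out) 1 (?s, 0, out)"
    using column by (intro runs_mono[OF runs_op]) auto
  moreover have "runs w Q (?s, 0, out) (q B) (?s(3 := ?h), 0, out)"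
    using realizesD(2)[OF h zero' bound', of w out] by (simp only: args)
  moreover have "runs w (Op (Output 3)) (?s(3 := ?h), 0, out) 1 (?s(3 := ?h), 0, out @ [?h \<noteq> 0])"
    by (intro runs_mono[OF runs_op]) auto
  moreover have "runs w (clear_reg 3) (?s(3 := ?h), 0, out @ [?h \<noteq> 0]) (q B * 3 + 1) (?s, 0, out @ [?h \<noteq> 0])"
    using value_bound zero by (intro runs_mono[OF runs_clear_reg[where N = "q B"]]) (auto simp: fun_eq_iff)
  ultimately show ?thesis unfolding matrix_cell_def cell_time_def by (intro runs_seq)
qed

lemma runs_matrix_row:
  assumes n: "realizes (\<lambda>w e. n w (e 0)) (\<lambda>_. 0) 2 P p"
    and h: "realizes (\<lambda>w e. h w (e 0) (e 1) (e 2)) matrix_args 3 Q q"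
    and zero: "\<forall>r\<ge>2. s r = 0" and bound: "s 0 \<le> B" "s 1 \<le> B" "N \<le> B" and size: "n w (s 0) \<le> N"
    and row: "s 1 = Suc i"
  shows "runs w (matrix_row P Q) (s, 0, out) (1 + (p (s 0) + (N * (cell_time q B + 2) + 1)))
    (s(1 := i), 0, out @ map (\<lambda>j. h w j i (s 0) \<noteq> 0) (rev [0..<n w (s 0)]))"
proof -
  let ?s = "s(1 := i)" and ?n = "n w (s 0)"
  let ?row = "\<lambda>k. map (\<lambda>j. h w j i (s 0) \<noteq> 0) (rev [k..<?n])"
  let ?S = "\<lambda>j. (?s(2 := j), 0, out @ ?row j) :: mem"
  have "runs w (Op (Dec 1)) (s, 0, out) 1 (?s, 0, out)"
    using row by (intro runs_mono[OF runs_op]) auto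
  moreover have "runs w P (?s, 0, out) (p (s 0)) (?s(2 := ?n), 0, out)"
    using realizesD(2)[OF n, of ?s "s 0" w out] zero by simp
  moreover have "runs w (While 2 (matrix_cell Q)) (?s(2 := ?n), 0, out) (N * (cell_time q B + 2) + 1)
      (?s, 0, out @ ?row 0)"
  proof (rule runs_loop_bound[where S = ?S and n = ?n])
    fix j assume j: "j < ?n"
    show "runs w (matrix_cell Q) (?S (Suc j)) (cell_time q B) (?S j)"
      by (rule runs_mono[OF runs_matrix_cell[OF h, where B = B and j = j]])
        (use j zero bound size row in \<open>auto simp: fun_eq_iff upt_conv_Cons\<close>)
  qed (use zero size in \<open>auto simp: fun_eq_iff\<close>)
  ultimately show ?thesis unfolding matrix_row_def by (intro runs_seq)
qed

lemma runs_matrix: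
  fixes w :: "bool list"
  assumes n0: "realizes (\<lambda>w e. n w (e 0)) (\<lambda>_. 0) 1 P0 p0"
    and n: "realizes (\<lambda>w e. n w (e 0)) (\<lambda>_. 0) 2 P p"
    and h: "realizes (\<lambda>w e. h w (e 0) (e 1) (e 2)) matrix_args 3 Q q"
  defines "L \<equiv> length w"
  defines "N \<equiv> n w L"
  defines "T \<equiv> 1 + (p L + (p0 L * (cell_time q (L + p0 L) + 2) + 1))"
  shows "runs w (length_prog ;; P0 ;; While 1 (matrix_row P Q)) init_mem
    (length_time L + (p0 L + (p0 L * (T + 2) + 1)))
    ((\<lambda>_. 0)(0 := L), 0, concat (map (\<lambda>i. map (\<lambda>j. h w j i L \<noteq> 0) (rev [0..<N])) (rev [0..<N])))"
proof -
  let ?s = "(\<lambda>_. 0)(0 := L) :: nat \<Rightarrow> nat"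
  have N: "N \<le> p0 L" "runs w P0 (?s, 0, []) (p0 L) (?s(1 := N), 0, [])"
    using realizesD[OF n0, of ?s L w] by (auto simp: N_def)
  let ?rows = "\<lambda>i. concat (map (\<lambda>i. map (\<lambda>j. h w j i L \<noteq> 0) (rev [0..<N])) (rev [i..<N]))"
  let ?S = "\<lambda>i. (?s(1 := i), 0, ?rows i) :: mem"
  have "runs w (While 1 (matrix_row P Q)) (?s(1 := N), 0, []) (p0 L * (T + 2) + 1) (?s, 0, ?rows 0)"
  proof (rule runs_loop_bound[where S = ?S and n = N])
    fix i assume i: "i < N"
    show "runs w (matrix_row P Q) (?S (Suc i)) T (?S i)"
      by (rule runs_mono[OF runs_matrix_row[OF n h, where B = "L + p0 L" and N = "p0 L" and i = i]])
        (use i N(1) in \<open>auto simp: fun_eq_iff upt_conv_Cons T_def N_def\<close>)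
  qed (use N(1) in \<open>auto simp: fun_eq_iff\<close>)
  from runs_seq[OF runs_length_prog runs_seq[OF N(2)[unfolded L_def] this[unfolded L_def]]]
  show ?thesis unfolding L_def .
qed

lemma feasible_matrix_computable:
  assumes n: "feasible (\<lambda>w e. n w (e 0))"
    and h: "feasible (\<lambda>w e. h w (e 0) (e 1) (e 2))"
  shows "polynomial_time_computable (\<lambda>w. let L = length w; N = n w L in
    concat (map (\<lambda>i. map (\<lambda>j. h w j i L \<noteq> 0) (rev [0..<N])) (rev [0..<N])))"
proof -
  obtain P0 m0 p0 where P0: "prog_below m0 P0" "poly_bounded p0" "realizes (\<lambda>w e. n w (e 0)) (\<lambda>_. 0) 1 P0 p0"
    using feasibleE[where \<rho> = "\<lambda>_. 0" and d = 1, OF n] by blast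
  obtain P m p where P: "prog_below m P" "poly_bounded p" "realizes (\<lambda>w e. n w (e 0)) (\<lambda>_. 0) 2 P p"
    using feasibleE[where \<rho> = "\<lambda>_. 0" and d = 2, OF n pos2] by blast
  obtain Q m' q where Q: "prog_below m' Q" "poly_bounded q"
      "realizes (\<lambda>w e. h w (e 0) (e 1) (e 2)) matrix_args 3 Q q"
    using feasibleE[where \<rho> = matrix_args and d = 3, OF h matrix_args_less] by blast
  let ?prog = "length_prog ;; P0 ;; While 1 (matrix_row P Q)"
  let ?T = "\<lambda>L. length_time L + (p0 L + (p0 L * (1 + (p L + (p0 L * (cell_time q (L + p0 L) + 2) + 1)) + 2) + 1))"
  have "poly_bounded (\<lambda>L. q (L + p0 L))"
    by (rule poly_bounded_comp[OF Q(2)]) (intro poly_bounded_intros P0)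
  then have "poly_bounded ?T"
    unfolding length_time_def cell_time_def by (intro poly_bounded_intros P0 P)
  then obtain t where t: "\<And>L. ?T L \<le> poly t L" unfolding poly_bounded_def by blast
  have "prog_below (m0 + m + m' + 4) ?prog"
    using P0(1) P(1) Q(1)
    by (auto intro: prog_below_mono simp: length_prog_def matrix_row_def matrix_cell_def reg_prog_defs)
  then show ?thesis
    unfolding Let_def
  proof (rule prog_computable[where p = t])
    fix w
    let ?out = "concat (map (\<lambda>i. map (\<lambda>j. h w j i (length w) \<noteq> 0) (rev [0..<n w (length w)]))
      (rev [0..<n w (length w)]))"
    obtain k where "k \<le> ?T (length w)" "exec w ?prog init_mem k ((\<lambda>_. 0)(0 := length w), 0, ?out)"
      using runs_matrix[OF P0(3) P(3) Q(3), of w] unfolding runs_def by blast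
    then show "\<exists>k s i. k \<le> poly t (length w) \<and> exec w ?prog init_mem k (s, i, ?out)"
      using order_trans[OF _ t[of "length w"]] by blast
  qed
qed

lemma feasible_rename:
  assumes "feasible f"
  shows "feasible (\<lambda>w e. f w (\<lambda>j. e (\<sigma> j)))"
proof (rule feasibleI)
  fix \<rho> :: "nat \<Rightarrow> nat" and d assume r: "\<And>j. \<rho> j < d"
  obtain P m q where P: "prog_below m P" "poly_bounded q" "realizes f (\<lambda>j. \<rho> (\<sigma> j)) d P q"
    using feasibleE[where \<rho> = "\<lambda>j. \<rho> (\<sigma> j)" and d = d, OF assms r] by blast
  then have "realizes (\<lambda>w e. f w (\<lambda>j. e (\<sigma> j))) \<rho> d P q" unfolding realizes_def by blast
  then show "\<exists>P m q. prog_below m P \<and> poly_bounded q \<and> realizes (\<lambda>w e. f w (\<lambda>j. e (\<sigma> j))) \<rho> d P q"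
    using P by blast
qed

lemma feasible_mult:
  assumes "feasible f" "feasible g" shows "feasible (\<lambda>w e. f w e * g w e)"
proof -
  have "feasible (\<lambda>w e. \<Sum>i<f w e. g w e)"
    by (rule feasible_sum[OF assms(1)]) (rule feasible_rename[OF assms(2)])
  then show ?thesis by simp
qed

definition feasibleb :: "(bool list \<Rightarrow> (nat \<Rightarrow> nat) \<Rightarrow> bool) \<Rightarrow> bool" where
  "feasibleb P \<longleftrightarrow> feasible (\<lambda>w e. if P w e then 1 else 0)"

lemma feasibleb_not: "feasibleb P \<Longrightarrow> feasibleb (\<lambda>w e. \<not> P w e)"
  unfolding feasibleb_def
proof -
  assume "feasible (\<lambda>w e. if P w e then 1 else 0)"
  then have "feasible (\<lambda>w e. 1 - (if P w e then 1 else 0))" by (intro feasible_diff feasible_1)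
  moreover have "(\<lambda>w e. 1 - (if P w e then 1 else (0::nat))) = (\<lambda>w e. if \<not> P w e then 1 else 0)" by (intro ext) simp
  ultimately show "feasible (\<lambda>w e. if \<not> P w e then 1 else 0)" by simp
qed

lemma feasibleb_conj: "feasibleb P \<Longrightarrow> feasibleb Q \<Longrightarrow> feasibleb (\<lambda>w e. P w e \<and> Q w e)"
  unfolding feasibleb_def
proof -
  assume "feasible (\<lambda>w e. if P w e then 1 else 0)" "feasible (\<lambda>w e. if Q w e then 1 else 0)"
  then have "feasible (\<lambda>w e. (if P w e then 1 else 0) * (if Q w e then 1 else 0))" by (rule feasible_mult)
  moreover have "(\<lambda>w e. (if P w e then 1 else 0) * (if Q w e then 1 else (0::nat))) =
      (\<lambda>w e. if P w e \<and> Q w e then 1 else 0)" by (intro ext) simp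
  ultimately show "feasible (\<lambda>w e. if P w e \<and> Q w e then 1 else 0)" by simp
qed

lemma feasibleb_disj: "feasibleb P \<Longrightarrow> feasibleb Q \<Longrightarrow> feasibleb (\<lambda>w e. P w e \<or> Q w e)"
  using feasibleb_not[OF feasibleb_conj[OF feasibleb_not[of P] feasibleb_not[of Q]]] by simp

lemma feasibleb_le: "feasible f \<Longrightarrow> feasible g \<Longrightarrow> feasibleb (\<lambda>w e. f w e \<le> g w e)"
  unfolding feasibleb_def
proof -
  assume "feasible f" "feasible g"
  then have "feasible (\<lambda>w e. 1 - (f w e - g w e))" by (intro feasible_diff feasible_1)
  moreover have "(\<lambda>w e. 1 - (f w e - g w e)) = (\<lambda>w e. if f w e \<le> g w e then 1 else 0)" by (intro ext) simp
  ultimately show "feasible (\<lambda>w e. if f w e \<le> g w e then 1 else 0)" by simp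
qed

lemma feasibleb_less: "feasible f \<Longrightarrow> feasible g \<Longrightarrow> feasibleb (\<lambda>w e. f w e < g w e)"
  using feasibleb_not[OF feasibleb_le[of g f]] by (simp add: not_le)

lemma feasibleb_eq: "feasible f \<Longrightarrow> feasible g \<Longrightarrow> feasibleb (\<lambda>w e. f w e = g w e)"
  using feasibleb_conj[OF feasibleb_le[of f g] feasibleb_le[of g f]] by (simp add: order_eq_iff)

lemma feasible_if:
  assumes "feasibleb P" "feasible f" "feasible g"
  shows "feasible (\<lambda>w e. if P w e then f w e else g w e)"
proof -
  have "feasible (\<lambda>w e. (if P w e then 1 else 0) * f w e + (if \<not> P w e then 1 else 0) * g w e)"
    using assms feasibleb_not[OF assms(1)] unfolding feasibleb_def by (intro feasible_add feasible_mult)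
  moreover have "(\<lambda>w e. (if P w e then 1 else 0) * f w e + (if \<not> P w e then 1 else 0) * g w e) =
      (\<lambda>w e. if P w e then f w e else g w e)" by (auto intro!: ext)
  ultimately show ?thesis by simp
qed

lemma feasibleb_ex:
  assumes "feasible f" "feasibleb (\<lambda>w e. P w (e 0) (\<lambda>j. e (Suc j)))"
  shows "feasibleb (\<lambda>w e. \<exists>i<f w e. P w i e)"
proof -
  have "feasible (\<lambda>w e. \<Sum>i<f w e. if P w i e then 1 else 0)"
    using assms(2) unfolding feasibleb_def by (rule feasible_sum[OF assms(1)])
  then have "feasibleb (\<lambda>w e. 0 < (\<Sum>i<f w e. if P w i e then 1 else (0::nat)))"
    by (rule feasibleb_less[OF feasible_0])
  moreover have "0 < (\<Sum>i<f w e. if P w i e then 1 else (0::nat)) \<longleftrightarrow> (\<exists>i<f w e. P w i e)" for w e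
  proof -
    have "(\<Sum>i<f w e. if P w i e then 1 else (0::nat)) = 0 \<longleftrightarrow> (\<forall>i\<in>{..<f w e}. (if P w i e then 1 else (0::nat)) = 0)"
      by (rule sum_eq_0_iff) simp
    also have "\<dots> \<longleftrightarrow> \<not> (\<exists>i<f w e. P w i e)" by auto
    finally have "(\<Sum>i<f w e. if P w i e then 1 else (0::nat)) \<noteq> 0 \<longleftrightarrow> (\<exists>i<f w e. P w i e)" by (simp only: not_not)
    then show ?thesis unfolding zero_less_iff_neq_zero .
  qed
  ultimately show ?thesis by (simp only:)
qed

lemma feasible_min: "feasible f \<Longrightarrow> feasible g \<Longrightarrow> feasible (\<lambda>w e. min (f w e) (g w e))"
  unfolding min_def by (intro feasible_if feasibleb_le)

lemma feasible_div:
  assumes f: "feasible f" and g: "feasible g" shows "feasible (\<lambda>w e. f w e div g w e)"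
proof -
  have "x div y = (\<Sum>i<x. if 0 < y \<and> (i + 1) * y \<le> x then 1 else 0)" for x y :: nat
  proof (cases "y = 0")
    case False
    have eq: "(i + 1) * y \<le> x \<longleftrightarrow> i < x div y" for i using False less_eq_div_iff_mult_less_eq[of y "i + 1" x] by auto
    have "(\<Sum>i<x. if 0 < y \<and> (i + 1) * y \<le> x then 1 else 0) = (\<Sum>i<x. if i \<in> {..<x div y} then 1 else (0::nat))"
      by (intro sum.cong refl if_cong) (use False in \<open>simp add: eq[unfolded Suc_eq_plus1[symmetric]] del: mult_Suc\<close>)
    also have "\<dots> = (\<Sum>i<x div y. 1)"
      by (rule sum.mono_neutral_cong_right) (use div_le_dividend[of x y] in auto)
    finally show ?thesis by simp
  qed simp
  moreover have "feasible (\<lambda>w e. \<Sum>i<f w e. if 0 < g w e \<and> (i + 1) * g w e \<le> f w e then 1 else 0)"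
    by (rule feasible_sum[OF f])
       (intro feasible_if feasibleb_conj feasibleb_less feasibleb_le feasible_mult feasible_add feasible_var
          feasible_const feasible_rename[OF f] feasible_rename[OF g])
  ultimately show ?thesis by simp
qed

lemma feasible_mod:
  assumes "feasible f" "feasible g" shows "feasible (\<lambda>w e. f w e mod g w e)"
  using feasible_diff[OF assms(1) feasible_mult[OF feasible_div[OF assms] assms(2)]]
  by (simp add: minus_div_mult_eq_mod)

lemma feasible_power: "feasible f \<Longrightarrow> feasible (\<lambda>w e. f w e ^ k)"
  by (induction k) (simp_all add: feasible_1[unfolded One_nat_def] feasible_mult)

lemma feasible_poly: "feasible f \<Longrightarrow> feasible (\<lambda>w e. poly p (f w e))"
  by (induction p) (simp_all add: feasible_0 feasible_add feasible_mult feasible_const)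

lemma feasible_table: "feasible f \<Longrightarrow> feasible (\<lambda>w e. if f w e < n then T (f w e) else 0)"
proof (induction n)
  case (Suc n)
  have "feasible (\<lambda>w e. (if f w e < n then T (f w e) else 0) + (if f w e = n then T n else 0))"
    using Suc by (intro feasible_add feasible_if[OF feasibleb_eq] feasible_const) auto
  moreover have "(\<lambda>w e. (if f w e < n then T (f w e) else 0) + (if f w e = n then T n else 0)) =
      (\<lambda>w e. if f w e < Suc n then T (f w e) else 0)" by (auto intro!: ext simp: less_Suc_eq)
  ultimately show ?case by simp
qed (simp add: feasible_0)

lemma feasible_table_pair:
  assumes f: "feasible f" and g: "feasible g"
  shows "feasible (\<lambda>w e. if f w e < n \<and> g w e < m then T (f w e) (g w e) else 0)"
proof (induction n)
  case (Suc n)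
  have "feasible (\<lambda>w e. (if f w e < n \<and> g w e < m then T (f w e) (g w e) else 0) +
      (if f w e = n then (if g w e < m then T n (g w e) else 0) else 0))"
    by (intro feasible_add feasible_if Suc feasible_table feasibleb_eq f g feasible_const)
  moreover have "(\<lambda>w e. (if f w e < n \<and> g w e < m then T (f w e) (g w e) else 0) +
      (if f w e = n then (if g w e < m then T n (g w e) else 0) else 0)) =
      (\<lambda>w e. if f w e < Suc n \<and> g w e < m then T (f w e) (g w e) else 0)" by (auto intro!: ext simp: less_Suc_eq)
  ultimately show ?case by simp
qed (simp add: feasible_0)

section \<open>RAC drawings in the complex plane\<close>

lemma scaleR_in_closed_segment: "0 \<le> l \<Longrightarrow> l \<le> 1 \<Longrightarrow> p + l *\<^sub>R (q - p) \<in> closed_segment p q"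
  unfolding in_segment by (intro exI[of _ l]) (auto simp: algebra_simps)

lemma closed_segmentE:
  assumes "r \<in> closed_segment p q"
  obtains l where "0 \<le> l" "l \<le> 1" "r = p + l *\<^sub>R (q - p)"
proof -
  obtain l where "0 \<le> l" "l \<le> 1" "r = (1 - l) *\<^sub>R p + l *\<^sub>R q" using assms by (auto simp: in_segment)
  then show thesis by (intro that[of l]) (auto simp: algebra_simps)
qed

lemma orthogonal_imp_scaleR:
  fixes D Z :: complex
  assumes "D \<noteq> 0" "inner D Z = 0"
  shows "Z = ((Im Z * Re D - Re Z * Im D) / ((Re D)\<^sup>2 + (Im D)\<^sup>2)) *\<^sub>R (\<i> * D)"
proof -
  have "(Re D)\<^sup>2 + (Im D)\<^sup>2 \<noteq> 0" using assms(1) by (simp add: complex_eq_iff sum_power2_eq_zero_iff)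
  moreover have "Re D * Re Z + Im D * Im Z = 0" using assms(2) by (simp add: inner_complex_def)
  then have "((Re D)\<^sup>2 + (Im D)\<^sup>2) * Re Z = - (Im Z * Re D - Re Z * Im D) * Im D"
    "((Re D)\<^sup>2 + (Im D)\<^sup>2) * Im Z = (Im Z * Re D - Re Z * Im D) * Re D"
    by algebra+
  ultimately show ?thesis by (auto simp: complex_eq_iff field_simps)
qed

lemma orthogonal_imp_parallel:
  fixes D X Y :: complex
  assumes "D \<noteq> 0" "X \<noteq> 0" "inner D X = 0" "inner D Y = 0"
  obtains l where "Y = l *\<^sub>R X"
proof -
  obtain a where a: "X = a *\<^sub>R (\<i> * D)" using orthogonal_imp_scaleR[OF assms(1,3)] by blast
  obtain b where "Y = b *\<^sub>R (\<i> * D)" using orthogonal_imp_scaleR[OF assms(1,4)] by blast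
  then have "Y = (b / a) *\<^sub>R X" using a assms(2) by auto
  then show thesis by (rule that)
qed

text \<open>Only disjoint edges need a condition: edges with a common end are excluded from overlapping by the
  condition on vertices.\<close>

definition complex_RAC_drawing :: "'a set \<Rightarrow> 'a set set \<Rightarrow> ('a \<Rightarrow> complex) \<Rightarrow> bool" where
  "complex_RAC_drawing V E g \<longleftrightarrow> inj_on g V \<and>
     (\<forall>a b c. {a, b} \<in> E \<and> c \<in> V - {a, b} \<longrightarrow> g c \<notin> closed_segment (g a) (g b)) \<and>
     (\<forall>a b c d. {a, b} \<in> E \<and> {c, d} \<in> E \<and> {a, b} \<inter> {c, d} = {} \<and>
        closed_segment (g a) (g b) \<inter> closed_segment (g c) (g d) \<noteq> {} \<longrightarrow>
        inner (g a - g b) (g c - g d) = 0)"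

lemma complex_RAC_drawingI:
  assumes "inj_on g V"
    and "\<And>a b c. {a, b} \<in> E \<Longrightarrow> c \<in> V \<Longrightarrow> c \<noteq> a \<Longrightarrow> c \<noteq> b \<Longrightarrow> g c \<notin> closed_segment (g a) (g b)"
    and "\<And>a b c d. {a, b} \<in> E \<Longrightarrow> {c, d} \<in> E \<Longrightarrow> {a, b} \<inter> {c, d} = {} \<Longrightarrow>
      closed_segment (g a) (g b) \<inter> closed_segment (g c) (g d) \<noteq> {} \<Longrightarrow> inner (g a - g b) (g c - g d) = 0"
  shows "complex_RAC_drawing V E g"
  unfolding complex_RAC_drawing_def using assms by auto

lemma complex_RAC_drawing_orthogonal:
  assumes "complex_RAC_drawing V E g" "{a, b} \<in> E" "{c, d} \<in> E" "{a, b} \<inter> {c, d} = {}"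
    "closed_segment (g a) (g b) \<inter> closed_segment (g c) (g d) \<noteq> {}"
  shows "inner (g a - g b) (g c - g d) = 0"
  using assms unfolding complex_RAC_drawing_def by blast

lemma complex_RAC_drawing_vertex_notin_edge:
  assumes "complex_RAC_drawing V E g" "{a, b} \<in> E" "c \<in> V" "c \<noteq> a" "c \<noteq> b"
  shows "g c \<notin> closed_segment (g a) (g b)"
  using assms unfolding complex_RAC_drawing_def by blast

lemma simple_graph_edgeD:
  assumes "simple_graph V E" "{a, b} \<in> E" shows "a \<in> V" "b \<in> V" "a \<noteq> b"
proof -
  have "{a, b} \<subseteq> V" "card {a, b} = 2" using assms by (auto simp: simple_graph_def)
  then show "a \<in> V" "b \<in> V" "a \<noteq> b" by auto
qed

locale complex_RAC_graph =
  fixes V :: "'a set" and E :: "'a set set" and g :: "'a \<Rightarrow> complex"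
  assumes graph: "simple_graph V E" and drawing: "complex_RAC_drawing V E g"
begin

lemmas edgeD = simple_graph_edgeD[OF graph]

lemmas vertex_notin_edge = complex_RAC_drawing_vertex_notin_edge[OF drawing]

lemma drawing_eq_iff: "a \<in> V \<Longrightarrow> b \<in> V \<Longrightarrow> g a = g b \<longleftrightarrow> a = b"
  using drawing by (auto simp: complex_RAC_drawing_def inj_on_def)

abbreviation meets :: "'a \<Rightarrow> 'a \<Rightarrow> 'a \<Rightarrow> 'a \<Rightarrow> bool" where
  "meets a b c d \<equiv> closed_segment (g a) (g b) \<inter> closed_segment (g c) (g d) \<noteq> {}"

lemmas meets_orthogonal = complex_RAC_drawing_orthogonal[OF drawing]

lemma edges_on_ray_eq:
  assumes "{p, t} \<in> E" "{p, t'} \<in> E" "g t' - g p = l *\<^sub>R (g t - g p)" "l > 0"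
  shows "t = t'"
proof (rule ccontr)
  assume neq: "t \<noteq> t'"
  note V = edgeD[OF assms(1)] edgeD[OF assms(2)]
  show False
  proof (cases "l \<le> 1")
    case True
    then have "g p + l *\<^sub>R (g t - g p) \<in> closed_segment (g p) (g t)"
      using assms by (intro scaleR_in_closed_segment) auto
    moreover have "g t' = g p + l *\<^sub>R (g t - g p)" using assms(3) by (simp add: algebra_simps)
    ultimately show False using vertex_notin_edge[OF assms(1), of t'] V neq by auto
  next
    case False
    have "g p + (1 / l) *\<^sub>R (g t' - g p) \<in> closed_segment (g p) (g t')"
      using assms False by (intro scaleR_in_closed_segment) auto
    moreover have "g t = g p + (1 / l) *\<^sub>R (g t' - g p)" using assms(3,4) by simp
    ultimately show False using vertex_notin_edge[OF assms(2), of t] V neq by auto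
  qed
qed

text \<open>Two edges at \<open>p\<close> perpendicular to the line \<open>cd\<close> lie on one line, and meeting \<open>cd\<close> they even lie on
  one ray.\<close>

lemma edge_meets_star_once:
  assumes e: "{c, d} \<in> E" "{p, t} \<in> E" "{p, t'} \<in> E"
    and disjoint: "c \<notin> {p, t, t'}" "d \<notin> {p, t, t'}" and meets: "meets c d p t" "meets c d p t'"
  shows "t = t'"
proof -
  let ?D = "g c - g d" and ?X = "g t - g p" and ?Y = "g t' - g p"
  note V = edgeD[OF e(1)] edgeD[OF e(2)] edgeD[OF e(3)]
  have nonzero: "?D \<noteq> 0" "?X \<noteq> 0" using V drawing_eq_iff by auto
  have "inner ?D (g p - g t) = 0" "inner ?D (g p - g t') = 0"
    using meets_orthogonal[OF e(1,2) _ meets(1)] meets_orthogonal[OF e(1,3) _ meets(2)] disjoint by auto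
  then have orthogonal: "inner ?D ?X = 0" "inner ?D ?Y = 0" by (simp_all add: inner_diff_right)
  then obtain l where l: "?Y = l *\<^sub>R ?X" using orthogonal_imp_parallel[OF nonzero] by blast
  obtain r where r: "r \<in> closed_segment (g c) (g d)" "r \<in> closed_segment (g p) (g t)" using meets by blast
  obtain r' where r': "r' \<in> closed_segment (g c) (g d)" "r' \<in> closed_segment (g p) (g t')" using meets by blast
  obtain i where i: "0 \<le> i" "r = g p + i *\<^sub>R ?X" using closed_segmentE[OF r(2)] by metis
  obtain j where j: "0 \<le> j" "r' = g p + j *\<^sub>R ?Y" using closed_segmentE[OF r'(2)] by metis
  obtain a where a: "r = g c + a *\<^sub>R (g d - g c)" using closed_segmentE[OF r(1)] by metis
  obtain b where b: "r' = g c + b *\<^sub>R (g d - g c)" using closed_segmentE[OF r'(1)] by metis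
  have "r - r' = (b - a) *\<^sub>R ?D" unfolding a b by (simp add: algebra_simps)
  moreover have along: "r - r' = (i - j * l) *\<^sub>R ?X" unfolding i j l by (simp add: algebra_simps)
  ultimately have "(b - a) * inner ?D ?D = (i - j * l) * inner ?D ?X"
    by (metis inner_scaleR_right)
  then have "b - a = 0" using nonzero orthogonal by simp
  then have "(i - j * l) *\<^sub>R ?X = 0" using a b along by simp
  then have ij: "i = j * l" using nonzero by simp
  have "i \<noteq> 0" using r(1) i vertex_notin_edge[OF e(1), of p] V disjoint by auto
  then have "l > 0" using ij i(1) j(1) by (metis less_eq_real_def mult_eq_0_iff zero_less_mult_pos)
  then show ?thesis using edges_on_ray_eq[OF e(2,3) l] by blast
qed

lemma adjacent_edges_meet:
  assumes e: "{a, b} \<in> E" "{a, c} \<in> E" "b \<noteq> c"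
    and p: "p \<in> closed_segment (g a) (g b)" "p \<in> closed_segment (g a) (g c)"
  shows "p = g a"
proof (rule ccontr)
  assume neq: "p \<noteq> g a"
  obtain s where s: "0 \<le> s" "p = g a + s *\<^sub>R (g b - g a)" using closed_segmentE[OF p(1)] by metis
  obtain t where t: "0 \<le> t" "p = g a + t *\<^sub>R (g c - g a)" using closed_segmentE[OF p(2)] by metis
  have pos: "s > 0" "t > 0" using s t neq by (auto simp: less_le)
  have "(1 / t) *\<^sub>R (t *\<^sub>R (g c - g a)) = (1 / t) *\<^sub>R (s *\<^sub>R (g b - g a))" using s t by simp
  then have "g c - g a = (s / t) *\<^sub>R (g b - g a)" using pos by simp
  then show False using edges_on_ray_eq[OF e(1,2) _ divide_pos_pos[OF pos]] e(3) by blast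
qed

lemma adjacent_edges_meet_end:
  assumes e: "{a, b} \<in> E" "{c, d} \<in> E" "{a, b} \<noteq> {c, d}" "{a, b} \<inter> {c, d} \<noteq> {}"
  obtains x where "x \<in> {a, b}" "x \<in> {c, d}"
    "\<And>p. p \<in> closed_segment (g a) (g b) \<Longrightarrow> p \<in> closed_segment (g c) (g d) \<Longrightarrow> p = g x"
proof -
  obtain x where x: "x \<in> {a, b}" "x \<in> {c, d}" using e(4) by blast
  have other: "\<exists>b'. {a', b'} = {a, b} \<and> closed_segment (g a') (g b') = closed_segment (g a) (g b)"
    if "a' \<in> {a, b}" for a' a b
    using that by (auto simp: closed_segment_commute insert_commute)
  obtain b' where b': "{x, b'} = {a, b}" "closed_segment (g x) (g b') = closed_segment (g a) (g b)"
    using other[OF x(1)] by blast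
  obtain d' where d': "{x, d'} = {c, d}" "closed_segment (g x) (g d') = closed_segment (g c) (g d)"
    using other[OF x(2)] by blast
  have "b' \<noteq> d'" using b'(1) d'(1) e(3) by auto
  then show thesis using that[OF x] adjacent_edges_meet[of x b' d'] e(1,2) b' d' by metis
qed

lemma distinct_edges_meet_once:
  assumes e: "{a, b} \<in> E" "{c, d} \<in> E" "{a, b} \<noteq> {c, d}"
    and p: "p \<in> closed_segment (g a) (g b)" "p \<in> closed_segment (g c) (g d)"
    and q: "q \<in> closed_segment (g a) (g b)" "q \<in> closed_segment (g c) (g d)"
  shows "p = q"
proof (cases "{a, b} \<inter> {c, d} = {}")
  case True
  then have orthogonal: "inner (g a - g b) (g c - g d) = 0" using meets_orthogonal[of a b c d] e p by blast
  obtain s s' where s: "p = g a + s *\<^sub>R (g b - g a)" "q = g a + s' *\<^sub>R (g b - g a)"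
    using closed_segmentE[OF p(1)] closed_segmentE[OF q(1)] by metis
  obtain t t' where t: "p = g c + t *\<^sub>R (g d - g c)" "q = g c + t' *\<^sub>R (g d - g c)"
    using closed_segmentE[OF p(2)] closed_segmentE[OF q(2)] by metis
  have "p - q = (s' - s) *\<^sub>R (g a - g b)" unfolding s by (simp add: algebra_simps)
  moreover have "p - q = (t' - t) *\<^sub>R (g c - g d)" unfolding t by (simp add: algebra_simps)
  ultimately have "inner (p - q) (p - q) = (s' - s) * ((t' - t) * inner (g a - g b) (g c - g d))"
    by (metis inner_scaleR_left inner_scaleR_right)
  then show ?thesis using orthogonal by simp
next
  case False
  then obtain z where
    "\<And>p. p \<in> closed_segment (g a) (g b) \<Longrightarrow> p \<in> closed_segment (g c) (g d) \<Longrightarrow> p = g z"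
    using adjacent_edges_meet_end[OF e] by blast
  then show ?thesis using p q by metis
qed

end

definition to_complex :: "real ^ 2 \<Rightarrow> complex" where
  "to_complex p = Complex (p $ 1) (p $ 2)"

definition to_plane :: "complex \<Rightarrow> real ^ 2" where
  "to_plane z = vector [Re z, Im z]"

lemma to_plane_inverse [simp]: "to_complex (to_plane z) = z" "to_plane (to_complex p) = p"
  by (simp_all add: to_complex_def to_plane_def vec_eq_iff forall_2)

lemma to_complex_eq_iff [simp]: "to_complex p = to_complex q \<longleftrightarrow> p = q"
  by (metis to_plane_inverse(2))

lemma to_complex_diff: "to_complex (p - q) = to_complex p - to_complex q"
  by (simp add: to_complex_def complex_eq_iff)

lemma inner_to_complex: "inner (to_complex p) (to_complex q) = inner p q"
  by (simp add: to_complex_def inner_complex_def inner_vec_def sum_2)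

lemma closed_segment_affine_image:
  fixes f :: "'a::real_vector \<Rightarrow> 'b::real_vector"
  assumes "\<And>u a b. f ((1 - u) *\<^sub>R a + u *\<^sub>R b) = (1 - u) *\<^sub>R f a + u *\<^sub>R f b"
  shows "closed_segment (f a) (f b) = f ` closed_segment a b"
  unfolding closed_segment_def using assms[symmetric] by auto

lemma closed_segment_to_complex:
  "closed_segment (to_complex a) (to_complex b) = to_complex ` closed_segment a b"
  by (rule closed_segment_affine_image) (simp add: to_complex_def complex_eq_iff)

lemma to_complex_in_closed_segment_iff:
  "to_complex p \<in> closed_segment (to_complex a) (to_complex b) \<longleftrightarrow> p \<in> closed_segment a b"
  unfolding closed_segment_to_complex by auto

lemma RAC_drawing_imp_complex:
  assumes f: "RAC_drawing V E f" and G: "simple_graph V E"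
  shows "complex_RAC_drawing V E (\<lambda>x. to_complex (f x))"
proof (rule complex_RAC_drawingI)
  show "inj_on (\<lambda>x. to_complex (f x)) V"
    using f by (simp add: RAC_drawing_def straight_line_drawing_def inj_on_def)
next
  fix a b c assume "{a, b} \<in> E" "c \<in> V" "c \<noteq> a" "c \<noteq> b"
  then show "to_complex (f c) \<notin> closed_segment (to_complex (f a)) (to_complex (f b))"
    unfolding to_complex_in_closed_segment_iff using f by (simp add: RAC_drawing_def straight_line_drawing_def)
next
  fix a b c d assume e: "{a, b} \<in> E" "{c, d} \<in> E" "{a, b} \<inter> {c, d} = {}"
    and "closed_segment (to_complex (f a)) (to_complex (f b)) \<inter>
      closed_segment (to_complex (f c)) (to_complex (f d)) \<noteq> {}"
  then obtain z where z: "z \<in> closed_segment (f a) (f b)" "z \<in> closed_segment (f c) (f d)"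
    unfolding closed_segment_to_complex by auto
  have V: "a \<in> V" "b \<in> V" "c \<in> V" "d \<in> V" using e G by (auto simp: simple_graph_def)
  have vertex: "f w \<notin> closed_segment (f x) (f y)" if "{x, y} \<in> E" "w \<in> V" "w \<noteq> x" "w \<noteq> y" for x y w
    using f that by (auto simp: RAC_drawing_def straight_line_drawing_def)
  have "z \<noteq> f a" "z \<noteq> f b" "z \<noteq> f c" "z \<noteq> f d"
    using vertex[of c d a] vertex[of c d b] vertex[of a b c] vertex[of a b d] e z V by auto
  then have "z \<in> open_segment (f a) (f b)" "z \<in> open_segment (f c) (f d)" using z by (auto simp: open_segment_def)
  moreover have "{a, b} \<noteq> {c, d}" using e by auto
  ultimately have "orthogonal (f a - f b) (f c - f d)"
    using f e unfolding RAC_drawing_def by blast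
  then show "inner (to_complex (f a) - to_complex (f b)) (to_complex (f c) - to_complex (f d)) = 0"
    by (simp add: orthogonal_def inner_to_complex flip: to_complex_diff)
qed

context complex_RAC_graph
begin

lemma in_closed_segment_to_plane_iff:
  "p \<in> closed_segment (to_plane (g a)) (to_plane (g b)) \<longleftrightarrow> to_complex p \<in> closed_segment (g a) (g b)"
  using to_complex_in_closed_segment_iff[of p "to_plane (g a)" "to_plane (g b)"] by simp

lemma straight_line_drawing_to_plane: "straight_line_drawing V E (\<lambda>x. to_plane (g x))"
  unfolding straight_line_drawing_def
proof (intro conjI allI impI)
  show "inj_on (\<lambda>x. to_plane (g x)) V"
    using drawing_eq_iff by (metis (mono_tags, lifting) inj_onI to_plane_inverse(1))
next
  fix u v w assume "{u, v} \<in> E \<and> w \<in> V - {u, v}"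
  then show "to_plane (g w) \<notin> closed_segment (to_plane (g u)) (to_plane (g v))"
    unfolding in_closed_segment_to_plane_iff using vertex_notin_edge[of u v w] by simp
next
  fix u v x y assume e: "{u, v} \<in> E \<and> {x, y} \<in> E \<and> {u, v} \<noteq> {x, y}"
  have "a = b" if sub: "closed_segment a b \<subseteq> closed_segment (to_plane (g u)) (to_plane (g v)) \<inter>
    closed_segment (to_plane (g x)) (to_plane (g y))" for a b
  proof -
    have "to_complex p \<in> closed_segment (g u) (g v)" "to_complex p \<in> closed_segment (g x) (g y)"
      if "p \<in> {a, b}" for p
      using that sub ends_in_segment[of a b] in_closed_segment_to_plane_iff by blast+
    then show ?thesis using distinct_edges_meet_once[of u v x y "to_complex a" "to_complex b"] e by simp
  qed
  then show "\<not> (\<exists>a b. a \<noteq> b \<and> closed_segment a b \<subseteq> closed_segment (to_plane (g u)) (to_plane (g v)) \<inter>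
    closed_segment (to_plane (g x)) (to_plane (g y)))" by blast
qed

lemma RAC_drawing_to_plane: "RAC_drawing V E (\<lambda>x. to_plane (g x))"
  unfolding RAC_drawing_def
proof (intro conjI straight_line_drawing_to_plane allI impI)
  let ?f = "\<lambda>x. to_plane (g x)"
  fix u v x y
  assume e: "{u, v} \<in> E \<and> {x, y} \<in> E \<and> {u, v} \<noteq> {x, y} \<and> open_segment (?f u) (?f v) \<inter> open_segment (?f x) (?f y) \<noteq> {}"
  then obtain p where p: "p \<in> open_segment (?f u) (?f v)" "p \<in> open_segment (?f x) (?f y)" by blast
  then have q: "to_complex p \<in> closed_segment (g u) (g v)" "to_complex p \<in> closed_segment (g x) (g y)"
    "to_complex p \<noteq> g u" "to_complex p \<noteq> g v"
    by (auto simp: open_segment_def in_closed_segment_to_plane_iff dest: arg_cong[of _ _ to_plane])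
  have "{u, v} \<inter> {x, y} = {}"
  proof (rule ccontr)
    assume "{u, v} \<inter> {x, y} \<noteq> {}"
    then obtain z where "z \<in> {u, v}"
      "\<And>p. p \<in> closed_segment (g u) (g v) \<Longrightarrow> p \<in> closed_segment (g x) (g y) \<Longrightarrow> p = g z"
      using adjacent_edges_meet_end[of u v x y] e by blast
    then show False using q by blast
  qed
  then have "inner (g u - g v) (g x - g y) = 0" using meets_orthogonal[of u v x y] e q by blast
  then show "orthogonal (?f u - ?f v) (?f x - ?f y)"
    unfolding orthogonal_def inner_to_complex[symmetric] to_complex_diff by simp
qed

end

lemma complex_RAC_drawing_similarity:
  assumes "complex_RAC_drawing V E g" "q \<noteq> 0"
  shows "complex_RAC_drawing V E (\<lambda>x. (g x - p) * q)"
proof -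
  let ?h = "\<lambda>z. (z - p) * q"
  have h_eq_iff: "?h z = ?h w \<longleftrightarrow> z = w" for z w using assms(2) by simp
  then have inj: "inj ?h" by (auto intro!: injI)
  have segment: "closed_segment (?h a) (?h b) = ?h ` closed_segment a b" for a b
    by (rule closed_segment_affine_image) (simp add: algebra_simps)
  have member: "?h z \<in> closed_segment (?h a) (?h b) \<longleftrightarrow> z \<in> closed_segment a b" for z a b
    unfolding segment by (rule inj_image_mem_iff[OF inj])
  have meet: "closed_segment (?h a) (?h b) \<inter> closed_segment (?h c) (?h d) \<noteq> {} \<longleftrightarrow>
      closed_segment a b \<inter> closed_segment c d \<noteq> {}" for a b c d
    unfolding segment image_Int[OF inj, symmetric] by simp
  have orthogonal: "inner (?h a - ?h b) (?h c - ?h d) = 0 \<longleftrightarrow> inner (a - b) (c - d) = 0" for a b c d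
  proof -
    have "inner (z * q) (w * q) = (norm q)\<^sup>2 * inner z w" for z w
      unfolding cmod_power2 inner_complex_def by (simp add: algebra_simps power2_eq_square)
    moreover have "?h a - ?h b = (a - b) * q" "?h c - ?h d = (c - d) * q" by (simp_all add: algebra_simps)
    ultimately show ?thesis using assms(2) by simp
  qed
  show ?thesis
    using assms(1) unfolding complex_RAC_drawing_def member meet orthogonal inj_on_def h_eq_iff by blast
qed

lemma Re_greater_notin_closed_segment:
  assumes "Re a < r" "Re b < r" "r \<le> Re c" shows "c \<notin> closed_segment a b"
  using closed_segment_subset[OF _ _ convex_halfspace_Re_lt[of r], of a b] assms by auto

lemma complex_RAC_drawing_extend:
  fixes V :: "'a::countable set"
  assumes g: "complex_RAC_drawing V E g" and G: "simple_graph V E"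
  obtains g' where "complex_RAC_drawing V' E g'"
proof -
  have "bdd_above ((\<lambda>x. Re (g x)) ` V)" using G by (simp add: simple_graph_def)
  then obtain M where M: "\<And>x. x \<in> V \<Longrightarrow> Re (g x) \<le> M" unfolding bdd_above_def by blast
  then have R: "Re (g x) < M + 1" if "x \<in> V" for x using M[OF that] by simp
  define g' where "g' x = (if x \<in> V then g x else of_real (M + 1 + real (to_nat x)))" for x
  have ends: "a \<in> V" "b \<in> V" "g' a = g a" "g' b = g b" if "{a, b} \<in> E" for a b
    using simple_graph_edgeD[OF G that] by (simp_all add: g'_def)
  have "complex_RAC_drawing V' E g'"
  proof (rule complex_RAC_drawingI)
    show "inj_on g' V'"
    proof (rule inj_onI)
      fix x y assume "g' x = g' y"
      then show "x = y"
        using R[of x] R[of y] g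
        by (auto simp: g'_def complex_RAC_drawing_def inj_on_def split: if_splits dest!: arg_cong[of _ _ Re])
    qed
  next
    fix a b c assume e: "{a, b} \<in> E" "c \<noteq> a" "c \<noteq> b"
    show "g' c \<notin> closed_segment (g' a) (g' b)"
    proof (cases "c \<in> V")
      case True
      then show ?thesis
        using complex_RAC_drawing_vertex_notin_edge[OF g e(1)] e(2,3) ends(3,4)[OF e(1)] by (simp add: g'_def)
    next
      case False
      then have "M + 1 \<le> Re (g' c)" by (simp add: g'_def)
      then show ?thesis
        using Re_greater_notin_closed_segment[OF R[OF ends(1)[OF e(1)]] R[OF ends(2)[OF e(1)]]]
        unfolding ends(3,4)[OF e(1)] by blast
    qed
  next
    fix a b c d assume e: "{a, b} \<in> E" "{c, d} \<in> E" "{a, b} \<inter> {c, d} = {}"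
      "closed_segment (g' a) (g' b) \<inter> closed_segment (g' c) (g' d) \<noteq> {}"
    then show "inner (g' a - g' b) (g' c - g' d) = 0"
      using complex_RAC_drawing_orthogonal[OF g e(1-3)]
      unfolding ends(3,4)[OF e(1)] ends(3,4)[OF e(2)] by blast
  qed
  then show thesis by (rule that)
qed

lemma complex_RAC_drawing_pullback:
  assumes g: "complex_RAC_drawing V' ((`) c ` E) g" and c: "inj_on c V" "c ` V \<subseteq> V'"
    and E: "\<And>e. e \<in> E \<Longrightarrow> e \<subseteq> V"
  shows "complex_RAC_drawing V E (\<lambda>x. g (c x))"
proof -
  have edge: "{c x, c y} \<in> (`) c ` E" "x \<in> V" "y \<in> V" if "{x, y} \<in> E" for x y
    using that E[OF that] by (auto intro!: image_eqI[of _ _ "{x, y}"])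
  have c_eq_iff: "c x = c y \<longleftrightarrow> x = y" if "x \<in> V" "y \<in> V" for x y using c(1) that by (auto simp: inj_on_def)
  show ?thesis
  proof (rule complex_RAC_drawingI)
    have "inj_on g V'" using g by (simp add: complex_RAC_drawing_def)
    then show "inj_on (\<lambda>x. g (c x)) V"
      using comp_inj_on[OF c(1) inj_on_subset[OF _ c(2)]] by (simp add: comp_def)
  next
    fix a b d assume e: "{a, b} \<in> E" "d \<in> V" "d \<noteq> a" "d \<noteq> b"
    then have "c d \<in> V'" "c d \<noteq> c a" "c d \<noteq> c b" using edge[OF e(1)] c_eq_iff c(2) by auto
    then show "g (c d) \<notin> closed_segment (g (c a)) (g (c b))"
      by (rule complex_RAC_drawing_vertex_notin_edge[OF g edge(1)[OF e(1)]])
  next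
    fix a b d e assume h: "{a, b} \<in> E" "{d, e} \<in> E" "{a, b} \<inter> {d, e} = {}"
       "closed_segment (g (c a)) (g (c b)) \<inter> closed_segment (g (c d)) (g (c e)) \<noteq> {}"
    then have "{c a, c b} \<inter> {c d, c e} = {}" using edge[of a b] edge[of d e] c_eq_iff by auto
    then show "inner (g (c a) - g (c b)) (g (c d) - g (c e)) = 0"
      using complex_RAC_drawing_orthogonal[OF g edge(1)[OF h(1)] edge(1)[OF h(2)]] h(4) by blast
  qed
qed

lemma complex_RAC_drawing_relabel:
  assumes g: "complex_RAC_drawing V E g" and c: "inj_on c V" and G: "simple_graph V E"
  shows "complex_RAC_drawing (c ` V) ((`) c ` E) (\<lambda>y. g (the_inv_into V c y))"
proof (rule complex_RAC_drawing_pullback[where c = "the_inv_into V c" and g = g and V' = V])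
  let ?i = "the_inv_into V c"
  have E: "e \<subseteq> V" if "e \<in> E" for e using G that by (auto simp: simple_graph_def)
  have inverse: "?i ` c ` A = A" if "A \<subseteq> V" for A
    using the_inv_into_f_f[OF c] that by (force simp: image_iff)
  have "(`) ?i ` (`) c ` E = E" using inverse E by (force simp: image_iff)
  then show "complex_RAC_drawing V ((`) ?i ` (`) c ` E) g" using g by simp
  show "inj_on ?i (c ` V)" by (rule inj_on_the_inv_into[OF c])
  show "?i ` c ` V \<subseteq> V" using inverse by simp
  show "e \<subseteq> c ` V" if "e \<in> (`) c ` E" for e using that E by blast
qed

section \<open>RAC drawings with two hubs\<close>

text \<open>The hubs are drawn at \<open>0\<close> and \<open>1\<close>. The determinants tell on which side of the lines through \<open>0\<close>, \<open>x\<close>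
  and \<open>1\<close>, \<open>x\<close> the point \<open>z\<close> lies. For points of the upper half-plane, \<open>in_upper_triangle x z\<close> says that
  \<open>z\<close> lies in the triangle with corners \<open>0\<close>, \<open>1\<close>, \<open>x\<close>.\<close>

definition det0 :: "complex \<Rightarrow> complex \<Rightarrow> real" where
  "det0 x z = Re z * Im x - Re x * Im z"

definition det1 :: "complex \<Rightarrow> complex \<Rightarrow> real" where
  "det1 x z = (1 - Re z) * Im x - (1 - Re x) * Im z"

definition in_upper_triangle :: "complex \<Rightarrow> complex \<Rightarrow> bool" where
  "in_upper_triangle x z \<longleftrightarrow> det0 x z \<ge> 0 \<and> det1 x z \<ge> 0"

definition in_triangle :: "complex \<Rightarrow> complex \<Rightarrow> bool" where
  "in_triangle x z \<longleftrightarrow>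
     (if Im x > 0 then Im z \<ge> 0 \<and> in_upper_triangle x z
      else Im z < 0 \<and> in_upper_triangle (cnj x) (cnj z))"

lemma det_affine:
  "det0 x (p + l *\<^sub>R (q - p)) = (1 - l) * det0 x p + l * det0 x q"
  "det1 x (p + l *\<^sub>R (q - p)) = (1 - l) * det1 x p + l * det1 x q"
  "Im (p + l *\<^sub>R (q - p)) = (1 - l) * Im p + l * Im q"
  by (simp_all add: det0_def det1_def algebra_simps)

lemma det_swap: "det0 y x = - det0 x y" "det1 y x = - det1 x y"
  by (simp_all add: det0_def det1_def)

lemma in_closed_segment_0I:
  assumes "Im x > 0" "Im r \<ge> 0" "det0 x r = 0" "det1 x r \<ge> 0"
  shows "r \<in> closed_segment 0 x"
proof -
  define l where "l = Im r / Im x"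
  have r: "r = l *\<^sub>R x" using assms by (auto simp: l_def det0_def complex_eq_iff field_simps)
  have "Im x * l \<le> Im x * 1" using assms(4) unfolding r det1_def by (simp add: algebra_simps)
  then have "l \<le> 1" using assms(1) by simp
  moreover have "0 \<le> l" using assms by (simp add: l_def)
  ultimately show ?thesis using scaleR_in_closed_segment[of l 0 x] r by simp
qed

lemma in_closed_segment_1I:
  assumes "Im x > 0" "Im r \<ge> 0" "det1 x r = 0" "det0 x r \<ge> 0"
  shows "r \<in> closed_segment 1 x"
proof -
  define l where "l = Im r / Im x"
  have r: "r = 1 + l *\<^sub>R (x - 1)" using assms by (auto simp: l_def det1_def complex_eq_iff field_simps)
  have "Im x * l \<le> Im x * 1" using assms(4) unfolding r det0_def by (simp add: algebra_simps)
  then have "l \<le> 1" using assms(1) by simp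
  moreover have "0 \<le> l" using assms by (simp add: l_def)
  ultimately show ?thesis using scaleR_in_closed_segment[of l 1 x] r by simp
qed

lemma convex_combination_zeroE:
  fixes a b :: real assumes "a \<ge> 0" "b < 0"
  obtains t where "0 \<le> t" "t \<le> 1" "(1 - t) * a + t * b = 0"
proof (rule that[of "a / (a - b)"])
  show "(1 - a / (a - b)) * a + a / (a - b) * b = 0" using assms by (simp add: field_simps)
qed (use assms in \<open>auto simp: field_simps\<close>)

lemma first_exit:
  fixes a b c d :: real
  assumes "a \<ge> 0" "c \<ge> 0" "b < 0 \<or> d < 0"
  shows "\<exists>t. 0 \<le> t \<and> t \<le> 1 \<and>
    (((1 - t) * a + t * b = 0 \<and> (1 - t) * c + t * d \<ge> 0) \<or>
     ((1 - t) * c + t * d = 0 \<and> (1 - t) * a + t * b \<ge> 0))"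
proof -
  have first: "\<exists>t. 0 \<le> t \<and> t \<le> 1 \<and>
    (((1 - t) * a + t * b = 0 \<and> (1 - t) * c + t * d \<ge> 0) \<or>
     ((1 - t) * c + t * d = 0 \<and> (1 - t) * a + t * b \<ge> 0))"
    if nonneg: "a \<ge> 0" "c \<ge> 0" and neg: "b < 0" for a b c d :: real
  proof -
    obtain t where t: "0 \<le> t" "t \<le> 1" "(1 - t) * a + t * b = 0"
      by (rule convex_combination_zeroE[OF nonneg(1) neg])
    show ?thesis
    proof (cases "(1 - t) * c + t * d \<ge> 0")
      case True
      then show ?thesis using t by blast
    next
      case False
      then have "(1 - t) * c + t * d < 0" by simp
      then obtain s where s: "0 \<le> s" "s \<le> 1" "(1 - s) * c + s * ((1 - t) * c + t * d) = 0"
        by (rule convex_combination_zeroE[OF nonneg(2)])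
      have zero: "(1 - s * t) * c + s * t * d = 0" using s(3) by (simp add: algebra_simps)
      have "(1 - s * t) * a + s * t * b = (1 - s) * a + s * ((1 - t) * a + t * b)"
        by (simp add: algebra_simps)
      also have "\<dots> \<ge> 0" using t(3) s nonneg(1) by simp
      finally show ?thesis using zero s t by (intro exI[of _ "s * t"]) (simp add: mult_le_one)
    qed
  qed
  from assms(3) show ?thesis
  proof
    assume "d < 0"
    from first[OF assms(2,1) this] show ?thesis by blast
  qed (rule first[OF assms(1,2)])
qed

lemma segment_leaving_triangle_meets_side:
  assumes x: "Im x > 0" and p: "Im p \<ge> 0" "in_upper_triangle x p"
    and q: "Im q \<ge> 0" "\<not> in_upper_triangle x q"
  shows "closed_segment p q \<inter> (closed_segment 0 x \<union> closed_segment 1 x) \<noteq> {}"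
proof -
  obtain t where t: "0 \<le> t" "t \<le> 1" and exit:
    "((1 - t) * det0 x p + t * det0 x q = 0 \<and> (1 - t) * det1 x p + t * det1 x q \<ge> 0) \<or>
     ((1 - t) * det1 x p + t * det1 x q = 0 \<and> (1 - t) * det0 x p + t * det0 x q \<ge> 0)"
    using first_exit[of "det0 x p" "det1 x p" "det0 x q" "det1 x q"] p(2) q(2)
    unfolding in_upper_triangle_def not_le de_Morgan_conj by blast
  define r where "r = p + t *\<^sub>R (q - p)"
  have "Im r \<ge> 0"
    unfolding r_def det_affine(3) using t p q by (intro add_nonneg_nonneg mult_nonneg_nonneg) auto
  then have "r \<in> closed_segment 0 x \<union> closed_segment 1 x"
    using exit in_closed_segment_0I[OF x, of r] in_closed_segment_1I[OF x, of r] by (auto simp: r_def det_affine)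
  moreover have "r \<in> closed_segment p q" using t scaleR_in_closed_segment by (simp add: r_def)
  ultimately show ?thesis by blast
qed

lemma in_upper_triangle_iff_of_disjoint_sides:
  assumes "Im x > 0" "Im p \<ge> 0" "Im q \<ge> 0"
    "closed_segment p q \<inter> closed_segment 0 x = {}" "closed_segment p q \<inter> closed_segment 1 x = {}"
  shows "in_upper_triangle x p \<longleftrightarrow> in_upper_triangle x q"
  using segment_leaving_triangle_meets_side[of x p q] segment_leaving_triangle_meets_side[of x q p] assms
  by (auto simp: closed_segment_commute)

lemma in_upper_triangle_real:
  "Im x > 0 \<Longrightarrow> Im m = 0 \<Longrightarrow> in_upper_triangle x m \<longleftrightarrow> 0 \<le> Re m \<and> Re m \<le> 1"
  by (auto simp: in_upper_triangle_def det0_def det1_def zero_le_mult_iff)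

lemma closed_segment_cnj: "closed_segment (cnj a) (cnj b) = cnj ` closed_segment a b"
  by (rule closed_segment_linear_image) (simp add: bounded_linear.linear bounded_linear_cnj)

lemma closed_segment_cnj_disjoint_iff:
  "closed_segment (cnj a) (cnj b) \<inter> closed_segment (cnj c) (cnj d) = {} \<longleftrightarrow>
   closed_segment a b \<inter> closed_segment c d = {}"
  unfolding closed_segment_cnj by (auto simp: inj_image_mem_iff)

lemma closed_segment_real_pointE:
  assumes "Im p \<ge> 0" "Im q < 0"
  obtains m where "m \<in> closed_segment p q" "Im m = 0"
proof -
  obtain t where "0 \<le> t" "t \<le> 1" "(1 - t) * Im p + t * Im q = 0" using convex_combination_zeroE assms by blast
  then show thesis
    using that[of "p + t *\<^sub>R (q - p)"] scaleR_in_closed_segment[of t p q] by (simp add: algebra_simps)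
qed

lemma in_triangle_upper_iff:
  assumes "Im p \<ge> 0" "Im q \<ge> 0" "closed_segment p q \<inter> closed_segment 0 x = {}"
    "closed_segment p q \<inter> closed_segment 1 x = {}"
  shows "in_triangle x p \<longleftrightarrow> in_triangle x q"
  using in_upper_triangle_iff_of_disjoint_sides[of x p q] assms by (auto simp: in_triangle_def)

lemma in_triangle_lower_iff:
  assumes "Im p < 0" "Im q < 0" "Im x \<noteq> 0" "closed_segment p q \<inter> closed_segment 0 x = {}"
    "closed_segment p q \<inter> closed_segment 1 x = {}"
  shows "in_triangle x p \<longleftrightarrow> in_triangle x q"
proof -
  have "closed_segment (cnj p) (cnj q) \<inter> closed_segment (cnj 0) (cnj x) = {}"
    "closed_segment (cnj p) (cnj q) \<inter> closed_segment (cnj 1) (cnj x) = {}"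
    unfolding closed_segment_cnj_disjoint_iff using assms by auto
  then show ?thesis
    using in_upper_triangle_iff_of_disjoint_sides[of "cnj x" "cnj p" "cnj q"] assms by (auto simp: in_triangle_def)
qed

lemma in_triangle_across_real_point:
  assumes p: "Im p \<ge> 0" "Im q < 0" and m: "m \<in> closed_segment p q" "Im m = 0" and x: "Im x \<noteq> 0"
    and disjoint: "closed_segment p q \<inter> closed_segment 0 x = {}" "closed_segment p q \<inter> closed_segment 1 x = {}"
  shows "in_triangle x p \<longleftrightarrow> (0 \<le> Re m \<and> Re m \<le> 1) \<and> Im x > 0"
    "in_triangle x q \<longleftrightarrow> (0 \<le> Re m \<and> Re m \<le> 1) \<and> Im x < 0"
proof -
  have sub: "closed_segment p m \<subseteq> closed_segment p q" "closed_segment q m \<subseteq> closed_segment p q"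
    using m by (auto simp: subset_closed_segment)
  have "(in_triangle x p \<longleftrightarrow> (0 \<le> Re m \<and> Re m \<le> 1) \<and> Im x > 0) \<and>
        (in_triangle x q \<longleftrightarrow> (0 \<le> Re m \<and> Re m \<le> 1) \<and> Im x < 0)"
  proof (cases "Im x > 0")
    case True
    have "in_upper_triangle x p \<longleftrightarrow> in_upper_triangle x m"
      using disjoint sub m p by (intro in_upper_triangle_iff_of_disjoint_sides True) auto
    then show ?thesis using True p in_upper_triangle_real[OF True m(2)] by (auto simp: in_triangle_def)
  next
    case False
    then have neg: "Im (cnj x) > 0" using x by simp
    have "closed_segment (cnj q) (cnj m) \<inter> closed_segment (cnj 0) (cnj x) = {}"
      "closed_segment (cnj q) (cnj m) \<inter> closed_segment (cnj 1) (cnj x) = {}"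
      unfolding closed_segment_cnj_disjoint_iff using disjoint sub by auto
    then have "in_upper_triangle (cnj x) (cnj q) \<longleftrightarrow> in_upper_triangle (cnj x) (cnj m)"
      using p m by (intro in_upper_triangle_iff_of_disjoint_sides neg) auto
    then show ?thesis
      using False neg p m in_upper_triangle_real[OF neg, of "cnj m"] by (auto simp: in_triangle_def)
  qed
  then show "in_triangle x p \<longleftrightarrow> (0 \<le> Re m \<and> Re m \<le> 1) \<and> Im x > 0"
    "in_triangle x q \<longleftrightarrow> (0 \<le> Re m \<and> Re m \<le> 1) \<and> Im x < 0" by blast+
qed

text \<open>Crossing the real axis changes both membership values at once, so their difference survives.\<close>

lemma in_triangle_difference:
  assumes "Im x \<noteq> 0" "Im y \<noteq> 0"
    "closed_segment p q \<inter> closed_segment 0 x = {}" "closed_segment p q \<inter> closed_segment 1 x = {}"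
    "closed_segment p q \<inter> closed_segment 0 y = {}" "closed_segment p q \<inter> closed_segment 1 y = {}"
  shows "(in_triangle x p \<noteq> in_triangle y p) \<longleftrightarrow> (in_triangle x q \<noteq> in_triangle y q)"
proof -
  have across: "(in_triangle x p \<noteq> in_triangle y p) \<longleftrightarrow> (in_triangle x q \<noteq> in_triangle y q)"
    if Im: "Im p \<ge> 0" "Im q < 0" and disjoint:
      "closed_segment p q \<inter> closed_segment 0 x = {}" "closed_segment p q \<inter> closed_segment 1 x = {}"
      "closed_segment p q \<inter> closed_segment 0 y = {}" "closed_segment p q \<inter> closed_segment 1 y = {}" for p q
  proof -
    obtain m where m: "m \<in> closed_segment p q" "Im m = 0" using closed_segment_real_pointE[OF Im] .
    show ?thesis
      using in_triangle_across_real_point[OF Im m assms(1) disjoint(1,2)]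
        in_triangle_across_real_point[OF Im m assms(2) disjoint(3,4)] assms(1,2) by auto
  qed
  consider (upper) "Im p \<ge> 0" "Im q \<ge> 0" | (lower) "Im p < 0" "Im q < 0" | (down) "Im p \<ge> 0" "Im q < 0" |
    (up) "Im p < 0" "Im q \<ge> 0"
    by linarith
  then show ?thesis
  proof cases
    case upper then show ?thesis using in_triangle_upper_iff assms by blast
  next
    case lower then show ?thesis using in_triangle_lower_iff assms by blast
  next
    case down then show ?thesis using across assms by blast
  next
    case up then show ?thesis using across[of q p] assms by (auto simp: closed_segment_commute)
  qed
qed

lemma closed_segment_0_meets_1:
  assumes "Im x > 0" "Im y > 0" "det0 x y \<ge> 0" "det1 x y < 0"
  shows "closed_segment 0 y \<inter> closed_segment 1 x \<noteq> {}"
proof -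
  have "det1 x 0 \<ge> 0" using assms by (simp add: det1_def)
  then obtain t where t: "0 \<le> t" "t \<le> 1" "(1 - t) * det1 x 0 + t * det1 x y = 0"
    using convex_combination_zeroE assms(4) by blast
  have "det1 x (t *\<^sub>R y) = (1 - t) * det1 x 0 + t * det1 x y" "det0 x (t *\<^sub>R y) = t * det0 x y"
    by (simp_all add: det1_def det0_def algebra_simps)
  then have "t *\<^sub>R y \<in> closed_segment 1 x" using assms t by (intro in_closed_segment_1I) auto
  moreover have "t *\<^sub>R y \<in> closed_segment 0 y" using scaleR_in_closed_segment[of t 0 y] t by simp
  ultimately show ?thesis by blast
qed

lemma nested_or_meet:
  assumes "Im x > 0" "Im y > 0" "closed_segment 0 x \<inter> closed_segment 1 y = {}"
    "closed_segment 0 y \<inter> closed_segment 1 x = {}"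
  shows "in_upper_triangle x y \<or> in_upper_triangle y x"
  using closed_segment_0_meets_1[of x y] closed_segment_0_meets_1[of y x] assms
  unfolding in_upper_triangle_def det_swap[of y x] by linarith

text \<open>By Thales' theorem perpendicular spokes from the two hubs meet on the circle with diameter \<open>[0, 1]\<close>.\<close>

lemma perpendicular_foot:
  fixes x y :: complex
  assumes "t *\<^sub>R x = 1 + s *\<^sub>R (y - 1)" "inner x (y - 1) = 0"
  shows "t * (norm x)\<^sup>2 = Re x"
proof -
  have "inner x (t *\<^sub>R x - 1) = 0" unfolding assms(1) using assms(2) by simp
  then show ?thesis unfolding cmod_power2 by (simp add: inner_complex_def power2_eq_square algebra_simps)
qed

lemma perpendicular_spoke_meets_ray:
  assumes x: "Im x > 0" and k: "Im k > 0" and angle: "Re k * Im x \<le> Re x * Im k"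
    and t: "0 < t" "t * (norm x)\<^sup>2 = Re x" and t': "0 < t'" "t' * (norm k)\<^sup>2 = Re k"
    and spoke: "0 < s'" "s' \<le> 1" "t' *\<^sub>R k = 1 + s' *\<^sub>R (l - 1)" "inner k (l - 1) = 0"
  obtains c where "0 \<le> c" "c \<le> t" "c *\<^sub>R x \<in> closed_segment 1 l" "inner (c *\<^sub>R x - 1) k = 0"
proof -
  have norms: "(norm x)\<^sup>2 > 0" "(norm k)\<^sup>2 > 0" using x k by auto
  then have Re: "Re x > 0" "Re k > 0" using t t' by (metis mult_pos_pos)+
  have t_eq: "t = Re x / (norm x)\<^sup>2" "t' = Re k / (norm k)\<^sup>2"
    using t(2) t'(2) norms by (simp_all add: eq_divide_eq)
  define c where "c = Re k / inner x k"
  have inner: "inner x k > 0" using Re x k by (simp add: inner_complex_def add_pos_pos)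
  have c_pos: "c > 0" using Re inner by (simp add: c_def)
  have "Re k * (norm x)\<^sup>2 \<le> Re x * inner x k"
    using mult_left_mono[OF angle, of "Im x"] x
    unfolding inner_complex_def cmod_power2 by (simp add: power2_eq_square algebra_simps)
  then have c_le: "c \<le> t" using inner norms by (simp add: c_def t_eq field_simps)
  have foot: "inner k (c *\<^sub>R x - 1) = 0"
    using inner by (simp add: c_def inner_diff_right inner_commute)
  have "inner k (t' *\<^sub>R k - 1) = 0" unfolding spoke(3) using spoke(4) by simp
  moreover have "t' *\<^sub>R k - 1 \<noteq> 0" "k \<noteq> 0" using k t'(1) by (auto simp: complex_eq_iff)
  ultimately obtain w where w: "c *\<^sub>R x - 1 = w *\<^sub>R (t' *\<^sub>R k - 1)"
    using foot orthogonal_imp_parallel[of k "t' *\<^sub>R k - 1" "c *\<^sub>R x - 1"] by blast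
  have height: "t' * Im k > 0" using t'(1) k by simp
  have "c * Im x = w * (t' * Im k)" using arg_cong[OF w, of Im] by simp
  then have w_eq: "w = c * Im x / (t' * Im k)" using height by (metis less_irrefl nonzero_eq_divide_eq)
  have "Im x * (norm k)\<^sup>2 \<le> Im k * inner x k"
    using mult_left_mono[OF angle, of "Re k"] Re
    unfolding inner_complex_def cmod_power2 by (simp add: power2_eq_square algebra_simps)
  then have "c * Im x \<le> t' * Im k"
    using mult_left_mono[of "Im x * (norm k)\<^sup>2" "Im k * inner x k" "Re k"] Re inner norms
    by (simp add: c_def t_eq field_simps)
  then have w_range: "0 \<le> w" "w \<le> 1"
    unfolding w_eq using height c_pos x by (simp_all add: divide_le_eq)
  have "c *\<^sub>R x - 1 = (w * s') *\<^sub>R (l - 1)" unfolding w spoke(3) by simp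
  then have "c *\<^sub>R x = 1 + (w * s') *\<^sub>R (l - 1)" by (simp add: algebra_simps)
  then have "c *\<^sub>R x \<in> closed_segment 1 l"
    using w_range spoke(1,2) scaleR_in_closed_segment[of "w * s'" 1 l] by (simp add: mult_le_one)
  then show thesis using that[of c] c_pos c_le foot by (simp add: inner_commute)
qed

locale hub_drawing = complex_RAC_graph +
  fixes u v :: 'a
  assumes hubs: "u \<in> V" "v \<in> V" "g u = 0" "g v = 1"
begin

definition layer :: "'a \<Rightarrow> bool" where
  "layer x \<longleftrightarrow> {u, x} \<in> E \<and> {v, x} \<in> E"

lemma layerD: assumes "layer x" shows "x \<in> V" "x \<noteq> u" "x \<noteq> v" "{u, x} \<in> E" "{v, x} \<in> E"
  using assms edgeD[of u x] edgeD[of v x] unfolding layer_def by auto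

lemma hubs_distinct: "u \<noteq> v" using hubs by auto

definition meets_spoke :: "'a \<Rightarrow> 'a \<Rightarrow> 'a \<Rightarrow> bool" where
  "meets_spoke c d x \<longleftrightarrow> meets c d u x \<or> meets c d v x"

lemma finite_layers: "finite {x. layer x}"
  using graph layerD(1) by (auto simp: simple_graph_def intro: finite_subset[of _ V])

lemma card_layers_le_1:
  assumes "\<And>x. x \<in> A \<Longrightarrow> layer x" "\<And>x y. x \<in> A \<Longrightarrow> y \<in> A \<Longrightarrow> x = y"
  shows "card A \<le> 1"
  using card_le_Suc0_iff_eq[of A] assms finite_subset[OF _ finite_layers, of A] by auto

definition real_layers :: "'a set" where
  "real_layers = {x. layer x \<and> Im (g x) = 0}"

lemma Re_real_layer_pos:
  assumes "x \<in> real_layers"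
  shows "Re (g x) > 0"
proof (rule ccontr)
  assume "\<not> Re (g x) > 0"
  then have nonpos: "Re (g x) \<le> 0" by simp
  have x: "layer x" "Im (g x) = 0" using assms by (auto simp: real_layers_def)
  define l where "l = 1 / (1 - Re (g x))"
  have "1 + l *\<^sub>R (g x - 1) \<in> closed_segment 1 (g x)"
    using nonpos by (intro scaleR_in_closed_segment) (auto simp: l_def)
  moreover have "1 + l *\<^sub>R (g x - 1) = 0" using x nonpos by (auto simp: complex_eq_iff l_def field_simps)
  ultimately show False
    using vertex_notin_edge[OF layerD(5)[OF x(1)] hubs(1)] hubs_distinct layerD[OF x(1)] hubs by auto
qed

lemma card_real_layers: "card real_layers \<le> 1"
proof (rule card_layers_le_1)
  fix x y assume xy: "x \<in> real_layers" "y \<in> real_layers"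
  then have layers: "layer x" "layer y" by (simp_all add: real_layers_def)
  have "g y - g u = (Re (g y) / Re (g x)) *\<^sub>R (g x - g u)"
    using xy Re_real_layer_pos[OF xy(1)] hubs by (auto simp: complex_eq_iff real_layers_def)
  then show "x = y"
    using edges_on_ray_eq[OF layerD(4)[OF layers(1)] layerD(4)[OF layers(2)]]
      divide_pos_pos[OF Re_real_layer_pos[OF xy(2)] Re_real_layer_pos[OF xy(1)]] by blast
qed (simp add: real_layers_def)

definition upper_layers :: "'a set" where
  "upper_layers = {x. layer x \<and> Im (g x) > 0}"

lemma upper_layersD: "x \<in> upper_layers \<Longrightarrow> layer x" "x \<in> upper_layers \<Longrightarrow> Im (g x) > 0"
  by (simp_all add: upper_layers_def)

lemma det_upper_layers_nonzero:
  assumes "x \<in> upper_layers" "y \<in> upper_layers" "x \<noteq> y"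
  shows "det0 (g x) (g y) \<noteq> 0" "det1 (g x) (g y) \<noteq> 0"
proof -
  note X = layerD[OF upper_layersD(1)[OF assms(1)]] and Y = layerD[OF upper_layersD(1)[OF assms(2)]]
  note Im = upper_layersD(2)[OF assms(1)] upper_layersD(2)[OF assms(2)]
  let ?l = "Im (g y) / Im (g x)"
  have l: "?l > 0" using Im by simp
  show "det0 (g x) (g y) \<noteq> 0"
  proof
    assume "det0 (g x) (g y) = 0"
    then have "g y - g u = ?l *\<^sub>R (g x - g u)"
      using Im hubs by (auto simp: det0_def complex_eq_iff field_simps)
    then show False using edges_on_ray_eq[OF X(4) Y(4) _ l] assms(3) by blast
  qed
  show "det1 (g x) (g y) \<noteq> 0"
  proof
    assume "det1 (g x) (g y) = 0"
    then have "g y - g v = ?l *\<^sub>R (g x - g v)"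
      using Im hubs by (auto simp: det1_def complex_eq_iff field_simps)
    then show False using edges_on_ray_eq[OF X(5) Y(5) _ l] assms(3) by blast
  qed
qed

lemma crossing_spokesE:
  assumes "layer x" "layer y" "x \<noteq> y" "meets u x v y"
  obtains t s where "0 < t" "t \<le> 1" "0 < s" "s \<le> 1" "t *\<^sub>R g x = 1 + s *\<^sub>R (g y - 1)"
    "inner (g x) (g y - 1) = 0" "t * (norm (g x))\<^sup>2 = Re (g x)"
proof -
  note X = layerD[OF assms(1)] and Y = layerD[OF assms(2)]
  obtain r where r: "r \<in> closed_segment 0 (g x)" "r \<in> closed_segment 1 (g y)" using assms(4) hubs by auto
  obtain t where t: "0 \<le> t" "t \<le> 1" "r = t *\<^sub>R g x" using closed_segmentE[OF r(1)] by (metis add_0 diff_0_right)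
  obtain s where s: "0 \<le> s" "s \<le> 1" "r = 1 + s *\<^sub>R (g y - 1)" using closed_segmentE[OF r(2)] by metis
  have "t \<noteq> 0" using t r(2) vertex_notin_edge[OF Y(5), of u] hubs hubs_distinct Y by auto
  moreover have "s \<noteq> 0" using s r(1) vertex_notin_edge[OF X(4), of v] hubs hubs_distinct X by auto
  moreover have "inner (g u - g x) (g v - g y) = 0"
    using meets_orthogonal[OF X(4) Y(5) _ assms(4)] assms(3) hubs_distinct X Y by auto
  then have "inner (g x) (g y - 1) = 0" using hubs by (simp add: inner_diff_right)
  ultimately show thesis using that[of t s] t s perpendicular_foot by auto
qed

lemma Re_crossing_spoke_pos:
  assumes "x \<in> upper_layers" "layer y" "x \<noteq> y" "meets u x v y"
  shows "Re (g x) > 0"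
proof -
  obtain t where t: "0 < t" "t * (norm (g x))\<^sup>2 = Re (g x)"
    using crossing_spokesE[OF upper_layersD(1)[OF assms(1)] assms(2-4)] by metis
  have "(norm (g x))\<^sup>2 > 0" using upper_layersD(2)[OF assms(1)] by auto
  then show ?thesis using t by (metis mult_pos_pos)
qed

text \<open>Two perpendicular crossings on one side would force a third, non-perpendicular one: the spoke from
  \<open>v\<close> to \<open>l\<close> also meets the spoke from \<open>u\<close> to \<open>x\<close>, but is perpendicular to the one from \<open>u\<close> to \<open>k\<close>.\<close>

lemma crossing_spokes_angle_unique:
  assumes x: "x \<in> upper_layers" "layer y" "x \<noteq> y" "meets u x v y"
    and k: "k \<in> upper_layers" "layer l" "k \<noteq> l" "meets u k v l"
    and angle: "Re (g k) * Im (g x) \<le> Re (g x) * Im (g k)"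
  shows "x = k"
proof (rule ccontr)
  assume xk: "x \<noteq> k"
  note Im = upper_layersD(2)[OF x(1)] upper_layersD(2)[OF k(1)]
  note X = layerD[OF upper_layersD(1)[OF x(1)]] and Y = layerD[OF x(2)]
  note K = layerD[OF upper_layersD(1)[OF k(1)]] and L = layerD[OF k(2)]
  obtain t s where t: "0 < t" "t \<le> 1" "0 < s" "s \<le> 1" "t *\<^sub>R g x = 1 + s *\<^sub>R (g y - 1)"
    "t * (norm (g x))\<^sup>2 = Re (g x)"
    using crossing_spokesE[OF upper_layersD(1)[OF x(1)] x(2-4)] by metis
  obtain t' s' where t': "0 < t'" "t' * (norm (g k))\<^sup>2 = Re (g k)" "0 < s'" "s' \<le> 1"
    "t' *\<^sub>R g k = 1 + s' *\<^sub>R (g l - 1)" "inner (g k) (g l - 1) = 0"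
    using crossing_spokesE[OF upper_layersD(1)[OF k(1)] k(2-4)] by metis
  obtain c where c: "0 \<le> c" "c \<le> t" "c *\<^sub>R g x \<in> closed_segment 1 (g l)" "inner (c *\<^sub>R g x - 1) (g k) = 0"
    using perpendicular_spoke_meets_ray[OF Im angle t(1,6) t'] by blast
  have on_spoke: "c *\<^sub>R g x \<in> closed_segment 0 (g x)" using scaleR_in_closed_segment[of c 0 "g x"] c t by simp
  show False
  proof (cases "x = l")
    case True
    have "inner (c *\<^sub>R g x - 1) (g k) - inner (g x - 1) (g k) = (c - 1) * inner (g x) (g k)"
      by (simp add: inner_diff_left algebra_simps)
    then have "(c - 1) * inner (g x) (g k) = 0" using c(4) t'(6) True by (simp add: inner_commute)
    moreover have "inner (g x) (g k) > 0"
      using Re_crossing_spoke_pos[OF x] Re_crossing_spoke_pos[OF k] Im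
      by (simp add: inner_complex_def add_pos_pos)
    ultimately have "t = 1" using c t by simp
    then have "g x \<in> closed_segment (g v) (g y)"
      using scaleR_in_closed_segment[of s 1 "g y"] t hubs by simp
    then show False using vertex_notin_edge[OF Y(5) X(1)] X x(3) by auto
  next
    case False
    have "meets u x v l" using on_spoke c(3) hubs by auto
    then have "inner (g u - g x) (g v - g l) = 0"
      using meets_orthogonal[OF X(4) L(5)] False hubs_distinct X L by auto
    then have "inner (g l - 1) (g x) = 0" "inner (g l - 1) (g k) = 0"
      using hubs t' by (simp_all add: inner_diff_right inner_commute)
    moreover have "g l - 1 \<noteq> 0" "g x \<noteq> 0" using drawing_eq_iff[OF L(1) hubs(2)] hubs L Im by auto
    ultimately obtain a where a: "g k = a *\<^sub>R g x" using orthogonal_imp_parallel by blast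
    then have "a > 0" using Im by (simp add: zero_less_mult_iff)
    then show False using edges_on_ray_eq[OF X(4) K(4), of a] a hubs xk by simp
  qed
qed

definition crossing_layers :: "'a set" where
  "crossing_layers = {x \<in> upper_layers. \<exists>y\<in>upper_layers. x \<noteq> y \<and> meets u x v y}"

lemma card_crossing_layers: "card crossing_layers \<le> 1"
proof (rule card_layers_le_1)
  fix x k assume "x \<in> crossing_layers" "k \<in> crossing_layers"
  then obtain y l where "x \<in> upper_layers" "layer y" "x \<noteq> y" "meets u x v y"
    "k \<in> upper_layers" "layer l" "k \<noteq> l" "meets u k v l"
    unfolding crossing_layers_def using upper_layersD(1) by blast
  then show "x = k"
    using crossing_spokes_angle_unique[of x y k l] crossing_spokes_angle_unique[of k l x y]
      linear[of "Re (g k) * Im (g x)" "Re (g x) * Im (g k)"] by blast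
qed (simp add: crossing_layers_def upper_layersD)

definition uncrossed_layers :: "'a set" where
  "uncrossed_layers = upper_layers - crossing_layers"

lemma uncrossed_layersD:
  "x \<in> uncrossed_layers \<Longrightarrow> x \<in> upper_layers"
  "x \<in> uncrossed_layers \<Longrightarrow> y \<in> upper_layers \<Longrightarrow> x \<noteq> y \<Longrightarrow> \<not> meets u x v y"
  by (auto simp: uncrossed_layers_def crossing_layers_def)

lemma nested_uncrossed_layers:
  assumes "x \<in> uncrossed_layers" "y \<in> uncrossed_layers" "x \<noteq> y"
  shows "in_upper_triangle (g x) (g y) \<noteq> in_upper_triangle (g y) (g x)"
proof -
  note upper = uncrossed_layersD(1)[OF assms(1)] uncrossed_layersD(1)[OF assms(2)]
  have "in_upper_triangle (g x) (g y) \<or> in_upper_triangle (g y) (g x)"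
    using nested_or_meet[of "g x" "g y"] uncrossed_layersD(2)[OF assms(1) upper(2)]
      uncrossed_layersD(2)[OF assms(2) upper(1)] assms(3) upper_layersD(2)[OF upper(1)]
      upper_layersD(2)[OF upper(2)] hubs by simp
  moreover have "\<not> (in_upper_triangle (g x) (g y) \<and> in_upper_triangle (g y) (g x))"
    using det_upper_layers_nonzero[OF upper assms(3)] det_swap[of "g y" "g x"] by (auto simp: in_upper_triangle_def)
  ultimately show ?thesis by blast
qed

text \<open>An edge meeting the spokes \<open>ux\<close> and \<open>vy\<close> makes them parallel, so that neither triangle contains the
  other.\<close>

lemma edge_not_meets_opposite_spokes:
  assumes e: "{c, d} \<in> E" "c \<notin> {u, v, x, y}" "d \<notin> {u, v, x, y}"
    and xy: "x \<in> uncrossed_layers" "y \<in> uncrossed_layers" "x \<noteq> y" and meets: "meets c d u x" "meets c d v y"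
  shows False
proof -
  note upper = uncrossed_layersD(1)[OF xy(1)] uncrossed_layersD(1)[OF xy(2)]
  note Im = upper_layersD(2)[OF upper(1)] upper_layersD(2)[OF upper(2)]
  note X = layerD[OF upper_layersD(1)[OF upper(1)]] and Y = layerD[OF upper_layersD(1)[OF upper(2)]]
  have "inner (g c - g d) (g u - g x) = 0" "inner (g c - g d) (g v - g y) = 0"
    using meets_orthogonal[OF e(1) X(4) _ meets(1)] meets_orthogonal[OF e(1) Y(5) _ meets(2)] e by auto
  then have "inner (g c - g d) (g x) = 0" "inner (g c - g d) (g y - 1) = 0"
    using hubs by (simp_all add: inner_diff_right)
  moreover have "g c - g d \<noteq> 0" "g x \<noteq> 0" using edgeD[OF e(1)] drawing_eq_iff Im by auto
  ultimately obtain l where l: "g y - 1 = l *\<^sub>R g x" using orthogonal_imp_parallel by blast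
  then have "Im (g y) = l * Im (g x)" "Re (g y) = 1 + l * Re (g x)" by (auto simp: complex_eq_iff)
  then have "det0 (g y) (g x) = - Im (g x)" "det1 (g x) (g y) = - Im (g y)"
    by (simp_all add: det0_def det1_def algebra_simps)
  then have "\<not> in_upper_triangle (g y) (g x)" "\<not> in_upper_triangle (g x) (g y)"
    using Im by (auto simp: in_upper_triangle_def)
  then show False using nested_uncrossed_layers[OF xy] by blast
qed

lemma edge_meets_one_uncrossed_layer:
  assumes e: "{c, d} \<in> E" "c \<notin> {u, v, x, y}" "d \<notin> {u, v, x, y}"
    and xy: "x \<in> uncrossed_layers" "y \<in> uncrossed_layers" and meets: "meets_spoke c d x" "meets_spoke c d y"
  shows "x = y"
proof (rule ccontr)
  assume neq: "x \<noteq> y"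
  note X = layerD[OF upper_layersD(1)[OF uncrossed_layersD(1)[OF xy(1)]]]
  note Y = layerD[OF upper_layersD(1)[OF uncrossed_layersD(1)[OF xy(2)]]]
  consider (both_u) "meets c d u x" "meets c d u y" | (both_v) "meets c d v x" "meets c d v y" |
    (u_x) "meets c d u x" "meets c d v y" | (u_y) "meets c d u y" "meets c d v x"
    using meets unfolding meets_spoke_def by blast
  then show False
  proof cases
    case both_u then show ?thesis using edge_meets_star_once[OF e(1) X(4) Y(4)] e neq by auto
  next
    case both_v then show ?thesis using edge_meets_star_once[OF e(1) X(5) Y(5)] e neq by auto
  next
    case u_x then show ?thesis using edge_not_meets_opposite_spokes[OF e xy neq] by blast
  next
    case u_y then show ?thesis
      using edge_not_meets_opposite_spokes[of c d y x] e xy neq by auto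
  qed
qed

lemma meets_spoke_upper_pointE:
  assumes "{c, d} \<in> E" "c \<notin> {u, v, x}" "d \<notin> {u, v, x}" "x \<in> upper_layers" "meets_spoke c d x"
  obtains r s h where "r \<in> closed_segment (g c) (g d)" "Im r > 0" "0 < s" "s \<le> 1"
    "h = 0 \<or> h = 1" "r = h + s *\<^sub>R (g x - h)"
proof -
  obtain r h where r: "r \<in> closed_segment (g c) (g d)" "r \<in> closed_segment h (g x)" "h = g u \<or> h = g v"
    using assms(5) by (auto simp: meets_spoke_def)
  obtain s where s: "0 \<le> s" "s \<le> 1" "r = h + s *\<^sub>R (g x - h)" using closed_segmentE[OF r(2)] by metis
  have "s \<noteq> 0"
    using s r vertex_notin_edge[OF assms(1) hubs(1)] vertex_notin_edge[OF assms(1) hubs(2)] assms by auto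
  moreover have "Im r = s * Im (g x)" using s r(3) hubs by auto
  ultimately show thesis using that[of r s h] r s upper_layersD(2)[OF assms(4)] hubs by auto
qed

text \<open>Edges that change sides meet only the innermost or only the outermost layer, depending on whether
  they cross the real axis between the hubs.\<close>

definition switching_layers :: "bool \<Rightarrow> 'a set" where
  "switching_layers b = {x \<in> uncrossed_layers. \<exists>c d m. {c, d} \<in> E \<and> c \<notin> {u, v} \<and> d \<notin> {u, v} \<and>
     \<not> layer c \<and> \<not> layer d \<and> m \<in> closed_segment (g c) (g d) \<and> Im m = 0 \<and>
     (b \<longleftrightarrow> 0 \<le> Re m \<and> Re m \<le> 1) \<and> meets_spoke c d x}"

lemma switching_layers_pointE:
  assumes x: "x \<in> switching_layers b" and y: "y \<in> uncrossed_layers" and neq: "x \<noteq> y"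
  obtains s h where "0 < s" "s \<le> 1" "h = 0 \<or> h = 1" "in_upper_triangle (g y) (h + s *\<^sub>R (g x - h)) \<longleftrightarrow> b"
proof -
  obtain c d m where e: "x \<in> uncrossed_layers" "{c, d} \<in> E" "c \<notin> {u, v}" "d \<notin> {u, v}" "\<not> layer c" "\<not> layer d"
    and m: "m \<in> closed_segment (g c) (g d)" "Im m = 0" "b \<longleftrightarrow> 0 \<le> Re m \<and> Re m \<le> 1" and meets: "meets_spoke c d x"
    using x unfolding switching_layers_def by blast
  note upper = uncrossed_layersD(1)[OF e(1)] uncrossed_layersD(1)[OF y]
  note layers = upper_layersD(1)[OF upper(1)] upper_layersD(1)[OF upper(2)]
  have ends: "c \<notin> {u, v, x, y}" "d \<notin> {u, v, x, y}" using e layers by auto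
  obtain r s h where r: "r \<in> closed_segment (g c) (g d)" "Im r > 0" "0 < s" "s \<le> 1"
    "h = 0 \<or> h = 1" "r = h + s *\<^sub>R (g x - h)"
    using meets_spoke_upper_pointE[OF e(2) _ _ upper(1) meets] ends by (metis insert_iff)
  have "\<not> meets_spoke c d y"
    using edge_meets_one_uncrossed_layer[OF e(2) ends e(1) y meets] neq by blast
  moreover have "closed_segment r m \<subseteq> closed_segment (g c) (g d)"
    using r m by (simp add: subset_closed_segment)
  ultimately have "closed_segment r m \<inter> closed_segment 0 (g y) = {}"
    "closed_segment r m \<inter> closed_segment 1 (g y) = {}"
    using hubs unfolding meets_spoke_def by auto
  then have "in_upper_triangle (g y) r \<longleftrightarrow> in_upper_triangle (g y) m"
    using upper_layersD(2)[OF upper(2)] r m by (intro in_upper_triangle_iff_of_disjoint_sides) auto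
  then show thesis
    using that r(3-6) in_upper_triangle_real[OF upper_layersD(2)[OF upper(2)] m(2)] m(3) by blast
qed

lemma switching_layers_not_nested:
  assumes x: "x \<in> switching_layers b" and y: "y \<in> switching_layers b" and neq: "x \<noteq> y"
  shows "\<not> in_upper_triangle (g y) (g x)"
proof
  assume nested: "in_upper_triangle (g y) (g x)"
  have uncrossed: "x \<in> uncrossed_layers" "y \<in> uncrossed_layers" using x y by (auto simp: switching_layers_def)
  note upper = uncrossed_layersD(1)[OF uncrossed(1)] uncrossed_layersD(1)[OF uncrossed(2)]
  obtain s h where s: "0 < s" "s \<le> 1" "h = 0 \<or> h = 1" "in_upper_triangle (g y) (h + s *\<^sub>R (g x - h)) \<longleftrightarrow> b"
    using switching_layers_pointE[OF x uncrossed(2) neq] by blast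
  have "in_upper_triangle (g y) h"
    using s(3) upper_layersD(2)[OF upper(2)] by (auto simp: in_upper_triangle_def det0_def det1_def)
  then have "in_upper_triangle (g y) (h + s *\<^sub>R (g x - h))"
    using nested s unfolding in_upper_triangle_def det_affine by (auto intro!: add_nonneg_nonneg mult_nonneg_nonneg)
  then have b using s by blast
  obtain s' h' where s': "0 < s'" "s' \<le> 1" "h' = 0 \<or> h' = 1" "in_upper_triangle (g x) (h' + s' *\<^sub>R (g y - h')) \<longleftrightarrow> b"
    using switching_layers_pointE[OF y uncrossed(1) neq[symmetric]] by blast
  then have inside: "in_upper_triangle (g x) (h' + s' *\<^sub>R (g y - h'))" using \<open>b\<close> by blast
  have "det0 (g y) (g x) > 0" "det1 (g y) (g x) > 0"
    using nested det_upper_layers_nonzero[OF upper(2,1)] neq by (auto simp: in_upper_triangle_def less_le)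
  then have negative: "det0 (g x) (g y) < 0" "det1 (g x) (g y) < 0"
    using det_swap[of "g y" "g x"] by auto
  have "h' = 0 \<Longrightarrow> det0 (g x) (h' + s' *\<^sub>R (g y - h')) = s' * det0 (g x) (g y)"
    "h' = 1 \<Longrightarrow> det1 (g x) (h' + s' *\<^sub>R (g y - h')) = s' * det1 (g x) (g y)"
    by (simp_all add: det0_def det1_def algebra_simps)
  then show False using s'(1,3) inside negative by (auto simp: in_upper_triangle_def zero_le_mult_iff)
qed

lemma card_switching_layers: "card (switching_layers b) \<le> 1"
proof (rule card_layers_le_1)
  fix x y assume xy: "x \<in> switching_layers b" "y \<in> switching_layers b"
  show "x = y"
  proof (rule ccontr)
    assume neq: "x \<noteq> y"
    have "x \<in> uncrossed_layers" "y \<in> uncrossed_layers" using xy by (auto simp: switching_layers_def)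
    then show False
      using nested_uncrossed_layers[OF _ _ neq] switching_layers_not_nested[OF xy neq]
        switching_layers_not_nested[OF xy(2,1)] neq by blast
  qed
qed (auto simp: switching_layers_def dest: uncrossed_layersD upper_layersD)

lemma hub_drawing_cnj: "hub_drawing V E (\<lambda>z. cnj (g z)) u v"
proof
  have "inner (cnj a) (cnj b) = inner a b" for a b by (simp add: inner_complex_def)
  then have inner_cnj: "inner (cnj a - cnj b) (cnj c - cnj d) = inner (a - b) (c - d)" for a b c d
    by (metis complex_cnj_diff)
  have "cnj z \<in> closed_segment (cnj a) (cnj b) \<longleftrightarrow> z \<in> closed_segment a b" for z a b
    unfolding closed_segment_cnj by (auto simp: inj_image_mem_iff)
  then show "complex_RAC_drawing V E (\<lambda>z. cnj (g z))"
    using drawing unfolding complex_RAC_drawing_def inner_cnj closed_segment_cnj_disjoint_iff inj_on_def by simp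
qed (use graph hubs in auto)

end

context hub_drawing
begin

interpretation reflected: hub_drawing V E "\<lambda>z. cnj (g z)" u v
  by (rule hub_drawing_cnj)

lemma reflected_meets_spoke: "reflected.meets_spoke c d x \<longleftrightarrow> meets_spoke c d x"
  by (simp add: reflected.meets_spoke_def meets_spoke_def closed_segment_cnj_disjoint_iff)

definition regular_layers :: "'a set" where
  "regular_layers = {x. layer x} - (real_layers \<union> crossing_layers \<union> reflected.crossing_layers \<union>
     switching_layers True \<union> switching_layers False)"

lemma regular_layersD:
  assumes "x \<in> regular_layers"
  shows "layer x" "Im (g x) \<noteq> 0"
  using assms by (auto simp: regular_layers_def real_layers_def)

lemma card_irregular_layers: "card ({x. layer x} - regular_layers) \<le> 5"
proof -
  let ?A = "[real_layers, crossing_layers, reflected.crossing_layers, switching_layers True, switching_layers False]"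
  have finite: "finite (\<Union> (set ?A))"
    by (rule finite_subset[OF _ finite_layers])
       (auto simp: real_layers_def crossing_layers_def reflected.crossing_layers_def switching_layers_def
         dest: upper_layersD reflected.upper_layersD uncrossed_layersD)
  have "{x. layer x} - regular_layers \<subseteq> \<Union> (set ?A)" by (auto simp: regular_layers_def)
  then have "card ({x. layer x} - regular_layers) \<le> card (\<Union> (set ?A))" by (rule card_mono[OF finite])
  also have "\<dots> \<le> card real_layers + (card crossing_layers + (card reflected.crossing_layers +
      (card (switching_layers True) + card (switching_layers False))))"
    by (simp, intro order_trans[OF card_Un_le] add_left_mono card_Un_le)
  also have "\<dots> \<le> 5"
    using card_real_layers card_crossing_layers reflected.card_crossing_layers
      card_switching_layers[of True] card_switching_layers[of False] by linarith
  finally show ?thesis .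
qed

lemma finite_irregular_layers: "finite ({x. layer x} - regular_layers)"
  using finite_layers by simp

lemma finite_regular_layers: "finite regular_layers"
  by (rule finite_subset[OF _ finite_layers]) (auto dest: regular_layersD)

lemma regular_layers_uncrossed:
  "x \<in> regular_layers \<Longrightarrow> Im (g x) > 0 \<Longrightarrow> x \<in> uncrossed_layers"
  "x \<in> regular_layers \<Longrightarrow> \<not> Im (g x) > 0 \<Longrightarrow> x \<in> reflected.uncrossed_layers"
  using regular_layersD(2)[of x]
  by (auto simp: regular_layers_def uncrossed_layers_def upper_layers_def reflected.uncrossed_layers_def
    reflected.upper_layers_def)

lemma regular_layers_nested:
  assumes "x \<in> regular_layers" "y \<in> regular_layers" "x \<noteq> y" "Im (g x) > 0 \<longleftrightarrow> Im (g y) > 0"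
  shows "in_triangle (g x) (g y) \<noteq> in_triangle (g y) (g x)"
proof (cases "Im (g x) > 0")
  case True
  then show ?thesis
    using nested_uncrossed_layers[of x y] regular_layers_uncrossed(1) assms by (auto simp: in_triangle_def)
next
  case False
  then have "in_upper_triangle (cnj (g x)) (cnj (g y)) \<noteq> in_upper_triangle (cnj (g y)) (cnj (g x))"
    using regular_layers_uncrossed(2) assms by (intro reflected.nested_uncrossed_layers) auto
  then show ?thesis
    using False assms(4) regular_layersD(2)[OF assms(1)] regular_layersD(2)[OF assms(2)]
    by (auto simp: in_triangle_def less_le)
qed

lemma regular_layers_opposite:
  assumes "x \<in> regular_layers" "y \<in> regular_layers" "(Im (g x) > 0) \<noteq> (Im (g y) > 0)"
  shows "\<not> in_triangle (g x) (g y)"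
  using assms(3) regular_layersD(2)[OF assms(1)] regular_layersD(2)[OF assms(2)] by (auto simp: in_triangle_def)

lemma edge_meets_one_regular_layer_per_side:
  assumes e: "{c, d} \<in> E" "c \<notin> {u, v, x, y}" "d \<notin> {u, v, x, y}"
    and xy: "x \<in> regular_layers" "y \<in> regular_layers" "Im (g x) > 0 \<longleftrightarrow> Im (g y) > 0"
    and meets: "meets_spoke c d x" "meets_spoke c d y"
  shows "x = y"
proof (cases "Im (g x) > 0")
  case True
  then show ?thesis using edge_meets_one_uncrossed_layer[OF e _ _ meets] regular_layers_uncrossed(1) xy by blast
next
  case False
  then show ?thesis
    using reflected.edge_meets_one_uncrossed_layer[OF e] meets reflected_meets_spoke
      regular_layers_uncrossed(2) xy by blast
qed

lemma switching_edge_meets_no_regular_layer: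
  assumes e: "{c, d} \<in> E" "c \<notin> {u, v}" "d \<notin> {u, v}" "\<not> layer c" "\<not> layer d"
    and xy: "x \<in> regular_layers" "y \<in> regular_layers" "Im (g x) > 0" "\<not> Im (g y) > 0"
    and meets: "meets_spoke c d x" "meets_spoke c d y"
  shows False
proof -
  note x = regular_layers_uncrossed(1)[OF xy(1,3)]
  note y = reflected.uncrossed_layersD(1)[OF regular_layers_uncrossed(2)[OF xy(2,4)]]
  have ends: "c \<notin> {u, v, x, y}" "d \<notin> {u, v, x, y}" using e xy regular_layersD(1) by blast+
  obtain r where r: "r \<in> closed_segment (g c) (g d)" "Im r > 0"
    using meets_spoke_upper_pointE[OF e(1) _ _ uncrossed_layersD(1)[OF x] meets(1)] ends by (metis insert_iff)
  obtain r' where "r' \<in> closed_segment (cnj (g c)) (cnj (g d))" "Im r' > 0"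
    using reflected.meets_spoke_upper_pointE[OF e(1) _ _ y] meets(2) reflected_meets_spoke ends by (metis insert_iff)
  then obtain r'' where r'': "r'' \<in> closed_segment (g c) (g d)" "Im r'' < 0"
    unfolding closed_segment_cnj by auto
  obtain m where m: "m \<in> closed_segment r r''" "Im m = 0"
    using closed_segment_real_pointE[of r r''] r r'' by (metis less_eq_real_def)
  have "m \<in> closed_segment (g c) (g d)" using m r r'' subset_closed_segment by blast
  then have "x \<in> switching_layers (0 \<le> Re m \<and> Re m \<le> 1)"
    using e x m meets(1) unfolding switching_layers_def by blast
  then show False using xy(1) unfolding regular_layers_def by (cases "0 \<le> Re m \<and> Re m \<le> 1") auto
qed

lemma edge_meets_one_regular_layer:
  assumes e: "{c, d} \<in> E" "c \<notin> {u, v}" "d \<notin> {u, v}" "\<not> layer c" "\<not> layer d"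
    and xy: "x \<in> regular_layers" "y \<in> regular_layers" and meets: "meets_spoke c d x" "meets_spoke c d y"
  shows "x = y"
proof -
  have ends: "c \<notin> {u, v, x, y}" "d \<notin> {u, v, x, y}" using e xy regular_layersD(1) by blast+
  show ?thesis
    using edge_meets_one_regular_layer_per_side[OF e(1) ends xy _ meets]
      switching_edge_meets_no_regular_layer[OF e xy _ _ meets]
      switching_edge_meets_no_regular_layer[OF e xy(2,1) _ _ meets(2,1)] by blast
qed

end

section \<open>From drawings to packings\<close>

context hub_drawing
begin

text \<open>Two vertices joined by nine paths of length two are not separated by a pair of layers: the edges of
  these paths meet the spokes of the pair at most eight times.\<close>

definition linked :: "'a \<Rightarrow> 'a \<Rightarrow> bool" where
  "linked p q \<longleftrightarrow> (\<exists>T. card T = 9 \<and> (\<forall>t\<in>T. {p, t} \<in> E \<and> {q, t} \<in> E \<and> t \<notin> {u, v} \<and> \<not> layer t))"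

definition differ :: "'a \<Rightarrow> 'a \<Rightarrow> 'a \<Rightarrow> bool" where
  "differ x y z \<longleftrightarrow> in_triangle (g x) (g z) \<noteq> in_triangle (g y) (g z)"

definition separates :: "'a \<Rightarrow> 'a \<Rightarrow> 'a \<Rightarrow> 'a \<Rightarrow> bool" where
  "separates x y a b \<longleftrightarrow> differ x y a \<noteq> differ x y b"

lemma not_separates_refl: "\<not> separates x y a a"
  by (simp add: separates_def)

lemma not_separates_trans: "\<not> separates x y a b \<Longrightarrow> \<not> separates x y b c \<Longrightarrow> \<not> separates x y a c"
  by (auto simp: separates_def)

lemma not_separates_edge:
  assumes "Im (g x) \<noteq> 0" "Im (g y) \<noteq> 0" "\<not> meets_spoke c d x" "\<not> meets_spoke c d y"
  shows "\<not> separates x y c d"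
  using in_triangle_difference[OF assms(1,2), of "g c" "g d"] assms(3,4) hubs
  unfolding separates_def differ_def meets_spoke_def by simp

lemma card_star_meeting_spoke:
  assumes T: "finite T" "\<And>t. t \<in> T \<Longrightarrow> {a, t} \<in> E \<and> t \<notin> {h, z}" and e: "{h, z} \<in> E" "a \<notin> {h, z}"
  shows "card {t \<in> T. meets a t h z} \<le> 1"
proof -
  have "t = t'" if "t \<in> {t \<in> T. meets a t h z}" "t' \<in> {t \<in> T. meets a t h z}" for t t'
    by (rule edge_meets_star_once[OF e(1), of a]) (use that T(2) e in \<open>auto simp: Int_commute\<close>)
  then show ?thesis using T(1) by (simp add: card_le_Suc0_iff_eq)
qed

lemma not_separates_linked:
  assumes link: "linked p q" and p: "p \<notin> {u, v}" "q \<notin> {u, v}"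
    and x: "layer x" "layer y" "x \<notin> {p, q}" "y \<notin> {p, q}" and Im: "Im (g x) \<noteq> 0" "Im (g y) \<noteq> 0"
  shows "\<not> separates x y p q"
proof
  assume sep: "separates x y p q"
  obtain T where T: "card T = 9" "\<And>t. t \<in> T \<Longrightarrow> {p, t} \<in> E \<and> {q, t} \<in> E \<and> t \<notin> {u, v} \<and> \<not> layer t"
    using link unfolding linked_def by blast
  have fin: "finite T" using T(1) card.infinite by fastforce
  define meeting where "meeting = (\<lambda>(a, h, z). {t \<in> T. meets a t h z})"
  let ?I = "{p, q} \<times> {u, v} \<times> {x, y}"
  have "card (meeting i) \<le> 1" if index: "i \<in> ?I" for i
  proof -
    obtain a h z where i: "i = (a, h, z)" "a \<in> {p, q}" "h \<in> {u, v}" "z \<in> {x, y}" using index by auto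
    have "layer z" "{h, z} \<in> E" using i x unfolding layer_def by auto
    then show ?thesis
      unfolding meeting_def i(1) prod.case
      using i T(2) p x by (intro card_star_meeting_spoke fin) auto
  qed
  then have "(\<Sum>i\<in>?I. card (meeting i)) \<le> (\<Sum>i\<in>?I. 1)" by (intro sum_mono) auto
  also have "\<dots> = card ?I" by simp
  also have "\<dots> \<le> 2 * (2 * 2)"
    unfolding card_cartesian_product by (intro mult_mono) (auto simp: card_insert_if)
  finally have "card (\<Union>i\<in>?I. meeting i) \<le> 8"
    using card_UN_le[of ?I meeting] by simp
  moreover have "T \<subseteq> (\<Union>i\<in>?I. meeting i)"
  proof
    fix t assume t: "t \<in> T"
    have "separates x y p t \<or> separates x y q t" using sep unfolding separates_def by blast
    then obtain a z where "a \<in> {p, q}" "z \<in> {x, y}" "meets_spoke a t z" using not_separates_edge[OF Im] by blast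
    then obtain h where "a \<in> {p, q}" "h \<in> {u, v}" "z \<in> {x, y}" "meets a t h z" by (auto simp: meets_spoke_def)
    then show "t \<in> (\<Union>i\<in>?I. meeting i)" using t by (intro UN_I[of "(a, h, z)"]) (auto simp: meeting_def)
  qed
  then have "card T \<le> card (\<Union>i\<in>?I. meeting i)" using fin by (intro card_mono) (auto simp: meeting_def)
  ultimately show False using T(1) by simp
qed

lemma not_separates_chain:
  assumes "\<And>k. i \<le> k \<Longrightarrow> k < j \<Longrightarrow> \<not> separates x y (f k) (f (Suc k))" and "i \<le> j"
  shows "\<not> separates x y (f i) (f j)"
  using assms(2)
proof (induction rule: inc_induct)
  case (step k)
  then show ?case using not_separates_trans assms(1) by blast
qed (rule not_separates_refl)

lemma not_separates_linked_chain:
  assumes "\<And>k. i \<le> k \<Longrightarrow> k < j \<Longrightarrow> linked (f k) (f (Suc k))" and "i \<le> j"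
    and "\<And>k. i \<le> k \<Longrightarrow> k \<le> j \<Longrightarrow> f k \<notin> {u, v, x, y}" and "x \<in> regular_layers" "y \<in> regular_layers"
  shows "\<not> separates x y (f i) (f j)"
proof (rule not_separates_chain[OF _ assms(2)])
  fix k assume "i \<le> k" "k < j"
  then show "\<not> separates x y (f k) (f (Suc k))"
    using assms(1)[of k] assms(3)[of k] assms(3)[of "Suc k"] regular_layersD[OF assms(4)] regular_layersD[OF assms(5)]
    by (intro not_separates_linked) auto
qed

lemma in_triangle_flip:
  assumes "x \<in> regular_layers" "y \<in> regular_layers" "x \<noteq> y"
  shows "in_triangle (g y) (g x) \<longleftrightarrow> (in_triangle (g x) (g y) \<noteq> (Im (g x) > 0 \<longleftrightarrow> Im (g y) > 0))"
  using regular_layers_nested[OF assms] regular_layers_opposite[OF assms(1,2)]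
    regular_layers_opposite[OF assms(2,1)] by blast

lemma separates_swap:
  assumes "x \<in> regular_layers" "y \<in> regular_layers" "a \<in> regular_layers" "b \<in> regular_layers"
    and "x \<noteq> a" "x \<noteq> b" "y \<noteq> a" "y \<noteq> b"
  shows "separates x y a b \<longleftrightarrow> separates a b x y"
  unfolding separates_def differ_def in_triangle_flip[OF assms(1,3,5)] in_triangle_flip[OF assms(1,4,6)]
    in_triangle_flip[OF assms(2,3,7)] in_triangle_flip[OF assms(2,4,8)]
  by argo

text \<open>The layers are cyclically ordered, and of the three ways to pair four of them exactly one separates.\<close>

lemma separates_remaining_pairing:
  assumes "b \<in> regular_layers" "c \<in> regular_layers" "d \<in> regular_layers" "b \<noteq> c" "b \<noteq> d" "c \<noteq> d"
    and "\<not> separates a b c d" "\<not> separates a c b d"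
  shows "separates a d b c"
  using assms(7,8)
  unfolding separates_def differ_def in_triangle_flip[OF assms(1,2,4)] in_triangle_flip[OF assms(1,3,5)]
    in_triangle_flip[OF assms(2,3,6)]
  by argo

lemma card_le_2_if_unique_per_side:
  assumes S: "S \<subseteq> regular_layers"
    and unique: "\<And>x y. x \<in> S \<Longrightarrow> y \<in> S \<Longrightarrow> Im (g x) > 0 \<longleftrightarrow> Im (g y) > 0 \<Longrightarrow> x = y"
  shows "card S \<le> 2"
proof -
  have "finite S" using finite_subset[OF S finite_regular_layers] .
  then have "card {x \<in> S. Im (g x) > 0} \<le> 1" "card {x \<in> S. \<not> Im (g x) > 0} \<le> 1"
    using unique by (auto simp: card_le_Suc0_iff_eq)
  moreover have "S = {x \<in> S. Im (g x) > 0} \<union> {x \<in> S. \<not> Im (g x) > 0}" by blast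
  ultimately show ?thesis
    by (metis (no_types, lifting) add_mono card_Un_le le_trans one_add_one)
qed

lemma card_layers_meeting_end_edge:
  assumes e: "{c, d} \<in> E" and c: "layer c" and d: "d \<notin> {u, v}" "\<not> layer d"
  shows "card {x \<in> regular_layers - {c}. meets_spoke c d x} \<le> 2"
proof (rule card_le_2_if_unique_per_side)
  fix x y assume xy: "x \<in> {x \<in> regular_layers - {c}. meets_spoke c d x}"
    "y \<in> {x \<in> regular_layers - {c}. meets_spoke c d x}" "Im (g x) > 0 \<longleftrightarrow> Im (g y) > 0"
  then have "layer x" "layer y" using regular_layersD by blast+
  then show "x = y"
    using edge_meets_one_regular_layer_per_side[OF e, of x y] layerD[OF c] xy d by auto
qed auto

lemma card_layers_meeting_path_edge:
  assumes "{c, d} \<in> E" "c \<notin> {u, v}" "d \<notin> {u, v}" "\<not> layer c" "\<not> layer d"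
  shows "card {x \<in> regular_layers. meets_spoke c d x} \<le> 1"
  using edge_meets_one_regular_layer[OF assms] by (intro card_layers_le_1) (auto dest: regular_layersD)

end

lemma exists_block_avoiding:
  fixes f :: "nat \<Rightarrow> 'a"
  assumes inj: "inj_on f {..<b * N}" and A: "finite A" "card A < N"
  obtains q where "q < N" "\<And>i. i < b \<Longrightarrow> f (b * q + i) \<notin> A"
proof (rule ccontr)
  assume "\<not> thesis"
  then have "\<forall>q<N. \<exists>i<b. f (b * q + i) \<in> A" using that by blast
  then obtain i where i: "\<And>q. q < N \<Longrightarrow> i q < b \<and> f (b * q + i q) \<in> A" by metis
  have index: "b * q + i q < b * N" if "q < N" for q
  proof -
    have "b * q + i q < b * Suc q" using i[OF that] by simp
    also have "\<dots> \<le> b * N" using that by (intro mult_le_mono2) simp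
    finally show ?thesis .
  qed
  have "inj_on (\<lambda>q. f (b * q + i q)) {..<N}"
  proof (rule inj_onI)
    fix q q' assume q: "q \<in> {..<N}" "q' \<in> {..<N}" "f (b * q + i q) = f (b * q' + i q')"
    then have "b * q + i q = b * q' + i q'" using inj_onD[OF inj] index by simp
    then have "(b * q + i q) div b = (b * q' + i q') div b" by simp
    then show "q = q'" using i[of q] i[of q'] q(1,2) by simp
  qed
  then have "card {..<N} \<le> card A" using A(1) i by (intro card_inj_on_le) auto
  then show False using A(2) by simp
qed

locale bin_frame = hub_drawing +
  fixes n m wall_len :: nat and B s :: "nat \<Rightarrow> nat" and W It Pt :: "nat \<Rightarrow> nat \<Rightarrow> 'a"
  assumes n: "n \<ge> 1"
    and layer_W: "\<And>j k. j \<le> n \<Longrightarrow> k < wall_len \<Longrightarrow> layer (W j k)"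
    and layer_It: "\<And>i k. i < m \<Longrightarrow> k < s i \<Longrightarrow> layer (It i k)"
    and W_inject: "\<And>j k j' k'. j \<le> n \<Longrightarrow> k < wall_len \<Longrightarrow> j' \<le> n \<Longrightarrow> k' < wall_len \<Longrightarrow> W j k = W j' k' \<Longrightarrow> j = j' \<and> k = k'"
    and It_inject: "\<And>i k i' k'. i < m \<Longrightarrow> k < s i \<Longrightarrow> i' < m \<Longrightarrow> k' < s i' \<Longrightarrow> It i k = It i' k' \<Longrightarrow> i = i' \<and> k = k'"
    and W_neq_It: "\<And>j k i l. j \<le> n \<Longrightarrow> k < wall_len \<Longrightarrow> i < m \<Longrightarrow> l < s i \<Longrightarrow> W j k \<noteq> It i l"
    and Pt: "\<And>j k. j < n \<Longrightarrow> k \<le> B j \<Longrightarrow> Pt j k \<notin> {u, v} \<and> \<not> layer (Pt j k)"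
    and linked_W: "\<And>j k. j \<le> n \<Longrightarrow> Suc k < wall_len \<Longrightarrow> linked (W j k) (W j (Suc k))"
    and linked_It: "\<And>i k. i < m \<Longrightarrow> Suc k < s i \<Longrightarrow> linked (It i k) (It i (Suc k))"
    and linked_wrap: "linked (W n (wall_len - 1)) (W 0 0)"
    and path: "\<And>j k. j < n \<Longrightarrow> k < B j \<Longrightarrow> {Pt j k, Pt j (Suc k)} \<in> E"
    and path_first: "\<And>j. j < n \<Longrightarrow> {W j (wall_len - 1), Pt j 0} \<in> E"
    and path_last: "\<And>j. j < n \<Longrightarrow> {Pt j (B j), W (Suc j) 0} \<in> E"
    and wall_len: "wall_len \<ge> 3 * ((\<Sum>j<n. B j + 4) + 6)"
begin

lemma wall_len_ge: "wall_len \<ge> 18"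
  using order_trans[OF _ wall_len, of 18] by simp

definition met_layers :: "nat \<Rightarrow> 'a set" where
  "met_layers j = (\<Union>k<B j. {x \<in> regular_layers. meets_spoke (Pt j k) (Pt j (Suc k)) x}) \<union>
     {x \<in> regular_layers - {W j (wall_len - 1)}. meets_spoke (W j (wall_len - 1)) (Pt j 0) x} \<union>
     {x \<in> regular_layers - {W (Suc j) 0}. meets_spoke (W (Suc j) 0) (Pt j (B j)) x}"

lemma finite_met_layers: "finite (met_layers j)"
  using finite_regular_layers by (auto simp: met_layers_def)

lemma card_met_layers:
  assumes j: "j < n"
  shows "card (met_layers j) \<le> B j + 4"
proof -
  have "card {x \<in> regular_layers. meets_spoke (Pt j k) (Pt j (Suc k)) x} \<le> 1" if "k < B j" for k
    using Pt[OF j, of k] Pt[OF j, of "Suc k"] path[OF j that] that by (intro card_layers_meeting_path_edge) auto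
  then have "(\<Sum>k<B j. card {x \<in> regular_layers. meets_spoke (Pt j k) (Pt j (Suc k)) x}) \<le> (\<Sum>k<B j. 1)"
    by (intro sum_mono) auto
  then have "card (\<Union>k<B j. {x \<in> regular_layers. meets_spoke (Pt j k) (Pt j (Suc k)) x}) \<le> B j"
    using card_UN_le[of "{..<B j}" "\<lambda>k. {x \<in> regular_layers. meets_spoke (Pt j k) (Pt j (Suc k)) x}"] by simp
  moreover have "card {x \<in> regular_layers - {W j (wall_len - 1)}. meets_spoke (W j (wall_len - 1)) (Pt j 0) x} \<le> 2"
    using path_first[OF j] layer_W[of j] Pt[OF j, of 0] j wall_len_ge by (intro card_layers_meeting_end_edge) auto
  moreover have "card {x \<in> regular_layers - {W (Suc j) 0}. meets_spoke (W (Suc j) 0) (Pt j (B j)) x} \<le> 2"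
    using path_last[OF j] layer_W[of "Suc j" 0] Pt[OF j, of "B j"] j wall_len_ge
    by (intro card_layers_meeting_end_edge) (auto simp: insert_commute)
  ultimately show ?thesis
    unfolding met_layers_def
    by (intro order_trans[OF card_Un_le] order_trans[OF add_mono[OF card_Un_le order_refl]]) linarith
qed

lemma not_separates_path:
  assumes j: "j < n" and xy: "x \<in> regular_layers" "y \<in> regular_layers" "x \<notin> met_layers j" "y \<notin> met_layers j"
    "x \<notin> {W j (wall_len - 1), W (Suc j) 0}" "y \<notin> {W j (wall_len - 1), W (Suc j) 0}"
  shows "\<not> separates x y (W j (wall_len - 1)) (W (Suc j) 0)"
proof -
  note Im = regular_layersD(2)[OF xy(1)] regular_layersD(2)[OF xy(2)]
  have "\<not> separates x y (W j (wall_len - 1)) (Pt j 0)"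
    using xy by (intro not_separates_edge Im) (auto simp: met_layers_def)
  moreover have "\<not> separates x y (Pt j 0) (Pt j (B j))"
  proof (rule not_separates_chain[where f = "Pt j"])
    show "\<not> separates x y (Pt j k) (Pt j (Suc k))" if "k < B j" for k
      using xy that by (intro not_separates_edge Im) (auto simp: met_layers_def)
  qed simp
  moreover have "\<not> separates x y (Pt j (B j)) (W (Suc j) 0)"
    using xy
    by (intro not_separates_edge Im) (auto simp: met_layers_def meets_spoke_def closed_segment_commute)
  ultimately show ?thesis using not_separates_trans by blast
qed

definition exceptional_layers :: "'a set" where
  "exceptional_layers = ({x. layer x} - regular_layers) \<union> (\<Union>j<n. met_layers j)"

lemma finite_exceptional_layers: "finite exceptional_layers"
  using finite_irregular_layers finite_met_layers by (simp add: exceptional_layers_def)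

lemma card_exceptional_layers: "card exceptional_layers < (\<Sum>j<n. B j + 4) + 6"
proof -
  have "card (\<Union>j<n. met_layers j) \<le> (\<Sum>j<n. card (met_layers j))" by (rule card_UN_le) simp
  also have "\<dots> \<le> (\<Sum>j<n. B j + 4)" by (intro sum_mono card_met_layers) auto
  finally show ?thesis
    using card_Un_le[of "{x. layer x} - regular_layers" "\<Union>j<n. met_layers j"] card_irregular_layers
    unfolding exceptional_layers_def by linarith
qed

lemma not_exceptionalD:
  assumes "layer x" "x \<notin> exceptional_layers"
  shows "x \<in> regular_layers" "j < n \<Longrightarrow> x \<notin> met_layers j"
  using assms by (auto simp: exceptional_layers_def)

lemma wall_pivotE:
  obtains r where "1 \<le> r" "r + 1 < wall_len" "W 0 (r - 1) \<notin> exceptional_layers" "W 0 r \<notin> exceptional_layers"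
    "W 0 (r + 1) \<notin> exceptional_layers"
proof -
  let ?N = "(\<Sum>j<n. B j + 4) + 6"
  have "inj_on (W 0) {..<3 * ?N}" using W_inject[of 0 _ 0] wall_len by (auto simp: inj_on_def)
  then obtain q where q: "q < ?N" "\<And>i. i < 3 \<Longrightarrow> W 0 (3 * q + i) \<notin> exceptional_layers"
    using exists_block_avoiding[OF _ finite_exceptional_layers card_exceptional_layers] by blast
  then show thesis
    using that[of "3 * q + 1"] q(2)[of 0] q(2)[of 1] q(2)[of 2] wall_len by simp
qed

lemma hub_notin_W: "j \<le> n \<Longrightarrow> k < wall_len \<Longrightarrow> W j k \<notin> {u, v}"
  using layerD[OF layer_W[of j k]] by auto

lemma not_separates_wall:
  assumes "j \<le> n" "k \<le> k'" "k' < wall_len" and "x \<in> regular_layers" "y \<in> regular_layers"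
    and "\<And>l. k \<le> l \<Longrightarrow> l \<le> k' \<Longrightarrow> W j l \<notin> {x, y}"
  shows "\<not> separates x y (W j k) (W j k')"
proof (rule not_separates_linked_chain[OF _ assms(2)])
  show "W j l \<notin> {u, v, x, y}" if "k \<le> l" "l \<le> k'" for l
    using that assms(3) hub_notin_W[OF assms(1), of l] assms(6)[of l] by auto
qed (use assms linked_W in auto)

lemma exists_regular_wall_layer:
  assumes "j \<le> n"
  obtains k where "k < wall_len" "W j k \<in> regular_layers"
proof (rule ccontr)
  assume "\<not> thesis"
  then have "W j ` {..<wall_len} \<subseteq> {x. layer x} - regular_layers" using layer_W assms that by auto
  then have "card (W j ` {..<wall_len}) \<le> 5"
    using card_mono[OF finite_irregular_layers] card_irregular_layers le_trans by blast
  moreover have "inj_on (W j) {..<wall_len}" using W_inject assms by (auto simp: inj_on_def)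
  ultimately show False using wall_len_ge by (simp add: card_image)
qed

lemma separates_item_iff:
  assumes j: "j < n" and i: "i < m" "k < s i" "k' < s i" "k \<le> k'"
    and regular: "It i k \<in> regular_layers" "It i k' \<in> regular_layers"
  shows "separates (It i k) y (W j (wall_len - 1)) (W (Suc j) 0) \<longleftrightarrow>
    separates (It i k') y (W j (wall_len - 1)) (W (Suc j) 0)"
proof -
  let ?x = "It i k" and ?x' = "It i k'"
  obtain l where l: "l < wall_len" "W j l \<in> regular_layers" using exists_regular_wall_layer[of j] j by auto
  obtain l' where l': "l' < wall_len" "W (Suc j) l' \<in> regular_layers"
    using exists_regular_wall_layer[of "Suc j"] j by auto
  have item_neq: "It i a \<noteq> W b c" if "a < s i" "b \<le> n" "c < wall_len" for a b c
    using W_neq_It[OF that(2,3) i(1) that(1)] by auto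
  have "\<not> separates (W j l) (W (Suc j) l') ?x ?x'"
  proof (rule not_separates_linked_chain[OF _ i(4) _ l(2) l'(2)])
    show "It i a \<notin> {u, v, W j l, W (Suc j) l'}" if "k \<le> a" "a \<le> k'" for a
      using that i layerD[OF layer_It[OF i(1), of a]] item_neq[of a j l] item_neq[of a "Suc j" l'] l l' j by auto
  qed (use i linked_It in auto)
  then have across: "\<not> separates ?x ?x' (W j l) (W (Suc j) l')"
    using separates_swap[OF regular l(2) l'(2)] l l' item_neq i j by auto
  have wall: "\<not> separates ?x ?x' (W b a) (W b c)" if w: "b \<le> n" "a \<le> c" "c < wall_len" for b a c
  proof (rule not_separates_wall[OF w regular])
    fix e assume "a \<le> e" "e \<le> c"
    then show "W b e \<notin> {?x, ?x'}" using item_neq[OF i(2) w(1), of e] item_neq[OF i(3) w(1), of e] w(3) by auto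
  qed
  have "\<not> separates ?x ?x' (W j l) (W j (wall_len - 1))" "\<not> separates ?x ?x' (W (Suc j) 0) (W (Suc j) l')"
    using l l' j wall[of j l "wall_len - 1"] wall[of "Suc j" 0 l'] by auto
  with across have "\<not> separates ?x ?x' (W j (wall_len - 1)) (W (Suc j) 0)" unfolding separates_def by argo
  then show ?thesis unfolding separates_def differ_def by argo
qed

end

text \<open>The layer \<open>r\<close> of the first wall cuts the cyclic order open: together with it, a layer separates the two
  ends of exactly one bin.\<close>

locale bin_frame_pivot = bin_frame +
  fixes r :: nat
  assumes r: "1 \<le> r" "r + 1 < wall_len"
    and not_exceptional: "W 0 (r - 1) \<notin> exceptional_layers" "W 0 r \<notin> exceptional_layers"
      "W 0 (r + 1) \<notin> exceptional_layers"
begin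

lemma pivot_regular: "W 0 (r - 1) \<in> regular_layers" "W 0 r \<in> regular_layers" "W 0 (r + 1) \<in> regular_layers"
  by (rule not_exceptionalD(1)[OF layer_W not_exceptional(1)]
      not_exceptionalD(1)[OF layer_W not_exceptional(2)]
      not_exceptionalD(1)[OF layer_W not_exceptional(3)]; use r in simp)+

lemma pivot_neq: "j \<le> n \<Longrightarrow> k < wall_len \<Longrightarrow> j \<noteq> 0 \<or> k \<noteq> r \<Longrightarrow> W 0 r \<noteq> W j k"
  using W_inject[of 0 r j k] r by auto

lemma separates_pivot_neighbours:
  assumes x: "x \<in> regular_layers" "\<And>k. k < wall_len \<Longrightarrow> x \<noteq> W 0 k"
  shows "separates x (W 0 r) (W 0 (r + 1)) (W 0 (r - 1))"
proof -
  let ?a = "W 0 (r - 1)" and ?y = "W 0 r" and ?b = "W 0 (r + 1)"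
  have bounds: "r - 1 < wall_len" "r < wall_len" "r + 1 < wall_len" using r by auto
  have "?a \<noteq> ?b" using W_inject[OF _ bounds(1) _ bounds(3), of 0 0] by auto
  moreover have "?y \<noteq> ?a" "?y \<noteq> ?b"
    using pivot_neq[OF _ bounds(1), of 0] pivot_neq[OF _ bounds(3), of 0] r by simp_all
  moreover have "x \<noteq> ?a" "x \<noteq> ?y" "x \<noteq> ?b" by (rule x(2)[OF bounds(1)] x(2)[OF bounds(2)] x(2)[OF bounds(3)])+
  ultimately have neq: "?a \<noteq> ?b" "?a \<noteq> ?y" "?b \<noteq> ?y" "x \<noteq> ?a" "x \<noteq> ?y" "x \<noteq> ?b" by auto
  have link: "linked ?a ?y" "linked ?y ?b" using linked_W[of 0 "r - 1"] linked_W[of 0 r] r by auto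
  have hub: "?a \<notin> {u, v}" "?y \<notin> {u, v}" "?b \<notin> {u, v}" using hub_notin_W[of 0] r by auto
  note layers = regular_layersD[OF x(1)] regular_layersD[OF pivot_regular(1)] regular_layersD[OF pivot_regular(3)]
  have "\<not> separates x ?b ?a ?y"
    using link hub layers neq by (intro not_separates_linked) auto
  moreover have "\<not> separates x ?a ?y ?b"
    using link hub layers neq by (intro not_separates_linked) auto
  ultimately show ?thesis
    using neq by (intro separates_remaining_pairing pivot_regular) (auto simp: separates_def)
qed

lemma item_separates_bin:
  assumes i: "i < m" "k < s i" and x: "It i k \<in> regular_layers"
  shows "\<exists>j<n. separates (It i k) (W 0 r) (W j (wall_len - 1)) (W (Suc j) 0)"
proof (rule ccontr)
  let ?x = "It i k" and ?y = "W 0 r"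
  assume no: "\<not> ?thesis"
  have item_neq: "?x \<noteq> W j l" if "j \<le> n" "l < wall_len" for j l using W_neq_It[OF that i] by auto
  have wall: "\<not> separates ?x ?y (W j a) (W j b)" if w: "j \<le> n" "a \<le> b" "b < wall_len" "j \<noteq> 0 \<or> r < a \<or> b < r" for j a b
  proof (rule not_separates_wall[OF w(1-3) x pivot_regular(2)])
    fix l assume "a \<le> l" "l \<le> b"
    then have "l < wall_len" "j \<noteq> 0 \<or> l \<noteq> r" using w by auto
    then show "W j l \<notin> {?x, ?y}" using item_neq[OF w(1), of l] pivot_neq[OF w(1), of l] by auto
  qed
  have "\<not> separates ?x ?y (W 0 (wall_len - 1)) (W j (wall_len - 1))" if "j \<le> n" for j
    using that
  proof (induction j)
    case (Suc j)
    have "\<not> separates ?x ?y (W j (wall_len - 1)) (W (Suc j) 0)" using no Suc by auto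
    moreover have "\<not> separates ?x ?y (W (Suc j) 0) (W (Suc j) (wall_len - 1))"
      using Suc wall_len_ge by (intro wall) auto
    ultimately show ?case using Suc by (auto simp: separates_def)
  qed (simp add: separates_def)
  then have "\<not> separates ?x ?y (W 0 (wall_len - 1)) (W n (wall_len - 1))" by blast
  moreover have "\<not> separates ?x ?y (W 0 (r + 1)) (W 0 (wall_len - 1))" "\<not> separates ?x ?y (W 0 0) (W 0 (r - 1))"
    by (rule wall; use r in simp)+
  moreover have "\<not> separates ?x ?y (W n (wall_len - 1)) (W 0 0)"
    using r item_neq[of n "wall_len - 1"] item_neq[of 0 0] pivot_neq[of n "wall_len - 1"] pivot_neq[of 0 0]
      hub_notin_W[of n "wall_len - 1"] hub_notin_W[of 0 0] n wall_len_ge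
      regular_layersD[OF x] regular_layersD[OF pivot_regular(2)]
    by (intro not_separates_linked linked_wrap) auto
  moreover have "separates ?x ?y (W 0 (r + 1)) (W 0 (r - 1))"
    using separates_pivot_neighbours x item_neq by blast
  ultimately show False unfolding separates_def by argo
qed

lemma item_in_bin:
  assumes i: "i < m"
  shows "\<exists>j<n. \<forall>k<s i. It i k \<in> regular_layers \<longrightarrow> It i k \<in> met_layers j"
proof (cases "\<exists>k<s i. It i k \<in> regular_layers")
  case True
  then obtain k where k: "k < s i" "It i k \<in> regular_layers" by blast
  obtain j where j: "j < n" "separates (It i k) (W 0 r) (W j (wall_len - 1)) (W (Suc j) 0)"
    using item_separates_bin[OF i k] by blast
  have "It i k' \<in> met_layers j" if k': "k' < s i" "It i k' \<in> regular_layers" for k'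
  proof (rule ccontr)
    assume not_met: "It i k' \<notin> met_layers j"
    have wall: "j \<le> n" "wall_len - 1 < wall_len" "Suc j \<le> n" "0 < wall_len" "wall_len - 1 \<noteq> r" "r \<noteq> 0"
      using j(1) wall_len_ge r by auto
    have "W 0 r \<notin> met_layers j" using not_exceptionalD(2)[OF layer_W not_exceptional(2) j(1)] r by simp
    moreover have "It i k' \<notin> {W j (wall_len - 1), W (Suc j) 0}"
      using W_neq_It[OF wall(1,2) i k'(1)] W_neq_It[OF wall(3,4) i k'(1)] by auto
    moreover have "W 0 r \<notin> {W j (wall_len - 1), W (Suc j) 0}"
      using pivot_neq[OF wall(1,2)] pivot_neq[OF wall(3,4)] wall(5) by auto
    ultimately have "\<not> separates (It i k') (W 0 r) (W j (wall_len - 1)) (W (Suc j) 0)"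
      by (intro not_separates_path j(1) k'(2) pivot_regular(2) not_met)
    moreover have "separates (It i k) (W 0 r) (W j (wall_len - 1)) (W (Suc j) 0) \<longleftrightarrow>
        separates (It i k') (W 0 r) (W j (wall_len - 1)) (W (Suc j) 0)"
      using separates_item_iff[OF j(1) i k(1) k'(1) _ k(2) k'(2)]
        separates_item_iff[OF j(1) i k'(1) k(1) _ k'(2) k(2)] linear[of k k'] by blast
    ultimately show False using j(2) by blast
  qed
  then show ?thesis using j(1) by blast
qed (use n in \<open>auto intro!: exI[of _ 0]\<close>)

end

context bin_frame
begin

lemma sum_sizes_le_met_layers:
  assumes "I \<subseteq> {..<m}" and met: "\<And>i k. i \<in> I \<Longrightarrow> k < s i \<Longrightarrow> It i k \<in> regular_layers \<Longrightarrow> It i k \<in> met_layers j"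
  shows "(\<Sum>i\<in>I. s i) \<le> card (met_layers j) + 5"
proof -
  let ?S = "SIGMA i:I. {..<s i}"
  have "finite I" using assms(1) finite_subset by blast
  then have "(\<Sum>i\<in>I. s i) = card ?S" by (simp add: card_SigmaI)
  also have "\<dots> = card ((\<lambda>(i, k). It i k) ` ?S)"
  proof (rule card_image[symmetric], rule inj_onI, clarify)
    fix i k i' k' assume "i \<in> I" "k < s i" "i' \<in> I" "k' < s i'" "It i k = It i' k'"
    then show "i = i' \<and> k = k'" using It_inject assms(1) by (meson lessThan_iff subsetD)
  qed
  also have "\<dots> \<le> card (met_layers j \<union> ({x. layer x} - regular_layers))"
  proof (rule card_mono)
    show "finite (met_layers j \<union> ({x. layer x} - regular_layers))"
      using finite_met_layers finite_irregular_layers by simp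
    show "(\<lambda>(i, k). It i k) ` ?S \<subseteq> met_layers j \<union> ({x. layer x} - regular_layers)"
    proof
      fix z assume "z \<in> (\<lambda>(i, k). It i k) ` ?S"
      then obtain i k where "i \<in> I" "k < s i" "z = It i k" by auto
      then show "z \<in> met_layers j \<union> ({x. layer x} - regular_layers)"
        using met[of i k] layer_It[of i k] assms(1) by blast
    qed
  qed
  also have "\<dots> \<le> card (met_layers j) + card ({x. layer x} - regular_layers)" by (rule card_Un_le)
  finally show ?thesis using card_irregular_layers by linarith
qed

theorem packing_exists:
  "\<exists>\<beta>. (\<forall>i<m. \<beta> i < n) \<and> (\<forall>j<n. (\<Sum>i | i < m \<and> \<beta> i = j. s i) \<le> B j + 9)"
proof -
  obtain r where r: "1 \<le> r" "r + 1 < wall_len" "W 0 (r - 1) \<notin> exceptional_layers" "W 0 r \<notin> exceptional_layers"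
    "W 0 (r + 1) \<notin> exceptional_layers"
    by (rule wall_pivotE)
  interpret bin_frame_pivot V E g u v n m wall_len B s W It Pt r
    by unfold_locales (rule r)+
  obtain \<beta> where \<beta>: "\<And>i. i < m \<Longrightarrow> \<beta> i < n \<and> (\<forall>k<s i. It i k \<in> regular_layers \<longrightarrow> It i k \<in> met_layers (\<beta> i))"
    using item_in_bin by metis
  have "(\<Sum>i | i < m \<and> \<beta> i = j. s i) \<le> B j + 9" if "j < n" for j
  proof -
    have "(\<Sum>i | i < m \<and> \<beta> i = j. s i) \<le> card (met_layers j) + 5"
      using \<beta> by (intro sum_sizes_le_met_layers) auto
    then show ?thesis using card_met_layers[OF that] by linarith
  qed
  then show ?thesis using \<beta> by blast
qed

end

section \<open>From packings to drawings\<close>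

type_synonym vertex = "nat \<times> nat \<times> nat \<times> nat"

definition HubU :: vertex where "HubU = (0, 0, 0, 0)"
definition HubV :: vertex where "HubV = (1, 0, 0, 0)"
definition Layer :: "nat \<Rightarrow> nat \<Rightarrow> vertex" where "Layer b k = (2, b, k, 0)"
definition Link :: "nat \<Rightarrow> nat \<Rightarrow> nat \<Rightarrow> vertex" where "Link b k r = (3, b, k, r)"
definition Path :: "nat \<Rightarrow> nat \<Rightarrow> vertex" where "Path j k = (4, j, k, 0)"

lemmas vertex_defs = HubU_def HubV_def Layer_def Link_def Path_def

text \<open>Blocks below \<open>m\<close> are the items, blocks \<open>m, \<dots>, m + n\<close> are walls of length \<open>wall_len\<close>; the path \<open>Path j\<close>
  spans bin \<open>j\<close>, which lies between walls \<open>m + j\<close> and \<open>m + j + 1\<close>. The vertices \<open>Link (m + n + 1) 0 r\<close>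
  join the last wall to the first one.\<close>

locale packing_graph =
  fixes n m wall_len :: nat and B s :: "nat \<Rightarrow> nat"
begin

definition block_len :: "nat \<Rightarrow> nat" where
  "block_len b = (if b < m then s b else if b \<le> m + n then wall_len else 0)"

definition packing_adj :: "vertex \<Rightarrow> vertex \<Rightarrow> bool" where
  "packing_adj x y \<longleftrightarrow>
     (\<exists>b k. k < block_len b \<and> x = Layer b k \<and> (y = HubU \<or> y = HubV)) \<or>
     (\<exists>b k r. k + 1 < block_len b \<and> r < 9 \<and> (x = Layer b k \<or> x = Layer b (k + 1)) \<and> y = Link b k r) \<or>
     (\<exists>r<9. (x = Layer m 0 \<or> x = Layer (m + n) (wall_len - 1)) \<and> y = Link (m + n + 1) 0 r) \<or>
     (\<exists>j<n. \<exists>k<B j. x = Path j k \<and> y = Path j (k + 1)) \<or>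
     (\<exists>j<n. x = Layer (m + j) (wall_len - 1) \<and> y = Path j 0) \<or>
     (\<exists>j<n. x = Layer (m + j + 1) 0 \<and> y = Path j (B j))"

definition packing_edges :: "vertex set set" where
  "packing_edges = {{x, y} |x y. packing_adj x y}"

lemma packing_edges_iff: "{x, y} \<in> packing_edges \<longleftrightarrow> packing_adj x y \<or> packing_adj y x"
proof -
  have "{x, y} \<in> packing_edges \<longleftrightarrow> (\<exists>a b. {x, y} = {a, b} \<and> packing_adj a b)" unfolding packing_edges_def by blast
  then show ?thesis unfolding doubleton_eq_iff by blast
qed

lemma packing_adj_neq: "packing_adj x y \<Longrightarrow> x \<noteq> y"
  by (auto simp: packing_adj_def vertex_defs)

lemma packing_adjI:
  "k < block_len b \<Longrightarrow> packing_adj (Layer b k) HubU" "k < block_len b \<Longrightarrow> packing_adj (Layer b k) HubV"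
  "k + 1 < block_len b \<Longrightarrow> r < 9 \<Longrightarrow> packing_adj (Layer b k) (Link b k r)"
  "k + 1 < block_len b \<Longrightarrow> r < 9 \<Longrightarrow> packing_adj (Layer b (k + 1)) (Link b k r)"
  "r < 9 \<Longrightarrow> packing_adj (Layer m 0) (Link (m + n + 1) 0 r)"
  "r < 9 \<Longrightarrow> packing_adj (Layer (m + n) (wall_len - 1)) (Link (m + n + 1) 0 r)"
  "j < n \<Longrightarrow> k < B j \<Longrightarrow> packing_adj (Path j k) (Path j (k + 1))"
  "j < n \<Longrightarrow> packing_adj (Layer (m + j) (wall_len - 1)) (Path j 0)"
  "j < n \<Longrightarrow> packing_adj (Layer (m + j + 1) 0) (Path j (B j))"
  unfolding packing_adj_def by blast+

end

definition RAC_compatible :: "complex \<Rightarrow> complex \<Rightarrow> complex \<Rightarrow> complex \<Rightarrow> bool" where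
  "RAC_compatible a b c d \<longleftrightarrow> closed_segment a b \<inter> closed_segment c d = {} \<or>
     (inner (a - b) (c - d) = 0 \<and> a \<notin> closed_segment c d \<and> b \<notin> closed_segment c d \<and>
      c \<notin> closed_segment a b \<and> d \<notin> closed_segment a b)"

lemma RAC_compatible_sym:
  "RAC_compatible a b c d \<Longrightarrow> RAC_compatible b a c d"
  "RAC_compatible a b c d \<Longrightarrow> RAC_compatible a b d c" "RAC_compatible a b c d \<Longrightarrow> RAC_compatible c d a b"
  by (auto simp: RAC_compatible_def closed_segment_commute inner_commute inner_diff_left inner_diff_right algebra_simps)

lemma complex_RAC_drawing_if_compatible:
  assumes inj: "inj_on g V"
    and compatible: "\<And>a b c d. {a, b} \<in> E \<Longrightarrow> {c, d} \<in> E \<Longrightarrow> {a, b} \<inter> {c, d} = {} \<Longrightarrow>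
      RAC_compatible (g a) (g b) (g c) (g d)"
    and neighbours: "\<And>c. c \<in> V \<Longrightarrow> \<exists>d d'. {c, d} \<in> E \<and> {c, d'} \<in> E \<and> d \<noteq> d' \<and> d \<noteq> c \<and> d' \<noteq> c \<and> {d, d'} \<notin> E"
  shows "complex_RAC_drawing V E g"
proof (rule complex_RAC_drawingI[OF inj])
  fix a b c assume ab: "{a, b} \<in> E" and c: "c \<in> V" "c \<noteq> a" "c \<noteq> b"
  obtain d d' where d: "{c, d} \<in> E" "{c, d'} \<in> E" "d \<noteq> d'" "{d, d'} \<notin> E" using neighbours c(1) by blast
  have "d \<notin> {a, b} \<or> d' \<notin> {a, b}" using d ab by (auto simp: insert_commute)
  then obtain e where e: "{c, e} \<in> E" "e \<notin> {a, b}" using d by blast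
  then have "RAC_compatible (g c) (g e) (g a) (g b)" using ab c by (intro compatible) auto
  then show "g c \<notin> closed_segment (g a) (g b)" unfolding RAC_compatible_def by auto
next
  fix a b c d assume "{a, b} \<in> E" "{c, d} \<in> E" "{a, b} \<inter> {c, d} = {}"
    "closed_segment (g a) (g b) \<inter> closed_segment (g c) (g d) \<noteq> {}"
  then show "inner (g a - g b) (g c - g d) = 0" using compatible[of a b c d] by (auto simp: RAC_compatible_def)
qed

definition affine_functional :: "(complex \<Rightarrow> real) \<Rightarrow> bool" where
  "affine_functional D \<longleftrightarrow> (\<exists>\<alpha> \<beta> \<gamma>. \<forall>z. D z = \<alpha> * Re z + \<beta> * Im z + \<gamma>)"

lemma affine_functional_segmentE:
  assumes "affine_functional D" "z \<in> closed_segment a b"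
  obtains t where "0 \<le> t" "t \<le> 1" "z = (1 - t) *\<^sub>R a + t *\<^sub>R b" "D z = (1 - t) * D a + t * D b"
proof -
  obtain t where t: "0 \<le> t" "t \<le> 1" "z = (1 - t) *\<^sub>R a + t *\<^sub>R b" using assms(2) by (auto simp: in_segment)
  moreover have "D z = (1 - t) * D a + t * D b"
    using assms(1) unfolding affine_functional_def t(3) by (auto simp: algebra_simps)
  ultimately show thesis using that by blast
qed

lemma RAC_compatible_separated:
  assumes D: "affine_functional D" and ab: "D a < 0" "D b \<le> 0" and cd: "D c \<ge> 0" "D d > 0" and neq: "b \<noteq> c"
  shows "RAC_compatible a b c d"
proof -
  have False if z: "z \<in> closed_segment a b" "z \<in> closed_segment c d" for z
  proof -
    obtain t where t: "0 \<le> t" "t \<le> 1" "z = (1 - t) *\<^sub>R a + t *\<^sub>R b" "D z = (1 - t) * D a + t * D b"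
      using affine_functional_segmentE[OF D z(1)] by metis
    obtain t' where t': "0 \<le> t'" "t' \<le> 1" "z = (1 - t') *\<^sub>R c + t' *\<^sub>R d" "D z = (1 - t') * D c + t' * D d"
      using affine_functional_segmentE[OF D z(2)] by metis
    have "(1 - t) * D a \<le> 0" "t * D b \<le> 0" "(1 - t') * D c \<ge> 0" "t' * D d \<ge> 0"
      using t t' ab cd by (auto simp: mult_nonneg_nonpos)
    then have "(1 - t) * D a = 0" "t' * D d = 0" using t(4) t'(4) by linarith+
    then have "t = 1" "t' = 0" using ab cd by auto
    then show False using t t' neq by simp
  qed
  then show ?thesis unfolding RAC_compatible_def by blast
qed

lemma affine_functional_segment_zero:
  assumes "affine_functional D" "D a = 0" "D b = 0" "z \<in> closed_segment a b"
  shows "D z = 0"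
  using affine_functional_segmentE[OF assms(1,4)] assms(2,3) by auto

lemma affine_functional_segment_pos:
  assumes "affine_functional D" "D a > 0" "D b > 0" "z \<in> closed_segment a b"
  shows "D z > 0"
proof -
  obtain t where t: "0 \<le> t" "t \<le> 1" "D z = (1 - t) * D a + t * D b"
    using affine_functional_segmentE[OF assms(1,4)] by metis
  show ?thesis
  proof (cases "t = 1")
    case False
    then show ?thesis unfolding t(3) using t assms(2,3) by (intro add_pos_nonneg) auto
  qed (use t assms(3) in simp)
qed

lemma affine_functional_segment_nonzero:
  assumes D: "affine_functional D" and cd: "D c > 0 \<and> D d > 0 \<or> D c < 0 \<and> D d < 0" and z: "z \<in> closed_segment c d"
  shows "D z \<noteq> 0"
proof -
  have minus: "affine_functional (\<lambda>z. - D z)"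
  proof -
    obtain \<alpha> \<beta> \<gamma> where "\<And>z. D z = \<alpha> * Re z + \<beta> * Im z + \<gamma>" using D unfolding affine_functional_def by blast
    then show ?thesis unfolding affine_functional_def
      by (intro exI[of _ "- \<alpha>"] exI[of _ "- \<beta>"] exI[of _ "- \<gamma>"]) simp
  qed
  from cd show ?thesis
  proof
    assume "D c > 0 \<and> D d > 0"
    then show ?thesis using affine_functional_segment_pos[OF D _ _ z] by auto
  next
    assume "D c < 0 \<and> D d < 0"
    then show ?thesis using affine_functional_segment_pos[OF minus _ _ z] by auto
  qed
qed

lemma RAC_compatible_one_side:
  assumes "affine_functional D" "D a = 0" "D b = 0" "D c > 0 \<and> D d > 0 \<or> D c < 0 \<and> D d < 0"
  shows "RAC_compatible a b c d"
  using affine_functional_segment_zero[OF assms(1-3)] affine_functional_segment_nonzero[OF assms(1,4)]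
  unfolding RAC_compatible_def by blast

locale bin_packing = packing_graph +
  fixes \<beta> :: "nat \<Rightarrow> nat"
  assumes wall_len_ge_2: "wall_len \<ge> 2" and n_pos: "n \<ge> 1" and bin_less: "\<And>i. i < m \<Longrightarrow> \<beta> i < n"
    and fits: "\<And>j. j < n \<Longrightarrow> (\<Sum>i | i < m \<and> \<beta> i = j. s i) \<le> B j"
begin

definition wall_pos :: "nat \<Rightarrow> nat" where
  "wall_pos j = (\<Sum>i<j. wall_len + B i)"

definition item_pos :: "nat \<Rightarrow> nat" where
  "item_pos i = wall_pos (\<beta> i) + wall_len + (\<Sum>i' | i' < i \<and> \<beta> i' = \<beta> i. s i')"

definition layer_pos :: "nat \<Rightarrow> nat \<Rightarrow> nat" where
  "layer_pos b k = (if b < m then item_pos b + k else wall_pos (b - m) + k)"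

definition path_pos :: "nat \<Rightarrow> nat \<Rightarrow> nat" where
  "path_pos j k = wall_pos j + (wall_len - 1) + k"

definition total_len :: nat where
  "total_len = wall_pos n + wall_len"

lemma wall_pos_Suc: "wall_pos (Suc j) = wall_pos j + wall_len + B j"
  by (simp add: wall_pos_def)

lemma wall_pos_mono: "i \<le> j \<Longrightarrow> wall_pos i \<le> wall_pos j"
  unfolding wall_pos_def by (intro sum_mono2) auto

lemma wall_pos_less: "i < j \<Longrightarrow> wall_pos i + wall_len + B i \<le> wall_pos j"
  using wall_pos_mono[of "Suc i" j] by (simp add: wall_pos_Suc)

lemma block_cases:
  assumes "k < block_len b"
  obtains (item) "b < m" "k < s b" | (wall) j where "b = m + j" "j \<le> n" "k < wall_len"
proof (cases "b < m")
  case True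
  then show thesis using assms item by (simp add: block_len_def)
next
  case False
  then have "b = m + (b - m)" "b - m \<le> n" "k < wall_len" using assms by (auto simp: block_len_def split: if_splits)
  then show thesis using wall by blast
qed

lemma item_pos_bounds:
  assumes "i < m" "k < s i"
  shows "wall_pos (\<beta> i) + wall_len \<le> item_pos i + k" "item_pos i + k < wall_pos (\<beta> i) + wall_len + B (\<beta> i)"
proof -
  have "(\<Sum>i' | i' < i \<and> \<beta> i' = \<beta> i. s i') + s i = (\<Sum>i'\<in>insert i {i'. i' < i \<and> \<beta> i' = \<beta> i}. s i')"
    by simp
  also have "\<dots> \<le> (\<Sum>i' | i' < m \<and> \<beta> i' = \<beta> i. s i')"
    using assms by (intro sum_mono2) auto
  also have "\<dots> \<le> B (\<beta> i)" using fits bin_less assms by simp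
  finally show "item_pos i + k < wall_pos (\<beta> i) + wall_len + B (\<beta> i)" using assms by (simp add: item_pos_def)
qed (simp add: item_pos_def)

lemma item_pos_less:
  assumes "i < i'" "\<beta> i = \<beta> i'"
  shows "item_pos i + s i \<le> item_pos i'"
proof -
  have "(\<Sum>l | l < i \<and> \<beta> l = \<beta> i. s l) + s i = (\<Sum>l\<in>insert i {l. l < i \<and> \<beta> l = \<beta> i}. s l)"
    by simp
  also have "\<dots> \<le> (\<Sum>l | l < i' \<and> \<beta> l = \<beta> i'. s l)" using assms by (intro sum_mono2) auto
  finally show ?thesis using assms by (simp add: item_pos_def)
qed

lemma item_wall_pos_neq:
  assumes "i < m" "k < s i" "l < wall_len"
  shows "item_pos i + k \<noteq> wall_pos j + l"
  using item_pos_bounds[OF assms(1,2)] wall_pos_less[of "\<beta> i" j] wall_pos_less[of j "\<beta> i"] assms(3)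
  by (cases j "\<beta> i" rule: linorder_cases) auto

lemma item_pos_inject:
  assumes "i < m" "k < s i" "i' < m" "k' < s i'" "item_pos i + k = item_pos i' + k'"
  shows "i = i' \<and> k = k'"
proof -
  have "\<beta> i = \<beta> i'"
    using item_pos_bounds[OF assms(1,2)] item_pos_bounds[OF assms(3,4)] wall_pos_less[of "\<beta> i" "\<beta> i'"]
      wall_pos_less[of "\<beta> i'" "\<beta> i"] assms(5)
    by (cases "\<beta> i" "\<beta> i'" rule: linorder_cases) auto
  then show ?thesis
    using item_pos_less[of i i'] item_pos_less[of i' i] assms by (cases i i' rule: linorder_cases) auto
qed

lemma layer_pos_inject:
  assumes "k < block_len b" "k' < block_len b'" "layer_pos b k = layer_pos b' k'"
  shows "b = b' \<and> k = k'"
  using assms(1)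
proof (cases rule: block_cases)
  case item
  note b = item
  show ?thesis using assms(2)
  proof (cases rule: block_cases)
    case item
    then show ?thesis using item_pos_inject[of b k b' k'] assms(3) b by (simp add: layer_pos_def)
  next
    case (wall j)
    then show ?thesis using item_wall_pos_neq[OF b, of k' j] assms(3) b by (simp add: layer_pos_def)
  qed
next
  case (wall j)
  note b = wall
  show ?thesis using assms(2)
  proof (cases rule: block_cases)
    case item
    then show ?thesis using item_wall_pos_neq[OF item b(3), of j] assms(3) b by (simp add: layer_pos_def)
  next
    case (wall j')
    then have "wall_pos j + k = wall_pos j' + k'" using assms(3) b by (simp add: layer_pos_def)
    then show ?thesis
      using wall_pos_less[of j j'] wall_pos_less[of j' j] b wall by (cases j j' rule: linorder_cases) auto
  qed
qed

lemma layer_pos_less: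
  assumes "k < block_len b"
  shows "layer_pos b k < total_len"
  using assms
proof (cases rule: block_cases)
  case item
  then show ?thesis using item_pos_bounds[OF item] wall_pos_less[OF bin_less[OF item(1)]]
    by (simp add: layer_pos_def total_len_def)
next
  case (wall j)
  then show ?thesis using wall_pos_mono[of j n] by (simp add: layer_pos_def total_len_def)
qed

lemma layer_pos_Suc: "layer_pos b (k + 1) = layer_pos b k + 1"
  by (simp add: layer_pos_def)

lemma layer_pos_ends:
  "layer_pos m 0 = 0" "layer_pos (m + n) (wall_len - 1) = total_len - 1" "total_len \<ge> 4"
  using wall_pos_less[of 0 n] n_pos wall_len_ge_2 by (auto simp: layer_pos_def total_len_def wall_pos_def)

lemma layer_pos_path_pos: "layer_pos (m + j) (wall_len - 1) = path_pos j 0"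
  "layer_pos (m + j + 1) 0 = path_pos j (B j) + 1"
  using wall_len_ge_2 wall_pos_Suc[of j] by (auto simp: layer_pos_def path_pos_def)

lemma path_pos_less: "j < n \<Longrightarrow> k \<le> B j \<Longrightarrow> path_pos j k + 1 < total_len"
  using wall_pos_less[of j n] wall_len_ge_2 by (simp add: path_pos_def total_len_def)

lemma path_pos_inject:
  assumes "k \<le> B j" "k' \<le> B j'" "path_pos j k = path_pos j' k'" shows "j = j' \<and> k = k'"
  using assms wall_pos_less[of j j'] wall_pos_less[of j' j] wall_len_ge_2
  by (cases j j' rule: linorder_cases) (auto simp: path_pos_def)

definition level :: "vertex \<Rightarrow> nat" where
  "level x = (case x of (t, b, k, r) \<Rightarrow>
     if t = 2 then 2 * layer_pos b k else if t = 3 then 2 * layer_pos b k + 1 else 2 * path_pos b k + 1)"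

lemma level_simps: "level (Layer b k) = 2 * layer_pos b k" "level (Link b k r) = 2 * layer_pos b k + 1"
  "level (Path j k) = 2 * path_pos j k + 1"
  by (simp_all add: level_def vertex_defs)

definition path_edge :: "vertex \<Rightarrow> vertex \<Rightarrow> bool" where
  "path_edge x y \<longleftrightarrow> (\<exists>j<n. (\<exists>k<B j. x = Path j k \<and> y = Path j (k + 1)) \<or>
     (x = Layer (m + j) (wall_len - 1) \<and> y = Path j 0) \<or> (x = Path j (B j) \<and> y = Layer (m + j + 1) 0))"

definition path_levels :: "nat \<Rightarrow> nat \<Rightarrow> nat \<Rightarrow> bool" where
  "path_levels j a b \<longleftrightarrow> 2 * path_pos j 0 \<le> a \<and> a < b \<and> b \<le> 2 * path_pos j (B j) + 2 \<and>
     (b = a + 1 \<or> b = a + 2 \<and> odd a) \<and> (even a \<longrightarrow> a = 2 * path_pos j 0) \<and> (even b \<longrightarrow> b = 2 * path_pos j (B j) + 2)"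

lemma path_edgeE:
  assumes "path_edge x y"
  obtains (inner) j k where "j < n" "k < B j" "x = Path j k" "y = Path j (k + 1)"
    | (first) j where "j < n" "x = Layer (m + j) (wall_len - 1)" "y = Path j 0"
    | (last) j where "j < n" "x = Path j (B j)" "y = Layer (m + j + 1) 0"
  using assms unfolding path_edge_def by blast

lemma path_edge_levels:
  assumes "path_edge x y"
  obtains j where "j < n" "path_levels j (level x) (level y)"
proof -
  have shift: "path_pos j k = path_pos j 0 + k" for j k by (simp add: path_pos_def)
  show thesis using assms
  proof (cases rule: path_edgeE)
    case (inner j k)
    then have "path_levels j (level x) (level y)"
      using shift[of j k] shift[of j "k + 1"] shift[of j "B j"] by (simp add: level_simps path_levels_def)
    then show thesis using that inner(1) by blast
  next
    case (first j)
    then have "path_levels j (level x) (level y)"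
      using shift[of j "B j"] by (simp only: level_simps path_levels_def layer_pos_path_pos) simp
    then show thesis using that first(1) by blast
  next
    case (last j)
    then have "path_levels j (level x) (level y)"
      using shift[of j "B j"] by (simp only: level_simps path_levels_def layer_pos_path_pos) simp
    then show thesis using that last(1) by blast
  qed
qed

lemma path_levels_less:
  assumes "path_levels j a b" "path_levels j a' b'" "a < a'"
  shows "b \<le> a'"
proof (rule ccontr)
  assume "\<not> b \<le> a'"
  then have "a' = a + 1" "odd a" using assms unfolding path_levels_def by auto
  then have "even a'" by simp
  then show False using assms unfolding path_levels_def by auto
qed

lemma path_levels_unique:
  assumes "path_levels j a b" "path_levels j a b'"
  shows "b = b'"
proof (rule ccontr)
  assume "b \<noteq> b'"
  then consider (short_long) "b = a + 1" "b' = a + 2" "odd a" | (long_short) "b = a + 2" "b' = a + 1" "odd a"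
    using assms unfolding path_levels_def by auto
  then show False
  proof cases
    case short_long
    then have "even b" by simp
    then show False using assms short_long unfolding path_levels_def by auto
  next
    case long_short
    then have "even b'" by simp
    then show False using assms long_short unfolding path_levels_def by auto
  qed
qed

lemma path_edge_order:
  assumes "path_edge x y" "path_edge x' y'"
  shows "level y \<le> level x' \<or> level y' \<le> level x \<or> (level x = level x' \<and> level y = level y')"
proof -
  obtain j where j: "j < n" "path_levels j (level x) (level y)" using path_edge_levels[OF assms(1)] by metis
  obtain j' where j': "j' < n" "path_levels j' (level x') (level y')" using path_edge_levels[OF assms(2)] by metis
  show ?thesis
  proof (cases j j' rule: linorder_cases)
    case less
    then have "path_pos j (B j) + 1 \<le> path_pos j' 0"
      using wall_pos_less[of j j'] wall_len_ge_2 by (simp add: path_pos_def)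
    then show ?thesis using j j' unfolding path_levels_def by linarith
  next
    case greater
    then have "path_pos j' (B j') + 1 \<le> path_pos j 0"
      using wall_pos_less[of j' j] wall_len_ge_2 by (simp add: path_pos_def)
    then show ?thesis using j j' unfolding path_levels_def by linarith
  next
    case equal
    then show ?thesis
      using path_levels_less[of j "level x" "level y" "level x'" "level y'"]
        path_levels_less[of j "level x'" "level y'" "level x" "level y"]
        path_levels_unique[of j "level x" "level y" "level y'"] j j'
      by (cases "level x" "level x'" rule: linorder_cases) auto
  qed
qed

definition eps :: real where
  "eps = 1 / (2 * (real total_len + 1)\<^sup>2)"

definition slope :: "nat \<Rightarrow> real" where
  "slope l = (real l / 2 - 1) * eps"

text \<open>The abscissae \<open>path_x\<close> are chosen such that consecutive path points differ by a vector
  perpendicular to the spoke between them.\<close>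

definition path_x :: "nat \<Rightarrow> real" where
  "path_x c = 1 / 2 - eps / 2 * (\<Sum>i\<le>c. slope (2 * i))"

definition draw :: "vertex \<Rightarrow> complex" where
  "draw x = (case x of (t, b, k, r) \<Rightarrow>
     if t = 0 then 0 else if t = 1 then 2
     else if t = 2 then Complex 1 (slope (2 * layer_pos b k))
     else if t = 3 then
       (if b \<le> m + n then Complex (1 + (real r + 1) / 10) ((1 - (real r + 1) / 10) * slope (2 * layer_pos b k + 1))
        else Complex (- 1 - real r) 0)
     else Complex (path_x (path_pos b k)) (slope (2 * path_pos b k + 1) / 2))"

lemma draw_simps:
  "draw HubU = 0" "draw HubV = 2" "draw (Layer b k) = Complex 1 (slope (2 * layer_pos b k))"
  "b \<le> m + n \<Longrightarrow>
     draw (Link b k r) = Complex (1 + (real r + 1) / 10) ((1 - (real r + 1) / 10) * slope (2 * layer_pos b k + 1))"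
  "draw (Link (m + n + 1) k r) = Complex (- 1 - real r) 0"
  "draw (Path j k) = Complex (path_x (path_pos j k)) (slope (2 * path_pos j k + 1) / 2)"
  by (simp_all add: draw_def vertex_defs)

lemma draw_wrap: "draw (Link (Suc (m + n)) k r) = Complex (- 1 - real r) 0"
  using draw_simps(5) by simp

lemma eps: "eps > 0" "(real total_len + 1)\<^sup>2 * eps = 1 / 2" "eps \<le> 1 / 2"
proof -
  have ge_1: "(real total_len + 1)\<^sup>2 \<ge> 1" by simp
  then show "eps > 0" "(real total_len + 1)\<^sup>2 * eps = 1 / 2" by (auto simp: eps_def)
  show "eps \<le> 1 / 2" unfolding eps_def using ge_1 by (simp add: field_simps)
qed

lemma slope_less: "slope a < slope b \<longleftrightarrow> a < b"
  using eps(1) by (simp add: slope_def mult_less_cancel_right)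

lemma slope_inj: "slope a = slope b \<longleftrightarrow> a = b"
  using slope_less[of a b] slope_less[of b a] by (metis less_irrefl linorder_neqE_nat)

lemma slope_bound: "i \<le> total_len \<Longrightarrow> \<bar>slope (2 * i)\<bar> \<le> (real total_len + 1) * eps"
  using eps(1) unfolding slope_def abs_mult by (intro mult_mono) auto

lemma slope_half: "i \<le> total_len \<Longrightarrow> \<bar>slope (2 * i)\<bar> \<le> 1 / 2"
proof -
  assume "i \<le> total_len"
  then have "\<bar>slope (2 * i)\<bar> \<le> (real total_len + 1) * eps" by (rule slope_bound)
  also have "\<dots> \<le> (real total_len + 1)\<^sup>2 * eps"
    using eps(1) by (intro mult_right_mono) (auto simp: power2_eq_square)
  finally show ?thesis using eps(2) by simp
qed

lemma path_x_near_half: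
  assumes "c < total_len"
  shows "\<bar>path_x c - 1 / 2\<bar> \<le> eps / 4"
proof -
  have "\<bar>\<Sum>i\<le>c. slope (2 * i)\<bar> \<le> (\<Sum>i\<le>c. \<bar>slope (2 * i)\<bar>)" by (rule sum_abs)
  also have "\<dots> \<le> (\<Sum>i\<le>c. (real total_len + 1) * eps)" using assms by (intro sum_mono slope_bound) auto
  also have "\<dots> = real (c + 1) * ((real total_len + 1) * eps)" by simp
  also have "\<dots> \<le> (real total_len + 1) * ((real total_len + 1) * eps)" using assms eps(1)
    by (intro mult_right_mono) auto
  also have "\<dots> = 1 / 2" using eps(2) by (simp add: power2_eq_square mult.assoc)
  finally have "eps / 2 * \<bar>\<Sum>i\<le>c. slope (2 * i)\<bar> \<le> eps / 2 * (1 / 2)" using eps(1) by (intro mult_left_mono) auto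
  then show ?thesis using eps(1) by (simp add: path_x_def abs_mult)
qed

lemma path_x_range: "c < total_len \<Longrightarrow> 1 / 4 < path_x c \<and> path_x c < 3 / 4"
  using path_x_near_half[of c] eps by linarith

lemma path_x_side:
  assumes "c < total_len" "j \<le> total_len"
  shows "j \<le> c \<Longrightarrow> slope (2 * j) * path_x c < slope (2 * c + 1) / 2"
    "c < j \<Longrightarrow> slope (2 * c + 1) / 2 < slope (2 * j) * path_x c"
proof -
  have "\<bar>slope (2 * j) * (path_x c - 1 / 2)\<bar> \<le> 1 / 2 * (eps / 4)"
    unfolding abs_mult using slope_half[OF assms(2)] path_x_near_half[OF assms(1)] by (intro mult_mono) auto
  then have "slope (2 * j) * (path_x c - 1 / 2) \<le> eps / 8" "- (slope (2 * j) * (path_x c - 1 / 2)) \<le> eps / 8"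
    unfolding abs_le_iff by simp_all
  then have deviation: "slope (2 * j) * path_x c - slope (2 * j) / 2 \<le> eps / 8"
    "slope (2 * j) / 2 - slope (2 * j) * path_x c \<le> eps / 8"
    by (simp_all add: right_diff_distrib)
  have difference: "slope (2 * c + 1) - slope (2 * j) = (real c - real j + 1 / 2) * eps"
    by (simp add: slope_def field_simps)
  show "slope (2 * j) * path_x c < slope (2 * c + 1) / 2" if "j \<le> c"
  proof -
    have "1 / 2 * eps \<le> (real c - real j + 1 / 2) * eps" using that eps(1) by (intro mult_right_mono) auto
    then show ?thesis using deviation difference eps(1) by linarith
  qed
  show "slope (2 * c + 1) / 2 < slope (2 * j) * path_x c" if "c < j"
  proof -
    have "(real c - real j + 1 / 2) * eps \<le> (- 1 / 2) * eps" using that eps(1) by (intro mult_right_mono) auto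
    then show ?thesis using deviation difference eps(1) by linarith
  qed
qed

definition upper_vertex :: "vertex \<Rightarrow> bool" where
  "upper_vertex x \<longleftrightarrow> (\<exists>b k. k < block_len b \<and> x = Layer b k) \<or> (\<exists>j<n. \<exists>k\<le>B j. x = Path j k)"

definition lower_vertex :: "vertex \<Rightarrow> bool" where
  "lower_vertex x \<longleftrightarrow> (\<exists>b k. k < block_len b \<and> x = Layer b k) \<or>
     (\<exists>b k r. k + 1 < block_len b \<and> r < 9 \<and> x = Link b k r)"

lemma upper_lower_vertexI:
  "k < block_len b \<Longrightarrow> upper_vertex (Layer b k)" "j < n \<Longrightarrow> k \<le> B j \<Longrightarrow> upper_vertex (Path j k)"
  "k < block_len b \<Longrightarrow> lower_vertex (Layer b k)" "k + 1 < block_len b \<Longrightarrow> r < 9 \<Longrightarrow> lower_vertex (Link b k r)"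
  unfolding upper_vertex_def lower_vertex_def by blast+

lemma block_le: "k < block_len b \<Longrightarrow> b \<le> m + n"
  by (auto simp: block_len_def split: if_splits)

definition side_u :: "nat \<Rightarrow> complex \<Rightarrow> real" where
  "side_u j z = Im z - slope (2 * j) * Re z"

definition side_v :: "nat \<Rightarrow> complex \<Rightarrow> real" where
  "side_v l z = Im z - slope l * (2 - Re z)"

lemma affine_functional_side_u: "affine_functional (side_u j)"
  unfolding affine_functional_def side_u_def by (intro exI[of _ "- slope (2 * j)"] exI[of _ 1] exI[of _ 0]) simp

lemma affine_functional_side_v: "affine_functional (side_v l)"
  unfolding affine_functional_def side_v_def
  by (intro exI[of _ "slope l"] exI[of _ 1] exI[of _ "- 2 * slope l"]) (simp add: algebra_simps)

lemma side_u_sign: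
  assumes "upper_vertex x" "j \<le> total_len"
  shows "level x < 2 * j \<Longrightarrow> side_u j (draw x) < 0" "level x = 2 * j \<Longrightarrow> side_u j (draw x) = 0"
    "level x > 2 * j \<Longrightarrow> side_u j (draw x) > 0"
proof -
  have "(level x < 2 * j \<longrightarrow> side_u j (draw x) < 0) \<and> (level x = 2 * j \<longrightarrow> side_u j (draw x) = 0) \<and>
    (level x > 2 * j \<longrightarrow> side_u j (draw x) > 0)"
    using assms(1) unfolding upper_vertex_def
  proof (elim disjE exE conjE)
    fix b k assume "x = Layer b k"
    then show ?thesis using slope_less[of "2 * layer_pos b k" "2 * j"] slope_less[of "2 * j" "2 * layer_pos b k"]
      by (auto simp: side_u_def draw_simps level_simps)
  next
    fix i k assume i: "i < n" "k \<le> B i" "x = Path i k"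
    then have "path_pos i k < total_len" using path_pos_less by fastforce
    then show ?thesis using i path_x_side[of "path_pos i k" j] assms(2)
      by (cases "j \<le> path_pos i k") (auto simp: side_u_def draw_simps level_simps)
  qed
  then show "level x < 2 * j \<Longrightarrow> side_u j (draw x) < 0" "level x = 2 * j \<Longrightarrow> side_u j (draw x) = 0"
    "level x > 2 * j \<Longrightarrow> side_u j (draw x) > 0"
    by auto
qed

lemma side_v_sign:
  assumes "lower_vertex x"
  shows "level x < l \<Longrightarrow> side_v l (draw x) < 0" "level x = l \<Longrightarrow> side_v l (draw x) = 0"
    "level x > l \<Longrightarrow> side_v l (draw x) > 0"
proof -
  have "\<exists>c>0. side_v l (draw x) = c * (slope (level x) - slope l)"
    using assms unfolding lower_vertex_def
  proof (elim disjE exE conjE)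
    fix b k assume "x = Layer b k"
    then show ?thesis by (intro exI[of _ 1]) (simp add: side_v_def draw_simps level_simps)
  next
    fix b k r assume x: "k + 1 < block_len b" "r < 9" "x = Link b k r"
    then have "b \<le> m + n" using block_le by blast
    then show ?thesis using x
      by (intro exI[of _ "1 - (real r + 1) / 10"]) (auto simp: side_v_def draw_simps level_simps algebra_simps)
  qed
  then show "level x < l \<Longrightarrow> side_v l (draw x) < 0" "level x = l \<Longrightarrow> side_v l (draw x) = 0"
    "level x > l \<Longrightarrow> side_v l (draw x) > 0"
    using slope_less[of "level x" l] slope_less[of l "level x"] by (auto simp: mult_pos_neg)
qed

lemma level_inject: "upper_vertex x \<Longrightarrow> upper_vertex y \<Longrightarrow> level x = level y \<Longrightarrow> x = y"
  unfolding upper_vertex_def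
proof (elim disjE exE conjE)
  fix b k b' k' assume "k < block_len b" "x = Layer b k" "k' < block_len b'" "y = Layer b' k'" "level x = level y"
  then show ?thesis using layer_pos_inject[of k b k' b'] by (simp add: level_simps)
next
  fix j k j' k' assume "k \<le> B j" "x = Path j k" "k' \<le> B j'" "y = Path j' k'" "level x = level y"
  then show ?thesis using path_pos_inject[of k j k' j'] by (simp add: level_simps)
qed (simp add: level_simps; presburger)+

lemma level_bound: "upper_vertex x \<Longrightarrow> level x + 1 \<le> 2 * total_len"
  unfolding upper_vertex_def
proof (elim disjE exE conjE)
  fix b k assume "k < block_len b" "x = Layer b k"
  then show ?thesis using layer_pos_less[of k b] by (simp add: level_simps)
next
  fix j k assume "j < n" "k \<le> B j" "x = Path j k"
  then show ?thesis using path_pos_less[of j k] by (simp add: level_simps)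
qed

lemma block_len_wall: "j \<le> n \<Longrightarrow> block_len (m + j) = wall_len"
  by (simp add: block_len_def)

lemma path_edge_upper:
  assumes "path_edge x y" shows "upper_vertex x" "upper_vertex y" "level x < level y"
proof -
  have wall: "wall_len - 1 < block_len (m + j)" "0 < block_len (m + j + 1)" if "j < n" for j
    using block_len_wall[of j] block_len_wall[of "j + 1"] that wall_len_ge_2 by auto
  from assms show "upper_vertex x" "upper_vertex y"
    by (cases rule: path_edgeE; use wall in \<open>auto intro!: upper_lower_vertexI\<close>)+
  obtain j' where "path_levels j' (level x) (level y)" using path_edge_levels[OF assms] by metis
  then show "level x < level y" by (simp add: path_levels_def)
qed

lemma compatible_path_path_ordered:
  assumes path: "path_edge x y" "path_edge x' y'" and level: "level y \<le> level x'"
    and neq: "draw y \<noteq> draw x'" "y \<noteq> x'"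
  shows "RAC_compatible (draw x) (draw y) (draw x') (draw y')"
proof -
  note upper = path_edge_upper[OF path(1)] path_edge_upper[OF path(2)]
  define j where "j = (level y + 1) div 2"
  have "level y < level x'" using level neq(2) level_inject[OF upper(2,4)] by (cases "level y = level x'") auto
  then have j: "level y \<le> 2 * j" "2 * j \<le> level x'" unfolding j_def by presburger+
  then have total: "j \<le> total_len" using level_bound[OF upper(4)] by linarith
  have "side_u j (draw x) < 0" using j upper by (intro side_u_sign total) auto
  moreover have "side_u j (draw y) \<le> 0" using j side_u_sign[OF upper(2) total] by (cases "level y = 2 * j") auto
  moreover have "side_u j (draw x') \<ge> 0" using j side_u_sign[OF upper(4) total] by (cases "level x' = 2 * j") auto
  moreover have "side_u j (draw y') > 0" using j upper by (intro side_u_sign total) auto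
  ultimately show ?thesis using neq(1) by (intro RAC_compatible_separated[OF affine_functional_side_u]) auto
qed

lemma compatible_path_path:
  assumes path: "path_edge x y" "path_edge x' y'" and disjoint: "{x, y} \<inter> {x', y'} = {}"
    and neq: "draw y \<noteq> draw x'" "draw y' \<noteq> draw x"
  shows "RAC_compatible (draw x) (draw y) (draw x') (draw y')"
proof -
  have "level y \<le> level x' \<or> level y' \<le> level x"
    using path_edge_order[OF path] level_inject[OF path_edge_upper(1)[OF path(1)] path_edge_upper(1)[OF path(2)]]
      disjoint by auto
  then show ?thesis
    using compatible_path_path_ordered[OF path _ neq(1)] compatible_path_path_ordered[OF path(2,1) _ neq(2)]
      RAC_compatible_sym(3) disjoint by blast
qed

lemma affine_functional_Re: "affine_functional (\<lambda>z. Re z - c)"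
  unfolding affine_functional_def by (intro exI[of _ 1] exI[of _ 0] exI[of _ "- c"]) simp

lemma Re_draw_path:
  "j < n \<Longrightarrow> k \<le> B j \<Longrightarrow> 1 / 4 < Re (draw (Path j k)) \<and> Re (draw (Path j k)) < 3 / 4"
  using path_x_range[of "path_pos j k"] path_pos_less[of j k] by (simp add: draw_simps)

lemma path_edge_across_layerE:
  assumes path: "path_edge x z" and across: "level x < 2 * p" "2 * p < level z"
  obtains j i where "j < n" "i < B j" "x = Path j i" "z = Path j (i + 1)" "p = path_pos j i + 1"
proof -
  obtain j where "path_levels j (level x) (level z)" using path_edge_levels[OF path] by metis
  then have level: "level z = level x + 2" "odd (level x)" "odd (level z)"
    using across unfolding path_levels_def by auto
  from path show thesis
  proof (cases rule: path_edgeE)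
    case (inner j k)
    then have "p = path_pos j k + 1" using across by (simp add: level_simps path_pos_def)
    then show thesis using that inner by blast
  next
    case (first j)
    then have "even (level x)" by (simp add: level_simps)
    then show thesis using level(2) by simp
  next
    case (last j)
    then have "even (level z)" by (simp add: level_simps)
    then show thesis using level(3) by simp
  qed
qed

lemma path_perpendicular_spoke:
  assumes "layer_pos b k = path_pos j i + 1"
  shows "inner (draw HubU - draw (Layer b k)) (draw (Path j i) - draw (Path j (i + 1))) = 0"
proof -
  let ?c = "path_pos j i"
  have next_pos: "path_pos j (i + 1) = ?c + 1" by (simp add: path_pos_def)
  have "path_x (?c + 1) = path_x ?c - eps / 2 * slope (2 * (?c + 1))"
    by (simp add: path_x_def algebra_simps)
  moreover have "slope (2 * (?c + 1) + 1) = slope (2 * ?c + 1) + eps"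
    by (simp add: slope_def field_simps)
  ultimately show ?thesis
    unfolding draw_simps assms next_pos by (simp add: inner_complex_def field_simps)
qed

lemma compatible_spoke_path:
  assumes b: "k < block_len b" and path: "path_edge x z" and disjoint: "Layer b k \<notin> {x, z}"
  shows "RAC_compatible (draw HubU) (draw (Layer b k)) (draw x) (draw z)"
proof -
  let ?y = "Layer b k" and ?p = "layer_pos b k"
  note upper = path_edge_upper[OF path]
  have y: "upper_vertex ?y" using b by (auto simp: upper_vertex_def)
  have total: "?p \<le> total_len" using layer_pos_less[OF b] by simp
  note sign = side_u_sign[OF upper(1) total] side_u_sign[OF upper(2) total]
  have neq: "level x \<noteq> 2 * ?p" "level z \<noteq> 2 * ?p"
    using level_inject[OF y upper(1)] level_inject[OF y upper(2)] disjoint by (auto simp: level_simps)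
  have on_spoke: "side_u ?p (draw HubU) = 0" "side_u ?p (draw ?y) = 0" by (auto simp: side_u_def draw_simps)
  show ?thesis
  proof (cases "level x < 2 * ?p \<and> 2 * ?p < level z")
    case False
    then have "level x < 2 * ?p \<and> level z < 2 * ?p \<or> level x > 2 * ?p \<and> level z > 2 * ?p"
      using neq upper(3) by linarith
    then show ?thesis
      using sign by (intro RAC_compatible_one_side[OF affine_functional_side_u on_spoke]) auto
  next
    case True
    then obtain j i where i: "j < n" "i < B j" "x = Path j i" "z = Path j (i + 1)" "?p = path_pos j i + 1"
      using path_edge_across_layerE[OF path, of ?p] by blast
    have range: "1 / 4 < Re (draw x) \<and> Re (draw x) < 3 / 4" "1 / 4 < Re (draw z) \<and> Re (draw z) < 3 / 4"
      using Re_draw_path[OF i(1), of i] Re_draw_path[OF i(1), of "i + 1"] i by auto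
    have "draw x \<notin> closed_segment (draw HubU) (draw ?y)" "draw z \<notin> closed_segment (draw HubU) (draw ?y)"
      using affine_functional_segment_zero[OF affine_functional_side_u on_spoke] sign True by force+
    moreover have "draw HubU \<notin> closed_segment (draw x) (draw z)"
      using affine_functional_segment_nonzero[OF affine_functional_Re[of 0]] range by (force simp: draw_simps)
    moreover have "draw ?y \<notin> closed_segment (draw x) (draw z)"
      using affine_functional_segment_nonzero[OF affine_functional_Re[of 1]] range by (force simp: draw_simps)
    ultimately show ?thesis using path_perpendicular_spoke[OF i(5)] i(3,4) by (auto simp: RAC_compatible_def)
  qed
qed

definition link_edge :: "vertex \<Rightarrow> vertex \<Rightarrow> bool" where
  "link_edge x y \<longleftrightarrow> (\<exists>b k r. k + 1 < block_len b \<and> r < 9 \<and>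
     (x = Layer b k \<and> y = Link b k r \<or> x = Link b k r \<and> y = Layer b (k + 1)))"

lemma link_edge_lower:
  assumes "link_edge x y" shows "lower_vertex x" "lower_vertex y" "level y = level x + 1"
  using assms unfolding link_edge_def
    by (auto simp: level_simps layer_pos_Suc[simplified] intro!: upper_lower_vertexI)

lemma link_edge_level_inject:
  assumes "link_edge x y" "link_edge x' y'" "level x = level x'"
  shows "\<exists>b k. Layer b k \<in> {x, y} \<inter> {x', y'} \<or> Layer b (k + 1) \<in> {x, y} \<inter> {x', y'}"
proof -
  obtain b k r where b: "k + 1 < block_len b"
    "x = Layer b k \<and> y = Link b k r \<or> x = Link b k r \<and> y = Layer b (k + 1)"
    using assms(1) unfolding link_edge_def by blast
  obtain b' k' r' where b': "k' + 1 < block_len b'"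
    "x' = Layer b' k' \<and> y' = Link b' k' r' \<or> x' = Link b' k' r' \<and> y' = Layer b' (k' + 1)"
    using assms(2) unfolding link_edge_def by blast
  have "layer_pos b k = layer_pos b' k'" using assms(3) b(2) b'(2) by (auto simp: level_simps; presburger)
  then have "b = b' \<and> k = k'" using layer_pos_inject b(1) b'(1) by (metis add_lessD1)
  then show ?thesis using b(2) b'(2) assms(3) by (auto simp: level_simps)
qed

lemma compatible_link_link_ordered:
  assumes link: "link_edge x y" "link_edge x' y'" and level: "level x < level x'" and neq: "draw y \<noteq> draw x'"
  shows "RAC_compatible (draw x) (draw y) (draw x') (draw y')"
proof -
  note lower = link_edge_lower[OF link(1)] link_edge_lower[OF link(2)]
  have "side_v (level x') (draw x) < 0" using level lower by (intro side_v_sign) auto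
  moreover have "side_v (level x') (draw y) \<le> 0"
    using level lower side_v_sign[OF lower(2), of "level x'"] by (cases "level y = level x'") auto
  moreover have "side_v (level x') (draw x') \<ge> 0" using side_v_sign(2)[OF lower(4)] by simp
  moreover have "side_v (level x') (draw y') > 0" using lower by (intro side_v_sign) auto
  ultimately show ?thesis using neq by (intro RAC_compatible_separated[OF affine_functional_side_v]) auto
qed

lemma compatible_link_link:
  assumes link: "link_edge x y" "link_edge x' y'" and disjoint: "{x, y} \<inter> {x', y'} = {}"
    and neq: "draw y \<noteq> draw x'" "draw y' \<noteq> draw x"
  shows "RAC_compatible (draw x) (draw y) (draw x') (draw y')"
proof -
  have "level x \<noteq> level x'" using link_edge_level_inject[OF link] disjoint by blast
  then show ?thesis
    using compatible_link_link_ordered[OF link _ neq(1)] compatible_link_link_ordered[OF link(2,1) _ neq(2)]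
      RAC_compatible_sym(3) by (meson linorder_neqE_nat)
qed

lemma compatible_spoke_link:
  assumes b: "k < block_len b" and link: "link_edge x z" and disjoint: "Layer b k \<notin> {x, z}"
  shows "RAC_compatible (draw HubV) (draw (Layer b k)) (draw x) (draw z)"
proof -
  let ?l = "2 * layer_pos b k"
  note lower = link_edge_lower[OF link]
  have on_spoke: "side_v ?l (draw HubV) = 0" "side_v ?l (draw (Layer b k)) = 0"
    by (auto simp: side_v_def draw_simps)
  obtain b' k' r where link': "k' + 1 < block_len b'"
    "x = Layer b' k' \<and> z = Link b' k' r \<or> x = Link b' k' r \<and> z = Layer b' (k' + 1)"
    using link unfolding link_edge_def by blast
  from link'(2) have "level x \<noteq> ?l \<and> level z \<noteq> ?l"
  proof
    assume xz: "x = Layer b' k' \<and> z = Link b' k' r"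
    then have "layer_pos b' k' \<noteq> layer_pos b k" using layer_pos_inject[of k' b' k b] b link'(1) disjoint by auto
    then show ?thesis using xz by (auto simp: level_simps; presburger)
  next
    assume xz: "x = Link b' k' r \<and> z = Layer b' (k' + 1)"
    then have "layer_pos b' (k' + 1) \<noteq> layer_pos b k"
      using layer_pos_inject[of "k' + 1" b' k b] b link'(1) disjoint by auto
    then show ?thesis using xz by (auto simp: level_simps; presburger)
  qed
  then have "level x < ?l \<and> level z < ?l \<or> level x > ?l \<and> level z > ?l" using lower(3) by linarith
  then show ?thesis
    using side_v_sign[OF lower(1)] side_v_sign[OF lower(2)]
    by (intro RAC_compatible_one_side[OF affine_functional_side_v on_spoke]) auto
qed

lemma wrap_in_block: "0 < block_len m" "wall_len - 1 < block_len (m + n)"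
  using block_len_wall[of 0] block_len_wall[of n] wall_len_ge_2 by auto

lemma wrap_points:
  "draw (Layer m 0) = Complex 1 (- eps)"
  "draw (Layer (m + n) (wall_len - 1)) = Complex 1 (slope (2 * (total_len - 1)))"
  "slope (2 * (total_len - 1)) > 0"
  using layer_pos_ends slope_less[of 2 "2 * (total_len - 1)"] by (auto simp: draw_simps slope_def)

definition wrap_side :: "real \<Rightarrow> nat \<Rightarrow> complex \<Rightarrow> real" where
  "wrap_side h r z = Im z - h * ((Re z + 1 + real r) / (2 + real r))"

lemma affine_functional_wrap_side: "affine_functional (wrap_side h r)"
proof -
  have "wrap_side h r z = (- h / (2 + real r)) * Re z + 1 * Im z + (- h * (1 + real r) / (2 + real r))" for z
    by (simp add: wrap_side_def add_divide_distrib diff_divide_distrib algebra_simps)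
  then show ?thesis unfolding affine_functional_def by blast
qed

lemma compatible_wrap_wrap:
  assumes "r \<noteq> r'"
  shows "RAC_compatible (draw (Layer m 0)) (draw (Link (m + n + 1) 0 r))
    (draw (Layer (m + n) (wall_len - 1))) (draw (Link (m + n + 1) 0 r'))"
proof -
  have "affine_functional Im" unfolding affine_functional_def by (intro exI[of _ 0] exI[of _ 1]) simp
  then have "RAC_compatible (draw (Layer m 0)) (draw (Link (m + n + 1) 0 r))
      (draw (Link (m + n + 1) 0 r')) (draw (Layer (m + n) (wall_len - 1)))"
    unfolding wrap_points(1,2) draw_simps(5) using wrap_points(3) eps(1) assms
    by (intro RAC_compatible_separated[where D = Im]) auto
  then show ?thesis by (rule RAC_compatible_sym)
qed

lemma wrap_side_first:
  assumes "upper_vertex x" "x \<noteq> Layer m 0"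
  shows "wrap_side (- eps) r (draw x) > 0"
  using assms(1) unfolding upper_vertex_def
proof (elim disjE exE conjE)
  fix b k assume x: "k < block_len b" "x = Layer b k"
  then have "layer_pos b k \<noteq> 0" using layer_pos_inject[of k b 0 m] wrap_in_block(1) layer_pos_ends(1) assms(2) by auto
  then have "slope (2 * layer_pos b k) > slope 0" by (simp add: slope_less)
  moreover have "(1 + 1 + real r) / (2 + real r) = 1" by simp
  ultimately show ?thesis unfolding x draw_simps wrap_side_def complex.sel by (simp add: slope_def)
next
  fix j k assume x: "j < n" "k \<le> B j" "x = Path j k"
  have "slope (2 * path_pos j k + 1) \<ge> - eps / 2" using eps(1) by (simp add: slope_def field_simps)
  moreover have "eps * (1 / 2) \<le> eps * ((Re (draw x) + 1 + real r) / (2 + real r))"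
    using Re_draw_path[OF x(1,2)] x eps(1) by (intro mult_left_mono) (auto simp: field_simps)
  ultimately show ?thesis unfolding x draw_simps wrap_side_def using eps(1) by simp
qed

lemma wrap_side_last:
  assumes "upper_vertex x" "x \<noteq> Layer (m + n) (wall_len - 1)"
  shows "wrap_side (slope (2 * (total_len - 1))) r (draw x) < 0"
  using assms(1) unfolding upper_vertex_def
proof (elim disjE exE conjE)
  fix b k assume x: "k < block_len b" "x = Layer b k"
  then have "layer_pos b k \<noteq> total_len - 1"
    using layer_pos_inject[of k b "wall_len - 1" "m + n"] wrap_in_block(2) layer_pos_ends(2) assms(2) by auto
  then have "slope (2 * layer_pos b k) < slope (2 * (total_len - 1))" using layer_pos_less[OF x(1)]
    by (simp add: slope_less)
  moreover have "(1 + 1 + real r) / (2 + real r) = 1" by simp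
  ultimately show ?thesis unfolding x draw_simps wrap_side_def complex.sel by simp
next
  fix j k assume x: "j < n" "k \<le> B j" "x = Path j k"
  have "slope (2 * path_pos j k + 1) < slope (2 * (total_len - 1))" using path_pos_less[OF x(1,2)]
    by (simp add: slope_less)
  moreover have "slope (2 * (total_len - 1)) * (1 / 2) \<le> slope (2 * (total_len - 1)) * ((Re (draw x) + 1 + real r) / (2 + real r))"
    using Re_draw_path[OF x(1,2)] x wrap_points(3) by (intro mult_left_mono) (auto simp: field_simps)
  ultimately show ?thesis unfolding x draw_simps wrap_side_def by simp
qed

lemma compatible_wrap:
  assumes "draw l = Complex 1 h"
    and "wrap_side h r (draw x) > 0 \<and> wrap_side h r (draw y) > 0 \<or>
      wrap_side h r (draw x) < 0 \<and> wrap_side h r (draw y) < 0"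
  shows "RAC_compatible (draw l) (draw (Link (m + n + 1) 0 r)) (draw x) (draw y)"
  using assms(2) unfolding assms(1) draw_simps(5)
  by (intro RAC_compatible_one_side[OF affine_functional_wrap_side]) (auto simp: wrap_side_def)

definition spoke :: "vertex \<Rightarrow> vertex \<Rightarrow> vertex \<Rightarrow> bool" where
  "spoke h x y \<longleftrightarrow> x = h \<and> (\<exists>b k. k < block_len b \<and> y = Layer b k)"

definition wrap_edge :: "vertex \<Rightarrow> vertex \<Rightarrow> vertex \<Rightarrow> bool" where
  "wrap_edge l x y \<longleftrightarrow> x = l \<and> (\<exists>r<9. y = Link (m + n + 1) 0 r)"

definition upper_edge :: "vertex \<Rightarrow> vertex \<Rightarrow> bool" where
  "upper_edge x y \<longleftrightarrow> spoke HubU x y \<or> path_edge x y \<or> wrap_edge (Layer m 0) x y \<or>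
     wrap_edge (Layer (m + n) (wall_len - 1)) x y"

definition lower_edge :: "vertex \<Rightarrow> vertex \<Rightarrow> bool" where
  "lower_edge x y \<longleftrightarrow> spoke HubV x y \<or> link_edge x y"

lemma packing_adj_cases:
  assumes "packing_adj x y"
  shows "upper_edge x y \<or> upper_edge y x \<or> lower_edge x y \<or> lower_edge y x"
  using assms unfolding packing_adj_def
proof (elim disjE)
  assume "\<exists>b k r. k + 1 < block_len b \<and> r < 9 \<and> (x = Layer b k \<or> x = Layer b (k + 1)) \<and> y = Link b k r"
  then have "link_edge x y \<or> link_edge y x" unfolding link_edge_def by blast
  then show ?thesis by (auto simp: lower_edge_def)
next
  assume "\<exists>r<9. (x = Layer m 0 \<or> x = Layer (m + n) (wall_len - 1)) \<and> y = Link (m + n + 1) 0 r"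
  then show ?thesis unfolding upper_edge_def wrap_edge_def by blast
next
  assume "\<exists>b k. k < block_len b \<and> x = Layer b k \<and> (y = HubU \<or> y = HubV)"
  then show ?thesis unfolding upper_edge_def lower_edge_def spoke_def by blast
next
  assume "\<exists>j<n. \<exists>k<B j. x = Path j k \<and> y = Path j (k + 1)"
  then show ?thesis unfolding upper_edge_def path_edge_def by blast
next
  assume "\<exists>j<n. x = Layer (m + j) (wall_len - 1) \<and> y = Path j 0"
  then show ?thesis unfolding upper_edge_def path_edge_def by blast
next
  assume "\<exists>j<n. x = Layer (m + j + 1) 0 \<and> y = Path j (B j)"
  then show ?thesis unfolding upper_edge_def path_edge_def by blast
qed

lemma upper_edge_Re:
  assumes "upper_edge x y"
  shows "Re (draw x) < 1 \<and> Re (draw y) \<le> 1 \<or> Re (draw y) < 1 \<and> Re (draw x) \<le> 1"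
  using assms unfolding upper_edge_def
proof (elim disjE)
  assume "path_edge x y"
  moreover have "Re (draw (Path j k)) < 1" if "j < n" "k \<le> B j" for j k using Re_draw_path[OF that] by simp
  ultimately show ?thesis by (auto elim!: path_edgeE simp: draw_simps(3) less_imp_le)
qed (auto simp: spoke_def wrap_edge_def draw_simps draw_wrap)

lemma lower_edge_Re:
  assumes "lower_edge x y"
  shows "Re (draw x) > 1 \<and> Re (draw y) \<ge> 1 \<or> Re (draw y) > 1 \<and> Re (draw x) \<ge> 1"
  using assms block_le unfolding lower_edge_def by (auto simp: spoke_def link_edge_def draw_simps)

lemma compatible_upper_lower:
  assumes e: "upper_edge a b" "lower_edge c d" and neq: "{draw a, draw b} \<inter> {draw c, draw d} = {}"
  shows "RAC_compatible (draw a) (draw b) (draw c) (draw d)"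
proof -
  have separated: "RAC_compatible a b c d" if "Re a < 1" "Re b \<le> 1" "Re d > 1" "Re c \<ge> 1" "b \<noteq> c" for a b d c
    using that by (intro RAC_compatible_separated[OF affine_functional_Re[of 1]]) auto
  show ?thesis
    using upper_edge_Re[OF e(1)] lower_edge_Re[OF e(2)] neq separated[of "draw a" "draw b" "draw d" "draw c"]
      RAC_compatible_sym(2)[OF separated[of "draw a" "draw b" "draw c" "draw d"]]
      RAC_compatible_sym(1)[OF separated[of "draw b" "draw a" "draw d" "draw c"]]
      RAC_compatible_sym(1)[OF RAC_compatible_sym(2)[OF separated[of "draw b" "draw a" "draw c" "draw d"]]] by blast
qed

lemma compatible_lower_lower:
  assumes e: "lower_edge a b" "lower_edge c d" and disjoint: "{a, b} \<inter> {c, d} = {}"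
    and neq: "{draw a, draw b} \<inter> {draw c, draw d} = {}"
  shows "RAC_compatible (draw a) (draw b) (draw c) (draw d)"
proof -
  have spoke_link: "RAC_compatible (draw x) (draw y) (draw z) (draw w)"
    if "spoke HubV x y" "link_edge z w" "{x, y} \<inter> {z, w} = {}" for x y z w
    using that compatible_spoke_link[of _ _ z w] by (auto simp: spoke_def)
  show ?thesis
    using e unfolding lower_edge_def
  proof (elim disjE)
    assume "spoke HubV a b" "spoke HubV c d"
    then show ?thesis using disjoint by (auto simp: spoke_def)
  next
    assume "spoke HubV a b" "link_edge c d"
    then show ?thesis using spoke_link disjoint by blast
  next
    assume "link_edge a b" "spoke HubV c d"
    then show ?thesis using spoke_link[of c d a b] disjoint RAC_compatible_sym(3) by blast
  next
    assume links: "link_edge a b" "link_edge c d"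
    have "draw b \<noteq> draw c" "draw d \<noteq> draw a" using neq by auto
    then show ?thesis by (rule compatible_link_link[OF links disjoint])
  qed
qed

lemma compatible_wrap_edge:
  assumes wrap: "wrap_edge l x y" "l = Layer m 0 \<or> l = Layer (m + n) (wall_len - 1)"
    and e: "spoke HubU z w \<or> path_edge z w" and disjoint: "{x, y} \<inter> {z, w} = {}"
  shows "RAC_compatible (draw x) (draw y) (draw z) (draw w)"
proof -
  obtain r where y: "x = l" "y = Link (m + n + 1) 0 r" using wrap(1) by (auto simp: wrap_edge_def)
  have zw: "z = HubU \<or> upper_vertex z" "upper_vertex w"
    using e path_edge_upper[of z w] upper_lower_vertexI(1) unfolding spoke_def by blast+
  have hub: "wrap_side (- eps) r (draw HubU) > 0" "wrap_side (slope (2 * (total_len - 1))) r (draw HubU) < 0"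
    using eps(1) wrap_points(3) by (auto simp: wrap_side_def draw_simps)
  from wrap(2) show ?thesis
  proof
    assume l: "l = Layer m 0"
    then have "wrap_side (- eps) r (draw z) > 0" "wrap_side (- eps) r (draw w) > 0"
      using zw disjoint y hub(1) wrap_side_first[of z r] wrap_side_first[of w r] l by auto
    then show ?thesis using compatible_wrap[OF wrap_points(1)] unfolding y l by blast
  next
    assume l: "l = Layer (m + n) (wall_len - 1)"
    then have "wrap_side (slope (2 * (total_len - 1))) r (draw z) < 0"
      "wrap_side (slope (2 * (total_len - 1))) r (draw w) < 0"
      using zw disjoint y hub(2) wrap_side_last[of z r] wrap_side_last[of w r] l by auto
    then show ?thesis using compatible_wrap[OF wrap_points(2)] unfolding y l by blast
  qed
qed

lemma compatible_wrap_edges: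
  assumes wrap: "wrap_edge (Layer m 0) x y" "wrap_edge (Layer (m + n) (wall_len - 1)) z w"
    and disjoint: "{x, y} \<inter> {z, w} = {}"
  shows "RAC_compatible (draw x) (draw y) (draw z) (draw w)"
proof -
  obtain r r' where xy: "x = Layer m 0" "y = Link (m + n + 1) 0 r"
    and zw: "z = Layer (m + n) (wall_len - 1)" "w = Link (m + n + 1) 0 r'"
    using wrap unfolding wrap_edge_def by blast
  then have "r \<noteq> r'" using disjoint by auto
  then show ?thesis unfolding xy zw by (rule compatible_wrap_wrap)
qed

lemma compatible_upper_upper:
  assumes e: "upper_edge a b" "upper_edge c d" and disjoint: "{a, b} \<inter> {c, d} = {}"
    and neq: "{draw a, draw b} \<inter> {draw c, draw d} = {}"
  shows "RAC_compatible (draw a) (draw b) (draw c) (draw d)"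
proof -
  let ?first = "Layer m 0" and ?last = "Layer (m + n) (wall_len - 1)"
  have spoke_path: "RAC_compatible (draw x) (draw y) (draw z) (draw w)"
    if "spoke HubU x y" "path_edge z w" "{x, y} \<inter> {z, w} = {}" for x y z w
    using that compatible_spoke_path[of _ _ z w] by (auto simp: spoke_def)
  have adjacent: False if "wrap_edge l x y \<and> wrap_edge l z w \<or> spoke h x y \<and> spoke h z w" "{x, y} \<inter> {z, w} = {}"
    for l h x y z w
    using that by (auto simp: wrap_edge_def spoke_def)
  have disjoint': "{c, d} \<inter> {a, b} = {}" using disjoint by blast
  have path_path: "RAC_compatible (draw a) (draw b) (draw c) (draw d)" if "path_edge a b" "path_edge c d"
    using compatible_path_path[OF that disjoint] neq by auto
  consider (spoke) "spoke HubU a b" | (path) "path_edge a b" | (first) "wrap_edge ?first a b" | (last) "wrap_edge ?last a b"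
    using e(1) unfolding upper_edge_def by blast
  then show ?thesis
  proof cases
    case spoke
    then show ?thesis
      using e(2) adjacent[OF _ disjoint] spoke_path[OF _ _ disjoint] compatible_wrap_edge[OF _ _ _ disjoint'] RAC_compatible_sym(3)
      unfolding upper_edge_def by blast
  next
    case path
    then show ?thesis
      using path_path e(2) spoke_path[OF _ _ disjoint'] compatible_wrap_edge[OF _ _ _ disjoint'] RAC_compatible_sym(3)
      unfolding upper_edge_def by blast
  next
    case first
    then show ?thesis
      using e(2) compatible_wrap_edge[OF _ _ _ disjoint] compatible_wrap_edges[OF _ _ disjoint] adjacent[OF _ disjoint]
      unfolding upper_edge_def by blast
  next
    case last
    then show ?thesis
      using e(2) compatible_wrap_edge[OF _ _ _ disjoint] compatible_wrap_edges[OF _ _ disjoint'] adjacent[OF _ disjoint] RAC_compatible_sym(3)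
      unfolding upper_edge_def by blast
  qed
qed

definition packing_vertex :: "vertex \<Rightarrow> bool" where
  "packing_vertex x \<longleftrightarrow> x = HubU \<or> x = HubV \<or> (\<exists>b k. k < block_len b \<and> x = Layer b k) \<or>
     (\<exists>b k r. k + 1 < block_len b \<and> r < 9 \<and> x = Link b k r) \<or>
     (\<exists>r<9. x = Link (m + n + 1) 0 r) \<or> (\<exists>j<n. \<exists>k\<le>B j. x = Path j k)"

lemma packing_vertexI:
  "packing_vertex HubU" "packing_vertex HubV" "k < block_len b \<Longrightarrow> packing_vertex (Layer b k)"
  "k + 1 < block_len b \<Longrightarrow> r < 9 \<Longrightarrow> packing_vertex (Link b k r)"
  "r < 9 \<Longrightarrow> packing_vertex (Link (m + n + 1) 0 r)" "j < n \<Longrightarrow> k \<le> B j \<Longrightarrow> packing_vertex (Path j k)"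
  unfolding packing_vertex_def by blast+

lemma packing_adj_vertices:
  assumes "packing_adj x y"
  shows "packing_vertex x \<and> packing_vertex y"
proof -
  have wall: "wall_len - 1 < block_len (m + n)" "0 < block_len m"
    "\<And>j. j < n \<Longrightarrow> wall_len - 1 < block_len (m + j)" "\<And>j. j < n \<Longrightarrow> 0 < block_len (m + j + 1)"
    using block_len_wall[of n] block_len_wall[of 0] block_len_wall block_len_wall[of "_ + 1"] wall_len_ge_2
    by (auto simp: add.assoc)
  show ?thesis
    using assms unfolding packing_adj_def
  proof (elim disjE exE conjE)
    fix b k r assume "k + 1 < block_len b" "r < 9" "x = Layer b k" "y = Link b k r"
    then show ?thesis using packing_vertexI(3)[of k b] packing_vertexI(4)[of k b r] by simp
  qed (use wall packing_vertexI(1,2) in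
    \<open>auto intro!: packing_vertexI(3,4) packing_vertexI(5)[simplified] packing_vertexI(6) simp: less_imp_le Suc_leI\<close>)
qed

lemma packing_vertex_cases:
  assumes "x \<in> \<Union> packing_edges"
  obtains (hubU) "x = HubU" "Re (draw x) = 0" | (hubV) "x = HubV" "Re (draw x) = 2" |
    (layer) b k where "k < block_len b" "x = Layer b k" "Re (draw x) = 1" |
    (link) b k r where "k + 1 < block_len b" "r < 9" "x = Link b k r" "1 < Re (draw x)" "Re (draw x) < 2" |
    (wrap) r where "r < 9" "x = Link (m + n + 1) 0 r" "Re (draw x) \<le> - 1" |
    (path) j k where "j < n" "k \<le> B j" "x = Path j k" "1 / 4 < Re (draw x)" "Re (draw x) < 3 / 4"
proof -
  obtain y where "packing_adj x y \<or> packing_adj y x" using assms unfolding packing_edges_def by auto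
  then have "packing_vertex x" using packing_adj_vertices by blast
  then show thesis
    unfolding packing_vertex_def
  proof (elim disjE exE conjE)
    assume "x = HubU" then show thesis using hubU by (simp add: draw_simps)
  next
    assume "x = HubV" then show thesis using hubV by (simp add: draw_simps)
  next
    fix b k assume "k < block_len b" "x = Layer b k" then show thesis using layer by (simp add: draw_simps)
  next
    fix b k r assume x: "k + 1 < block_len b" "r < 9" "x = Link b k r"
    then show thesis using link[OF x] block_le[OF x(1)] by (simp add: draw_simps)
  next
    fix r :: nat assume "r < 9" "x = Link (m + n + 1) 0 r" then show thesis using wrap by (simp add: draw_wrap)
  next
    fix j k assume "j < n" "k \<le> B j" "x = Path j k" then show thesis using path Re_draw_path by blast
  qed
qed

lemma draw_Link_inject:
  assumes "k + 1 < block_len b" "r < 9" "k' + 1 < block_len b'" "draw (Link b k r) = draw (Link b' k' r')"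
  shows "Link b k r = Link b' k' r'"
proof -
  note draw = draw_simps(4)[OF block_le[OF assms(1)], of k r] draw_simps(4)[OF block_le[OF assms(3)], of k' r']
  have r: "r = r'" using arg_cong[OF assms(4), of Re] unfolding draw by simp
  then have "(1 - (real r + 1) / 10) * slope (2 * layer_pos b k + 1) =
      (1 - (real r + 1) / 10) * slope (2 * layer_pos b' k' + 1)"
    using arg_cong[OF assms(4), of Im] unfolding draw by simp
  moreover have "1 - (real r + 1) / 10 \<noteq> 0" using assms(2) by simp
  ultimately have "layer_pos b k = layer_pos b' k'" by (simp add: slope_inj)
  then show ?thesis using layer_pos_inject[of k b k' b'] assms(1,3) r by auto
qed

lemma draw_eq_Layer:
  assumes b: "k < block_len b" and y: "y \<in> \<Union> packing_edges" and draw: "draw (Layer b k) = draw y"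
  shows "Layer b k = y"
proof -
  have Re: "Re (draw y) = 1" using draw[symmetric] by (simp add: draw_simps)
  show ?thesis using y
  proof (cases rule: packing_vertex_cases)
    case (layer b' k')
    then have "layer_pos b k = layer_pos b' k'" using draw by (simp add: draw_simps slope_inj)
    then show ?thesis using layer_pos_inject[OF b layer(1)] layer(2) by simp
  qed (use Re in auto)
qed

lemma draw_eq_Path:
  assumes j: "j < n" "k \<le> B j" and y: "y \<in> \<Union> packing_edges" and draw: "draw (Path j k) = draw y"
  shows "Path j k = y"
proof -
  have Re: "1 / 4 < Re (draw y)" "Re (draw y) < 3 / 4" using Re_draw_path[OF j] unfolding draw by simp_all
  show ?thesis using y
  proof (cases rule: packing_vertex_cases)
    case (path j' k')
    then have "path_pos j k = path_pos j' k'" using draw by (simp add: draw_simps slope_inj)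
    then show ?thesis using path_pos_inject[OF j(2) path(2)] path(3) by simp
  qed (use Re in auto)
qed

lemma draw_inject:
  assumes x: "x \<in> \<Union> packing_edges" and y: "y \<in> \<Union> packing_edges" and draw: "draw x = draw y"
  shows "x = y"
proof -
  have Re: "Re (draw x) = Re (draw y)" using draw by simp
  show ?thesis using x
  proof (cases rule: packing_vertex_cases)
    case hubU
    with Re have "Re (draw y) = 0" by simp
    with y show ?thesis by (cases rule: packing_vertex_cases) (use hubU in auto)
  next
    case hubV
    with Re have "Re (draw y) = 2" by simp
    with y show ?thesis by (cases rule: packing_vertex_cases) (use hubV in auto)
  next
    case (layer b k)
    then show ?thesis using draw_eq_Layer[of k b y] y draw by simp
  next
    case x: (link b k r)
    show ?thesis using y
    proof (cases rule: packing_vertex_cases)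
      case (link b' k' r')
      then show ?thesis using draw_Link_inject[OF x(1,2) link(1)] x(3) draw by blast
    qed (use Re x in auto)
  next
    case x: (wrap r)
    show ?thesis using y
    proof (cases rule: packing_vertex_cases)
      case (wrap r')
      then show ?thesis using Re x by (simp add: draw_wrap)
    qed (use Re x in auto)
  next
    case (path j k)
    then show ?thesis using draw_eq_Path[of j k y] y draw by simp
  qed
qed

lemma packing_edges_compatible:
  assumes e: "{a, b} \<in> packing_edges" "{c, d} \<in> packing_edges" and disjoint: "{a, b} \<inter> {c, d} = {}"
  shows "RAC_compatible (draw a) (draw b) (draw c) (draw d)"
proof -
  have V: "a \<in> \<Union> packing_edges" "b \<in> \<Union> packing_edges" "c \<in> \<Union> packing_edges" "d \<in> \<Union> packing_edges"
    using e by blast+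
  have oriented: "RAC_compatible (draw a) (draw b) (draw c) (draw d)"
    if kind: "upper_edge a b \<or> lower_edge a b" "upper_edge c d \<or> lower_edge c d"
    and disjoint: "{a, b} \<inter> {c, d} = {}"
     and V: "a \<in> \<Union> packing_edges" "b \<in> \<Union> packing_edges" "c \<in> \<Union> packing_edges" "d \<in> \<Union> packing_edges" for a b c d
  proof -
    have neq: "{draw a, draw b} \<inter> {draw c, draw d} = {}"
      using draw_inject[OF V(1,3)] draw_inject[OF V(1,4)] draw_inject[OF V(2,3)] draw_inject[OF V(2,4)] disjoint
        by auto
    then have neq': "{draw c, draw d} \<inter> {draw a, draw b} = {}" by blast
    show ?thesis
      using kind compatible_upper_upper[OF _ _ disjoint neq] compatible_lower_lower[OF _ _ disjoint neq]
        compatible_upper_lower[OF _ _ neq] RAC_compatible_sym(3)[OF compatible_upper_lower[OF _ _ neq']] by blast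
  qed
  have swap: "RAC_compatible (draw a) (draw b) p q"
    if "{x, y} = {a, b}" "RAC_compatible (draw x) (draw y) p q" for x y a b p q
    using that RAC_compatible_sym(1) by (auto simp: doubleton_eq_iff)
  have orient: "\<exists>x y. {x, y} = {a, b} \<and> (upper_edge x y \<or> lower_edge x y)" if "{a, b} \<in> packing_edges" for a b
  proof -
    have "packing_adj a b \<or> packing_adj b a" using that by (simp add: packing_edges_iff)
    then consider "upper_edge a b \<or> lower_edge a b" | "upper_edge b a \<or> lower_edge b a"
      using packing_adj_cases by blast
    then show ?thesis by cases (blast, use insert_commute[of a b "{}"] in blast)
  qed
  obtain x y where xy: "{x, y} = {a, b}" "upper_edge x y \<or> lower_edge x y" using orient[OF e(1)] by blast
  obtain z w where zw: "{z, w} = {c, d}" "upper_edge z w \<or> lower_edge z w" using orient[OF e(2)] by blast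
  have "x \<in> {a, b}" "y \<in> {a, b}" "z \<in> {c, d}" "w \<in> {c, d}" using xy(1) zw(1) by blast+
  then have "RAC_compatible (draw x) (draw y) (draw z) (draw w)"
    using V by (intro oriented[OF xy(2) zw(2) disjoint[folded xy(1) zw(1)]]) auto
  then have "RAC_compatible (draw z) (draw w) (draw a) (draw b)"
    using swap[OF xy(1)] RAC_compatible_sym(3) by blast
  then show ?thesis using swap[OF zw(1)] RAC_compatible_sym(3) by blast
qed

lemma not_packing_adj_layers: "\<not> packing_adj (Layer b k) (Layer b' k')"
  by (auto simp: packing_adj_def vertex_defs)

lemma path_vertex_neighbours:
  assumes "j < n" "k \<le> B j"
  obtains d d' where "packing_adj d (Path j k)" "packing_adj (Path j k) d' \<or> packing_adj d' (Path j k)"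
    "d \<noteq> d'" "\<not> packing_adj d d'" "\<not> packing_adj d' d"
proof -
  define d where "d = (if k = 0 then Layer (m + j) (wall_len - 1) else Path j (k - 1))"
  define d' where "d' = (if k = B j then Layer (m + j + 1) 0 else Path j (k + 1))"
  show thesis
  proof (rule that[of d d'])
    show "packing_adj d (Path j k)"
      using packing_adjI(8)[OF assms(1)] packing_adjI(7)[OF assms(1), of "k - 1"] assms(2)
      by (cases "k = 0") (auto simp: d_def)
    show "packing_adj (Path j k) d' \<or> packing_adj d' (Path j k)"
      using packing_adjI(9)[OF assms(1)] packing_adjI(7)[OF assms(1), of k] assms(2)
      by (cases "k = B j") (auto simp: d'_def)
    show "d \<noteq> d'" using wall_len_ge_2 by (auto simp: d_def d'_def vertex_defs)
    show "\<not> packing_adj d d'" "\<not> packing_adj d' d"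
      using wall_len_ge_2 assms(2) by (auto simp: d_def d'_def packing_adj_def vertex_defs)
  qed
qed

lemma packing_vertex_neighbours:
  assumes "c \<in> \<Union> packing_edges"
  shows "\<exists>d d'. {c, d} \<in> packing_edges \<and> {c, d'} \<in> packing_edges \<and> d \<noteq> d' \<and> d \<noteq> c \<and> d' \<noteq> c \<and>
    {d, d'} \<notin> packing_edges"
proof -
  have witness: ?thesis if "packing_adj c d \<or> packing_adj d c" "packing_adj c d' \<or> packing_adj d' c" "d \<noteq> d'"
    "\<not> packing_adj d d'" "\<not> packing_adj d' d" for d d'
    using that packing_adj_neq unfolding packing_edges_iff by blast
  have "1 < block_len m" "0 < block_len m" using block_len_wall[of 0] wall_len_ge_2 by auto
  then have hub: ?thesis if "c = HubU \<or> c = HubV"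
    using that packing_adjI(1,2) not_packing_adj_layers
    by (intro witness[of "Layer m 0" "Layer m 1"]) (auto simp: Layer_def)
  show ?thesis using assms
  proof (cases rule: packing_vertex_cases)
    case (layer b k)
    show ?thesis
    proof (rule witness[of HubU HubV])
      show "packing_adj c HubU \<or> packing_adj HubU c" "packing_adj c HubV \<or> packing_adj HubV c"
        using layer packing_adjI by blast+
    qed (auto simp: packing_adj_def vertex_defs)
  next
    case (link b k r)
    show ?thesis
    proof (rule witness[of "Layer b k" "Layer b (k + 1)"])
      show "packing_adj c (Layer b k) \<or> packing_adj (Layer b k) c"
        "packing_adj c (Layer b (k + 1)) \<or> packing_adj (Layer b (k + 1)) c"
        using link packing_adjI by blast+
    qed (use not_packing_adj_layers in \<open>auto simp: vertex_defs\<close>)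
  next
    case (wrap r)
    show ?thesis
    proof (rule witness[of "Layer m 0" "Layer (m + n) (wall_len - 1)"])
      show "packing_adj c (Layer m 0) \<or> packing_adj (Layer m 0) c"
        "packing_adj c (Layer (m + n) (wall_len - 1)) \<or> packing_adj (Layer (m + n) (wall_len - 1)) c"
        using wrap packing_adjI by blast+
    qed (use not_packing_adj_layers n_pos in \<open>auto simp: vertex_defs\<close>)
  next
    case (path j k)
    then show ?thesis using path_vertex_neighbours[of j k] witness by metis
  qed (use hub in blast)+
qed

theorem complex_RAC_drawing_draw: "complex_RAC_drawing (\<Union> packing_edges) packing_edges draw"
proof (rule complex_RAC_drawing_if_compatible)
  show "inj_on draw (\<Union> packing_edges)" using draw_inject by (rule inj_onI)
qed (rule packing_edges_compatible packing_vertex_neighbours; assumption)+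

end

section \<open>Packings and RAC drawings\<close>

locale packing_drawing =
  packing_graph n m wall_len B s +
  hub_drawing "\<Union> (packing_graph.packing_edges n m wall_len B s)" "packing_graph.packing_edges n m wall_len B s"
    g HubU HubV
  for n m wall_len :: nat and B s :: "nat \<Rightarrow> nat" and g :: "vertex \<Rightarrow> complex" +
  assumes n_pos: "n \<ge> 1" and wall_len_ge: "wall_len \<ge> 3 * ((\<Sum>j<n. B j + 4) + 6)"
begin

lemma layer_iff: "layer x \<longleftrightarrow> (\<exists>b k. k < block_len b \<and> x = Layer b k)"
  unfolding layer_def packing_edges_iff by (auto simp: packing_adj_def vertex_defs)

lemma linked_if_common_links:
  assumes "\<And>r. r < 9 \<Longrightarrow> packing_adj (Layer b k) (Link a l r) \<and> packing_adj (Layer b' k') (Link a l r)"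
  shows "linked (Layer b k) (Layer b' k')"
  unfolding linked_def
proof (intro exI[of _ "Link a l ` {..<9}"] conjI ballI)
  show "card (Link a l ` {..<9}) = 9" by (subst card_image) (auto simp: inj_on_def Link_def)
  fix t assume "t \<in> Link a l ` {..<9}"
  then obtain r where r: "r < 9" "t = Link a l r" by auto
  then show "{Layer b k, t} \<in> packing_edges" "{Layer b' k', t} \<in> packing_edges"
    using assms[of r] by (auto simp: packing_edges_iff)
  show "t \<notin> {HubU, HubV}" using r by (auto simp: vertex_defs)
  show "\<not> layer t" unfolding layer_iff r by (auto simp: vertex_defs)
qed

lemma linked_in_block: "k + 1 < block_len b \<Longrightarrow> linked (Layer b k) (Layer b (k + 1))"
  by (rule linked_if_common_links[of b k b k]) (unfold packing_adj_def, blast)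

lemma linked_wrap: "linked (Layer (m + n) (wall_len - 1)) (Layer m 0)"
  by (rule linked_if_common_links[of _ _ "m + n + 1" 0]) (unfold packing_adj_def, blast)

lemma bin_frame:
  "bin_frame (\<Union> packing_edges) packing_edges g HubU HubV n m wall_len B s (\<lambda>j. Layer (m + j)) Layer Path"
proof
  show "n \<ge> 1" "wall_len \<ge> 3 * ((\<Sum>j<n. B j + 4) + 6)" by (rule n_pos wall_len_ge)+
  show "layer (Layer (m + j) k)" if "j \<le> n" "k < wall_len" for j k
    using that by (auto simp: layer_iff block_len_def)
  show "layer (Layer i k)" if "i < m" "k < s i" for i k
    using that by (auto simp: layer_iff block_len_def)
  show "linked (Layer (m + j) k) (Layer (m + j) (Suc k))" if "j \<le> n" "Suc k < wall_len" for j k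
    using that linked_in_block[of k "m + j"] by (simp add: block_len_def)
  show "linked (Layer i k) (Layer i (Suc k))" if "i < m" "Suc k < s i" for i k
    using that linked_in_block[of k i] by (simp add: block_len_def)
  show "linked (Layer (m + n) (wall_len - 1)) (Layer (m + 0) 0)" using linked_wrap by simp
  show "{Path j k, Path j (Suc k)} \<in> packing_edges" if "j < n" "k < B j" for j k
    using that unfolding packing_edges_iff packing_adj_def Suc_eq_plus1 by blast
  show "{Layer (m + j) (wall_len - 1), Path j 0} \<in> packing_edges" if "j < n" for j
    using that unfolding packing_edges_iff packing_adj_def by blast
  show "{Path j (B j), Layer (m + Suc j) 0} \<in> packing_edges" if "j < n" for j
    using that unfolding packing_edges_iff packing_adj_def Suc_eq_plus1 add.assoc[symmetric] by blast
  show "Path j k \<notin> {HubU, HubV} \<and> \<not> layer (Path j k)" for j k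
    unfolding layer_iff by (auto simp: vertex_defs)
qed (auto simp: Layer_def)

end

context packing_graph
begin

definition packs :: "(nat \<Rightarrow> nat) \<Rightarrow> (nat \<Rightarrow> nat) \<Rightarrow> bool" where
  "packs C \<beta> \<longleftrightarrow> (\<forall>i<m. \<beta> i < n) \<and> (\<forall>j<n. (\<Sum>i | i < m \<and> \<beta> i = j. s i) \<le> C j)"

lemma simple_graph_packing_edges:
  assumes "finite (\<Union> packing_edges)" shows "simple_graph (\<Union> packing_edges) packing_edges"
  unfolding simple_graph_def
proof (intro conjI ballI assms Union_upper)
  fix e assume "e \<in> packing_edges"
  then obtain x y where "e = {x, y}" "packing_adj x y" unfolding packing_edges_def by blast
  then show "card e = 2" using packing_adj_neq[of x y] by simp
qed

lemma packs_if_complex_RAC_drawing: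
  assumes g: "complex_RAC_drawing (\<Union> packing_edges) packing_edges g" and fin: "finite (\<Union> packing_edges)"
    and n: "n \<ge> 1" and wall_len: "wall_len \<ge> 3 * ((\<Sum>j<n. B j + 4) + 6)"
  shows "\<exists>\<beta>. packs (\<lambda>j. B j + 9) \<beta>"
proof -
  have "0 < block_len m" using wall_len by (simp add: block_len_def)
  then have "{Layer m 0, HubU} \<in> packing_edges" "{Layer m 0, HubV} \<in> packing_edges"
    unfolding packing_edges_iff using packing_adjI(1,2) by blast+
  then have hubs: "HubU \<in> \<Union> packing_edges" "HubV \<in> \<Union> packing_edges" by blast+
  define q where "q = 1 / (g HubV - g HubU)"
  have "g HubV \<noteq> g HubU"
    using g hubs by (auto simp: complex_RAC_drawing_def inj_on_def HubU_def HubV_def)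
  then have q: "q \<noteq> 0" "(g HubV - g HubU) * q = 1" by (auto simp: q_def)
  interpret packing_drawing n m wall_len B s "\<lambda>x. (g x - g HubU) * q"
    by unfold_locales
      (rule complex_RAC_drawing_similarity[OF g q(1)] simple_graph_packing_edges[OF fin] hubs n wall_len |
        simp add: q(2))+
  show ?thesis unfolding packs_def by (rule bin_frame.packing_exists[OF bin_frame])
qed

lemma complex_RAC_drawing_if_packs:
  assumes "packs B \<beta>" "n \<ge> 1" "wall_len \<ge> 2"
  obtains g where "complex_RAC_drawing (\<Union> packing_edges) packing_edges g"
proof -
  interpret bin_packing n m wall_len B s \<beta> by unfold_locales (use assms in \<open>auto simp: packs_def\<close>)
  show thesis by (rule that[OF complex_RAC_drawing_draw])
qed

end

locale labelled_packing_graph = packing_graph +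
  fixes c :: "vertex \<Rightarrow> nat" and N :: nat
  assumes n_pos: "n \<ge> 1" and wall_len_ge: "wall_len \<ge> 3 * ((\<Sum>j<n. B j + 4) + 6)"
    and inj_c: "inj_on c (\<Union> packing_edges)" and c_less: "c ` \<Union> packing_edges \<subseteq> {..<N}"
begin

definition labelled_edges :: "nat set set" where
  "labelled_edges = (`) c ` packing_edges"

lemma finite_packing_vertices: "finite (\<Union> packing_edges)"
  by (rule inj_on_finite[OF inj_c c_less]) (rule finite_lessThan)

lemma card_labelled_edge: "e \<in> labelled_edges \<Longrightarrow> card e = 2"
proof -
  assume "e \<in> labelled_edges"
  then obtain e' where e': "e = c ` e'" "e' \<in> packing_edges" by (auto simp: labelled_edges_def)
  have "card e = card e'" unfolding e'(1) by (rule card_image[OF inj_on_subset[OF inj_c Union_upper[OF e'(2)]]])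
  also have "\<dots> = 2" using simple_graph_packing_edges[OF finite_packing_vertices] e'(2) by (simp add: simple_graph_def)
  finally show ?thesis .
qed

lemma simple_graph_labelled_edges:
  "simple_graph {..<N} labelled_edges" "simple_graph (c ` \<Union> packing_edges) labelled_edges"
  using card_labelled_edge c_less finite_lessThan finite_imageI[OF finite_packing_vertices, of c]
  unfolding simple_graph_def labelled_edges_def by blast+

lemma admits_RAC_drawing_if_packs:
  assumes "packs B \<beta>"
  shows "admits_RAC_drawing {..<N} labelled_edges"
proof -
  obtain g where "complex_RAC_drawing (\<Union> packing_edges) packing_edges g"
    using complex_RAC_drawing_if_packs[OF assms n_pos] wall_len_ge by auto
  then have "complex_RAC_drawing (c ` \<Union> packing_edges) labelled_edges (\<lambda>y. g (the_inv_into (\<Union> packing_edges) c y))"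
    unfolding labelled_edges_def
    by (rule complex_RAC_drawing_relabel[OF _ inj_c simple_graph_packing_edges[OF finite_packing_vertices]])
  then obtain g' where "complex_RAC_drawing {..<N} labelled_edges g'"
    using complex_RAC_drawing_extend[OF _ simple_graph_labelled_edges(2)] by blast
  then interpret complex_RAC_graph "{..<N}" labelled_edges g'
    by unfold_locales (rule simple_graph_labelled_edges(1))
  show ?thesis unfolding admits_RAC_drawing_def using RAC_drawing_to_plane by blast
qed

lemma packs_if_admits_RAC_drawing:
  assumes "admits_RAC_drawing {..<N} labelled_edges"
  shows "\<exists>\<beta>. packs (\<lambda>j. B j + 9) \<beta>"
proof -
  obtain f where "RAC_drawing {..<N} labelled_edges f" using assms by (auto simp: admits_RAC_drawing_def)
  then have "complex_RAC_drawing {..<N} labelled_edges (\<lambda>x. to_complex (f x))"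
    by (rule RAC_drawing_imp_complex[OF _ simple_graph_labelled_edges(1)])
  then have "complex_RAC_drawing (\<Union> packing_edges) packing_edges (\<lambda>x. to_complex (f (c x)))"
    unfolding labelled_edges_def by (rule complex_RAC_drawing_pullback[OF _ inj_c c_less]) auto
  then show ?thesis by (rule packs_if_complex_RAC_drawing[OF _ finite_packing_vertices n_pos wall_len_ge])
qed

end

section \<open>Satisfiability as bin packing\<close>

definition literal :: "(nat \<Rightarrow> bool) \<Rightarrow> nat \<Rightarrow> bool" where
  "literal \<alpha> l \<longleftrightarrow> (if even l then \<alpha> (l div 2) else \<not> \<alpha> (l div 2))"

text \<open>Literals \<open>2 x\<close> and \<open>2 x + 1\<close> are the variable \<open>x\<close> and its negation; rows of \<open>occ\<close> without
  literals are not clauses. Both literals and clauses are bins. The two items of an ordered pair of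
  adjacent bins \<open>p\<close>, \<open>q\<close> must be put into these two bins, one carrying the weight \<open>weight p q\<close>; the
  digits of \<open>signature\<close> enforce this, since they determine the sum of \<open>((p - k) * (q - k))\<^sup>2\<close> over bin \<open>k\<close>.\<close>

locale cnf =
  fixes num_vars num_clauses :: nat and occ :: "nat \<Rightarrow> nat \<Rightarrow> bool"
begin

definition satisfies :: "(nat \<Rightarrow> bool) \<Rightarrow> bool" where
  "satisfies \<alpha> \<longleftrightarrow> (\<forall>c<num_clauses. (\<exists>l<2 * num_vars. occ l c) \<longrightarrow> (\<exists>l<2 * num_vars. occ l c \<and> literal \<alpha> l))"

definition satisfiable :: bool where
  "satisfiable \<longleftrightarrow> (\<exists>\<alpha>. satisfies \<alpha>)"

definition num_bins :: nat where "num_bins = 2 * num_vars + num_clauses"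

definition weight :: "nat \<Rightarrow> nat \<Rightarrow> nat" where
  "weight p q = (if p < 2 * num_vars \<and> q < 2 * num_vars then (if p div 2 = q div 2 \<and> p \<noteq> q then num_bins else 0)
     else if p < 2 * num_vars \<and> 2 * num_vars \<le> q then (if occ p (q - 2 * num_vars) then 1 else 0)
     else if q < 2 * num_vars \<and> 2 * num_vars \<le> p then (if occ q (p - 2 * num_vars) then 1 else 0) else 0)"

definition radix :: nat where "radix = 13 * (num_bins + 1) ^ 6"

definition signature :: "nat \<Rightarrow> nat \<Rightarrow> nat" where
  "signature p q = ((((p * q) * (p * q) * radix + (p + q) * (p * q)) * radix +
     ((p + q) * (p + q) + 2 * (p * q))) * radix + (p + q)) * radix + 1"

definition item_size :: "nat \<Rightarrow> nat \<Rightarrow> nat" where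
  "item_size p q = (if weight p q = 0 then 0 else signature p q * radix + (if p < q then weight p q else 0))"

definition slack :: "nat \<Rightarrow> nat" where
  "slack k = (if k < 2 * num_vars then num_bins else (\<Sum>l<2 * num_vars. weight l k) - 1)"

definition capacity :: "nat \<Rightarrow> nat" where
  "capacity k = (\<Sum>q<num_bins. if weight k q = 0 then 0 else signature k q) * radix + slack k"

definition bin_pairs :: "(nat \<times> nat) set" where "bin_pairs = {..<num_bins} \<times> {..<num_bins}"

definition adjacent_pairs :: "(nat \<times> nat) set" where
  "adjacent_pairs = {(p, q) \<in> bin_pairs. weight p q \<noteq> 0}"

definition carried_weight :: "nat \<times> nat \<Rightarrow> nat" where
  "carried_weight = (\<lambda>(p, q). if p < q then weight p q else 0)"

definition packs :: "(nat \<times> nat \<Rightarrow> nat) \<Rightarrow> bool" where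
  "packs \<beta> \<longleftrightarrow> (\<forall>x\<in>bin_pairs. \<beta> x < num_bins) \<and>
     (\<forall>k<num_bins. (\<Sum>x | x \<in> bin_pairs \<and> \<beta> x = k. item_size (fst x) (snd x)) \<le> capacity k)"

lemma weight_sym: "weight p q = weight q p"
  by (auto simp: weight_def)

lemma signature_sym: "signature p q = signature q p"
  by (simp add: signature_def add.commute mult.commute)

lemma weight_self: "weight p p = 0"
  by (simp add: weight_def)

lemma weight_le: "num_bins \<ge> 1 \<Longrightarrow> weight p q \<le> num_bins"
  by (auto simp: weight_def)

lemma weight_clause_le: "2 * num_vars \<le> k \<Longrightarrow> weight l k \<le> 1"
  by (auto simp: weight_def)

lemma weight_literal_clause:
  "l < 2 * num_vars \<Longrightarrow> weight l (2 * num_vars + c) = (if occ l c then 1 else 0)"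
  by (simp add: weight_def)

lemma sum_weight_clause:
  "(\<Sum>l<2 * num_vars. weight l (2 * num_vars + c)) = card {l. l < 2 * num_vars \<and> occ l c}"
proof -
  have "(\<Sum>l<2 * num_vars. weight l (2 * num_vars + c)) = (\<Sum>l<2 * num_vars. if occ l c then 1 else 0)"
    by (rule sum.cong) (simp_all add: weight_literal_clause)
  also have "\<dots> = card {l. l < 2 * num_vars \<and> occ l c}" by (simp add: sum.If_cases Int_def)
  finally show ?thesis .
qed

lemma slack_less: "slack k < radix"
proof -
  have "num_bins < radix"
  proof -
    have "num_bins + 1 \<le> (num_bins + 1) ^ 6" by (rule self_le_power) auto
    then show ?thesis unfolding radix_def by linarith
  qed
  moreover have "(\<Sum>l<2 * num_vars. weight l k) \<le> num_bins" if "\<not> k < 2 * num_vars"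
  proof -
    have "(\<Sum>l<2 * num_vars. weight l k) \<le> (\<Sum>l<2 * num_vars. 1)"
      using that by (intro sum_mono weight_clause_le) auto
    then show ?thesis by (simp add: num_bins_def)
  qed
  ultimately show ?thesis by (auto simp: slack_def)
qed

lemma digit_sum_less:
  assumes X: "X \<subseteq> bin_pairs" and f: "\<And>p q. p < num_bins \<Longrightarrow> q < num_bins \<Longrightarrow> f (p, q) \<le> 6 * (num_bins + 1) ^ 4"
  shows "sum f X < radix"
proof -
  have fin: "finite bin_pairs" by (simp add: bin_pairs_def)
  have "sum f X \<le> (\<Sum>x\<in>X. 6 * (num_bins + 1) ^ 4)" using X f by (intro sum_mono) (auto simp: bin_pairs_def)
  also have "\<dots> = card X * (6 * (num_bins + 1) ^ 4)" by simp
  also have "\<dots> \<le> (num_bins + 1) ^ 2 * (6 * (num_bins + 1) ^ 4)"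
  proof (rule mult_right_mono)
    have "card X \<le> card bin_pairs" using X fin by (rule card_mono[rotated])
    also have "\<dots> \<le> (num_bins + 1) ^ 2" by (simp add: bin_pairs_def card_cartesian_product power2_eq_square)
    finally show "card X \<le> (num_bins + 1) ^ 2" .
  qed simp
  also have "\<dots> = 6 * (num_bins + 1) ^ 6" by (simp add: power_add[symmetric])
  also have "\<dots> < radix" unfolding radix_def by simp
  finally show ?thesis .
qed

lemma digit_bounds:
  assumes "p < num_bins" "q < num_bins"
  shows "(p * q) * (p * q) \<le> 6 * (num_bins + 1) ^ 4" "(p + q) * (p * q) \<le> 6 * (num_bins + 1) ^ 4"
    "(p + q) * (p + q) + 2 * (p * q) \<le> 6 * (num_bins + 1) ^ 4" "p + q \<le> 6 * (num_bins + 1) ^ 4"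
    "(1::nat) \<le> 6 * (num_bins + 1) ^ 4"
proof -
  let ?N = "num_bins + 1"
  have power_le: "?N ^ i \<le> ?N ^ 4" if "i \<le> 4" for i using that by (intro power_increasing) auto
  have product: "p * q \<le> ?N ^ 2" using mult_mono[of p ?N q ?N] assms by (simp add: power2_eq_square)
  have sum: "p + q \<le> 2 * ?N" using assms by simp
  show "(p * q) * (p * q) \<le> 6 * ?N ^ 4"
    using mult_mono[OF product product] by (simp add: power_add[symmetric])
  have "(p + q) * (p * q) \<le> 2 * ?N * ?N ^ 2" using mult_mono[OF sum product] by simp
  also have "\<dots> = 2 * ?N ^ 3" by (simp add: numeral_3_eq_3 power2_eq_square)
  also have "\<dots> \<le> 6 * ?N ^ 4" using power_le[of 3] by linarith
  finally show "(p + q) * (p * q) \<le> 6 * ?N ^ 4" .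
  have "(p + q) * (p + q) \<le> 2 * ?N * (2 * ?N)" using mult_mono[OF sum sum] by simp
  also have "\<dots> = 4 * ?N ^ 2" by (simp add: power2_eq_square)
  finally show "(p + q) * (p + q) + 2 * (p * q) \<le> 6 * ?N ^ 4" using product power_le[of 2] by linarith
  show "p + q \<le> 6 * ?N ^ 4" using sum power_le[of 1] by simp
  show "1 \<le> 6 * ?N ^ 4" using power_le[of 0] by simp
qed

end

lemma digits_unique:
  fixes a b c d R :: nat
  assumes "a * R + b = c * R + d" "b < R" "d < R"
  shows "a = c" "b = d"
proof -
  show "b = d" using arg_cong[OF assms(1), of "\<lambda>x. x mod R"] assms(2,3) by simp
  then show "a = c" using assms by simp
qed

text \<open>Up to factors \<open>1\<close> and \<open>- 2\<close>, the digits of \<open>signature\<close> are the coefficients of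
  \<open>((p - k) * (q - k))\<^sup>2 = (p q - k (p + q) + k\<^sup>2)\<^sup>2\<close> as a polynomial in \<open>k\<close>.\<close>

definition sum_digit4 :: "(nat \<times> nat) set \<Rightarrow> nat" where
  "sum_digit4 X = (\<Sum>(p, q)\<in>X. (p * q) * (p * q))"

definition sum_digit3 :: "(nat \<times> nat) set \<Rightarrow> nat" where
  "sum_digit3 X = (\<Sum>(p, q)\<in>X. (p + q) * (p * q))"

definition sum_digit2 :: "(nat \<times> nat) set \<Rightarrow> nat" where
  "sum_digit2 X = (\<Sum>(p, q)\<in>X. (p + q) * (p + q) + 2 * (p * q))"

definition sum_digit1 :: "(nat \<times> nat) set \<Rightarrow> nat" where
  "sum_digit1 X = (\<Sum>(p, q)\<in>X. p + q)"

lemmas sum_digit_defs = sum_digit4_def sum_digit3_def sum_digit2_def sum_digit1_def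

lemma sum_square_digits:
  "(\<Sum>(p, q)\<in>X. ((int p - int k) * (int q - int k))\<^sup>2) =
     int (sum_digit4 X) - 2 * int k * int (sum_digit3 X) + int k ^ 2 * int (sum_digit2 X)
     - 2 * int k ^ 3 * int (sum_digit1 X) + int k ^ 4 * int (card X)"
proof -
  let ?d4 = "\<lambda>(p, q). (p * q) * (p * q) :: nat" and ?d3 = "\<lambda>(p, q). (p + q) * (p * q) :: nat"
  let ?d2 = "\<lambda>(p, q). (p + q) * (p + q) + 2 * (p * q) :: nat" and ?d1 = "\<lambda>(p, q). p + q :: nat"
  have "(\<Sum>(p, q)\<in>X. ((int p - int k) * (int q - int k))\<^sup>2) = (\<Sum>x\<in>X. int (?d4 x) - 2 * int k * int (?d3 x) +
      int k ^ 2 * int (?d2 x) - 2 * int k ^ 3 * int (?d1 x) + int k ^ 4 * 1)"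
  proof (intro sum.cong refl)
    fix x :: "nat \<times> nat"
    obtain p q where x: "x = (p, q)" by force
    have "((P - K) * (Q - K))\<^sup>2 = (P * Q) * (P * Q) - 2 * K * ((P + Q) * (P * Q)) + K ^ 2 * ((P + Q) * (P + Q) + 2 * (P * Q))
        - 2 * K ^ 3 * (P + Q) + K ^ 4 * 1" for P Q K :: int by algebra
    then show "(case x of (p, q) \<Rightarrow> ((int p - int k) * (int q - int k))\<^sup>2) = int (?d4 x) - 2 * int k * int (?d3 x) +
        int k ^ 2 * int (?d2 x) - 2 * int k ^ 3 * int (?d1 x) + int k ^ 4 * 1"
      by (simp add: x)
  qed
  also have "\<dots> = int (sum_digit4 X) - 2 * int k * int (sum_digit3 X) + int k ^ 2 * int (sum_digit2 X)
      - 2 * int k ^ 3 * int (sum_digit1 X) + int k ^ 4 * int (card X)"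
    unfolding sum_digit_defs
    by (simp only: sum.distrib sum_subtractf sum_distrib_left[symmetric] of_nat_sum) simp
  finally show ?thesis .
qed

context cnf
begin

lemma sum_digits_less:
  assumes "X \<subseteq> bin_pairs"
  shows "sum_digit4 X < radix" "sum_digit3 X < radix" "sum_digit2 X < radix" "sum_digit1 X < radix" "card X < radix"
proof -
  show "sum_digit4 X < radix" "sum_digit3 X < radix" "sum_digit2 X < radix" "sum_digit1 X < radix"
    unfolding sum_digit_defs using digit_bounds by (auto intro!: digit_sum_less[OF assms])
  show "card X < radix" using digit_sum_less[OF assms, of "\<lambda>_. 1"] digit_bounds(5) by simp
qed

lemma sum_signature:
  "(\<Sum>(p, q)\<in>X. signature p q) =
     (((sum_digit4 X * radix + sum_digit3 X) * radix + sum_digit2 X) * radix + sum_digit1 X) * radix + card X"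
proof -
  let ?d4 = "\<lambda>(p, q). (p * q) * (p * q) :: nat" and ?d3 = "\<lambda>(p, q). (p + q) * (p * q) :: nat"
  let ?d2 = "\<lambda>(p, q). (p + q) * (p + q) + 2 * (p * q) :: nat" and ?d1 = "\<lambda>(p, q). p + q :: nat"
  let ?R = radix
  have "(\<Sum>(p, q)\<in>X. signature p q) =
      (\<Sum>x\<in>X. ?d4 x * (?R * ?R * ?R * ?R) + ?d3 x * (?R * ?R * ?R) + ?d2 x * (?R * ?R) + ?d1 x * ?R + 1)"
    by (intro sum.cong refl) (auto simp: signature_def algebra_simps)
  also have "\<dots> = sum_digit4 X * (?R * ?R * ?R * ?R) + sum_digit3 X * (?R * ?R * ?R) + sum_digit2 X * (?R * ?R) +
      sum_digit1 X * ?R + card X"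
    unfolding sum_digit_defs by (simp only: sum.distrib sum_distrib_right[symmetric]) simp
  finally show ?thesis by (simp add: algebra_simps)
qed

lemma sum_square_eq_if_sum_signature_eq:
  assumes X: "X \<subseteq> bin_pairs" and Y: "Y \<subseteq> bin_pairs"
    and eq: "(\<Sum>(p, q)\<in>X. signature p q) = (\<Sum>(p, q)\<in>Y. signature p q)"
  shows "(\<Sum>(p, q)\<in>X. ((int p - int k) * (int q - int k))\<^sup>2) = (\<Sum>(p, q)\<in>Y. ((int p - int k) * (int q - int k))\<^sup>2)"
proof -
  note less = sum_digits_less[OF X] sum_digits_less[OF Y]
  note digits0 = digits_unique[OF eq[unfolded sum_signature] less(5,10)]
  note digits1 = digits_unique[OF digits0(1) less(4,9)]
  note digits2 = digits_unique[OF digits1(1) less(3,8)]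
  note digits3 = digits_unique[OF digits2(1) less(2,7)]
  show ?thesis unfolding sum_square_digits digits0(2) digits1(2) digits2(2) digits3 ..
qed

lemma signature_confines:
  assumes X: "X \<subseteq> bin_pairs" and Y: "Y \<subseteq> bin_pairs"
    and eq: "(\<Sum>(p, q)\<in>X. signature p q) = (\<Sum>(p, q)\<in>Y. signature p q)"
    and fst_Y: "\<And>p q. (p, q) \<in> Y \<Longrightarrow> p = k" and pq: "(p, q) \<in> X"
  shows "p = k \<or> q = k"
proof -
  let ?f = "\<lambda>(p, q). ((int p - int k) * (int q - int k))\<^sup>2"
  have "finite X" using X finite_subset by (auto simp: bin_pairs_def)
  moreover have "sum ?f Y = 0" using fst_Y by (intro sum.neutral) auto
  then have "sum ?f X = 0" using sum_square_eq_if_sum_signature_eq[OF X Y eq] by simp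
  moreover have "0 \<le> ?f x" for x by (auto split: prod.split)
  ultimately have "\<forall>x\<in>X. ?f x = 0" using sum_nonneg_eq_0_iff[of X ?f] by blast
  from bspec[OF this pq] show ?thesis by simp
qed

lemma adjacent_pairs_iff: "(p, q) \<in> adjacent_pairs \<longleftrightarrow> p < num_bins \<and> q < num_bins \<and> weight p q \<noteq> 0"
  by (auto simp: adjacent_pairs_def bin_pairs_def)

lemma adjacent_pairs_subset: "adjacent_pairs \<subseteq> bin_pairs"
  by (auto simp: adjacent_pairs_def)

lemma finite_adjacent_pairs: "finite adjacent_pairs"
  by (rule finite_subset[OF adjacent_pairs_subset]) (simp add: bin_pairs_def)

lemma adjacent_pairs_sym: "(p, q) \<in> adjacent_pairs \<Longrightarrow> (q, p) \<in> adjacent_pairs"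
  using weight_sym by (auto simp: adjacent_pairs_iff)

lemma adjacent_pairs_neq: "(p, q) \<in> adjacent_pairs \<Longrightarrow> p \<noteq> q"
  using weight_self by (auto simp: adjacent_pairs_iff)

lemma capacity_adjacent_pairs:
  assumes "k < num_bins"
  shows "capacity k = (\<Sum>(p, q)\<in>{x \<in> adjacent_pairs. fst x = k}. signature p q) * radix + slack k"
proof -
  have "(\<Sum>q<num_bins. if weight k q = 0 then 0 else signature k q) =
      (\<Sum>q | q < num_bins \<and> weight k q \<noteq> 0. signature k q)"
    by (rule sum.mono_neutral_cong_right) auto
  also have "\<dots> = (\<Sum>(p, q)\<in>{x \<in> adjacent_pairs. fst x = k}. signature p q)"
    by (rule sum.reindex_bij_witness[of _ snd "\<lambda>q. (k, q)"]) (use assms in \<open>auto simp: adjacent_pairs_iff\<close>)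
  finally show ?thesis by (simp add: capacity_def)
qed

lemma sum_item_size_adjacent_pairs:
  "(\<Sum>x | x \<in> bin_pairs \<and> \<beta> x = k. item_size (fst x) (snd x)) =
   (\<Sum>(p, q)\<in>{x \<in> adjacent_pairs. \<beta> x = k}. signature p q) * radix + sum carried_weight {x \<in> adjacent_pairs. \<beta> x = k}"
proof -
  let ?A = "{x \<in> adjacent_pairs. \<beta> x = k}"
  have "(\<Sum>x | x \<in> bin_pairs \<and> \<beta> x = k. item_size (fst x) (snd x)) = (\<Sum>x\<in>?A. item_size (fst x) (snd x))"
    by (rule sum.mono_neutral_right) (auto simp: adjacent_pairs_def bin_pairs_def item_size_def)
  also have "\<dots> = (\<Sum>x\<in>?A. (\<lambda>(p, q). signature p q) x * radix + carried_weight x)"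
    by (rule sum.cong) (auto simp: adjacent_pairs_def item_size_def carried_weight_def)
  also have "\<dots> = (\<Sum>x\<in>?A. (\<lambda>(p, q). signature p q) x) * radix + sum carried_weight ?A"
    by (simp only: sum.distrib sum_distrib_right[symmetric])
  finally show ?thesis .
qed

end

locale packed_cnf = cnf +
  fixes \<beta> :: "nat \<times> nat \<Rightarrow> nat"
  assumes packs: "packs \<beta>"
begin

abbreviation packed :: "nat \<Rightarrow> (nat \<times> nat) set" where
  "packed k \<equiv> {x \<in> adjacent_pairs. \<beta> x = k}"

lemma packed_size_le:
  assumes "k < num_bins"
  shows "(\<Sum>(p, q)\<in>packed k. signature p q) * radix + sum carried_weight (packed k) \<le>
    (\<Sum>(p, q)\<in>{x \<in> adjacent_pairs. fst x = k}. signature p q) * radix + slack k"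
  using packs assms
  unfolding packs_def capacity_adjacent_pairs[OF assms, symmetric] sum_item_size_adjacent_pairs[symmetric] by blast

text \<open>No bin can hold more signatures than its capacity allows, and altogether they fill the bins exactly.\<close>

lemma packed_signature_eq:
  assumes "k < num_bins"
  shows "(\<Sum>(p, q)\<in>packed k. signature p q) = (\<Sum>(p, q)\<in>{x \<in> adjacent_pairs. fst x = k}. signature p q)"
proof -
  let ?h = "\<lambda>(p, q). signature p q" and ?Y = "\<lambda>k. {x \<in> adjacent_pairs. fst x = k}"
  have le: "sum ?h (packed k) \<le> sum ?h (?Y k)" if "k < num_bins" for k
  proof (rule ccontr)
    assume "\<not> ?thesis"
    then have "(sum ?h (?Y k) + 1) * radix \<le> sum ?h (packed k) * radix" by (intro mult_right_mono) auto
    then show False using packed_size_le[OF that] slack_less[of k] by (simp add: algebra_simps)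
  qed
  have "(\<Sum>k<num_bins. sum ?h (packed k)) = sum ?h adjacent_pairs"
    "(\<Sum>k<num_bins. sum ?h (?Y k)) = sum ?h adjacent_pairs"
    using adjacent_pairs_subset packs
    by (auto intro!: sum.group finite_adjacent_pairs simp: bin_pairs_def packs_def)
  then show ?thesis
    using sum_mono_inv[of "\<lambda>k. sum ?h (packed k)" "{..<num_bins}" "\<lambda>k. sum ?h (?Y k)" k] le assms by simp
qed

lemma packed_in_own_bin:
  assumes "(p, q) \<in> adjacent_pairs"
  shows "\<beta> (p, q) = p \<or> \<beta> (p, q) = q"
proof -
  let ?k = "\<beta> (p, q)"
  have "?k < num_bins" using packs subsetD[OF adjacent_pairs_subset assms] by (simp add: packs_def)
  note signature_eq = packed_signature_eq[OF this]
  have "p = ?k \<or> q = ?k"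
  proof (rule signature_confines[OF _ _ signature_eq])
    show "packed ?k \<subseteq> bin_pairs" "{x \<in> adjacent_pairs. fst x = ?k} \<subseteq> bin_pairs"
      using adjacent_pairs_subset by blast+
    show "(p, q) \<in> packed ?k" using assms by simp
  qed simp
  then show ?thesis by auto
qed

lemma carried_weight_le_slack:
  assumes "k < num_bins" "A \<subseteq> packed k"
  shows "sum carried_weight A \<le> slack k"
proof -
  have "sum carried_weight A \<le> sum carried_weight (packed k)"
    using assms(2) finite_adjacent_pairs by (intro sum_mono2) auto
  also have "\<dots> \<le> slack k"
    using packed_size_le[OF assms(1)] packed_signature_eq[OF assms(1)] by simp
  finally show ?thesis .
qed

definition packed_assignment :: "nat \<Rightarrow> bool" where
  "packed_assignment x \<longleftrightarrow> \<beta> (2 * x, 2 * x + 1) = 2 * x + 1"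

text \<open>The weight between a literal and its negation fills the bin of the false one.\<close>

lemma false_literal_in_clause:
  assumes l: "l < 2 * num_vars" "occ l c" "\<not> literal packed_assignment l" and c: "c < num_clauses"
  shows "\<beta> (l, 2 * num_vars + c) = 2 * num_vars + c"
proof (rule ccontr)
  let ?k = "2 * num_vars + c"
  assume other: "\<beta> (l, ?k) \<noteq> ?k"
  have clause: "(l, ?k) \<in> adjacent_pairs"
    using l c by (simp add: adjacent_pairs_iff weight_literal_clause num_bins_def)
  have in_l: "\<beta> (l, ?k) = l" using packed_in_own_bin[OF clause] other by blast
  define x where "x = l div 2"
  have bound: "l < num_bins" "2 * x + 1 < 2 * num_vars" using l by (auto simp: num_bins_def x_def) presburger
  have negation: "(2 * x, 2 * x + 1) \<in> adjacent_pairs" using bound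
    by (auto simp: adjacent_pairs_iff weight_def num_bins_def)
  have "\<beta> (2 * x, 2 * x + 1) = l"
    using packed_in_own_bin[OF negation] l(3) unfolding literal_def packed_assignment_def x_def
    by (cases "even l") (auto elim!: evenE oddE)
  then have "sum carried_weight {(l, ?k), (2 * x, 2 * x + 1)} \<le> slack l"
    using in_l clause negation by (intro carried_weight_le_slack bound) auto
  moreover have "sum carried_weight {(l, ?k), (2 * x, 2 * x + 1)} = 1 + num_bins"
    using l bound by (auto simp: carried_weight_def weight_def)
  ultimately show False using l by (simp add: slack_def)
qed

lemma satisfies_packed_assignment: "satisfies packed_assignment"
  unfolding satisfies_def
proof (intro allI impI, rule ccontr)
  fix c assume c: "c < num_clauses" and ex: "\<exists>l<2 * num_vars. occ l c"
    and none: "\<not> (\<exists>l<2 * num_vars. occ l c \<and> literal packed_assignment l)"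
  let ?k = "2 * num_vars + c" and ?O = "{l. l < 2 * num_vars \<and> occ l c}"
  have k: "?k < num_bins" using c by (simp add: num_bins_def)
  have "card ?O = sum carried_weight ((\<lambda>l. (l, ?k)) ` ?O)"
    by (subst sum.reindex) (auto simp: inj_on_def carried_weight_def weight_literal_clause)
  also have "\<dots> \<le> slack ?k"
    using false_literal_in_clause none c k
    by (intro carried_weight_le_slack) (auto simp: adjacent_pairs_iff weight_literal_clause num_bins_def)
  also have "\<dots> = card ?O - 1" unfolding slack_def sum_weight_clause by simp
  finally have "card ?O \<le> card ?O - 1" .
  moreover have "card ?O > 0" using ex by (auto simp: card_gt_0_iff)
  ultimately show False by linarith
qed

end

text \<open>Conversely, the weight between a literal and its negation goes to the false one and the weight between
  a literal and a clause to the literal if it is true.\<close>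

locale assigned_cnf = cnf +
  fixes \<alpha> :: "nat \<Rightarrow> bool"
  assumes satisfies: "satisfies \<alpha>"
begin

definition weight_bin :: "nat \<Rightarrow> nat \<Rightarrow> nat" where
  "weight_bin p q =
     (if q < 2 * num_vars then (if literal \<alpha> p then q else p) else (if literal \<alpha> p then p else q))"

definition assigned_bin :: "nat \<times> nat \<Rightarrow> nat" where
  "assigned_bin = (\<lambda>(p, q). if p < q then weight_bin p q else if weight_bin q p = q then p else q)"

abbreviation assigned :: "nat \<Rightarrow> (nat \<times> nat) set" where
  "assigned k \<equiv> {x \<in> adjacent_pairs. assigned_bin x = k}"

lemma assigned_bin_cases: "assigned_bin (p, q) = p \<or> assigned_bin (p, q) = q"
  by (auto simp: assigned_bin_def weight_bin_def)

lemma assigned_bin_swap: "p \<noteq> q \<Longrightarrow> assigned_bin (q, p) = q \<longleftrightarrow> assigned_bin (p, q) \<noteq> q"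
  by (auto simp: assigned_bin_def weight_bin_def)

lemma sum_signature_assigned:
  "(\<Sum>(p, q)\<in>assigned k. signature p q) = (\<Sum>(p, q)\<in>{x \<in> adjacent_pairs. fst x = k}. signature p q)"
proof -
  let ?f = "\<lambda>x. if assigned_bin x = k then x else prod.swap x" and ?g = "\<lambda>x. if fst x = k then x else prod.swap x"
  show ?thesis
  proof (rule sum.reindex_bij_witness[of _ ?f ?g])
    fix x assume x: "x \<in> assigned k"
    obtain p q where pq: "x = (p, q)" by force
    have "p = k \<or> q = k" using x pq assigned_bin_cases[of p q] by auto
    then show "?f (?g x) = x" "?g x \<in> {x \<in> adjacent_pairs. fst x = k}"
      "(case ?g x of (p, q) \<Rightarrow> signature p q) = (case x of (p, q) \<Rightarrow> signature p q)"
      using x pq adjacent_pairs_neq[of p q] assigned_bin_swap[of p q] adjacent_pairs_sym[of p q] signature_sym[of p q]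
      by auto
  next
    fix x assume x: "x \<in> {x \<in> adjacent_pairs. fst x = k}"
    obtain p q where pq: "x = (p, q)" by force
    then show "?g (?f x) = x" "?f x \<in> assigned k"
      using x adjacent_pairs_neq[of p q] assigned_bin_swap[of q p] assigned_bin_cases[of p q] adjacent_pairs_sym[of p q]
      by auto
  qed
qed

lemma carried_weight_true_literal:
  assumes k: "k < 2 * num_vars" "literal \<alpha> k"
  shows "sum carried_weight (assigned k) \<le> num_bins"
proof -
  let ?C = "{x \<in> assigned k. snd x \<ge> 2 * num_vars}"
  have subset: "?C \<subseteq> (\<lambda>q. (k, q)) ` {..<num_bins}"
  proof
    fix x assume x: "x \<in> ?C"
    obtain p q where "x = (p, q)" by force
    with x show "x \<in> (\<lambda>q. (k, q)) ` {..<num_bins}"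
      using assigned_bin_cases[of p q] k(1) by (auto simp: adjacent_pairs_iff)
  qed
  have "carried_weight x \<le> (if snd x \<ge> 2 * num_vars then 1 else 0)" if x: "x \<in> assigned k" for x
  proof -
    obtain p q where pq: "x = (p, q)" by force
    show ?thesis
    proof (cases "p < q \<and> q < 2 * num_vars")
      case True
      then have "p div 2 = q div 2" using x pq True by (auto simp: adjacent_pairs_iff weight_def split: if_splits)
      then have "even p" "q = p + 1" using True by presburger+
      then have "literal \<alpha> p \<noteq> literal \<alpha> q" by (simp add: literal_def)
      moreover have "weight_bin p q = k" using x pq True by (simp add: assigned_bin_def)
      ultimately show ?thesis using k(2) True by (auto simp: weight_bin_def split: if_splits)
    next
      case False
      then show ?thesis using pq by (auto simp: carried_weight_def weight_def)
    qed
  qed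
  then have "sum carried_weight (assigned k) \<le> (\<Sum>x\<in>assigned k. if snd x \<ge> 2 * num_vars then 1 else 0)"
    by (rule sum_mono)
  also have "\<dots> = card ?C" using finite_adjacent_pairs by (simp add: sum.If_cases Int_def)
  also have "\<dots> \<le> card ((\<lambda>q. (k, q)) ` {..<num_bins})"
    by (intro card_mono subset) auto
  also have "\<dots> \<le> num_bins" using card_image_le[of "{..<num_bins}" "\<lambda>q. (k, q)"] by simp
  finally show ?thesis .
qed

lemma carried_weight_false_literal:
  assumes k: "k < 2 * num_vars" "\<not> literal \<alpha> k"
  shows "sum carried_weight (assigned k) \<le> num_bins"
proof -
  let ?p = "if even k then k + 1 else k - 1"
  have "carried_weight x \<le> (if x = (min k ?p, max k ?p) then num_bins else 0)" if x: "x \<in> assigned k" for x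
  proof -
    obtain p q where pq: "x = (p, q)" by force
    show ?thesis
    proof (cases "p < q \<and> weight p q \<noteq> 0")
      case True
      have bin: "weight_bin p q = k" using x pq True by (simp add: assigned_bin_def)
      have k_cases: "k = p \<or> k = q" using x pq assigned_bin_cases[of p q] by auto
      have "q < 2 * num_vars"
        using bin k k_cases by (auto simp: weight_bin_def not_less split: if_splits intro: ccontr)
      then have "p div 2 = q div 2" using True by (auto simp: weight_def split: if_splits)
      then have "even p" "q = p + 1" using True by presburger+
      then have "x = (min k ?p, max k ?p)" using k_cases pq by auto
      moreover have "weight p q \<le> num_bins" using weight_le[of p q] k(1) by (simp add: num_bins_def)
      ultimately show ?thesis using pq by (simp add: carried_weight_def)
    qed (use pq in \<open>auto simp: carried_weight_def\<close>)
  qed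
  then have "sum carried_weight (assigned k) \<le> (\<Sum>x\<in>assigned k. if x = (min k ?p, max k ?p) then num_bins else 0)"
    by (rule sum_mono)
  also have "\<dots> \<le> num_bins" using finite_adjacent_pairs by simp
  finally show ?thesis .
qed

lemma assigned_clause_false_literal:
  assumes k: "k = 2 * num_vars + c" and pq: "(p, q) \<in> assigned k" "p < q"
  shows "p < 2 * num_vars" "q = k" "occ p c" "\<not> literal \<alpha> p"
proof -
  have bin: "k = p \<or> k = q" "weight p q \<noteq> 0" "weight_bin p q = k"
    using pq assigned_bin_cases[of p q] by (auto simp: adjacent_pairs_iff assigned_bin_def)
  show "p < 2 * num_vars" "q = k" using bin(1,2) k pq(2) by (auto simp: weight_def split: if_splits)
  then show "occ p c" "\<not> literal \<alpha> p"
    using bin(2,3) k by (auto simp: weight_literal_clause weight_bin_def split: if_splits)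
qed

lemma card_false_literals:
  assumes "c < num_clauses"
  shows "card {l. l < 2 * num_vars \<and> occ l c \<and> \<not> literal \<alpha> l} \<le> card {l. l < 2 * num_vars \<and> occ l c} - 1"
proof (cases "\<exists>l<2 * num_vars. occ l c")
  case True
  then obtain l where l: "l < 2 * num_vars" "occ l c" "literal \<alpha> l"
    using satisfies assms unfolding satisfies_def by blast
  have "card {l. l < 2 * num_vars \<and> occ l c \<and> \<not> literal \<alpha> l} \<le> card ({l. l < 2 * num_vars \<and> occ l c} - {l})"
    using l by (intro card_mono) auto
  then show ?thesis using l by simp
next
  case False
  then have "{l. l < 2 * num_vars \<and> occ l c \<and> \<not> literal \<alpha> l} = {}" by auto
  then show ?thesis by (metis card.empty zero_le)
qed

lemma carried_weight_clause:
  assumes k: "k = 2 * num_vars + c" and c: "c < num_clauses"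
  shows "sum carried_weight (assigned k) \<le> slack k"
proof -
  let ?F = "{l. l < 2 * num_vars \<and> occ l c \<and> \<not> literal \<alpha> l}"
  have subset: "{x \<in> assigned k. fst x < snd x} \<subseteq> (\<lambda>l. (l, k)) ` ?F"
  proof
    fix x assume x: "x \<in> {x \<in> assigned k. fst x < snd x}"
    obtain p q where pq: "x = (p, q)" by force
    with x have "(p, q) \<in> assigned k" "p < q" by simp_all
    from assigned_clause_false_literal[OF k this] show "x \<in> (\<lambda>l. (l, k)) ` ?F" by (simp add: pq)
  qed
  have "sum carried_weight (assigned k) = sum carried_weight {x \<in> assigned k. fst x < snd x}"
    by (rule sum.mono_neutral_right) (auto simp: finite_adjacent_pairs carried_weight_def split: if_splits)
  also have "\<dots> \<le> sum carried_weight ((\<lambda>l. (l, k)) ` ?F)"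
    by (intro sum_mono2 subset) auto
  also have "\<dots> = card ?F"
    by (subst sum.reindex) (auto simp: inj_on_def carried_weight_def weight_literal_clause k)
  also have "\<dots> \<le> slack k" using card_false_literals[OF c] unfolding slack_def k sum_weight_clause by simp
  finally show ?thesis .
qed

lemma carried_weight_assigned_le_slack:
  assumes "k < num_bins"
  shows "sum carried_weight (assigned k) \<le> slack k"
proof (cases "k < 2 * num_vars")
  case True
  then show ?thesis
    using carried_weight_true_literal carried_weight_false_literal by (auto simp: slack_def)
next
  case False
  then show ?thesis using carried_weight_clause[of k "k - 2 * num_vars"] assms by (simp add: num_bins_def)
qed

lemma packs_assigned_bin: "packs assigned_bin"
proof -
  have "assigned_bin x < num_bins" if "x \<in> bin_pairs" for x
    using that assigned_bin_cases[of "fst x" "snd x"] by (auto simp: bin_pairs_def)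
  then show ?thesis
    unfolding packs_def
    by (simp add: sum_item_size_adjacent_pairs sum_signature_assigned capacity_adjacent_pairs
        carried_weight_assigned_le_slack)
qed

end

theorem (in cnf) satisfiable_iff_packs: "satisfiable \<longleftrightarrow> (\<exists>\<beta>. packs \<beta>)"
proof
  assume satisfiable
  then obtain \<alpha> where "satisfies \<alpha>" unfolding satisfiable_def by blast
  then interpret assigned_cnf num_vars num_clauses occ \<alpha> by unfold_locales
  show "\<exists>\<beta>. packs \<beta>" using packs_assigned_bin by blast
next
  assume "\<exists>\<beta>. packs \<beta>"
  then obtain \<beta> where "packs \<beta>" by blast
  then interpret packed_cnf num_vars num_clauses occ \<beta> by unfold_locales
  show satisfiable unfolding satisfiable_def using satisfies_packed_assignment by blast
qed

section \<open>Computations as satisfying assignments\<close>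

locale ntm =
  fixes M :: turing_machine and tr :: "((nat \<times> nat list) \<times> (nat \<times> (nat \<times> head_move) list)) list" and D :: nat
  assumes well_formed: "well_formed M" and set_tr: "set tr = trans M" and D_ge_3: "D \<ge> 3"
    and tr_bounds: "\<And>q rs q' ws. ((q, rs), (q', ws)) \<in> set tr \<Longrightarrow>
      q < D \<and> q' < D \<and> set rs \<subseteq> {..<D} \<and> fst ` set ws \<subseteq> {..<D}"
begin

text \<open>The state is treated as a further tape, and all tapes are viewed relative to their heads.
  Moves are encoded by \<open>0\<close>, \<open>1\<close>, \<open>2\<close>.\<close>

abbreviation state_tape :: nat where "state_tape \<equiv> tapes M"
abbreviation idle :: nat where "idle \<equiv> length tr"

definition read_sym :: "nat \<Rightarrow> nat \<Rightarrow> nat" where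
  "read_sym r i = (if r < idle then case tr ! r of ((q, rs), _) \<Rightarrow> if i < tapes M then rs ! i else q else 0)"

definition write_sym :: "nat \<Rightarrow> nat \<Rightarrow> nat" where
  "write_sym r i = (if r < idle then case tr ! r of (_, (q', ws)) \<Rightarrow> if i < tapes M then fst (ws ! i) else q' else 0)"

definition move :: "nat \<Rightarrow> nat \<Rightarrow> nat" where
  "move r i = (if r < idle \<and> i < tapes M then nat (shift (snd (snd (snd (tr ! r)) ! i)) + 1) else 1)"

definition view :: "config \<Rightarrow> nat \<Rightarrow> int \<Rightarrow> nat" where
  "view c i p = (if i < tapes M then fst (snd c ! i) (snd (snd c ! i) + p) else if p = 0 then fst c else 0)"

definition enabled :: "nat \<Rightarrow> config \<Rightarrow> bool" where
  "enabled r c \<longleftrightarrow> (\<forall>i\<le>state_tape. view c i 0 = read_sym r i)"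

definition follows :: "nat \<Rightarrow> config \<Rightarrow> config \<Rightarrow> bool" where
  "follows r c c' \<longleftrightarrow> (\<forall>i\<le>state_tape. \<forall>p. view c' i p =
     (let p' = p + int (move r i) - 1 in if r < idle \<and> p' = 0 then write_sym r i else view c i p'))"

lemma tapes_pos: "tapes M \<ge> 1" using well_formed by (simp add: well_formed_def)

lemma tr_lengths:
  assumes "r < idle" "tr ! r = ((q, rs), (q', ws))"
  shows "length rs = tapes M" "length ws = tapes M" "((q, rs), (q', ws)) \<in> trans M"
proof -
  show "((q, rs), (q', ws)) \<in> trans M" using assms set_tr by (metis nth_mem)
  then show "length rs = tapes M" "length ws = tapes M" using well_formed unfolding well_formed_def by auto
qed

lemma read_write_less:
  assumes r: "r < idle"
  shows "read_sym r i < D" "write_sym r i < D"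
proof -
  obtain q rs q' ws where transition: "tr ! r = ((q, rs), (q', ws))" by (metis prod.exhaust)
  then have "((q, rs), (q', ws)) \<in> set tr" using r by (metis nth_mem)
  then have bounds: "q < D" "q' < D" "set rs \<subseteq> {..<D}" "fst ` set ws \<subseteq> {..<D}" using tr_bounds by blast+
  have "rs ! i \<in> set rs" "ws ! i \<in> set ws" if "i < tapes M" using that tr_lengths[OF r transition] by simp_all
  then show "read_sym r i < D" "write_sym r i < D"
    using bounds transition by (auto simp: read_sym_def write_sym_def)
qed

lemma shift_bounds: "- 1 \<le> shift h" "shift h \<le> 1"
  by (cases h; simp)+

lemma move_le: "move r i \<le> 2"
  using shift_bounds by (simp add: move_def nat_le_iff)

lemma shift_eq_move:
  assumes "r < idle" "tr ! r = ((q, rs), (q', ws))" "i < tapes M"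
  shows "shift (snd (ws ! i)) = int (move r i) - 1"
  using shift_bounds(1)[of "snd (ws ! i)"] assms by (simp add: move_def)

lemma follows_idle: "follows idle c c"
  by (simp add: follows_def move_def)

lemma enabled_iff:
  assumes r: "r < idle" and transition: "tr ! r = ((q, rs), (q', ws))" and ts: "length ts = tapes M"
  shows "enabled r (q\<^sub>0, ts) \<longleftrightarrow> q\<^sub>0 = q \<and> map read_tape ts = rs"
proof -
  have view: "view (q\<^sub>0, ts) i 0 = (if i < tapes M then map read_tape ts ! i else q\<^sub>0)" for i
    using ts by (cases "ts ! i") (auto simp: view_def)
  have read: "read_sym r i = (if i < tapes M then rs ! i else q)" for i
    using r transition by (simp add: read_sym_def)
  have "enabled r (q\<^sub>0, ts) \<longleftrightarrow> q\<^sub>0 = q \<and> (\<forall>i<tapes M. map read_tape ts ! i = rs ! i)"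
    unfolding enabled_def view read by (auto simp: le_less)
  also have "(\<forall>i<tapes M. map read_tape ts ! i = rs ! i) \<longleftrightarrow> map read_tape ts = rs"
    using ts tr_lengths(1)[OF r transition] by (simp add: list_eq_iff_nth_eq)
  finally show ?thesis .
qed

lemma follows_update_tape:
  assumes r: "r < idle" and transition: "tr ! r = ((q, rs), (q', ws))" and ts: "length ts = tapes M"
  shows "follows r (q\<^sub>0, ts) (q', map2 update_tape ws ts)"
  unfolding follows_def
proof (intro allI impI)
  fix i p assume "i \<le> state_tape"
  show "view (q', map2 update_tape ws ts) i p =
    (let p' = p + int (move r i) - 1 in if r < idle \<and> p' = 0 then write_sym r i else view (q\<^sub>0, ts) i p')"
  proof (cases "i < tapes M")
    case True
    obtain tape head where tape: "ts ! i = (tape, head)" by force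
    obtain a h where action: "ws ! i = (a, h)" by force
    have new_position: "p + int (move r i) - 1 = p + shift h" using shift_eq_move[OF r transition True] action
      by simp
    have "map2 update_tape ws ts ! i = (tape(head := a), head + shift h)"
      using True tr_lengths(2)[OF r transition] ts tape action by simp
    then show ?thesis unfolding new_position Let_def using True r transition tape action
      by (auto simp: view_def write_sym_def ac_simps)
  next
    case False
    then show ?thesis using r transition by (auto simp: view_def write_sym_def move_def)
  qed
qed

lemma stepE:
  assumes "(c, c') \<in> step M" "length (snd c) = tapes M"
  obtains r where "r < idle" "enabled r c" "follows r c c'" "length (snd c') = tapes M"
proof -
  obtain q ts q' ws where c: "c = (q, ts)" "c' = (q', map2 update_tape ws ts)"
    "((q, map read_tape ts), (q', ws)) \<in> trans M"
    using assms(1) by (auto simp: step_def)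
  then obtain r where r: "r < idle" "tr ! r = ((q, map read_tape ts), (q', ws))"
    using set_tr by (metis in_set_conv_nth)
  have ts: "length ts = tapes M" using assms(2) c by simp
  show thesis
  proof (rule that[OF r(1)])
    show "enabled r c" using enabled_iff[OF r ts] c by simp
    show "follows r c c'" using follows_update_tape[OF r ts] c by simp
    show "length (snd c') = tapes M" using tr_lengths(2)[OF r] ts c by simp
  qed
qed

lemma enabled_step:
  assumes "r < idle" "length (snd c) = tapes M" "enabled r c"
  obtains c' where "(c, c') \<in> step M" "follows r c c'" "length (snd c') = tapes M"
proof -
  obtain q rs q' ws where transition: "tr ! r = ((q, rs), (q', ws))" by (metis prod.exhaust)
  note lengths = tr_lengths[OF assms(1) transition]
  obtain q\<^sub>0 ts where c: "c = (q\<^sub>0, ts)" by force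
  then have ts: "length ts = tapes M" using assms(2) by simp
  have "q\<^sub>0 = q" "map read_tape ts = rs" using enabled_iff[OF assms(1) transition ts] assms(3) c by simp_all
  then have "(c, (q', map2 update_tape ws ts)) \<in> step M" using lengths(3) c by (auto simp: step_def)
  then show thesis using that follows_update_tape[OF assms(1) transition ts] lengths(2) ts c by simp
qed

definition start_symbol :: "bool list \<Rightarrow> nat \<Rightarrow> nat \<Rightarrow> nat \<Rightarrow> nat" where
  "start_symbol w C i p = (if i = 0 \<and> C \<le> p then word_content w (int (p - C)) else 0)"

lemma start_symbol_less: "start_symbol w C i p < D"
  using D_ge_3 by (auto simp: start_symbol_def word_content_def)

lemma length_initial: "length (snd (initial M w)) = tapes M"
  using tapes_pos by (simp add: initial_def)

lemma view_initial:
  assumes "i \<le> state_tape"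
  shows "view (initial M w) i (int p - int C) = start_symbol w C i p"
proof (cases "i < tapes M")
  case True
  then have "snd (initial M w) ! i = (if i = 0 then word_content w else (\<lambda>_. 0), 0)"
    by (cases i) (auto simp: initial_def)
  then show ?thesis using True by (auto simp: view_def start_symbol_def word_content_def of_nat_diff)
next
  case False
  then show ?thesis using tapes_pos by (auto simp: view_def initial_def start_symbol_def)
qed

end

text \<open>\<open>Applied t r\<close>: transition \<open>r\<close> is taken at time \<open>t\<close>; \<open>Holds t i p a\<close>: at time \<open>t\<close> tape \<open>i\<close> has symbol \<open>a\<close>
  at distance \<open>p - C\<close> from its head. Only the cells that can still reach the head by time \<open>N\<close> matter.\<close>

datatype tableau_var = Applied nat nat | Holds nat nat nat nat

datatype tableau_literal = Positive tableau_var | Negative tableau_var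

datatype constraint =
    Transition nat
  | Reads nat nat nat
  | Writes nat nat nat
  | Keeps nat nat nat nat nat
  | Unique nat nat nat nat nat
  | Starts nat nat
  | Accepts
  | Halts nat

primrec true_literal :: "(tableau_var \<Rightarrow> bool) \<Rightarrow> tableau_literal \<Rightarrow> bool" where
  "true_literal \<alpha> (Positive x) \<longleftrightarrow> \<alpha> x"
| "true_literal \<alpha> (Negative x) \<longleftrightarrow> \<not> \<alpha> x"

context ntm
begin

primrec relevant :: "nat \<Rightarrow> nat \<Rightarrow> constraint \<Rightarrow> bool" where
  "relevant N C (Transition t) \<longleftrightarrow> t < N"
| "relevant N C (Reads t r i) \<longleftrightarrow> t < N \<and> r < idle \<and> i \<le> state_tape"
| "relevant N C (Writes t r i) \<longleftrightarrow> t < N \<and> r < idle \<and> i \<le> state_tape"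
| "relevant N C (Keeps t r i p a) \<longleftrightarrow>
     t < N \<and> r \<le> idle \<and> i \<le> state_tape \<and> 1 \<le> p \<and> p \<le> 2 * C \<and> (p \<noteq> C \<or> r = idle) \<and> a < D"
| "relevant N C (Unique t i p a b) \<longleftrightarrow> t \<le> N \<and> i \<le> state_tape \<and> p \<le> 2 * C \<and> a < D \<and> b < D \<and> a \<noteq> b"
| "relevant N C (Starts i p) \<longleftrightarrow> i \<le> state_tape \<and> p \<le> 2 * C"
| "relevant N C Accepts \<longleftrightarrow> True"
| "relevant N C (Halts r) \<longleftrightarrow> r < idle"

primrec clause :: "bool list \<Rightarrow> nat \<Rightarrow> nat \<Rightarrow> constraint \<Rightarrow> tableau_literal set" where
  "clause w N C (Transition t) = {Positive (Applied t r) |r. r \<le> idle}"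
| "clause w N C (Reads t r i) = {Negative (Applied t r), Positive (Holds t i C (read_sym r i))}"
| "clause w N C (Writes t r i) =
     {Negative (Applied t r), Positive (Holds (t + 1) i (C + 1 - move r i) (write_sym r i))}"
| "clause w N C (Keeps t r i p a) =
     {Negative (Applied t r), Negative (Holds t i p a), Positive (Holds (t + 1) i (p + 1 - move r i) a)}"
| "clause w N C (Unique t i p a b) = {Negative (Holds t i p a), Negative (Holds t i p b)}"
| "clause w N C (Starts i p) = {Positive (Holds 0 i p (start_symbol w C i p))}"
| "clause w N C Accepts = {Positive (Holds N state_tape C 1)}"
| "clause w N C (Halts r) = {Negative (Holds N i C (read_sym r i)) |i. i \<le> state_tape}"

definition tableau :: "bool list \<Rightarrow> nat \<Rightarrow> nat \<Rightarrow> (tableau_var \<Rightarrow> bool) \<Rightarrow> bool" where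
  "tableau w N C \<alpha> \<longleftrightarrow> (\<forall>\<kappa>. relevant N C \<kappa> \<longrightarrow> (\<exists>x\<in>clause w N C \<kappa>. true_literal \<alpha> x))"

primrec run_assignment :: "nat \<Rightarrow> (nat \<Rightarrow> nat) \<Rightarrow> (nat \<Rightarrow> config) \<Rightarrow> tableau_var \<Rightarrow> bool" where
  "run_assignment C \<rho> g (Applied t r) \<longleftrightarrow> r = \<rho> t"
| "run_assignment C \<rho> g (Holds t i p a) \<longleftrightarrow> view (g t) i (int p - int C) = a"

lemma padded_run:
  assumes "(initial M w, c) \<in> step M ^^ j" "j \<le> N"
  obtains g \<rho> where "g 0 = initial M w" "g N = c" "\<And>t. length (snd (g t)) = tapes M" "\<And>t. \<rho> t \<le> idle"
    "\<And>t. \<rho> t < idle \<Longrightarrow> enabled (\<rho> t) (g t)" "\<And>t. follows (\<rho> t) (g t) (g (Suc t))"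
proof -
  obtain f where f: "f 0 = initial M w" "f j = c" "\<And>t. t < j \<Longrightarrow> (f t, f (Suc t)) \<in> step M"
    using assms(1) unfolding relpow_fun_conv by blast
  define g where "g t = f (min t j)" for t
  have step: "(g t, g (Suc t)) \<in> step M" if "t < j" for t using f(3)[OF that] that by (simp add: g_def)
  have unchanged: "g (Suc t) = g t" if "\<not> t < j" for t using that by (simp add: g_def)
  have length: "length (snd (g t)) = tapes M" for t
  proof (induction t)
    case 0
    then show ?case using f(1) length_initial by (simp add: g_def)
  next
    case (Suc t)
    then show ?case using stepE[OF step Suc] unchanged[of t] by (cases "t < j") auto
  qed
  have "\<exists>r\<le>idle. (r < idle \<longrightarrow> enabled r (g t)) \<and> follows r (g t) (g (Suc t))" for t
  proof (cases "t < j")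
    case True
    from stepE[OF step[OF True] length] show ?thesis by (metis less_imp_le)
  next
    case False
    then show ?thesis using unchanged follows_idle by (intro exI[of _ idle]) simp
  qed
  then obtain \<rho> where "\<And>t. \<rho> t \<le> idle" "\<And>t. \<rho> t < idle \<Longrightarrow> enabled (\<rho> t) (g t)" "\<And>t. follows (\<rho> t) (g t) (g (Suc t))"
    by metis
  moreover have "g 0 = initial M w" "g N = c" using f assms(2) by (simp_all add: g_def)
  ultimately show thesis using that length by blast
qed

lemma tableau_run_assignment:
  assumes start: "g 0 = initial M w" and lengths: "length (snd (g N)) = tapes M" and \<rho>: "\<And>t. \<rho> t \<le> idle"
    and enabled: "\<And>t. \<rho> t < idle \<Longrightarrow> enabled (\<rho> t) (g t)" and follows: "\<And>t. follows (\<rho> t) (g t) (g (Suc t))"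
    and accepting: "fst (g N) = 1" and halted: "g N \<notin> Domain (step M)" and C: "C \<ge> 1"
  shows "tableau w N C (run_assignment C \<rho> g)"
  unfolding tableau_def
proof (intro allI impI)
  fix \<kappa> assume relevant: "relevant N C \<kappa>"
  have next_view: "view (g (Suc t)) i (int (p + 1 - move (\<rho> t) i) - int C) =
      (if \<rho> t < idle \<and> p = C then write_sym (\<rho> t) i else view (g t) i (int p - int C))"
    if "i \<le> state_tape" "1 \<le> p" for t i p
  proof -
    have "int (p + 1 - move (\<rho> t) i) - int C + int (move (\<rho> t) i) - 1 = int p - int C"
      using that(2) move_le[of "\<rho> t" i] by linarith
    then show ?thesis using follows[of t] that(1) by (simp add: follows_def Let_def)
  qed
  show "\<exists>x\<in>clause w N C \<kappa>. true_literal (run_assignment C \<rho> g) x"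
  proof (cases \<kappa>)
    case (Transition t)
    then show ?thesis using \<rho>[of t] by auto
  next
    case (Reads t r i)
    then show ?thesis using relevant enabled[of t] by (auto simp: enabled_def)
  next
    case (Writes t r i)
    then show ?thesis using relevant next_view[of i C t] C by auto
  next
    case (Keeps t r i p a)
    then show ?thesis using relevant next_view[of i p t] by auto
  next
    case (Starts i p)
    then show ?thesis using relevant view_initial start by simp
  next
    case (Halts r)
    have "\<not> enabled r (g N)" using Halts relevant halted enabled_step[OF _ lengths, of r] by auto
    then show ?thesis using Halts by (auto simp: enabled_def)
  qed (use relevant accepting in \<open>auto simp: view_def\<close>)
qed

lemma accepts_imp_tableau:
  assumes accepts: "accepts M w" and time: "\<And>j c. (initial M w, c) \<in> step M ^^ j \<Longrightarrow> j \<le> N" and C: "C \<ge> 1"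
  shows "\<exists>\<alpha>. tableau w N C \<alpha>"
proof -
  obtain c where c: "(initial M w, c) \<in> (step M)\<^sup>*" "c \<notin> Domain (step M)" "fst c = 1"
    using accepts by (auto simp: accepts_def halts_in_def)
  obtain j where j: "(initial M w, c) \<in> step M ^^ j" using c(1) rtrancl_imp_relpow by blast
  obtain g \<rho> where run: "g 0 = initial M w" "g N = c" "\<And>t. length (snd (g t)) = tapes M" "\<And>t. \<rho> t \<le> idle"
    "\<And>t. \<rho> t < idle \<Longrightarrow> enabled (\<rho> t) (g t)" "\<And>t. follows (\<rho> t) (g t) (g (Suc t))"
    by (rule padded_run[OF j time[OF j]]) blast
  have "tableau w N C (run_assignment C \<rho> g)"
    using c run(2) run(3)[of N] by (intro tableau_run_assignment run C) simp_all
  then show ?thesis by blast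
qed

definition symbols_bounded :: "config \<Rightarrow> bool" where
  "symbols_bounded c \<longleftrightarrow> (\<forall>i\<le>state_tape. \<forall>p. view c i p < D)"

definition describes :: "(tableau_var \<Rightarrow> bool) \<Rightarrow> nat \<Rightarrow> nat \<Rightarrow> nat \<Rightarrow> config \<Rightarrow> bool" where
  "describes \<alpha> N C t c \<longleftrightarrow>
     (\<forall>i\<le>state_tape. \<forall>p. \<bar>p\<bar> \<le> int N - int t \<longrightarrow> \<alpha> (Holds t i (nat (int C + p)) (view c i p)))"

lemma tableauD: "tableau w N C \<alpha> \<Longrightarrow> relevant N C \<kappa> \<Longrightarrow> \<exists>x\<in>clause w N C \<kappa>. true_literal \<alpha> x"
  by (simp add: tableau_def)

lemma symbols_bounded_initial: "symbols_bounded (initial M w)"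
  unfolding symbols_bounded_def
proof (intro allI impI)
  fix i p assume "i \<le> state_tape"
  then show "view (initial M w) i p < D"
    using D_ge_3 tapes_pos by (cases i) (auto simp: view_def initial_def word_content_def)
qed

lemma symbols_bounded_follows:
  assumes "symbols_bounded c" "follows r c c'" shows "symbols_bounded c'"
  using assms read_write_less(2)[of r] unfolding symbols_bounded_def follows_def by (simp add: Let_def)

lemma describes_initial:
  assumes tableau: "tableau w N C \<alpha>" and C: "C > N"
  shows "describes \<alpha> N C 0 (initial M w)"
  unfolding describes_def
proof (intro allI impI)
  fix i p assume i: "i \<le> state_tape" and p: "\<bar>p\<bar> \<le> int N - int 0"
  have "int (nat (int C + p)) - int C = p" "nat (int C + p) \<le> 2 * C" using p C by auto
  then show "\<alpha> (Holds 0 i (nat (int C + p)) (view (initial M w) i p))"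
    using tableauD[OF tableau, of "Starts i (nat (int C + p))"] view_initial[OF i, of w "nat (int C + p)" C] i
      by simp
qed

lemma describes_head:
  assumes "describes \<alpha> N C t c" "t \<le> N" "i \<le> state_tape"
  shows "\<alpha> (Holds t i C (view c i 0))"
proof -
  have "\<bar>0\<bar> \<le> int N - int t" using assms(2) by simp
  then have "\<alpha> (Holds t i (nat (int C + 0)) (view c i 0))" using assms(1,3) unfolding describes_def by blast
  then show ?thesis by simp
qed

lemma describes_imp_view_eq:
  assumes tableau: "tableau w N C \<alpha>" and c: "describes \<alpha> N C t c" "symbols_bounded c"
    and t: "t \<le> N" and i: "i \<le> state_tape" and a: "a < D" "\<alpha> (Holds t i C a)"
  shows "view c i 0 = a"
proof (rule ccontr)
  assume neq: "view c i 0 \<noteq> a"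
  show False
    using describes_head[OF c(1) t i] tableauD[OF tableau, of "Unique t i C (view c i 0) a"] c(2) t i a neq
      by (auto simp: symbols_bounded_def)
qed

lemma describes_imp_enabled:
  assumes tableau: "tableau w N C \<alpha>" and c: "describes \<alpha> N C t c" "symbols_bounded c"
    and r: "t < N" "r < idle" "\<alpha> (Applied t r)"
  shows "enabled r c"
  unfolding enabled_def
proof (intro allI impI)
  fix i assume i: "i \<le> state_tape"
  have "\<alpha> (Holds t i C (read_sym r i))" using tableauD[OF tableau, of "Reads t r i"] r i by simp
  then show "view c i 0 = read_sym r i" using describes_imp_view_eq[OF tableau c] r i read_write_less(1) by simp
qed

lemma describes_follows:
  assumes tableau: "tableau w N C \<alpha>" and C: "C > N" and c: "describes \<alpha> N C t c" "symbols_bounded c"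
    and r: "t < N" "r \<le> idle" "\<alpha> (Applied t r)" and follows: "follows r c c'"
  shows "describes \<alpha> N C (Suc t) c'"
  unfolding describes_def
proof (intro allI impI)
  fix i p assume i: "i \<le> state_tape" and p: "\<bar>p\<bar> \<le> int N - int (Suc t)"
  let ?p = "p + int (move r i) - 1"
  let ?old = "nat (int C + ?p)"
  have view: "view c' i p = (if r < idle \<and> ?p = 0 then write_sym r i else view c i ?p)"
    using follows i by (simp add: follows_def Let_def)
  have old: "\<bar>?p\<bar> \<le> int N - int t" "1 \<le> ?old" "?old \<le> 2 * C" "?old = C \<longleftrightarrow> ?p = 0"
    "?old + 1 - move r i = nat (int C + p)"
    using p C move_le[of r i] r(1) by linarith+
  show "\<alpha> (Holds (Suc t) i (nat (int C + p)) (view c' i p))"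
  proof (cases "r < idle \<and> ?p = 0")
    case True
    then have "C + 1 - move r i = nat (int C + p)" using old(4,5) by simp
    then show ?thesis using tableauD[OF tableau, of "Writes t r i"] True view r i by simp
  next
    case False
    have "\<alpha> (Holds t i ?old (view c i ?p))" "view c i ?p < D"
      using c old(1) i by (auto simp: describes_def symbols_bounded_def)
    then have "\<alpha> (Holds (t + 1) i (?old + 1 - move r i) (view c i ?p))"
      using tableauD[OF tableau, of "Keeps t r i ?old (view c i ?p)"] False r i old(2-4) by auto
    moreover have "view c' i p = view c i ?p" unfolding view using False by (rule if_not_P)
    ultimately show ?thesis using old(5) by simp
  qed
qed

lemma tableau_run:
  assumes tableau: "tableau w N C \<alpha>" and C: "C > N" and "t \<le> N"
  shows "\<exists>c. (initial M w, c) \<in> (step M)\<^sup>* \<and> length (snd c) = tapes M \<and> symbols_bounded c \<and> describes \<alpha> N C t c"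
  using \<open>t \<le> N\<close>
proof (induction t)
  case 0
  then show ?case
    using length_initial symbols_bounded_initial describes_initial[OF tableau C] by blast
next
  case (Suc t)
  then obtain c where c: "(initial M w, c) \<in> (step M)\<^sup>*" "length (snd c) = tapes M" "symbols_bounded c"
    "describes \<alpha> N C t c"
    by auto
  obtain r where r: "r \<le> idle" "\<alpha> (Applied t r)" using tableauD[OF tableau, of "Transition t"] Suc.prems by auto
  note describes = describes_follows[OF tableau C c(4,3) _ r]
  show ?case
  proof (cases "r < idle")
    case True
    then have "enabled r c" using describes_imp_enabled[OF tableau c(4,3)] r(2) Suc.prems by simp
    with True c(2) obtain c' where c': "(c, c') \<in> step M" "follows r c c'" "length (snd c') = tapes M"
      by (rule enabled_step)
    have "describes \<alpha> N C (Suc t) c'" using describes[OF _ c'(2)] Suc.prems by simp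
    moreover have "(initial M w, c') \<in> (step M)\<^sup>*" using c(1) c'(1) by (rule rtrancl_into_rtrancl)
    ultimately show ?thesis using c'(3) symbols_bounded_follows[OF c(3) c'(2)] by blast
  next
    case False
    then have "follows r c c" using follows_idle r(1) by simp
    then have "describes \<alpha> N C (Suc t) c" using describes Suc.prems by simp
    then show ?thesis using c(1-3) by blast
  qed
qed

lemma tableau_imp_accepts:
  assumes tableau: "tableau w N C \<alpha>" and C: "C > N"
  shows "accepts M w"
proof -
  obtain c where c: "(initial M w, c) \<in> (step M)\<^sup>*" "length (snd c) = tapes M" "symbols_bounded c"
    "describes \<alpha> N C N c"
    using tableau_run[OF tableau C order_refl] by blast
  have "\<alpha> (Holds N state_tape C 1)" using tableauD[OF tableau, of Accepts] by simp
  then have "fst c = 1" using describes_imp_view_eq[OF tableau c(4,3), of state_tape 1] D_ge_3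
    by (simp add: view_def)
  moreover have "c \<notin> Domain (step M)"
  proof
    assume "c \<in> Domain (step M)"
    then obtain r where r: "r < idle" "enabled r c" using stepE[OF _ c(2)] by blast
    obtain i where "i \<le> state_tape" "\<not> \<alpha> (Holds N i C (read_sym r i))"
      using tableauD[OF tableau, of "Halts r"] r(1) by auto
    then show False using describes_head[OF c(4) order_refl] r(2) by (simp add: enabled_def)
  qed
  ultimately show ?thesis unfolding accepts_def halts_in_def using c(1) by blast
qed

end

fun encode :: "nat \<Rightarrow> nat list \<Rightarrow> nat" where
  "encode F [] = 0"
| "encode F (x # xs) = x + F * encode F xs"

definition digit :: "nat \<Rightarrow> nat \<Rightarrow> nat \<Rightarrow> nat" where
  "digit F j x = x div F ^ j mod F"

lemma encode_less: "\<forall>x\<in>set xs. x < F \<Longrightarrow> encode F xs < F ^ length xs"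
proof (induction xs)
  case (Cons x xs)
  then have "encode F xs + 1 \<le> F ^ length xs" by simp
  then have "F * (encode F xs + 1) \<le> F * F ^ length xs" by (rule mult_le_mono2)
  then show ?case using Cons.prems by simp
qed simp

lemma digit_encode: "\<forall>x\<in>set xs. x < F \<Longrightarrow> j < length xs \<Longrightarrow> digit F j (encode F xs) = xs ! j"
proof (induction xs arbitrary: j)
  case (Cons x xs)
  have x: "x < F" using Cons.prems by simp
  show ?case
  proof (cases j)
    case 0
    then show ?thesis using x by (simp add: digit_def)
  next
    case (Suc i)
    have "(x + F * encode F xs) div F ^ Suc i = encode F xs div F ^ i"
      using x by (simp add: div_mult2_eq)
    then show ?thesis using Cons Suc by (simp add: digit_def)
  qed
qed simp

lemma encode_digits: "x < F ^ n \<Longrightarrow> encode F (map (\<lambda>j. digit F j x) [0..<n]) = x"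
proof (induction n arbitrary: x)
  case (Suc n)
  have "x div F < F ^ n" using Suc.prems by (simp add: less_mult_imp_div_less mult.commute)
  moreover have "digit F (Suc j) x = digit F j (x div F)" for j by (simp add: digit_def div_mult2_eq)
  ultimately have "encode F (map (\<lambda>j. digit F (Suc j) x) [0..<n]) = x div F" using Suc.IH by simp
  moreover have "map (\<lambda>j. digit F j x) [0..<Suc n] = digit F 0 x # map (\<lambda>j. digit F (Suc j) x) [0..<n]"
    by (simp add: upt_conv_Cons map_Suc_upt[symmetric] del: upt_Suc)
  ultimately show ?case by (simp add: digit_def)
qed simp

primrec var_digits :: "tableau_var \<Rightarrow> nat list" where
  "var_digits (Applied t r) = [0, t, r, 0, 0]"
| "var_digits (Holds t i p a) = [1, t, i, p, a]"

definition var_of_digits :: "(nat \<Rightarrow> nat) \<Rightarrow> tableau_var" where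
  "var_of_digits d = (if d 0 = 0 then Applied (d 1) (d 2) else Holds (d 1) (d 2) (d 3) (d 4))"

primrec literal_var :: "tableau_literal \<Rightarrow> tableau_var" where
  "literal_var (Positive x) = x"
| "literal_var (Negative x) = x"

primrec literal_code :: "nat \<Rightarrow> tableau_literal \<Rightarrow> nat" where
  "literal_code F (Positive x) = 2 * encode F (var_digits x)"
| "literal_code F (Negative x) = 2 * encode F (var_digits x) + 1"

primrec constraint_digits :: "constraint \<Rightarrow> nat list" where
  "constraint_digits (Transition t) = [0, t, 0, 0, 0, 0, 0]"
| "constraint_digits (Reads t r i) = [1, t, r, i, 0, 0, 0]"
| "constraint_digits (Writes t r i) = [2, t, r, i, 0, 0, 0]"
| "constraint_digits (Keeps t r i p a) = [3, t, r, i, p, a, 0]"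
| "constraint_digits (Unique t i p a b) = [4, t, 0, i, p, a, b]"
| "constraint_digits (Starts i p) = [5, 0, 0, i, p, 0, 0]"
| "constraint_digits Accepts = [6, 0, 0, 0, 0, 0, 0]"
| "constraint_digits (Halts r) = [7, 0, r, 0, 0, 0, 0]"

definition constraint_of_digits :: "(nat \<Rightarrow> nat) \<Rightarrow> constraint" where
  "constraint_of_digits d =
    (if d 0 = 0 then Transition (d 1)
     else if d 0 = 1 then Reads (d 1) (d 2) (d 3)
     else if d 0 = 2 then Writes (d 1) (d 2) (d 3)
     else if d 0 = 3 then Keeps (d 1) (d 2) (d 3) (d 4) (d 5)
     else if d 0 = 4 then Unique (d 1) (d 3) (d 4) (d 5) (d 6)
     else if d 0 = 5 then Starts (d 3) (d 4)
     else if d 0 = 6 then Accepts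
     else Halts (d 2))"

lemma length_digits: "length (var_digits x) = 5" "length (constraint_digits \<kappa>) = 7"
  by (cases x; simp) (cases \<kappa>; simp)

lemma var_of_digits_nth: "var_of_digits ((!) (var_digits x)) = x"
  by (cases x) (simp_all add: var_of_digits_def eval_nat_numeral)

lemma constraint_of_digits_nth: "constraint_of_digits ((!) (constraint_digits \<kappa>)) = \<kappa>"
  by (cases \<kappa>) (simp_all add: constraint_of_digits_def eval_nat_numeral)

lemma var_of_digits_encode:
  assumes "\<forall>a\<in>set (var_digits x). a < F"
  shows "var_of_digits (\<lambda>j. digit F j (encode F (var_digits x))) = x"
proof -
  have "var_of_digits (\<lambda>j. digit F j (encode F (var_digits x))) = var_of_digits ((!) (var_digits x))"
    by (simp add: var_of_digits_def digit_encode[OF assms] length_digits)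
  then show ?thesis by (simp add: var_of_digits_nth)
qed

lemma constraint_of_digits_encode:
  assumes "\<forall>a\<in>set (constraint_digits \<kappa>). a < F"
  shows "constraint_of_digits (\<lambda>j. digit F j (encode F (constraint_digits \<kappa>))) = \<kappa>"
proof -
  have "constraint_of_digits (\<lambda>j. digit F j (encode F (constraint_digits \<kappa>))) =
      constraint_of_digits ((!) (constraint_digits \<kappa>))"
    by (simp add: constraint_of_digits_def digit_encode[OF assms] length_digits)
  then show ?thesis by (simp add: constraint_of_digits_nth)
qed

lemma literal_literal_code: "literal \<alpha> (literal_code F x) \<longleftrightarrow> true_literal (\<lambda>y. \<alpha> (encode F (var_digits y))) x"
  by (cases x) (simp_all add: literal_def)

lemma literal_code_less:
  assumes "\<forall>a\<in>set (var_digits (literal_var x)). a < F"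
  shows "literal_code F x < 2 * F ^ 5"
  using encode_less[OF assms] by (cases x) (simp_all add: length_digits)

context ntm
begin

abbreviation digit_bound :: "nat \<Rightarrow> nat \<Rightarrow> nat" where
  "digit_bound N C \<equiv> N + 2 * C + D + idle + tapes M + 8"

definition occurs :: "bool list \<Rightarrow> nat \<Rightarrow> nat \<Rightarrow> nat \<Rightarrow> nat \<Rightarrow> nat \<Rightarrow> bool" where
  "occurs w N C F l c \<longleftrightarrow> (let \<kappa> = constraint_of_digits (\<lambda>j. digit F j c) in
     relevant N C \<kappa> \<and> l \<in> literal_code F ` clause w N C \<kappa>)"

lemma clause_nonempty: "clause w N C \<kappa> \<noteq> {}"
  by (cases \<kappa>) auto

lemma clause_digits_less:
  assumes "relevant N C \<kappa>" "x \<in> clause w N C \<kappa>" "F \<ge> digit_bound N C"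
  shows "\<forall>a\<in>set (var_digits (literal_var x)). a < F"
proof -
  have less: "read_sym r i < F" "write_sym r i < F" if "r < idle" for r i
    using read_write_less[OF that, of i] assms(3) by linarith+
  have start: "start_symbol w C i p < F" for i p
    using start_symbol_less[of w C i p] assms(3) by linarith
  show ?thesis using assms less start by (cases \<kappa>) auto
qed

lemma constraint_digits_less:
  assumes "relevant N C \<kappa>" "F \<ge> digit_bound N C"
  shows "\<forall>a\<in>set (constraint_digits \<kappa>). a < F"
  using assms by (cases \<kappa>) auto

lemma satisfiable_imp_tableau:
  assumes F: "F \<ge> digit_bound N C" and sat: "cnf.satisfiable (F ^ 5) (F ^ 7) (occurs w N C F)"
  shows "\<exists>\<alpha>. tableau w N C \<alpha>"
proof -
  obtain \<alpha> where true_literal: "\<And>c l. c < F ^ 7 \<Longrightarrow> l < 2 * F ^ 5 \<Longrightarrow> occurs w N C F l c \<Longrightarrow>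
      \<exists>l<2 * F ^ 5. occurs w N C F l c \<and> literal \<alpha> l"
    using sat unfolding cnf.satisfiable_def cnf.satisfies_def by blast
  have "\<exists>x\<in>clause w N C \<kappa>. true_literal (\<lambda>y. \<alpha> (encode F (var_digits y))) x" if relevant: "relevant N C \<kappa>" for \<kappa>
  proof -
    let ?c = "encode F (constraint_digits \<kappa>)"
    note less = constraint_digits_less[OF relevant F]
    have occurs: "occurs w N C F l ?c \<longleftrightarrow> l \<in> literal_code F ` clause w N C \<kappa>" for l
      using relevant by (simp add: occurs_def constraint_of_digits_encode[OF less])
    obtain x where x: "x \<in> clause w N C \<kappa>" using clause_nonempty by blast
    have "\<exists>l<2 * F ^ 5. occurs w N C F l ?c \<and> literal \<alpha> l"
    proof (rule true_literal)
      show "?c < F ^ 7" using encode_less[OF less] by (simp add: length_digits)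
      show "literal_code F x < 2 * F ^ 5" using clause_digits_less[OF relevant x F] by (rule literal_code_less)
      show "occurs w N C F (literal_code F x) ?c" using x occurs by simp
    qed
    then show ?thesis by (auto simp: occurs literal_literal_code)
  qed
  then show ?thesis unfolding tableau_def by blast
qed

lemma tableau_imp_satisfiable:
  assumes F: "F \<ge> digit_bound N C" and tableau: "tableau w N C \<alpha>"
  shows "cnf.satisfiable (F ^ 5) (F ^ 7) (occurs w N C F)"
proof -
  let ?\<alpha> = "\<lambda>x. \<alpha> (var_of_digits (\<lambda>j. digit F j x))"
  have "\<exists>l<2 * F ^ 5. occurs w N C F l c \<and> literal ?\<alpha> l" if "occurs w N C F l\<^sub>0 c" for c l\<^sub>0
  proof -
    let ?\<kappa> = "constraint_of_digits (\<lambda>j. digit F j c)"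
    have relevant: "relevant N C ?\<kappa>" using that by (simp add: occurs_def Let_def)
    then obtain x where x: "x \<in> clause w N C ?\<kappa>" "true_literal \<alpha> x" using tableauD[OF tableau] by blast
    note less = clause_digits_less[OF relevant x(1) F]
    have "literal ?\<alpha> (literal_code F x)"
      using x(2) var_of_digits_encode[OF less] unfolding literal_literal_code by (cases x) simp_all
    moreover have "occurs w N C F (literal_code F x) c" using relevant x(1) by (simp add: occurs_def Let_def)
    ultimately show ?thesis using literal_code_less[OF less] by blast
  qed
  then have "cnf.satisfies (F ^ 5) (F ^ 7) (occurs w N C F) ?\<alpha>" unfolding cnf.satisfies_def by blast
  then show ?thesis unfolding cnf.satisfiable_def by blast
qed

theorem accepts_iff_satisfiable:
  assumes time: "\<And>j c. (initial M w, c) \<in> step M ^^ j \<Longrightarrow> j \<le> N" and C: "C > N"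
    and F: "F \<ge> digit_bound N C"
  shows "accepts M w \<longleftrightarrow> cnf.satisfiable (F ^ 5) (F ^ 7) (occurs w N C F)"
proof
  assume accepts: "accepts M w"
  have "\<exists>\<alpha>. tableau w N C \<alpha>" by (rule accepts_imp_tableau[OF accepts]) (use time C in auto)
  then obtain \<alpha> where "tableau w N C \<alpha>" by blast
  then show "cnf.satisfiable (F ^ 5) (F ^ 7) (occurs w N C F)" by (rule tableau_imp_satisfiable[OF F])
next
  assume "cnf.satisfiable (F ^ 5) (F ^ 7) (occurs w N C F)"
  then obtain \<alpha> where "tableau w N C \<alpha>" using satisfiable_imp_tableau[OF F] by blast
  then show "accepts M w" using C by (rule tableau_imp_accepts)
qed

end

section \<open>The reduction\<close>

definition RAC_words :: "bool list set" where
  "RAC_words = {adjacency_word n E | n E. simple_graph {..<n} E \<and> admits_RAC_drawing {..<n} E}"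

lemma length_adjacency_word: "length (adjacency_word n E) = n * n"
  by (simp add: adjacency_word_def length_concat comp_def sum_list_triv)

lemma adjacency_word_inject:
  assumes E: "simple_graph {..<n} E" and E': "simple_graph {..<n'} E'"
    and words: "adjacency_word n E = adjacency_word n' E'"
  shows "n = n'" "E = E'"
proof -
  have "n * n = n' * n'" using arg_cong[OF words, of length] by (simp add: length_adjacency_word)
  then show n: "n = n'" using power2_eq_imp_eq[of n n'] by (simp add: power2_eq_square)
  have "map (\<lambda>i. map (\<lambda>j. {i, j} \<in> E) [0..<n]) [0..<n] = map (\<lambda>i. map (\<lambda>j. {i, j} \<in> E') [0..<n]) [0..<n]"
    using words unfolding n adjacency_word_def by (rule concat_injective) (auto simp: set_zip)
  then have pairs: "{i, j} \<in> E \<longleftrightarrow> {i, j} \<in> E'" if "i < n" "j < n" for i j using that by simp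
  have same: "e \<in> E \<longleftrightarrow> e \<in> E'" if e: "e \<subseteq> {..<n}" "card e = 2" for e
  proof -
    obtain i j where "e = {i, j}" using e(2) by (auto simp: card_2_iff)
    then show ?thesis using pairs e(1) by simp
  qed
  have edge: "e \<subseteq> {..<n}" "card e = 2" if "e \<in> E \<or> e \<in> E'" for e
    using that E E' by (auto simp: simple_graph_def n)
  show "E = E'"
  proof (rule set_eqI)
    fix e
    show "e \<in> E \<longleftrightarrow> e \<in> E'" using same[of e] edge[of e] by metis
  qed
qed

lemma adjacency_word_in_RAC_words:
  assumes "simple_graph {..<n} E"
  shows "adjacency_word n E \<in> RAC_words \<longleftrightarrow> admits_RAC_drawing {..<n} E"
  unfolding RAC_words_def using assms adjacency_word_inject[OF assms] by blast

lemma map_upt_rev: "map g [0..<N] = map (\<lambda>i. g (N - 1 - i)) (rev [0..<N])"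
  by (rule nth_equalityI) (simp_all add: rev_nth)

lemma adjacency_word_computable:
  assumes n: "\<And>f. feasible f \<Longrightarrow> feasible (\<lambda>w e. n w (f w e))"
    and adj: "\<And>f x y. feasible f \<Longrightarrow> feasible x \<Longrightarrow> feasible y \<Longrightarrow> feasibleb (\<lambda>w e. adj w (f w e) (x w e) (y w e))"
    and E: "\<And>w x y. x < n w (length w) \<Longrightarrow> y < n w (length w) \<Longrightarrow> {x, y} \<in> E w \<longleftrightarrow> adj w (length w) x y"
  shows "polynomial_time_computable (\<lambda>w. adjacency_word (n w (length w)) (E w))"
proof -
  let ?h = "\<lambda>w j i L. if adj w L (n w L - 1 - i) (n w L - 1 - j) then 1 else (0::nat)"
  have "feasible (\<lambda>w e. ?h w (e 0) (e 1) (e 2))"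
    by (intro feasible_if adj feasible_diff n feasible_var feasible_const)
  note computable = feasible_matrix_computable[OF n[OF feasible_var] this]
  have "adjacency_word (n w (length w)) (E w) = (let L = length w; N = n w L in
      concat (map (\<lambda>i. map (\<lambda>j. ?h w j i L \<noteq> 0) (rev [0..<N])) (rev [0..<N])))" for w
  proof -
    let ?L = "length w" let ?N = "n w ?L"
    have "adjacency_word ?N (E w) = concat (map (\<lambda>i. map (\<lambda>j. adj w ?L i j) [0..<?N]) [0..<?N])"
      unfolding adjacency_word_def by (intro arg_cong[of _ _ concat] map_cong refl E) auto
    also have "\<dots> = concat (map (\<lambda>i. map (\<lambda>j. adj w ?L (?N - 1 - i) (?N - 1 - j)) (rev [0..<?N])) (rev [0..<?N]))"
      by (subst map_upt_rev, subst map_upt_rev) (rule refl)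
    finally show ?thesis unfolding Let_def by (simp only: if_split_eq1) simp
  qed
  then show ?thesis using computable by presburger
qed

lemma sum_div_mod:
  fixes n :: nat
  shows "(\<Sum>i | i < n * n \<and> P (i div n, i mod n). g (i div n, i mod n)) = (\<Sum>x | x \<in> {..<n} \<times> {..<n} \<and> P x. g x)"
proof (rule sum.reindex_bij_witness[where i = "\<lambda>x. fst x * n + snd x" and j = "\<lambda>i. (i div n, i mod n)"])
  fix x assume x: "x \<in> {x. x \<in> {..<n} \<times> {..<n} \<and> P x}"
  then obtain p q where pq: "x = (p, q)" "p < n" "q < n" by auto
  have "p * n + q < (p + 1) * n" using pq by simp
  also have "\<dots> \<le> n * n" using pq by (intro mult_right_mono) auto
  finally have "p * n + q < n * n" .
  then show "((fst x * n + snd x) div n, (fst x * n + snd x) mod n) = x"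
    "fst x * n + snd x \<in> {i. i < n * n \<and> P (i div n, i mod n)}" using pq x by auto
next
  fix i assume i: "i \<in> {i. i < n * n \<and> P (i div n, i mod n)}"
  then have "n > 0" by (cases n) auto
  then show "(i div n, i mod n) \<in> {x. x \<in> {..<n} \<times> {..<n} \<and> P x}" using i by (simp add: less_mult_imp_div_less)
qed simp_all

definition vertices_below :: "nat \<Rightarrow> vertex set" where
  "vertices_below G = {(t, b, k, r). t < G \<and> b < G \<and> k < G \<and> r < G}"

definition vertex_code :: "nat \<Rightarrow> vertex \<Rightarrow> nat" where
  "vertex_code G = (\<lambda>(t, b, k, r). encode G [t, b, k, r])"

definition vertex_of_code :: "nat \<Rightarrow> nat \<Rightarrow> vertex" where
  "vertex_of_code G x = (digit G 0 x, digit G 1 x, digit G 2 x, digit G 3 x)"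

lemma vertex_code_less: "v \<in> vertices_below G \<Longrightarrow> vertex_code G v < G ^ 4"
  using encode_less[of "[fst v, fst (snd v), fst (snd (snd v)), snd (snd (snd v))]" G]
  by (auto simp: vertices_below_def vertex_code_def eval_nat_numeral)

lemma vertex_of_vertex_code:
  assumes "v \<in> vertices_below G" shows "vertex_of_code G (vertex_code G v) = v"
proof -
  obtain t b k r where v: "v = (t, b, k, r)" by (cases v) auto
  have "digit G j (encode G [t, b, k, r]) = [t, b, k, r] ! j" if "j < 4" for j
    using assms that v by (intro digit_encode) (auto simp: vertices_below_def)
  from this[of 0] this[of 1] this[of 2] this[of 3] show ?thesis
    by (simp add: v vertex_of_code_def vertex_code_def eval_nat_numeral del: encode.simps)
qed

lemma vertex_code_of_code: "x < G ^ 4 \<Longrightarrow> vertex_code G (vertex_of_code G x) = x"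
  using encode_digits[of x G 4] by (simp add: vertex_code_def vertex_of_code_def upt_rec eval_nat_numeral)

context packing_graph
begin

lemma packing_adj_iff:
  "packing_adj (t, b, k, r) (t', b', k', r') \<longleftrightarrow>
     (t = 2 \<and> r = 0 \<and> k < block_len b \<and> t' \<le> 1 \<and> b' = 0 \<and> k' = 0 \<and> r' = 0) \<or>
     (t = 2 \<and> r = 0 \<and> t' = 3 \<and> b' = b \<and> (k = k' \<or> k = k' + 1) \<and> k' + 1 < block_len b \<and> r' < 9) \<or>
     (t = 2 \<and> r = 0 \<and> t' = 3 \<and> b' = m + n + 1 \<and> k' = 0 \<and> r' < 9 \<and> (b = m \<and> k = 0 \<or> b = m + n \<and> k = wall_len - 1)) \<or>
     (t = 4 \<and> r = 0 \<and> t' = 4 \<and> b' = b \<and> k' = k + 1 \<and> r' = 0 \<and> b < n \<and> k < B b) \<or>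
     (t = 2 \<and> r = 0 \<and> t' = 4 \<and> b' < n \<and> b = m + b' \<and> k = wall_len - 1 \<and> k' = 0 \<and> r' = 0) \<or>
     (t = 2 \<and> r = 0 \<and> t' = 4 \<and> b' < n \<and> b = m + b' + 1 \<and> k = 0 \<and> k' = B b' \<and> r' = 0)"
  unfolding packing_adj_def vertex_defs prod.inject by fastforce

lemma packing_adj_below:
  assumes G: "m + n + wall_len + (\<Sum>i<m. s i) + (\<Sum>j<n. B j) + 20 \<le> G" and adj: "packing_adj x y"
  shows "x \<in> vertices_below G" "y \<in> vertices_below G"
proof -
  have block: "b \<le> m + n \<and> block_len b < G" if "k < block_len b" for b k
  proof -
    have "s b \<le> (\<Sum>i<m. s i)" if "b < m" using that by (intro member_le_sum) auto
    then show ?thesis using that G unfolding block_len_def by (auto split: if_splits)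
  qed
  have bin: "B j < G" if "j < n" for j
  proof -
    have "B j \<le> (\<Sum>j<n. B j)" using that by (intro member_le_sum) auto
    then show ?thesis using G by linarith
  qed
  have "x \<in> vertices_below G \<and> y \<in> vertices_below G"
    using adj unfolding packing_adj_def
  proof (elim disjE exE conjE)
    fix b k assume "k < block_len b" "x = Layer b k" "y = HubU"
    then show ?thesis using block[of k b] G by (simp add: vertices_below_def vertex_defs)
  next
    fix b k assume "k < block_len b" "x = Layer b k" "y = HubV"
    then show ?thesis using block[of k b] G by (simp add: vertices_below_def vertex_defs)
  next
    fix b k r assume "k + 1 < block_len b" "r < 9" "x = Layer b k" "y = Link b k r"
    then show ?thesis using block[of "k + 1" b] G by (simp add: vertices_below_def vertex_defs)
  next
    fix b k r assume "k + 1 < block_len b" "r < 9" "x = Layer b (k + 1)" "y = Link b k r"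
    then show ?thesis using block[of "k + 1" b] G by (simp add: vertices_below_def vertex_defs)
  next
    fix j k assume "j < n" "k < B j" "x = Path j k" "y = Path j (k + 1)"
    then show ?thesis using bin[of j] G by (simp add: vertices_below_def vertex_defs)
  next
    fix j assume "j < n" "x = Layer (m + j + 1) 0" "y = Path j (B j)"
    then show ?thesis using bin[of j] G by (simp add: vertices_below_def vertex_defs)
  qed (use G in \<open>auto simp: vertices_below_def vertex_defs\<close>)
  then show "x \<in> vertices_below G" "y \<in> vertices_below G" by simp_all
qed

lemma coded_edge_iff:
  assumes G: "m + n + wall_len + (\<Sum>i<m. s i) + (\<Sum>j<n. B j) + 20 \<le> G" and xy: "x < G ^ 4" "y < G ^ 4"
  shows "{x, y} \<in> (`) (vertex_code G) ` packing_edges \<longleftrightarrow>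
    packing_adj (vertex_of_code G x) (vertex_of_code G y) \<or> packing_adj (vertex_of_code G y) (vertex_of_code G x)"
    (is "_ \<longleftrightarrow> ?adj")
proof
  assume "{x, y} \<in> (`) (vertex_code G) ` packing_edges"
  then obtain u v where uv: "{x, y} = {vertex_code G u, vertex_code G v}" "packing_adj u v"
    unfolding packing_edges_def by auto
  have "vertex_of_code G (vertex_code G u) = u" "vertex_of_code G (vertex_code G v) = v"
    using packing_adj_below[OF G uv(2)] by (simp_all add: vertex_of_vertex_code)
  then show ?adj using uv unfolding doubleton_eq_iff by auto
next
  assume ?adj
  then have "{vertex_of_code G x, vertex_of_code G y} \<in> packing_edges" by (simp add: packing_edges_iff)
  then have "vertex_code G ` {vertex_of_code G x, vertex_of_code G y} \<in> (`) (vertex_code G) ` packing_edges"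
    by (rule imageI)
  then show "{x, y} \<in> (`) (vertex_code G) ` packing_edges" using xy by (simp add: vertex_code_of_code)
qed

end

lemma feasible_digit:
  assumes "feasible g" "feasible f" shows "feasible (\<lambda>w e. digit (g w e) j (f w e))"
  unfolding digit_def using assms by (intro feasible_mod feasible_div feasible_power)

context ntm
begin

lemma feasible_read_sym:
  assumes f: "feasible f" and g: "feasible g" shows "feasible (\<lambda>w e. read_sym (f w e) (g w e))"
proof -
  have "feasible (\<lambda>w e. if f w e < idle \<and> min (g w e) state_tape < state_tape + 1
      then read_sym (f w e) (min (g w e) state_tape) else 0)"
    by (rule feasible_table_pair) (intro f g feasible_min feasible_const)+
  then show ?thesis by (rule back_subst[of feasible]) (auto simp: fun_eq_iff read_sym_def min_def)
qed

lemma feasible_write_sym: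
  assumes f: "feasible f" and g: "feasible g" shows "feasible (\<lambda>w e. write_sym (f w e) (g w e))"
proof -
  have "feasible (\<lambda>w e. if f w e < idle \<and> min (g w e) state_tape < state_tape + 1
      then write_sym (f w e) (min (g w e) state_tape) else 0)"
    by (rule feasible_table_pair) (intro f g feasible_min feasible_const)+
  then show ?thesis by (rule back_subst[of feasible]) (auto simp: fun_eq_iff write_sym_def min_def)
qed

lemma feasible_move:
  assumes f: "feasible f" and g: "feasible g" shows "feasible (\<lambda>w e. move (f w e) (g w e))"
proof -
  have "feasible (\<lambda>w e. if f w e < idle \<and> g w e < tapes M
      then if f w e < idle \<and> g w e < tapes M then move (f w e) (g w e) else 0 else 1)"
    by (intro feasible_if[OF _ feasible_table_pair] feasibleb_conj feasibleb_less f g feasible_const)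
  then show ?thesis by (rule back_subst[of feasible]) (auto simp: fun_eq_iff move_def)
qed

lemma clause_of_digits_iff:
  "relevant N C (constraint_of_digits d) \<and> l \<in> literal_code F ` clause w N C (constraint_of_digits d) \<longleftrightarrow>
     d 0 = 0 \<and> d 1 < N \<and> (\<exists>r<idle + 1. l = 2 * encode F [0, d 1, r, 0, 0]) \<or>
     d 0 = 1 \<and> d 1 < N \<and> d 2 < idle \<and> d 3 \<le> state_tape \<and>
       (l = 2 * encode F [0, d 1, d 2, 0, 0] + 1 \<or> l = 2 * encode F [1, d 1, d 3, C, read_sym (d 2) (d 3)]) \<or>
     d 0 = 2 \<and> d 1 < N \<and> d 2 < idle \<and> d 3 \<le> state_tape \<and>
       (l = 2 * encode F [0, d 1, d 2, 0, 0] + 1 \<or>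
        l = 2 * encode F [1, d 1 + 1, d 3, C + 1 - move (d 2) (d 3), write_sym (d 2) (d 3)]) \<or>
     d 0 = 3 \<and> d 1 < N \<and> d 2 \<le> idle \<and> d 3 \<le> state_tape \<and> 1 \<le> d 4 \<and> d 4 \<le> 2 * C \<and> (d 4 \<noteq> C \<or> d 2 = idle) \<and> d 5 < D \<and>
       (l = 2 * encode F [0, d 1, d 2, 0, 0] + 1 \<or> l = 2 * encode F [1, d 1, d 3, d 4, d 5] + 1 \<or>
        l = 2 * encode F [1, d 1 + 1, d 3, d 4 + 1 - move (d 2) (d 3), d 5]) \<or>
     d 0 = 4 \<and> d 1 \<le> N \<and> d 3 \<le> state_tape \<and> d 4 \<le> 2 * C \<and> d 5 < D \<and> d 6 < D \<and> d 5 \<noteq> d 6 \<and>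
       (l = 2 * encode F [1, d 1, d 3, d 4, d 5] + 1 \<or> l = 2 * encode F [1, d 1, d 3, d 4, d 6] + 1) \<or>
     d 0 = 5 \<and> d 3 \<le> state_tape \<and> d 4 \<le> 2 * C \<and> l = 2 * encode F [1, 0, d 3, d 4, start_symbol w C (d 3) (d 4)] \<or>
     d 0 = 6 \<and> l = 2 * encode F [1, N, state_tape, C, 1] \<or>
     7 \<le> d 0 \<and> d 2 < idle \<and> (\<exists>i<state_tape + 1. l = 2 * encode F [1, N, i, C, read_sym (d 2) i] + 1)"
proof -
  consider "d 0 = 0" | "d 0 = 1" | "d 0 = 2" | "d 0 = 3" | "d 0 = 4" | "d 0 = 5" | "d 0 = 6" | "7 \<le> d 0" by linarith
  then show ?thesis
    by cases (auto simp: constraint_of_digits_def less_Suc_eq_le setcompr_eq_image image_image simp del: encode.simps)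
qed

lemma feasibleb_occurs:
  assumes N: "feasible N" and C: "feasible C" and F: "feasible F" and l: "feasible l" and c: "feasible c"
  shows "feasibleb (\<lambda>w e. occurs w (N w e) (C w e) (F w e) (l w e) (c w e))"
proof -
  have transition: "feasibleb (\<lambda>w e. \<exists>r<idle + 1. l w e = 2 * encode (F w e) [0, digit (F w e) 1 (c w e), r, 0, 0])"
    unfolding encode.simps
    by (rule feasibleb_ex[OF feasible_const])
       (intro feasibleb_eq feasible_add feasible_mult feasible_const feasible_digit feasible_var
          feasible_rename[OF F] feasible_rename[OF l] feasible_rename[OF c])
  have halts: "feasibleb (\<lambda>w e. \<exists>i<state_tape + 1.
      l w e = 2 * encode (F w e) [1, N w e, i, C w e, read_sym (digit (F w e) 2 (c w e)) i] + 1)"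
    unfolding encode.simps
    by (rule feasibleb_ex[OF feasible_const])
       (intro feasibleb_eq feasible_add feasible_mult feasible_const feasible_digit feasible_read_sym feasible_var
          feasible_rename[OF F] feasible_rename[OF l] feasible_rename[OF c] feasible_rename[OF N] feasible_rename[OF C])
  show ?thesis
    unfolding occurs_def Let_def clause_of_digits_iff start_symbol_def encode.simps
    by (intro feasibleb_disj feasibleb_conj transition[unfolded encode.simps] halts[unfolded encode.simps]
        feasibleb_eq feasibleb_le feasibleb_less feasibleb_not feasible_digit feasible_read_sym feasible_write_sym
        feasible_move feasible_if feasible_symbol feasible_add feasible_diff feasible_mult feasible_const N C F l c)
qed

end

locale reduction = ntm +
  fixes p :: "nat poly"
  assumes time: "\<And>w k c. (initial M w, c) \<in> step M ^^ k \<Longrightarrow> k \<le> poly p (length w)"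
begin

definition tableau_base :: "nat \<Rightarrow> nat" where
  "tableau_base L = digit_bound (poly p L) (poly p L + 1)"

abbreviation var_count :: "nat \<Rightarrow> nat" where "var_count L \<equiv> tableau_base L ^ 5"
abbreviation clause_count :: "nat \<Rightarrow> nat" where "clause_count L \<equiv> tableau_base L ^ 7"

definition literal_in_clause :: "bool list \<Rightarrow> nat \<Rightarrow> nat \<Rightarrow> nat \<Rightarrow> bool" where
  "literal_in_clause w L = occurs w (poly p L) (poly p L + 1) (tableau_base L)"

abbreviation bin_weight :: "bool list \<Rightarrow> nat \<Rightarrow> nat \<Rightarrow> nat \<Rightarrow> nat" where
  "bin_weight w L \<equiv> cnf.weight (var_count L) (clause_count L) (literal_in_clause w L)"

definition bin_count :: "nat \<Rightarrow> nat" where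
  "bin_count L = cnf.num_bins (var_count L) (clause_count L)"

definition item_count :: "nat \<Rightarrow> nat" where "item_count L = bin_count L * bin_count L"

definition block_size :: "bool list \<Rightarrow> nat \<Rightarrow> nat \<Rightarrow> nat" where
  "block_size w L i = 10 * cnf.item_size (var_count L) (clause_count L) (literal_in_clause w L)
     (i div bin_count L) (i mod bin_count L)"

definition path_length :: "bool list \<Rightarrow> nat \<Rightarrow> nat \<Rightarrow> nat" where
  "path_length w L j = 10 * cnf.capacity (var_count L) (clause_count L) (literal_in_clause w L) j"

definition wall_length :: "bool list \<Rightarrow> nat \<Rightarrow> nat" where
  "wall_length w L = 3 * ((\<Sum>j<bin_count L. path_length w L j + 4) + 6)"

definition vertex_base :: "bool list \<Rightarrow> nat \<Rightarrow> nat" where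
  "vertex_base w L = item_count L + bin_count L + wall_length w L + (\<Sum>i<item_count L. block_size w L i) +
     (\<Sum>j<bin_count L. path_length w L j) + 20"

definition adjacent :: "bool list \<Rightarrow> nat \<Rightarrow> nat \<Rightarrow> nat \<Rightarrow> bool" where
  "adjacent w L x y =
     packing_graph.packing_adj (bin_count L) (item_count L) (wall_length w L) (path_length w L) (block_size w L)
     (vertex_of_code (vertex_base w L) x) (vertex_of_code (vertex_base w L) y)"

definition graph :: "bool list \<Rightarrow> nat set set" where
  "graph w = (let L = length w in (`) (vertex_code (vertex_base w L)) `
     packing_graph.packing_edges (bin_count L) (item_count L) (wall_length w L) (path_length w L) (block_size w L))"

context
  fixes L :: "bool list \<Rightarrow> (nat \<Rightarrow> nat) \<Rightarrow> nat"
  assumes L: "feasible L"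
begin

lemma feasible_tableau_base: "feasible (\<lambda>w e. tableau_base (L w e))"
  unfolding tableau_base_def by (intro feasible_add feasible_mult feasible_const feasible_poly L)

lemma feasible_bin_count: "feasible (\<lambda>w e. bin_count (L w e))"
  unfolding bin_count_def cnf.num_bins_def
  by (intro feasible_add feasible_mult feasible_const feasible_power feasible_tableau_base)

lemma feasible_item_count: "feasible (\<lambda>w e. item_count (L w e))"
  unfolding item_count_def by (intro feasible_mult feasible_bin_count)

lemma feasible_radix: "feasible (\<lambda>w e. cnf.radix (var_count (L w e)) (clause_count (L w e)))"
  unfolding cnf.radix_def bin_count_def[symmetric]
  by (intro feasible_mult feasible_const feasible_power feasible_add feasible_bin_count)

lemma feasible_signature:
  assumes "feasible x" "feasible y"
  shows "feasible (\<lambda>w e. cnf.signature (var_count (L w e)) (clause_count (L w e)) (x w e) (y w e))"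
  unfolding cnf.signature_def using assms by (intro feasible_add feasible_mult feasible_const feasible_radix)

lemma feasible_bin_weight:
  assumes "feasible x" "feasible y"
  shows "feasible (\<lambda>w e. bin_weight w (L w e) (x w e) (y w e))"
  unfolding cnf.weight_def literal_in_clause_def bin_count_def[symmetric] using assms
  by (intro feasible_if feasibleb_conj feasibleb_less feasibleb_le feasibleb_eq feasibleb_not feasibleb_occurs feasible_poly
      feasible_add feasible_diff feasible_mult feasible_div feasible_const feasible_power feasible_tableau_base feasible_bin_count L)

lemma feasible_block_size:
  assumes "feasible x" shows "feasible (\<lambda>w e. block_size w (L w e) (x w e))"
  unfolding block_size_def cnf.item_size_def using assms
  by (intro feasible_if feasibleb_less feasibleb_eq feasible_bin_weight feasible_signature feasible_radix
      feasible_add feasible_mult feasible_div feasible_mod feasible_const feasible_bin_count)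

end

lemma feasible_path_length:
  assumes L: "feasible L" and x: "feasible x" shows "feasible (\<lambda>w e. path_length w (L w e) (x w e))"
proof -
  have clause_size: "feasible (\<lambda>w e. \<Sum>l<2 * var_count (L w e).
      bin_weight w (L w e) l (x w e))"
    by (rule feasible_sum) (intro feasible_bin_weight feasible_mult feasible_const feasible_power feasible_tableau_base L feasible_var
      feasible_rename[OF L] feasible_rename[OF x])+
  have signatures: "feasible (\<lambda>w e. \<Sum>q<bin_count (L w e).
      if bin_weight w (L w e) (x w e) q = 0 then 0
      else cnf.signature (var_count (L w e)) (clause_count (L w e)) (x w e) q)"
    by (rule feasible_sum) (intro feasible_if feasibleb_eq feasible_bin_weight feasible_signature feasible_const feasible_bin_count L
      feasible_var feasible_rename[OF L] feasible_rename[OF x])+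
  show ?thesis unfolding path_length_def cnf.capacity_def cnf.slack_def bin_count_def[symmetric]
    by (intro feasible_if feasibleb_less clause_size signatures feasible_radix feasible_add feasible_diff feasible_mult feasible_const
        feasible_power feasible_tableau_base feasible_bin_count L x)
qed

lemma feasible_wall_length:
  assumes L: "feasible L" shows "feasible (\<lambda>w e. wall_length w (L w e))"
proof -
  have "feasible (\<lambda>w e. \<Sum>j<bin_count (L w e). path_length w (L w e) j + 4)"
    by (rule feasible_sum)
       (intro feasible_bin_count L feasible_add feasible_path_length feasible_const feasible_var feasible_rename[OF L])+
  then show ?thesis unfolding wall_length_def by (intro feasible_add feasible_mult feasible_const)
qed

lemma feasible_vertex_base:
  assumes L: "feasible L" shows "feasible (\<lambda>w e. vertex_base w (L w e))"
proof -
  have paths: "feasible (\<lambda>w e. \<Sum>j<bin_count (L w e). path_length w (L w e) j)"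
    by (rule feasible_sum) (intro feasible_bin_count L feasible_path_length feasible_var feasible_rename[OF L])+
  have blocks: "feasible (\<lambda>w e. \<Sum>i<item_count (L w e). block_size w (L w e) i)"
    by (rule feasible_sum) (intro feasible_item_count L feasible_block_size feasible_var feasible_rename[OF L])+
  show ?thesis unfolding vertex_base_def
    by (intro feasible_add feasible_const paths blocks feasible_wall_length feasible_item_count feasible_bin_count L)
qed

lemma feasibleb_adjacent:
  assumes L: "feasible L" and x: "feasible x" and y: "feasible y"
  shows "feasibleb (\<lambda>w e. adjacent w (L w e) (x w e) (y w e))"
  unfolding adjacent_def vertex_of_code_def packing_graph.packing_adj_iff packing_graph.block_len_def
  by (intro feasibleb_disj feasibleb_conj feasibleb_eq feasibleb_le feasibleb_less feasible_if feasible_digit feasible_wall_length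
      feasible_path_length feasible_block_size feasible_item_count feasible_bin_count feasible_vertex_base feasible_add feasible_diff
      feasible_const L x y)

lemma graph_iff:
  assumes "x < vertex_base w (length w) ^ 4" "y < vertex_base w (length w) ^ 4"
  shows "{x, y} \<in> graph w \<longleftrightarrow> adjacent w (length w) x y \<or> adjacent w (length w) y x"
  unfolding graph_def Let_def adjacent_def
  by (rule packing_graph.coded_edge_iff[OF _ assms]) (simp add: vertex_base_def)

definition reduct :: "bool list \<Rightarrow> bool list" where
  "reduct w = adjacency_word (vertex_base w (length w) ^ 4) (graph w)"

lemma reduct_computable: "polynomial_time_computable reduct"
  unfolding reduct_def
proof (rule adjacency_word_computable[where adj = "\<lambda>w L x y. adjacent w L x y \<or> adjacent w L y x"])
  show "feasible (\<lambda>w e. vertex_base w (f w e) ^ 4)" if "feasible f" for f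
    using that by (intro feasible_power feasible_vertex_base)
  show "feasibleb (\<lambda>w e. adjacent w (f w e) (x w e) (y w e) \<or> adjacent w (f w e) (y w e) (x w e))"
    if "feasible f" "feasible x" "feasible y" for f x y
    using that by (intro feasibleb_disj feasibleb_adjacent)
qed (rule graph_iff)

lemma bin_count_pos: "bin_count L \<ge> 1"
  by (simp add: bin_count_def cnf.num_bins_def tableau_base_def Suc_le_eq)

end

locale reduction_instance = reduction +
  fixes w :: "bool list"
begin

abbreviation L :: nat where "L \<equiv> length w"

sublocale sat: cnf "var_count L" "clause_count L" "literal_in_clause w L" .

sublocale labelled_packing_graph "bin_count L" "item_count L" "wall_length w L" "path_length w L" "block_size w L"
  "vertex_code (vertex_base w L)" "vertex_base w L ^ 4"
proof -
  interpret packing_graph "bin_count L" "item_count L" "wall_length w L" "path_length w L" "block_size w L" .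
  have "\<Union> packing_edges \<subseteq> vertices_below (vertex_base w L)"
    using packing_adj_below[of "vertex_base w L"] unfolding packing_edges_def vertex_base_def by auto
  then show "labelled_packing_graph (bin_count L) (item_count L) (wall_length w L) (path_length w L) (block_size w L)
      (vertex_code (vertex_base w L)) (vertex_base w L ^ 4)"
    using bin_count_pos vertex_code_less vertex_of_vertex_code
    by unfold_locales (auto simp: wall_length_def intro!: inj_on_inverseI[of _ "vertex_of_code (vertex_base w L)"])
qed

lemma graph_eq: "graph w = labelled_edges"
  by (simp add: graph_def labelled_edges_def Let_def)

lemma num_bins_eq: "sat.num_bins = bin_count L"
  by (simp add: bin_count_def)

lemma path_length_eq: "path_length w L j = 10 * sat.capacity j"
  by (simp add: path_length_def)

lemma accepts_iff_satisfiable: "accepts M w \<longleftrightarrow> sat.satisfiable"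
  unfolding literal_in_clause_def by (rule accepts_iff_satisfiable[OF time]) (simp_all add: tableau_base_def)

lemma sum_block_size:
  "(\<Sum>i | i < item_count L \<and> \<beta> (i div bin_count L, i mod bin_count L) = j. block_size w L i) =
   10 * (\<Sum>x | x \<in> sat.bin_pairs \<and> \<beta> x = j. sat.item_size (fst x) (snd x))"
  using sum_div_mod[where n = "bin_count L" and P = "\<lambda>x. \<beta> x = j" and g = "\<lambda>x. 10 * sat.item_size (fst x) (snd x)"]
  by (simp add: item_count_def block_size_def sat.bin_pairs_def num_bins_eq sum_distrib_left)

lemma packs_if_sat_packs:
  assumes "sat.packs \<beta>"
  shows "packs (path_length w L) (\<lambda>i. \<beta> (i div bin_count L, i mod bin_count L))"
proof -
  have "(i div bin_count L, i mod bin_count L) \<in> sat.bin_pairs" if "i < item_count L" for i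
    using that bin_count_pos[of L]
    by (simp add: item_count_def sat.bin_pairs_def num_bins_eq less_mult_imp_div_less)
  then show ?thesis
    using assms by (simp add: packs_def sat.packs_def sum_block_size path_length_eq num_bins_eq)
qed

lemma sat_packs_if_packs:
  assumes "packs (\<lambda>j. path_length w L j + 9) \<beta>"
  shows "sat.packs (\<lambda>x. \<beta> (fst x * bin_count L + snd x))"
  unfolding sat.packs_def
proof (intro conjI ballI allI impI)
  fix x assume "x \<in> sat.bin_pairs"
  then have x: "fst x + 1 \<le> bin_count L" "snd x < bin_count L" by (auto simp: sat.bin_pairs_def num_bins_eq)
  have "fst x * bin_count L + snd x < (fst x + 1) * bin_count L" using x by simp
  also have "\<dots> \<le> item_count L" unfolding item_count_def using x(1) by (rule mult_right_mono) simp
  finally show "\<beta> (fst x * bin_count L + snd x) < sat.num_bins" using assms by (simp add: packs_def num_bins_eq)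
next
  fix j assume "j < sat.num_bins"
  then have "(\<Sum>i | i < item_count L \<and> \<beta> i = j. block_size w L i) \<le> 10 * sat.capacity j + 9"
    using assms by (simp add: packs_def path_length_eq num_bins_eq)
  then show "(\<Sum>x | x \<in> sat.bin_pairs \<and> \<beta> (fst x * bin_count L + snd x) = j. sat.item_size (fst x) (snd x))
      \<le> sat.capacity j"
    using sum_block_size[of "\<lambda>x. \<beta> (fst x * bin_count L + snd x)" j] by simp
qed

lemma accepts_iff_admits_RAC_drawing: "accepts M w \<longleftrightarrow> admits_RAC_drawing {..<vertex_base w L ^ 4} (graph w)"
  unfolding accepts_iff_satisfiable sat.satisfiable_iff_packs graph_eq
  using packs_if_sat_packs sat_packs_if_packs admits_RAC_drawing_if_packs packs_if_admits_RAC_drawing by blast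

lemma accepts_iff_reduct: "accepts M w \<longleftrightarrow> reduct w \<in> RAC_words"
  unfolding reduct_def accepts_iff_admits_RAC_drawing graph_eq
  by (rule adjacency_word_in_RAC_words[OF simple_graph_labelled_edges(1), symmetric])

end

lemma (in reduction) reducible_to_RAC_words: "polynomial_time_reducible {w. accepts M w} RAC_words"
  unfolding polynomial_time_reducible_def
proof (intro exI[of _ reduct] conjI reduct_computable allI)
  fix w
  interpret reduction_instance M tr D p w by unfold_locales
  show "w \<in> {w. accepts M w} \<longleftrightarrow> reduct w \<in> RAC_words" using accepts_iff_reduct by simp
qed

lemma ntm_exists:
  assumes "well_formed M"
  obtains tr D where "ntm M tr D"
proof -
  obtain tr where tr: "set tr = trans M" using assms finite_list unfolding well_formed_def by blast
  let ?S = "\<lambda>((q, rs), (q', ws)). {q, q'} \<union> set rs \<union> fst ` set ws"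
  have "finite (\<Union>t\<in>set tr. ?S t)" by auto
  then obtain D where D: "\<forall>x\<in>(\<Union>t\<in>set tr. ?S t). x < D" unfolding finite_nat_set_iff_bounded ..
  have "ntm M tr (D + 3)"
  proof
    fix q rs q' ws assume "((q, rs), (q', ws)) \<in> set tr"
    then have "\<forall>x\<in>?S ((q, rs), (q', ws)). x < D + 3" using D by (meson UN_I trans_less_add1)
    then show "q < D + 3 \<and> q' < D + 3 \<and> set rs \<subseteq> {..<D + 3} \<and> fst ` set ws \<subseteq> {..<D + 3}" by auto
  qed (rule assms tr le_add2)+
  then show thesis by (rule that)
qed

theorem theorem4:
  "NP_hard {adjacency_word n E | n E. simple_graph {..<n} E \<and> admits_RAC_drawing {..<n} E}"
  unfolding NP_hard_def RAC_words_def[symmetric]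
proof
  fix A assume "A \<in> NP"
  then obtain M where M: "well_formed M" "polynomial_time M" "A = {w. accepts M w}" unfolding NP_def by blast
  obtain p :: "nat poly" where p: "\<And>w k c. (initial M w, c) \<in> step M ^^ k \<Longrightarrow> k \<le> poly p (length w)"
    using M(2) unfolding polynomial_time_def by blast
  obtain tr D where "ntm M tr D" using M(1) by (rule ntm_exists)
  then interpret ntm M tr D .
  interpret reduction M tr D p by unfold_locales (rule p)
  show "polynomial_time_reducible A RAC_words" unfolding M(3) by (rule reducible_to_RAC_words)
qed

end
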